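(* Let $H<\mathrm{GL}(d,\mathbb{R})$ be an admissible dilation group with open dual orbit $\mathcal{O}$ and $G=\mathbb{R}^d\rtimes H$. Let $s\ge0$ and let $v$ be a weight on $G$ satisfying $v(x,h)\le(1+|x|)^sw(h)$ for all $(x,h)\in G$, where $w$ is a weight on $H$. Let $1\le p\le\infty$ and $1\le q<\infty$. Assume that $\mathcal{O}$ is $(s,q,w)$-temperately embedded with index $\ell\in\mathbb{N}$. Then any function $f\in L^1(\mathbb{R}^d)$ with vanishing moments in $\mathcal{O}^c$ of order $t>\ell+s+d/p+1$ (where $d/\infty=0$) and $|\widehat f|_{t,t}<\infty$ is in $\mathrm{Co}(L^{p,q}_v(G))$.
   Context: Let $d>1$ and let $H$ be a closed subgroup of $\mathrm{GL}(d,\mathbb{R})$. $G=\mathbb{R}^d\rtimes H$ has product $(x,h)(y,g)=(x+hy,hg)$, left Haar measure $|\det h|^{-1}\,dx\,dh$ ($dh$ left Haar measure on $H$) and modular function $\Delta_G(x,h)=\Delta_H(h)|\det h|^{-1}$. The quasi-regular representation is $[\pi(x,h)f](y)=|\det h|^{-1/2}f(h^{-1}(y-x))$ on $L^2(\mathbb{R}^d)$. $H$ is called an admissible dilation group if $\pi$ is irreducible and square-integrable (there is a nonzero $\psi$ with $(x,h)\mapsto\langle\psi,\pi(x,h)\psi\rangle$ in $L^2(G)$). It is known that this holds iff the dual action $(\xi,h)\mapsto h^T\xi$ has a single open orbit $\mathcal{O}=\{h^T\xi_0:h\in H\}$ of full measure, with compact stabilizers; $\mathcal{O}$ is called the open dual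 orbit and $\mathcal{O}^c=\mathbb{R}^d\setminus\mathcal{O}$. $\mathcal{W}_\psi f(x,h)=\langle f,\pi(x,h)\psi\rangle$. Fourier transform: $\widehat f(\xi)=\int f(x)e^{-2\pi i\langle x,\xi\rangle}dx$. A weight on a locally compact group is a continuous positive submultiplicative function. $L^{p,q}_v(G)$ is the space of measurable $F$ on $G$ with finite norm $\left(\int_H\left(\int_{\mathbb{R}^d}|F(x,h)|^pv(x,h)^pdx\right)^{q/p}\frac{dh}{|\det h|}\right)^{1/q}$, integrals being replaced by essential suprema for infinite exponents; $L^1_v=L^{1,1}_v$. For $r,m>0$: $|g|_{r,m}=\sup_{x\in\mathbb{R}^d,|\alpha|\le r}(1+|x|)^m|\partial^\alpha g(x)|$, where $|\alpha|=\sum_i\alpha_i$ for multiindices and $|x|$ is the euclidean norm for vectors. Auxiliary function: $A(\xi)=\min\left(\frac{\mathrm{dist}(\xi,\mathcal{O}^c)}{1+\sqrt{|\xi|^2-\mathrm{dist}(\xi,\mathcal{O}^c)^2}},\frac1{1+|\xi|}\right)$ for $\xi\in\mathcal{O}$, with $\mathrm{dist}$ the euclidean distance. For a weight $w$ on $H$, $s\ge0$, $1\le q<\infty$, the orbit $\mathcal{O}$ is $(s,q,w)$-temperately embedded with index $\ell\in\mathbb{N}$ if for a fixed $\xi_0\in\mathcal{O}$ (the choice is immaterial): (i) $h\mapsto|\det h|^{1/2-1/q}(1+\|h\|)^{s+d+1}w(h)A(h^T\xi_0)^\ell$ is in $L^q(H)$, and (ii) $h\mapsto|\det h|^{-1/2-1/q}(1+\|h\|)^{s+d+1}w(h)A(h^{-T}\xi_0)^\ell$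 is in $L^1(H)$; here $\|\cdot\|$ is any matrix norm, $h^{-T}$ is the transpose inverse, and $L^q(H)$ is with respect to left Haar measure. For $r\in\mathbb{N}$, $f\in L^1(\mathbb{R}^d)$ has vanishing moments in $\mathcal{O}^c$ of order $r$ if all distributional derivatives $\partial^\alpha\widehat f$ with $|\alpha|\le r$ are continuous functions, and all those with $|\alpha|<r$ vanish identically on $\mathcal{O}^c$. Coorbit spaces: let $Y=L^{p,q}_v(G)$. A weight $v_0$ on $G$ is a control weight for $Y$ if $v_0(z)=\Delta_G(z)^{-1}v_0(z^{-1})$ and $\max(\|L_{z^{\pm1}}\|_{Y\to Y},\|R_z\|_{Y\to Y},\|R_{z^{-1}}\|_{Y\to Y}\Delta_G(z)^{-1})\le v_0(z)$ for all $z\in G$, where $L_zF(z')=F(z^{-1}z')$ and $R_zF(z')=F(z'z)$. Fix a control weight $v_0$ for $Y$ satisfying $v_0(x,h)\le(1+|x|)^{s}w_0(h)$ for some weight $w_0$ on $H$, and a nonzero $\psi_0\in L^2(\mathbb{R}^d)$ with $\mathcal{W}_{\psi_0}\psi_0\in L^1_{v_0}(G)$. Let $\mathcal{H}_{1,v_0}=\{f\in L^2(\mathbb{R}^d):\mathcal{W}_{\psi_0}f\in L^1_{v_0}(G)\}$ with norm $\|\mathcal{W}_{\psi_0}f\|_{L^1_{v_0}}$, and let $\mathcal{H}_{1,v_0}^{\sim}$ be its conjugate dual, so that $\mathcal{H}_{1,v_0}\subset L^2(\mathbb{R}^d)\subset\mathcal{H}_{1,v_0}^{\sim}$ (functions $f$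 being identified with the functional $g\mapsto\langle f,g\rangle$), and $\mathcal{W}_\psi f(x,h)=\langle f,\pi(x,h)\psi\rangle$ is defined for $f\in\mathcal{H}_{1,v_0}^\sim$, $\psi\in\mathcal{H}_{1,v_0}$. For nonzero $\psi\in\mathcal{H}_{1,v_0}$, $\mathrm{Co}(Y)=\{f\in\mathcal{H}_{1,v_0}^{\sim}:\mathcal{W}_\psi f\in Y\}$ with norm $\|\mathcal{W}_\psi f\|_Y$; this space is independent (up to equivalent norms) of $\psi$, $\psi_0$ and $v_0$. Any nonzero element of $\{\psi:\widehat\psi\in C_c^\infty(\mathcal{O})\}$ may be used as $\psi$. *)

theory Defs
  imports "HOL-Analysis.Analysis" "HOL-Probability.Essential_Supremum"
begin

text \<open>Only used for exponents \<open>a > 0\<close>.\<close>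

definition epow :: "ennreal \<Rightarrow> real \<Rightarrow> ennreal" where
  "epow x a = (if x = \<infinity> then \<infinity> else ennreal (enn2real x powr a))"

definition lp_norm :: "'a measure \<Rightarrow> ennreal \<Rightarrow> ('a \<Rightarrow> ennreal) \<Rightarrow> ennreal" where
  "lp_norm M p f =
     (if p = \<infinity> then esssup M f
      else epow (\<integral>\<^sup>+ x. epow (f x) (enn2real p) \<partial>M) (1 / enn2real p))"

text \<open>Elements are functions; functions that agree almost everywhere are not identified.\<close>

definition Lp :: "'a measure \<Rightarrow> ennreal \<Rightarrow> ('a \<Rightarrow> 'b::{real_normed_vector, second_countable_topology}) set" where
  "Lp M p = {F \<in> borel_measurable M. lp_norm M p (\<lambda>x. ennreal (norm (F x))) < \<infinity>}"

definition l2_inner :: "(real^'d \<Rightarrow> complex) \<Rightarrow> (real^'d \<Rightarrow> complex) \<Rightarrow> complex" where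
  "l2_inner f g = (\<integral>x. f x * cnj (g x) \<partial>lborel)"

definition ae_zero :: "(real^'d \<Rightarrow> complex) \<Rightarrow> bool" where
  "ae_zero f \<longleftrightarrow> (AE x in lborel. f x = 0)"

definition closed_GL_subgroup :: "(real^'d^'d) set \<Rightarrow> bool" where
  "closed_GL_subgroup H \<longleftrightarrow>
     closedin (top_of_set {h. invertible h}) H \<and> mat 1 \<in> H \<and>
     (\<forall>h\<in>H. \<forall>g\<in>H. h ** g \<in> H) \<and> (\<forall>h\<in>H. matrix_inv h \<in> H)"

text \<open>
  \<open>H\<close> is locally compact and second countable, so a Borel measure that is finite on compact
  sets is automatically regular.
\<close>

definition left_haar_measure :: "(real^'d^'d) set \<Rightarrow> (real^'d^'d) measure \<Rightarrow> bool" where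
  "left_haar_measure H \<mu> \<longleftrightarrow>
     sets \<mu> = sets (restrict_space borel H) \<and>
     emeasure \<mu> H \<noteq> 0 \<and>
     (\<forall>K. compact K \<and> K \<subseteq> H \<longrightarrow> emeasure \<mu> K < \<infinity>) \<and>
     (\<forall>h\<in>H. distr \<mu> \<mu> (\<lambda>g. h ** g) = \<mu>)"

text \<open>
  The normalisation \<open>\<mu>(A h) = \<Delta>\<^sub>H(h) \<mu>(A)\<close> is the one for which
  \<open>\<Delta>\<^sub>G(x,h) = \<Delta>\<^sub>H(h) / \<bar>det h\<bar>\<close>.
\<close>

definition modular_H :: "(real^'d^'d) measure \<Rightarrow> real^'d^'d \<Rightarrow> real" where
  "modular_H \<mu> h =
     (THE c. 0 < c \<and> (\<forall>A\<in>sets \<mu>. emeasure \<mu> ((\<lambda>g. g ** h) ` A) = ennreal c * emeasure \<mu> A))"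

fun sd_mult :: "(real^'d) \<times> (real^'d^'d) \<Rightarrow> (real^'d) \<times> (real^'d^'d) \<Rightarrow> (real^'d) \<times> (real^'d^'d)" where
  "sd_mult (x, h) (y, g) = (x + h *v y, h ** g)"

fun sd_inv :: "(real^'d) \<times> (real^'d^'d) \<Rightarrow> (real^'d) \<times> (real^'d^'d)" where
  "sd_inv (x, h) = (- (matrix_inv h *v x), matrix_inv h)"

definition modular_G :: "(real^'d^'d) measure \<Rightarrow> (real^'d) \<times> (real^'d^'d) \<Rightarrow> real" where
  "modular_G \<mu> z = modular_H \<mu> (snd z) / \<bar>det (snd z)\<bar>"

definition haar_G :: "(real^'d^'d) measure \<Rightarrow> ((real^'d) \<times> (real^'d^'d)) measure" where
  "haar_G \<mu> = density (lborel \<Otimes>\<^sub>M \<mu>) (\<lambda>(x, h). ennreal (1 / \<bar>det h\<bar>))"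

definition weight_on :: "'g::topological_space set \<Rightarrow> ('g \<Rightarrow> 'g \<Rightarrow> 'g) \<Rightarrow> ('g \<Rightarrow> real) \<Rightarrow> bool" where
  "weight_on C m v \<longleftrightarrow>
     continuous_on C v \<and> (\<forall>a\<in>C. 0 < v a) \<and> (\<forall>a\<in>C. \<forall>b\<in>C. v (m a b) \<le> v a * v b)"

fun qreg :: "(real^'d) \<times> (real^'d^'d) \<Rightarrow> (real^'d \<Rightarrow> complex) \<Rightarrow> real^'d \<Rightarrow> complex" where
  "qreg (x, h) f = (\<lambda>y. complex_of_real (\<bar>det h\<bar> powr (-1/2)) * f (matrix_inv h *v (y - x)))"

text \<open>The closure condition makes \<open>V\<close> closed under modification on null sets.\<close>

definition closed_subspace_L2 :: "(real^'d \<Rightarrow> complex) set \<Rightarrow> bool" where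
  "closed_subspace_L2 V \<longleftrightarrow>
     V \<subseteq> Lp lborel 2 \<and> (\<lambda>_. 0) \<in> V \<and>
     (\<forall>f\<in>V. \<forall>g\<in>V. (\<lambda>x. f x + g x) \<in> V) \<and>
     (\<forall>c. \<forall>f\<in>V. (\<lambda>x. c * f x) \<in> V) \<and>
     (\<forall>f\<in>Lp lborel 2.
        (\<forall>\<epsilon>>0. \<exists>g\<in>V. lp_norm lborel 2 (\<lambda>x. ennreal (norm (f x - g x))) < \<epsilon>) \<longrightarrow> f \<in> V)"

definition irreducible_qreg :: "(real^'d^'d) set \<Rightarrow> bool" where
  "irreducible_qreg H \<longleftrightarrow>
     (\<forall>V. closed_subspace_L2 V \<and> (\<forall>x. \<forall>h\<in>H. \<forall>f\<in>V. qreg (x, h) f \<in> V) \<longrightarrow>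
        V = {f \<in> Lp lborel 2. ae_zero f} \<or> V = Lp lborel 2)"

definition square_integrable_qreg :: "(real^'d^'d) measure \<Rightarrow> bool" where
  "square_integrable_qreg \<mu> \<longleftrightarrow>
     (\<exists>\<psi>\<in>Lp lborel 2. \<not> ae_zero \<psi> \<and> (\<lambda>z. l2_inner \<psi> (qreg z \<psi>)) \<in> Lp (haar_G \<mu>) 2)"

definition admissible_dilation_group :: "(real^'d^'d) set \<Rightarrow> (real^'d^'d) measure \<Rightarrow> bool" where
  "admissible_dilation_group H \<mu> \<longleftrightarrow>
     closed_GL_subgroup H \<and> irreducible_qreg H \<and> square_integrable_qreg \<mu>"

definition open_dual_orbit :: "(real^'d^'d) set \<Rightarrow> (real^'d) set \<Rightarrow> bool" where
  "open_dual_orbit H Orb \<longleftrightarrow>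
     (\<exists>\<xi>\<^sub>0. Orb = {transpose h *v \<xi>\<^sub>0 |h. h \<in> H}) \<and>
     open Orb \<and> - Orb \<in> null_sets lborel \<and>
     (\<forall>\<xi>\<in>Orb. compact {h \<in> H. transpose h *v \<xi> = \<xi>})"

definition aux_A :: "(real^'d) set \<Rightarrow> real^'d \<Rightarrow> real" where
  "aux_A Orb \<xi> =
     min (infdist \<xi> (- Orb) / (1 + sqrt ((norm \<xi>)\<^sup>2 - (infdist \<xi> (- Orb))\<^sup>2)))
         (1 / (1 + norm \<xi>))"

text \<open>
  The matrix norm is the Frobenius norm (the norm of the type). The base point is immaterial,
  so asking for some base point is the weakest form of the condition.
\<close>

definition temperately_embedded ::
  "(real^'d^'d) set \<Rightarrow> (real^'d^'d) measure \<Rightarrow> (real^'d) set \<Rightarrow> real \<Rightarrow> real \<Rightarrow>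
   (real^'d^'d \<Rightarrow> real) \<Rightarrow> nat \<Rightarrow> bool" where
  "temperately_embedded H \<mu> Orb s q w l \<longleftrightarrow>
     (\<exists>\<xi>\<^sub>0\<in>Orb.
        (\<lambda>h. \<bar>det h\<bar> powr (1/2 - 1/q) * (1 + norm h) powr (s + real CARD('d) + 1) * w h *
             aux_A Orb (transpose h *v \<xi>\<^sub>0) ^ l) \<in> Lp \<mu> (ennreal q) \<and>
        (\<lambda>h. \<bar>det h\<bar> powr (-1/2 - 1/q) * (1 + norm h) powr (s + real CARD('d) + 1) * w h *
             aux_A Orb (transpose (matrix_inv h) *v \<xi>\<^sub>0) ^ l) \<in> Lp \<mu> 1)"

definition partial :: "'d::finite \<Rightarrow> (real^'d \<Rightarrow> complex) \<Rightarrow> real^'d \<Rightarrow> complex" where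
  "partial i g x = vector_derivative (\<lambda>t. g (x + t *\<^sub>R axis i 1)) (at 0)"

text \<open>
  The index type carries no order, so the iterated derivatives are taken along an arbitrary
  fixed enumeration of the coordinates; for smooth functions the order does not matter.
\<close>

definition coord_list :: "'d::finite list" where
  "coord_list = (SOME xs. distinct xs \<and> set xs = UNIV)"

definition mi_deriv :: "('d::finite \<Rightarrow> nat) \<Rightarrow> (real^'d \<Rightarrow> complex) \<Rightarrow> real^'d \<Rightarrow> complex" where
  "mi_deriv \<alpha> g = foldr (\<lambda>i. (partial i) ^^ (\<alpha> i)) coord_list g"

definition mi_order :: "('d::finite \<Rightarrow> nat) \<Rightarrow> nat" where
  "mi_order \<alpha> = (\<Sum>i\<in>UNIV. \<alpha> i)"

primrec Ck :: "nat \<Rightarrow> (real^'d \<Rightarrow> complex) \<Rightarrow> bool" where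
  "Ck 0 g \<longleftrightarrow> continuous_on UNIV g"
| "Ck (Suc k) g \<longleftrightarrow> g differentiable_on UNIV \<and> (\<forall>i. Ck k (partial i g))"

definition test_function :: "(real^'d \<Rightarrow> complex) \<Rightarrow> bool" where
  "test_function \<phi> \<longleftrightarrow> (\<forall>k. Ck k \<phi>) \<and> compact (closure {x. \<phi> x \<noteq> 0})"

text \<open>The distribution \<open>\<partial>\<^sup>\<alpha> g\<close> is given by the continuous function \<open>k\<close>.\<close>

definition has_cont_distr_deriv ::
  "('d::finite \<Rightarrow> nat) \<Rightarrow> (real^'d \<Rightarrow> complex) \<Rightarrow> (real^'d \<Rightarrow> complex) \<Rightarrow> bool" where
  "has_cont_distr_deriv \<alpha> g k \<longleftrightarrow>
     continuous_on UNIV k \<and>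
     (\<forall>\<phi>. test_function \<phi> \<longrightarrow>
        (\<integral>x. g x * mi_deriv \<alpha> \<phi> x \<partial>lborel) = (-1) ^ mi_order \<alpha> * (\<integral>x. k x * \<phi> x \<partial>lborel))"

definition fourier :: "(real^'d \<Rightarrow> complex) \<Rightarrow> real^'d \<Rightarrow> complex" where
  "fourier f \<xi> = (\<integral>x. f x * exp (- 2 * complex_of_real pi * \<i> * complex_of_real (x \<bullet> \<xi>)) \<partial>lborel)"

definition vanishing_moments :: "(real^'d) set \<Rightarrow> nat \<Rightarrow> (real^'d \<Rightarrow> complex) \<Rightarrow> bool" where
  "vanishing_moments Oc r f \<longleftrightarrow>
     (\<forall>\<alpha>. mi_order \<alpha> \<le> r \<longrightarrow>
        (\<exists>k. has_cont_distr_deriv \<alpha> (fourier f) k \<and> (mi_order \<alpha> < r \<longrightarrow> (\<forall>\<xi>\<in>Oc. k \<xi> = 0))))"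

text \<open>
  Meaningful only for functions with classical derivatives up to order \<open>r\<close>. A continuous function
  whose distributional derivatives up to order \<open>r\<close> are all continuous is one of these.
\<close>

definition schwartz_norm :: "real \<Rightarrow> real \<Rightarrow> (real^'d \<Rightarrow> complex) \<Rightarrow> ennreal" where
  "schwartz_norm r m g =
     (SUP \<alpha>\<in>{\<alpha>. real (mi_order \<alpha>) \<le> r}. SUP x. ennreal ((1 + norm x) powr m * norm (mi_deriv \<alpha> g x)))"

definition mixed_norm ::
  "(real^'d^'d) measure \<Rightarrow> ennreal \<Rightarrow> ennreal \<Rightarrow> ((real^'d) \<times> (real^'d^'d) \<Rightarrow> real) \<Rightarrow>
   ((real^'d) \<times> (real^'d^'d) \<Rightarrow> complex) \<Rightarrow> ennreal" where
  "mixed_norm \<mu> p q v F =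
     lp_norm (density \<mu> (\<lambda>h. ennreal (1 / \<bar>det h\<bar>))) q
       (\<lambda>h. lp_norm lborel p (\<lambda>x. ennreal (norm (F (x, h)) * v (x, h))))"

definition mixed_space ::
  "(real^'d^'d) measure \<Rightarrow> ennreal \<Rightarrow> ennreal \<Rightarrow> ((real^'d) \<times> (real^'d^'d) \<Rightarrow> real) \<Rightarrow>
   ((real^'d) \<times> (real^'d^'d) \<Rightarrow> complex) set" where
  "mixed_space \<mu> p q v = {F \<in> borel_measurable (lborel \<Otimes>\<^sub>M \<mu>). mixed_norm \<mu> p q v F < \<infinity>}"

definition mixed_opnorm ::
  "(real^'d^'d) measure \<Rightarrow> ennreal \<Rightarrow> ennreal \<Rightarrow> ((real^'d) \<times> (real^'d^'d) \<Rightarrow> real) \<Rightarrow>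
   (((real^'d) \<times> (real^'d^'d) \<Rightarrow> complex) \<Rightarrow> ((real^'d) \<times> (real^'d^'d) \<Rightarrow> complex)) \<Rightarrow> ennreal" where
  "mixed_opnorm \<mu> p q v T =
     (SUP F\<in>{F \<in> mixed_space \<mu> p q v. mixed_norm \<mu> p q v F \<le> 1}. mixed_norm \<mu> p q v (T F))"

definition left_trans ::
  "(real^'d) \<times> (real^'d^'d) \<Rightarrow> ((real^'d) \<times> (real^'d^'d) \<Rightarrow> complex) \<Rightarrow>
   ((real^'d) \<times> (real^'d^'d) \<Rightarrow> complex)" where
  "left_trans z F = (\<lambda>z'. F (sd_mult (sd_inv z) z'))"

definition right_trans ::
  "(real^'d) \<times> (real^'d^'d) \<Rightarrow> ((real^'d) \<times> (real^'d^'d) \<Rightarrow> complex) \<Rightarrow>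
   ((real^'d) \<times> (real^'d^'d) \<Rightarrow> complex)" where
  "right_trans z F = (\<lambda>z'. F (sd_mult z' z))"

definition control_weight ::
  "(real^'d^'d) set \<Rightarrow> (real^'d^'d) measure \<Rightarrow> ennreal \<Rightarrow> ennreal \<Rightarrow>
   ((real^'d) \<times> (real^'d^'d) \<Rightarrow> real) \<Rightarrow> ((real^'d) \<times> (real^'d^'d) \<Rightarrow> real) \<Rightarrow> bool" where
  "control_weight H \<mu> p q v v\<^sub>0 \<longleftrightarrow>
     weight_on (UNIV \<times> H) sd_mult v\<^sub>0 \<and>
     (\<forall>z\<in>UNIV \<times> H.
        v\<^sub>0 z = v\<^sub>0 (sd_inv z) / modular_G \<mu> z \<and>
        mixed_opnorm \<mu> p q v (left_trans z) \<le> ennreal (v\<^sub>0 z) \<and>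
        mixed_opnorm \<mu> p q v (left_trans (sd_inv z)) \<le> ennreal (v\<^sub>0 z) \<and>
        mixed_opnorm \<mu> p q v (right_trans z) \<le> ennreal (v\<^sub>0 z) \<and>
        mixed_opnorm \<mu> p q v (right_trans (sd_inv z)) * ennreal (1 / modular_G \<mu> z) \<le> ennreal (v\<^sub>0 z))"

definition l2_functional :: "(real^'d \<Rightarrow> complex) \<Rightarrow> (real^'d \<Rightarrow> complex) \<Rightarrow> complex" where
  "l2_functional f = (\<lambda>g. l2_inner f g)"

text \<open>
  The transform is defined for conjugate-linear functionals; for \<open>f \<in> L\<^sup>2\<close> it is applied to
  \<open>l2_functional f\<close>.
\<close>

definition wavelet ::
  "(real^'d \<Rightarrow> complex) \<Rightarrow> ((real^'d \<Rightarrow> complex) \<Rightarrow> complex) \<Rightarrow>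
   (real^'d) \<times> (real^'d^'d) \<Rightarrow> complex" where
  "wavelet \<psi> \<Phi> z = \<Phi> (qreg z \<psi>)"

definition H1_norm ::
  "(real^'d^'d) measure \<Rightarrow> ((real^'d) \<times> (real^'d^'d) \<Rightarrow> real) \<Rightarrow> (real^'d \<Rightarrow> complex) \<Rightarrow>
   (real^'d \<Rightarrow> complex) \<Rightarrow> ennreal" where
  "H1_norm \<mu> v\<^sub>0 \<psi>\<^sub>0 f = mixed_norm \<mu> 1 1 v\<^sub>0 (wavelet \<psi>\<^sub>0 (l2_functional f))"

definition H1 ::
  "(real^'d^'d) measure \<Rightarrow> ((real^'d) \<times> (real^'d^'d) \<Rightarrow> real) \<Rightarrow> (real^'d \<Rightarrow> complex) \<Rightarrow>
   (real^'d \<Rightarrow> complex) set" where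
  "H1 \<mu> v\<^sub>0 \<psi>\<^sub>0 =
     {f \<in> Lp lborel 2. wavelet \<psi>\<^sub>0 (l2_functional f) \<in> mixed_space \<mu> 1 1 v\<^sub>0}"

text \<open>
  Functionals are total functions, of which only the values on \<open>H1\<close> matter. Boundedness makes
  them constant on almost-everywhere classes.
\<close>

definition H1_conj_dual ::
  "(real^'d^'d) measure \<Rightarrow> ((real^'d) \<times> (real^'d^'d) \<Rightarrow> real) \<Rightarrow> (real^'d \<Rightarrow> complex) \<Rightarrow>
   ((real^'d \<Rightarrow> complex) \<Rightarrow> complex) set" where
  "H1_conj_dual \<mu> v\<^sub>0 \<psi>\<^sub>0 =
     {\<Phi>. (\<forall>g\<in>H1 \<mu> v\<^sub>0 \<psi>\<^sub>0. \<forall>k\<in>H1 \<mu> v\<^sub>0 \<psi>\<^sub>0. \<Phi> (\<lambda>x. g x + k x) = \<Phi> g + \<Phi> k) \<and>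
         (\<forall>c. \<forall>g\<in>H1 \<mu> v\<^sub>0 \<psi>\<^sub>0. \<Phi> (\<lambda>x. c * g x) = cnj c * \<Phi> g) \<and>
         (\<exists>B::real. \<forall>g\<in>H1 \<mu> v\<^sub>0 \<psi>\<^sub>0. ennreal (norm (\<Phi> g)) \<le> ennreal B * H1_norm \<mu> v\<^sub>0 \<psi>\<^sub>0 g)}"

definition coorbit ::
  "(real^'d^'d) measure \<Rightarrow> ennreal \<Rightarrow> ennreal \<Rightarrow> ((real^'d) \<times> (real^'d^'d) \<Rightarrow> real) \<Rightarrow>
   ((real^'d) \<times> (real^'d^'d) \<Rightarrow> real) \<Rightarrow> (real^'d \<Rightarrow> complex) \<Rightarrow> (real^'d \<Rightarrow> complex) \<Rightarrow>
   ((real^'d \<Rightarrow> complex) \<Rightarrow> complex) set" where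
  "coorbit \<mu> p q v v\<^sub>0 \<psi>\<^sub>0 \<psi> =
     {\<Phi> \<in> H1_conj_dual \<mu> v\<^sub>0 \<psi>\<^sub>0. wavelet \<psi> \<Phi> \<in> mixed_space \<mu> p q v}"

end

theory Submission
  imports Defs "HOL-Probability.Probability"
begin

text \<open>
  Write \<open>F\<close> for the Fourier transform of \<open>f\<close>. The whole argument takes place on the Fourier side, where
  \<open>\<pi>(x,h)\<close> acts by \<open>\<Psi> \<mapsto> \<bar>det h\<bar>\<^sup>1\<^sup>/\<^sup>2 e\<^sup>-\<^sup>2\<^sup>\<pi>\<^sup>i\<^sup>x\<^sup>\<xi> \<Psi>(h\<^sup>T \<xi>)\<close>, and it compares \<open>f\<close> with a single auxiliary
  window whose Fourier transform \<open>\<phi>\<close> is a smooth function with compact support in the orbit. Let \<open>V(x,h)\<close> be the transform of \<open>f\<close>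
  with this window (\<open>dual_wavelet\<close>).

  Decay. The vanishing moments make \<open>F\<close> and its derivatives up to order \<open>t - l\<close> at most of size
  \<open>A(\<xi>)\<^sup>l\<close>, where \<open>A\<close> measures the distance to the complement of the orbit (\<open>fourier_moment_decay\<close>).
  Integrating by parts \<open>m\<close> times, with \<open>s + d/p < m \<le> t - l\<close>, gives
  \<open>\<bar>V(x,h)\<bar> \<le> C (1 + \<bar>x\<bar>)\<^sup>-\<^sup>m \<bar>det h\<bar>\<^sup>1\<^sup>/\<^sup>2 (1 + \<parallel>h\<parallel>)\<^sup>m \<integral> A(\<xi>)\<^sup>l A(h\<^sup>T \<xi>)\<^sup>l d\<xi>\<close> (\<open>dual_wavelet_decay\<close>). The last integral is,
  up to a constant, a convolution over \<open>H\<close> of the two functions in the definition of temperate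
  embedding, so its weighted \<open>L\<^sup>q\<close> norm is finite (\<open>Phi_finite\<close>). Hence \<open>V\<close> lies in \<open>L\<^sup>p\<^sup>,\<^sup>q\<^sub>v(G)\<close>
  (\<open>dual_wavelet_mixed_norm\<close>). The same integral shows that \<open>F\<close>, and so \<open>f\<close>, is square-integrable.

  Orthogonality. With \<open>\<Psi>\<^sub>0\<close> the Fourier transform of \<open>\<psi>\<^sub>0\<close>, the number \<open>\<kappa> = \<integral>\<^sub>H \<Psi>\<^sub>0(h\<^sup>T \<xi>) cnj (\<phi>(h\<^sup>T \<xi>)) dh\<close> is the same for all \<open>\<xi>\<close> in the orbit,
  and \<open>\<phi>\<close> can be chosen with \<open>\<kappa> \<noteq> 0\<close> (\<open>ex_overlapping_window\<close>). Parseval's identity in \<open>x\<close> and Fubini's theorem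
  then give \<open>\<bar>\<kappa>\<bar> \<bar>\<langle>f,g\<rangle>\<bar> \<le> \<integral>\<^sub>G \<bar>V\<bar> \<bar>W g\<bar>\<close> for every \<open>g\<close> in \<open>L\<^sup>2\<close> whose transform \<open>W g(z) = \<langle>g, \<pi>(z) \<psi>\<^sub>0\<rangle>\<close> is integrable over \<open>G\<close>
  (\<open>orthogonality_bound\<close>). This one inequality is used twice. As \<open>V\<close> is bounded and \<open>v\<^sub>0 \<ge> 1\<close>
  (\<open>control_weight_ge_1\<close>), it bounds the functional of \<open>f\<close> on \<open>H1\<close>. Applied to \<open>g = \<pi>(z) \<psi>\<close> it becomes
  \<open>\<bar>\<kappa>\<bar> \<bar>\<langle>f, \<pi>(z) \<psi>\<rangle>\<bar> \<le> \<integral>\<^sub>G \<bar>V(z u)\<bar> \<bar>W \<psi>(u)\<bar> du\<close>, an average of right translates of \<open>V\<close>. Minkowski's inequality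
  and the bound \<open>v\<^sub>0(u)\<close> for right translation by \<open>u\<close> give its norm in \<open>L\<^sup>p\<^sup>,\<^sup>q\<^sub>v(G)\<close>
  (\<open>right_convolution_bound\<close>), finite because \<open>W \<psi>\<close> is integrable against \<open>v\<^sub>0\<close>.
\<close>

section \<open>Mixed Lebesgue norms and Minkowski's inequality\<close>

lemmas Bochner_cong = Bochner_Integration.integral_cong

lemma epow_1 [simp]: "epow x 1 = x"
 by (cases x) (auto simp: epow_def)

lemma epow_0 [simp]: "epow 0 a = 0"
 by (simp add: epow_def)

lemma epow_top [simp]: "epow top a = top"
 by (simp add: epow_def)

lemma epow_ennreal: "0 \<le> x ==> epow (ennreal x) a = ennreal (x powr a)"
 by (simp add: epow_def)

lemma epow_mono: "x \<le> y ==> 0 \<le> a ==> epow x a \<le> epow y a"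
 by (cases x; cases y)
  (auto simp: epow_def top_unique intro!: ennreal_leI powr_mono2)

lemma epow_mult: "0 < a ==> epow (x * y) a = epow x a * epow y a"
 by (cases x; cases y)
  (auto simp: epow_def powr_mult ennreal_mult ennreal_mult_top ennreal_top_mult simp flip: ennreal_mult)

lemma epow_epow: "0 < a ==> 0 < b ==> epow (epow x a) b = epow x (a * b)"
 by (cases x) (auto simp: epow_def powr_powr)

lemma epow_less_top: "epow x a < top \<longleftrightarrow> x < top"
 by (cases x) (auto simp: epow_def)

lemma epow_measurable [measurable]:
 assumes [measurable]: "f \<in> borel_measurable M" shows "(\<lambda>x. epow (f x) a) \<in> borel_measurable M"
 unfolding epow_def by measurable

lemma lp_norm_top: "lp_norm M \<infinity> f = esssup M f"
 by (simp add: lp_norm_def)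

lemma lp_norm_ennreal:
 "0 < r ==> lp_norm M (ennreal r) f = epow (\<integral>\<^sup>+x. epow (f x) r \<partial>M) (1 / r)"
 by (simp add: lp_norm_def)

lemma lp_norm_1: "lp_norm M 1 f = (\<integral>\<^sup>+x. f x \<partial>M)"
 using lp_norm_ennreal[of 1 M f] by simp

lemma exponent_cases:
 assumes "(1::ennreal) \<le> p"
 obtains "p = \<infinity>" | r where "p = ennreal r" "1 \<le> r"
 using assms by (cases p) (auto simp: ennreal_ge_1)

lemma lp_norm_mono_AE:
 assumes "f \<in> borel_measurable M" "AE x in M. f x \<le> g x"
 shows "lp_norm M p f \<le> lp_norm M p g"
 unfolding lp_norm_def
 using assms by (auto intro!: esssup_AE_mono epow_mono nn_integral_mono_AE elim!: eventually_mono)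

lemma lp_norm_mono:
 assumes "f \<in> borel_measurable M" "\<And>x. x \<in> space M ==> f x \<le> g x"
 shows "lp_norm M p f \<le> lp_norm M p g"
 using assms by (intro lp_norm_mono_AE) auto

lemma lp_norm_le_iff:
 assumes "0 < r" "0 \<le> c"
 shows "lp_norm M (ennreal r) f \<le> c \<longleftrightarrow> (\<integral>\<^sup>+x. epow (f x) r \<partial>M) \<le> epow c r"
proof -
 have eq: "epow (epow y (1 / r)) r = y" "epow (epow y r) (1 / r) = y" for y
  using \<open>0 < r\<close> by (simp_all add: epow_epow)
 show ?thesis
  unfolding lp_norm_ennreal[OF \<open>0 < r\<close>]
  using epow_mono[of "epow (\<integral>\<^sup>+x. epow (f x) r \<partial>M) (1 / r)" c r]
   epow_mono[of "\<integral>\<^sup>+x. epow (f x) r \<partial>M" "epow c r" "1 / r"] \<open>0 < r\<close>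
  by (auto simp: eq)
qed

lemma lp_norm_cmult:
 assumes c: "0 \<le> c" and p: "1 \<le> p" and f [measurable]: "f \<in> borel_measurable M"
 shows "lp_norm M p (\<lambda>x. ennreal c * f x) \<le> ennreal c * lp_norm M p f"
 using p
proof (cases rule: exponent_cases)
 case 1
 have "AE x in M. ennreal c * f x \<le> ennreal c * esssup M f"
  using esssup_AE[of f M] by eventually_elim (rule mult_left_mono, auto)
 then show ?thesis
  unfolding 1 lp_norm_top by (intro esssup_I) auto
next
 case (2 r)
 then have "0 < r" by simp
 show ?thesis
  unfolding 2 lp_norm_ennreal[OF \<open>0 < r\<close>]
  using \<open>0 < r\<close> by (simp add: epow_mult nn_integral_cmult epow_epow)
qed

lemma borel_measurable_lp_norm:
 assumes M: "sigma_finite_measure M"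
  and F: "case_prod F \<in> borel_measurable (N \<Otimes>\<^sub>M M)" and p: "1 \<le> p"
 shows "(\<lambda>y. lp_norm M p (F y)) \<in> borel_measurable N"
 using p
proof (cases rule: exponent_cases)
 interpret M: sigma_finite_measure M by fact
 note F [measurable]
 case 1
 have "{y \<in> space N. a < esssup M (F y)} \<in> sets N" for a :: ennreal
 proof -
  have "{y \<in> space N. a < esssup M (F y)} =
   {y \<in> space N. 0 < emeasure M {x \<in> space M. a < F y x}}" (is "?L = ?R")
  proof (intro Collect_cong conj_cong refl)
   fix y assume y: "y \<in> space N"
   have [measurable]: "F y \<in> borel_measurable M"
    using measurable_compose[OF measurable_Pair1'[OF y] F] by simp
   show "a < esssup M (F y) \<longleftrightarrow> 0 < emeasure M {x \<in> space M. a < F y x}"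
   proof
    assume "0 < emeasure M {x \<in> space M. a < F y x}"
    moreover have "emeasure M {x \<in> space M. a < F y x} = 0" if "esssup M (F y) \<le> a"
    proof -
     have "AE x in M. F y x \<le> a"
      using esssup_AE[of "F y" M] by eventually_elim (use that in auto)
     then show ?thesis
      by (simp add: AE_iff_measurable[OF _ refl] not_le)
    qed
    ultimately show "a < esssup M (F y)"
     by (metis less_irrefl not_le_imp_less)
   qed (rule esssup_pos_measure, auto)
  qed
  also have "\<dots> \<in> sets N" by measurable
  finally show ?thesis .
 qed
 then show ?thesis
  unfolding 1 lp_norm_top by (rule borel_measurableI_greater)
next
 interpret M: sigma_finite_measure M by fact
 note F [measurable]
 case (2 r)
 then show ?thesis by (simp add: lp_norm_ennreal)
qed

lemma young_tangent:
 fixes m y r :: real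
 assumes r: "1 \<le> r" and m: "0 \<le> m" and y: "0 \<le> y"
 shows "r * m powr (r - 1) * y \<le> y powr r + (r - 1) * m powr r"
proof (cases "m = 0 \<or> y = 0")
 case True
 then show ?thesis using assms by auto
next
 case False
 then have pos: "0 < m" "0 < y" using assms by auto
 have "(y powr r) powr (1 / r) * (m powr r) powr (1 - 1 / r) \<le> 1 / r * y powr r + (1 - 1 / r) * m powr r"
  using r pos by (intro Youngs_inequality_0) (auto simp: divide_simps)
 moreover have "(y powr r) powr (1 / r) = y" "(m powr r) powr (1 - 1 / r) = m powr (r - 1)"
  using pos r by (simp_all add: powr_powr algebra_simps)
 ultimately have "r * (y * m powr (r - 1)) \<le> r * (1 / r * y powr r + (1 - 1 / r) * m powr r)"
  using r by (intro mult_left_mono) auto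
 then show ?thesis using r by (simp add: algebra_simps)
qed

text \<open>Jensen's inequality for powers: integrate the tangent-line bound of \<open>y \<mapsto> y\<^sup>r\<close> at the mean.\<close>

lemma (in prob_space) jensen_epow:
 assumes r: "1 \<le> r" and f [measurable]: "f \<in> borel_measurable M"
 shows "epow (\<integral>\<^sup>+x. f x \<partial>M) r \<le> (\<integral>\<^sup>+x. epow (f x) r \<partial>M)"
proof (cases "(\<integral>\<^sup>+x. f x \<partial>M) = \<infinity>")
 case True
 have le: "y \<le> 1 + epow y r" for y
 proof (cases y)
  case (real t)
  have "t \<le> 1 + t powr r"
  proof (cases "t \<le> 1")
   case True
   with powr_ge_zero[of t r] show ?thesis by linarith
  next
   case False
   with powr_mono[of 1 r t] r show ?thesis by simp
  qed
  then show ?thesis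
   using real ennreal_leI[of t "1 + t powr r"] by (simp add: epow_ennreal)
 qed auto
 have "(\<integral>\<^sup>+x. f x \<partial>M) \<le> (\<integral>\<^sup>+x. 1 + epow (f x) r \<partial>M)"
  by (intro nn_integral_mono le)
 also have "\<dots> = 1 + (\<integral>\<^sup>+x. epow (f x) r \<partial>M)"
  by (simp add: nn_integral_add emeasure_space_1)
 finally show ?thesis using True by (auto simp: top_unique)
next
 case False
 then obtain m where m: "(\<integral>\<^sup>+x. f x \<partial>M) = ennreal m" "0 \<le> m"
  by (cases "\<integral>\<^sup>+x. f x \<partial>M") auto
 have le: "ennreal (r * m powr (r - 1)) * y \<le> epow y r + ennreal ((r - 1) * m powr r)" for y
 proof (cases y)
  case (real t)
  then show ?thesis
   using young_tangent[OF r m(2), of t] r m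
   by (simp add: epow_ennreal flip: ennreal_mult ennreal_plus)
 qed simp
 have "ennreal (r * m powr r) = ennreal (r * m powr (r - 1)) * (\<integral>\<^sup>+x. f x \<partial>M)"
  using r m by (cases "m = 0") (auto simp: powr_diff simp flip: ennreal_mult)
 also have "\<dots> = (\<integral>\<^sup>+x. ennreal (r * m powr (r - 1)) * f x \<partial>M)"
  by (simp add: nn_integral_cmult)
 also have "\<dots> \<le> (\<integral>\<^sup>+x. epow (f x) r + ennreal ((r - 1) * m powr r) \<partial>M)"
  by (intro nn_integral_mono le)
 also have "\<dots> = (\<integral>\<^sup>+x. epow (f x) r \<partial>M) + ennreal ((r - 1) * m powr r)"
  by (simp add: nn_integral_add emeasure_space_1)
 finally have *: "ennreal (r * m powr r) \<le> (\<integral>\<^sup>+x. epow (f x) r \<partial>M) + ennreal ((r - 1) * m powr r)" .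
 show ?thesis
 proof (cases "\<integral>\<^sup>+x. epow (f x) r \<partial>M")
  case (real t)
  then have "ennreal (r * m powr r) \<le> ennreal (t + (r - 1) * m powr r)"
   using * r by simp
  then have "r * m powr r \<le> t + (r - 1) * m powr r"
   using real r by (subst (asm) ennreal_le_iff) auto
  then show ?thesis
   using real m by (simp add: epow_ennreal algebra_simps)
 qed simp
qed

text \<open>Stated with an upper bound \<open>g\<close> for the norms of the slices rather than with the norms
 themselves. With \<open>g > 0\<close> and finite integral, \<open>g dN / \<integral>g\<close> is a probability measure, and Jensen's
 inequality applies to \<open>F / g\<close>, all of whose slices have norm at most one. The strictly positive
 integrable function \<open>e\<close> removes the zeros of \<open>g\<close>.\<close>

lemma Minkowski_nn_integral:
 assumes M: "sigma_finite_measure M" and N: "sigma_finite_measure N"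
  and F: "case_prod F \<in> borel_measurable (M \<Otimes>\<^sub>M N)"
  and g: "g \<in> borel_measurable N" and p: "1 \<le> p"
  and le: "\<And>u. u \<in> space N ==> lp_norm M p (\<lambda>x. F x u) \<le> g u"
 shows "lp_norm M p (\<lambda>x. \<integral>\<^sup>+u. F x u \<partial>N) \<le> (\<integral>\<^sup>+u. g u \<partial>N)"
proof -
 interpret M: sigma_finite_measure M by fact
 interpret N: sigma_finite_measure N by fact
 interpret P: pair_sigma_finite M N ..
 note F[measurable] g[measurable]
 show ?thesis
  using p
 proof (cases rule: exponent_cases)
  case 1
  have "AE u in N. AE x in M. F x u \<le> g u"
  proof (rule AE_I2)
   fix u assume u: "u \<in> space N"
   show "AE x in M. F x u \<le> g u"
    using esssup_AE[of "\<lambda>x. F x u" M]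
    by eventually_elim (use le[OF u, unfolded 1 lp_norm_top] in \<open>auto intro: order_trans\<close>)
  qed
  then have "AE x in M. AE u in N. F x u \<le> g u"
   by (subst P.AE_commute) measurable
  then have "AE x in M. (\<integral>\<^sup>+u. F x u \<partial>N) \<le> (\<integral>\<^sup>+u. g u \<partial>N)"
   by eventually_elim (rule nn_integral_mono_AE)
  then show ?thesis
   unfolding 1 lp_norm_top by (intro esssup_I) measurable
 next
  case (2 r)
  then have r0: "0 < r" by simp
  obtain e where e [measurable]: "e \<in> borel_measurable N" and e_fin: "(\<integral>\<^sup>+u. e u \<partial>N) \<noteq> \<infinity>"
   and e_pos: "\<And>u. u \<in> space N ==> 0 < e u \<and> e u < \<infinity>"
   using N.Ex_finite_integrable_function by blast
  show ?thesis
  proof (cases "(\<integral>\<^sup>+u. g u \<partial>N) = \<infinity>")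
   case False
   have main: "lp_norm M p (\<lambda>x. \<integral>\<^sup>+u. F x u \<partial>N) \<le> (\<integral>\<^sup>+u. g u \<partial>N) + ennreal \<epsilon> * (\<integral>\<^sup>+u. e u \<partial>N)"
    if "0 < \<epsilon>" for \<epsilon>
   proof -
    define k where "k u = g u + ennreal \<epsilon> * e u" for u
    have k [measurable]: "k \<in> borel_measurable N" unfolding k_def by measurable
    define K where "K = (\<integral>\<^sup>+u. k u \<partial>N)"
    have K_eq: "K = (\<integral>\<^sup>+u. g u \<partial>N) + ennreal \<epsilon> * (\<integral>\<^sup>+u. e u \<partial>N)"
     by (simp add: K_def k_def nn_integral_add nn_integral_cmult)
    have K_fin: "K \<noteq> \<infinity>"
     using False e_fin by (simp add: K_eq ennreal_mult_eq_top_iff)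
    have k_pos: "0 < k u" if "u \<in> space N" for u
     using e_pos[OF that] \<open>0 < \<epsilon>\<close> by (simp add: k_def add_nonneg_pos ennreal_zero_less_mult_iff)
    have k_fin: "AE u in N. k u \<noteq> \<infinity>"
     using K_fin unfolding K_def by (intro nn_integral_noteq_infinite) auto
    have "lp_norm M p (\<lambda>x. \<integral>\<^sup>+u. F x u \<partial>N) \<le> K"
    proof (cases "K = 0")
     case True
     then have "AE u in N. k u = 0" by (simp add: K_def nn_integral_0_iff_AE)
     then have "AE u in N. False"
      using AE_space by eventually_elim (use k_pos in force)
     then have "(\<integral>\<^sup>+u. F x u \<partial>N) = 0" for x
      by (intro nn_integral_zero') auto
     then show ?thesis by (simp add: 2 lp_norm_ennreal r0)
    next
     case K0: False
     define Q where "Q = density N (\<lambda>u. k u / K)"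
     have KK: "K / K = 1"
      using K0 K_fin by (intro ennreal_divide_self) (auto simp: less_top)
     have "(\<integral>\<^sup>+u. k u / K \<partial>N) = K / K"
      unfolding K_def by (rule nn_integral_divide) simp
     note int_k = this[unfolded KK]
     then have "emeasure Q (space Q) = 1"
      using int_k by (simp add: Q_def emeasure_density cong: nn_integral_cong)
     then interpret Q: prob_space Q by (rule prob_spaceI)
     have [simp]: "sets Q = sets N" by (simp add: Q_def)
     have slice: "(\<integral>\<^sup>+x. epow (F x u / k u) r \<partial>M) \<le> 1" if u: "u \<in> space N" "k u \<noteq> \<infinity>" for u
     proof -
      have "(\<integral>\<^sup>+x. epow (F x u) r \<partial>M) \<le> epow (k u) r"
       using le[OF u(1)] unfolding 2 lp_norm_le_iff[OF r0 zero_le]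
       by (rule order_trans) (use r0 in \<open>auto intro!: epow_mono simp: k_def\<close>)
      moreover have "(\<integral>\<^sup>+x. epow (F x u / k u) r \<partial>M) = (\<integral>\<^sup>+x. epow (F x u) r \<partial>M) * epow (1 / k u) r"
       using r0 u(1) by (subst nn_integral_multc[symmetric]) (auto simp: divide_ennreal_def epow_mult)
      ultimately have "(\<integral>\<^sup>+x. epow (F x u / k u) r \<partial>M) \<le> epow (k u) r * epow (1 / k u) r"
       by (simp add: mult_right_mono)
      also have "\<dots> = epow (k u / k u) r"
       using r0 by (simp add: divide_ennreal_def flip: epow_mult)
      also have "\<dots> = 1"
       using k_pos[OF u(1)] u(2) by (simp add: ennreal_divide_self epow_def less_top)
      finally show ?thesis .
     qed
     have pt: "epow (\<integral>\<^sup>+u. F x u \<partial>N) r \<le> epow K r * (\<integral>\<^sup>+u. epow (F x u / k u) r * (k u / K) \<partial>N)"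
      if x: "x \<in> space M" for x
     proof -
      have Fx [measurable]: "F x \<in> borel_measurable N"
       using measurable_compose[OF measurable_Pair1'[OF x] F] by simp
      have "(\<integral>\<^sup>+u. F x u \<partial>N) = (\<integral>\<^sup>+u. K * ((k u / K) * (F x u / k u)) \<partial>N)"
      proof (rule nn_integral_cong_AE)
       show "AE u in N. F x u = K * ((k u / K) * (F x u / k u))"
        using k_fin AE_space
       proof eventually_elim
        case (elim u)
        have "K * ((k u / K) * (F x u / k u)) = (K / K) * (k u / k u) * F x u"
         by (simp add: divide_ennreal_def ac_simps)
        then show ?case
         using elim k_pos[of u] by (simp add: ennreal_divide_self KK less_top)
       qed
      qed
      also have "\<dots> = K * (\<integral>\<^sup>+u. F x u / k u \<partial>Q)"
       by (simp add: Q_def nn_integral_density nn_integral_cmult)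
      finally have "epow (\<integral>\<^sup>+u. F x u \<partial>N) r = epow K r * epow (\<integral>\<^sup>+u. F x u / k u \<partial>Q) r"
       using r0 by (simp add: epow_mult)
      also have "\<dots> \<le> epow K r * (\<integral>\<^sup>+u. epow (F x u / k u) r \<partial>Q)"
       using 2 by (intro mult_left_mono Q.jensen_epow) (auto simp: Q_def)
      finally show ?thesis by (simp add: Q_def nn_integral_density mult.commute)
     qed
     have "(\<integral>\<^sup>+x. epow (\<integral>\<^sup>+u. F x u \<partial>N) r \<partial>M)
       \<le> (\<integral>\<^sup>+x. epow K r * (\<integral>\<^sup>+u. epow (F x u / k u) r * (k u / K) \<partial>N) \<partial>M)"
      by (intro nn_integral_mono pt)
     also have "\<dots> = epow K r * (\<integral>\<^sup>+x. (\<integral>\<^sup>+u. epow (F x u / k u) r * (k u / K) \<partial>N) \<partial>M)"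
      by (subst nn_integral_cmult) auto
     also have "(\<integral>\<^sup>+x. (\<integral>\<^sup>+u. epow (F x u / k u) r * (k u / K) \<partial>N) \<partial>M)
       = (\<integral>\<^sup>+u. (\<integral>\<^sup>+x. epow (F x u / k u) r \<partial>M) * (k u / K) \<partial>N)"
      by (subst P.Fubini'[symmetric]) (auto intro!: nn_integral_cong nn_integral_multc)
     also have "\<dots> \<le> (\<integral>\<^sup>+u. 1 * (k u / K) \<partial>N)"
     proof (rule nn_integral_mono_AE)
      show "AE u in N. (\<integral>\<^sup>+x. epow (F x u / k u) r \<partial>M) * (k u / K) \<le> 1 * (k u / K)"
       using k_fin AE_space by eventually_elim (intro mult_right_mono slice, auto)
     qed
     also have "\<dots> = 1"
      using int_k by simp
     finally show ?thesis
      unfolding 2 lp_norm_le_iff[OF r0 zero_le] by (simp add: mult_left_mono)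
    qed
    then show ?thesis by (simp add: K_eq)
   qed
   obtain E where E: "(\<integral>\<^sup>+u. e u \<partial>N) = ennreal E" "0 \<le> E"
    using e_fin by (cases "\<integral>\<^sup>+u. e u \<partial>N") auto
   show ?thesis
   proof (rule ennreal_le_epsilon)
    fix \<epsilon> :: real assume "0 < \<epsilon>"
    have "lp_norm M p (\<lambda>x. \<integral>\<^sup>+u. F x u \<partial>N) \<le> (\<integral>\<^sup>+u. g u \<partial>N) + ennreal (\<epsilon> / (E + 1)) * ennreal E"
     using main[of "\<epsilon> / (E + 1)"] \<open>0 < \<epsilon>\<close> E by simp
    also have "\<dots> \<le> (\<integral>\<^sup>+u. g u \<partial>N) + ennreal \<epsilon>"
     using \<open>0 < \<epsilon>\<close> E by (intro add_left_mono) (simp add: field_simps flip: ennreal_mult)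
    finally show "lp_norm M p (\<lambda>x. \<integral>\<^sup>+u. F x u \<partial>N) \<le> (\<integral>\<^sup>+u. g u \<partial>N) + ennreal \<epsilon>" .
   qed
  qed simp
 qed
qed

lemma Minkowski_mixed:
 assumes M: "sigma_finite_measure M" and L: "sigma_finite_measure L" and N: "sigma_finite_measure N"
  and F [measurable]: "(\<lambda>(x, h, u). F x h u) \<in> borel_measurable (M \<Otimes>\<^sub>M L \<Otimes>\<^sub>M N)"
  and g [measurable]: "g \<in> borel_measurable N" and p: "1 \<le> p" and q: "1 \<le> q"
  and le: "\<And>u. u \<in> space N ==> lp_norm L q (\<lambda>h. lp_norm M p (\<lambda>x. F x h u)) \<le> g u"
 shows "lp_norm L q (\<lambda>h. lp_norm M p (\<lambda>x. \<integral>\<^sup>+u. F x h u \<partial>N)) \<le> (\<integral>\<^sup>+u. g u \<partial>N)"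
proof -
 interpret M: sigma_finite_measure M by fact
 interpret L: sigma_finite_measure L by fact
 interpret N: sigma_finite_measure N by fact
 have [measurable]: "(\<lambda>z. lp_norm M p (\<lambda>x. F x (fst z) (snd z))) \<in> borel_measurable (L \<Otimes>\<^sub>M N)"
  by (rule borel_measurable_lp_norm[OF M _ p])
   (use measurable_compose[of "\<lambda>x. (snd x, fst (fst x), snd (fst x))", OF _ F] in \<open>simp add: split_beta'\<close>)
 have [measurable]: "(\<lambda>h. lp_norm M p (\<lambda>x. \<integral>\<^sup>+u. F x h u \<partial>N)) \<in> borel_measurable L"
  by (rule borel_measurable_lp_norm[OF M _ p], simp add: split_beta', rule N.borel_measurable_nn_integral)
   (use measurable_compose[of "\<lambda>x. (snd (fst x), fst (fst x), snd x)", OF _ F] in \<open>simp add: split_beta'\<close>)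
 have "lp_norm L q (\<lambda>h. lp_norm M p (\<lambda>x. \<integral>\<^sup>+u. F x h u \<partial>N))
   \<le> lp_norm L q (\<lambda>h. \<integral>\<^sup>+u. lp_norm M p (\<lambda>x. F x h u) \<partial>N)"
 proof (rule lp_norm_mono)
  fix h assume h [measurable]: "h \<in> space L"
  show "lp_norm M p (\<lambda>x. \<integral>\<^sup>+u. F x h u \<partial>N) \<le> (\<integral>\<^sup>+u. lp_norm M p (\<lambda>x. F x h u) \<partial>N)"
  proof (rule Minkowski_nn_integral[OF M N _ _ p order_refl])
   show "(\<lambda>(x, u). F x h u) \<in> borel_measurable (M \<Otimes>\<^sub>M N)"
    using measurable_compose[of "\<lambda>x. (fst x, h, snd x)", OF _ F] h by (simp add: split_beta')
   then show "(\<lambda>u. lp_norm M p (\<lambda>x. F x h u)) \<in> borel_measurable N"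
    by (intro borel_measurable_lp_norm[OF M _ p])
     (use measurable_compose[of "\<lambda>x. (snd x, h, fst x)", OF _ F] h in \<open>simp add: split_beta'\<close>)
  qed
 qed measurable
 also have "\<dots> \<le> (\<integral>\<^sup>+u. g u \<partial>N)"
  by (rule Minkowski_nn_integral[OF L N _ g q le]) measurable
 finally show ?thesis .
qed

section \<open>Matrices and Lebesgue measure on coordinate space\<close>

lemma Basis_vec_eq_axis: "(Basis :: (real^'d) set) = range (\<lambda>i. axis i 1)"
 by (auto simp: Basis_vec_def)

lemma prod_Basis_axis: "(\<Prod>b\<in>(Basis :: (real^'d) set). g b) = (\<Prod>i\<in>UNIV. g (axis i 1))"
 unfolding Basis_vec_eq_axis by (subst prod.reindex) (auto simp: inj_on_def axis_eq_axis)

lemma borel_measurable_vec_nth [measurable (raw)]: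
 fixes f :: "'a => ('b::euclidean_space)^'d"
 assumes "f \<in> borel_measurable M"
 shows "(\<lambda>x. f x $ i) \<in> borel_measurable M"
 using assms by (rule borel_measurable_continuous_on[rotated]) (intro continuous_intros)

lemma borel_measurable_vec_lambda [measurable (raw)]:
 fixes f :: "'d::finite => 'a => 'b::euclidean_space"
 assumes [measurable]: "\<And>i. f i \<in> borel_measurable M"
 shows "(\<lambda>x. \<chi> i. f i x) \<in> borel_measurable M"
proof -
 have "(\<lambda>x. (\<chi> i. f i x) \<bullet> b) \<in> borel_measurable M" if "b \<in> Basis" for b
  using that by (auto simp: Basis_vec_def inner_axis)
 then show ?thesis by (subst borel_measurable_euclidean_space) auto
qed

lemma borel_measurable_matrix_vector_mult [measurable (raw)]:
 fixes f :: "'a => real^'d^'e"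
 assumes [measurable]: "f \<in> borel_measurable M" "g \<in> borel_measurable M"
 shows "(\<lambda>x. f x *v g x) \<in> borel_measurable M"
 unfolding matrix_vector_mult_def by measurable

lemma borel_measurable_matrix_mult [measurable (raw)]:
 fixes f :: "'a => real^'d^'e" and g :: "'a => real^'k^'d"
 assumes [measurable]: "f \<in> borel_measurable M" "g \<in> borel_measurable M"
 shows "(\<lambda>x. f x ** g x) \<in> borel_measurable M"
 unfolding matrix_matrix_mult_def by measurable

lemma borel_measurable_transpose [measurable (raw)]:
 fixes f :: "'a => real^'d^'e"
 assumes [measurable]: "f \<in> borel_measurable M"
 shows "(\<lambda>x. transpose (f x)) \<in> borel_measurable M"
 unfolding transpose_def by measurable

lemma borel_measurable_det [measurable (raw)]:
 fixes f :: "'a => real^'d^'d"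
 assumes [measurable]: "f \<in> borel_measurable M"
 shows "(\<lambda>x. det (f x)) \<in> borel_measurable M"
 unfolding det_def by measurable

lemma matrix_inv:
 fixes A :: "real^'d^'d"
 assumes "invertible A"
 shows "A ** matrix_inv A = mat 1" "matrix_inv A ** A = mat 1"
 using someI_ex[of "\<lambda>A'. A ** A' = mat 1 \<and> A' ** A = mat 1"] assms
 by (auto simp: matrix_inv_def invertible_def)

lemma matrix_inv_unique':
 fixes A :: "real^'d^'d"
 assumes "A ** B = mat 1"
 shows "matrix_inv A = B"
proof -
 have "invertible A" using assms invertible_right_inverse by blast
 then show ?thesis
  by (metis assms matrix_inv(2) matrix_mul_assoc matrix_mul_lid matrix_mul_rid)
qed

lemma matrix_inv_cofactor:
 fixes A :: "real^'d^'d"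
 assumes "det A \<noteq> 0"
 shows "matrix_inv A = (\<chi> k j. det (\<chi> i m. if m = k then axis j 1 $ i else A $ i $ m) / det A)"
proof -
 have "invertible A" using assms by (simp add: invertible_det_nz)
 have "matrix_inv A *v axis j 1 = (\<chi> k. det (\<chi> i m. if m = k then axis j 1 $ i else A $ i $ m) / det A)" for j
  using cramer[OF assms, of "matrix_inv A *v axis j 1" "axis j 1"]
  by (simp add: matrix_vector_mul_assoc matrix_inv[OF \<open>invertible A\<close>])
 then have "matrix_inv A $ k $ j = det (\<chi> i m. if m = k then axis j 1 $ i else A $ i $ m) / det A" for k j
  by (metis (no_types, lifting) column_def matrix_vector_mult_basis vec_lambda_beta)
 then show ?thesis by (simp add: vec_eq_iff)
qed

lemma borel_measurable_matrix_inv [measurable (raw)]: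
 fixes f :: "'a => real^'d^'d"
 assumes [measurable]: "f \<in> borel_measurable M"
 shows "(\<lambda>x. matrix_inv (f x)) \<in> borel_measurable M"
proof -
 have "matrix_inv A = (if det A \<noteq> 0 then
   (\<chi> k j. det (\<chi> i m. if m = k then axis j 1 $ i else A $ i $ m) / det A) else (SOME A'. False))"
  for A :: "real^'d^'d"
 proof (cases "det A = 0")
  case True
  then have "\<nexists>A'. A ** A' = mat 1 \<and> A' ** A = mat 1"
   by (auto simp flip: invertible_def simp: invertible_det_nz)
  then have "(\<lambda>A'. A ** A' = mat 1 \<and> A' ** A = mat 1) = (\<lambda>_. False)" by auto
  then show ?thesis using True by (simp add: matrix_inv_def)
 qed (simp add: matrix_inv_cofactor)
 then show ?thesis by simp
qed

lemma norm_transpose: "norm (transpose A) = norm (A :: real^'d^'e)"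
proof -
 have "(\<Sum>i\<in>UNIV. \<Sum>j\<in>UNIV. (A $ j $ i)\<^sup>2) = (\<Sum>j\<in>UNIV. \<Sum>i\<in>UNIV. (A $ j $ i)\<^sup>2)"
  by (rule sum.swap)
 then show ?thesis
  by (simp add: norm_vec_def L2_set_def sum_nonneg transpose_def)
qed

lemma norm_matrix_vector_mult_le: "norm (A *v x) \<le> norm A * norm (x :: real^'d)" for A :: "real^'d^'e"
proof (rule power2_le_imp_le)
 have "(norm (A *v x))\<^sup>2 = (\<Sum>i\<in>UNIV. (A $ i \<bullet> x)\<^sup>2)"
  by (simp add: norm_vec_def L2_set_def sum_nonneg matrix_vector_mul_component)
 also have "\<dots> \<le> (\<Sum>i\<in>UNIV. (norm (A $ i))\<^sup>2 * (norm x)\<^sup>2)"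
 proof (rule sum_mono)
  fix i
  have "\<bar>A $ i \<bullet> x\<bar>\<^sup>2 \<le> (norm (A $ i) * norm x)\<^sup>2"
   by (intro power_mono Cauchy_Schwarz_ineq2) auto
  then show "(A $ i \<bullet> x)\<^sup>2 \<le> (norm (A $ i))\<^sup>2 * (norm x)\<^sup>2" by (simp add: power_mult_distrib)
 qed
 also have "\<dots> = (norm A)\<^sup>2 * (norm x)\<^sup>2"
  by (simp add: norm_vec_def[of A] L2_set_def sum_nonneg sum_distrib_right)
 finally show "(norm (A *v x))\<^sup>2 \<le> (norm A * norm x)\<^sup>2" by (simp add: power_mult_distrib)
qed simp

lemma norm_matrix_mult_le: "norm (A ** B) \<le> norm A * norm B" for A :: "real^'d^'e" and B :: "real^'k^'d"
proof (rule power2_le_imp_le)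
 have row: "(A ** B) $ i = transpose B *v (A $ i)" for i
  by (simp add: matrix_matrix_mult_def matrix_vector_mult_def transpose_def vec_eq_iff mult.commute)
 have "(norm (A ** B))\<^sup>2 = (\<Sum>i\<in>UNIV. (norm ((A ** B) $ i))\<^sup>2)"
  by (simp add: norm_vec_def[of "A ** B"] L2_set_def sum_nonneg)
 also have "\<dots> \<le> (\<Sum>i\<in>UNIV. (norm B * norm (A $ i))\<^sup>2)"
  unfolding row
  by (intro sum_mono power_mono order_trans[OF norm_matrix_vector_mult_le]) (auto simp: norm_transpose)
 also have "\<dots> = (norm A)\<^sup>2 * (norm B)\<^sup>2"
  by (simp add: norm_vec_def[of A] L2_set_def sum_nonneg power_mult_distrib sum_distrib_left mult.commute)
 finally show "(norm (A ** B))\<^sup>2 \<le> (norm A * norm B)\<^sup>2" by (simp add: power_mult_distrib)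
qed simp

interpretation lborel_product: product_sigma_finite "\<lambda>_::'d. lborel :: real measure" ..

lemma lborel_vec: "(lborel :: (real^'d) measure) = distr (\<Pi>\<^sub>M i\<in>UNIV. lborel) borel (\<lambda>f. \<chi> i. f i)"
proof (rule lborel_eqI)
 fix l u :: "real^'d"
 assume le: "\<And>b. b \<in> Basis ==> l \<bullet> b \<le> u \<bullet> b"
 have le': "l $ i \<le> u $ i" for i
  using le[of "axis i 1"] by (auto simp: Basis_vec_eq_axis inner_axis)
 have [measurable]: "(\<lambda>f. \<chi> i. f i) \<in> (\<Pi>\<^sub>M i\<in>(UNIV :: 'd set). (lborel :: real measure)) \<rightarrow>\<^sub>M borel"
  by measurable
 have "(\<lambda>f. \<chi> i. f i) -` box l u \<inter> space (\<Pi>\<^sub>M i\<in>(UNIV :: 'd set). (lborel :: real measure))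
   = (\<Pi>\<^sub>E i\<in>UNIV. {l $ i<..<u $ i})"
  by (auto simp: mem_box_cart space_PiM PiE_iff)
 then have "emeasure (distr (\<Pi>\<^sub>M i\<in>UNIV. lborel) borel (\<lambda>f. \<chi> i. f i)) (box l u)
   = (\<Prod>i\<in>UNIV. emeasure lborel {l $ i<..<u $ i})"
  by (simp add: emeasure_distr lborel_product.emeasure_PiM)
 also have "\<dots> = ennreal (\<Prod>b\<in>Basis. (u - l) \<bullet> b)"
  using le' by (simp add: prod_Basis_axis inner_axis prod_ennreal)
 finally show "emeasure (distr (\<Pi>\<^sub>M i\<in>UNIV. lborel) borel (\<lambda>f. \<chi> i. f i)) (box l u) = (\<Prod>b\<in>Basis. (u - l) \<bullet> b)" .
qed simp

lemma nn_integral_prod_vec: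
 fixes u :: "'d::finite => real => ennreal"
 assumes [measurable]: "\<And>i. u i \<in> borel_measurable borel"
 shows "(\<integral>\<^sup>+x. (\<Prod>i\<in>UNIV. u i (x $ i)) \<partial>lborel) = (\<Prod>i\<in>UNIV. \<integral>\<^sup>+t. u i t \<partial>lborel)"
 by (simp add: lborel_vec nn_integral_distr lborel_product.product_nn_integral_prod)

lemma integral_prod_vec:
 fixes u :: "'d::finite => real => complex"
 assumes u: "\<And>i. integrable lborel (u i)"
 shows "integrable (lborel :: (real^'d) measure) (\<lambda>x. \<Prod>i\<in>UNIV. u i (x $ i))"
  and "(\<integral>x. (\<Prod>i\<in>UNIV. u i (x $ i)) \<partial>(lborel :: (real^'d) measure)) = (\<Prod>i\<in>UNIV. \<integral>t. u i t \<partial>lborel)"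
proof -
 have [measurable]: "u i \<in> borel_measurable borel" for i
  using borel_measurable_integrable[OF u[of i]] by simp
 show "integrable (lborel :: (real^'d) measure) (\<lambda>x. \<Prod>i\<in>UNIV. u i (x $ i))"
  using lborel_product.product_integrable_prod[of UNIV u] u
  by (simp add: lborel_vec integrable_distr_eq)
 show "(\<integral>x. (\<Prod>i\<in>UNIV. u i (x $ i)) \<partial>(lborel :: (real^'d) measure)) = (\<Prod>i\<in>UNIV. \<integral>t. u i t \<partial>lborel)"
  using lborel_product.product_integral_prod[of UNIV u] u
  by (simp add: lborel_vec integral_distr)
qed

lemma lborel_translation: "distr lborel borel (\<lambda>x. a + x) = (lborel :: (real^'d) measure)"
 using lborel_affine[of 1 a] by (simp add: density_1)

lemma nn_integral_translation:
 fixes a :: "real^'d"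
 assumes [measurable]: "f \<in> borel_measurable borel"
 shows "(\<integral>\<^sup>+x. f (a + x) \<partial>lborel) = (\<integral>\<^sup>+x. f x \<partial>lborel)"
 by (subst (2) lborel_translation[of a, symmetric]) (simp add: nn_integral_distr)

text \<open>The change of variables formula is proved by decomposing a matrix into elementary ones; only the
 shears need Fubini's theorem.\<close>

lemma nn_integral_linear_image:
 fixes A :: "real^'d^'d"
 shows "det A \<noteq> 0 \<longrightarrow> (\<forall>f\<in>borel_measurable borel.
  ennreal \<bar>det A\<bar> * (\<integral>\<^sup>+x. f (A *v x) \<partial>lborel) = (\<integral>\<^sup>+x. f x \<partial>lborel))"
proof (induction A rule: induct_matrix_elementary)
 case (1 A B)
 show ?case
 proof (intro impI ballI)
  fix f :: "real^'d => ennreal" assume f [measurable]: "f \<in> borel_measurable borel"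
  assume "det (A ** B) \<noteq> 0"
  then have nz: "det A \<noteq> 0" "det B \<noteq> 0" by (auto simp: det_mul)
  have "(\<lambda>x. f (A *v x)) \<in> borel_measurable borel" by measurable
  with 1(2) nz(2) have "ennreal \<bar>det B\<bar> * (\<integral>\<^sup>+x. f (A *v (B *v x)) \<partial>lborel) = (\<integral>\<^sup>+x. f (A *v x) \<partial>lborel)"
   by (auto dest: bspec)
  moreover have "ennreal \<bar>det A\<bar> * (\<integral>\<^sup>+x. f (A *v x) \<partial>lborel) = (\<integral>\<^sup>+x. f x \<partial>lborel)"
   using 1(1) nz f by blast
  ultimately show "ennreal \<bar>det (A ** B)\<bar> * (\<integral>\<^sup>+x. f ((A ** B) *v x) \<partial>lborel) = (\<integral>\<^sup>+x. f x \<partial>lborel)"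
   by (simp add: det_mul abs_mult ennreal_mult matrix_vector_mul_assoc flip: mult.assoc)
    (metis mult.assoc)
 qed
next
 case (2 A i)
 then show ?case by (simp add: det_zero_row)
next
 case (3 A)
 show ?case
 proof (intro impI ballI)
  fix f :: "real^'d => ennreal" assume f [measurable]: "f \<in> borel_measurable borel"
  assume nz: "det A \<noteq> 0"
  have det: "det A = (\<Prod>i\<in>UNIV. A $ i $ i)" using 3 by (rule det_diagonal)
  have nz': "A $ i $ i \<noteq> 0" for i using nz det by auto
  define c where "c b = (\<Sum>i\<in>UNIV. A $ i $ i * b $ i)" for b :: "real^'d"
  have c: "c (axis i 1) = A $ i $ i" for i
   by (simp add: c_def axis_def if_distrib cong: if_cong)
  have T: "A *v x = (\<Sum>j\<in>Basis. (c j * (x \<bullet> j)) *\<^sub>R j)" for x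
  proof -
   have "A *v x = (\<chi> i. A $ i $ i * x $ i)"
    unfolding vec_eq_iff
   proof
    fix i
    have "(A *v x) $ i = (\<Sum>j\<in>UNIV. if j = i then A $ i $ i * x $ i else 0)"
     unfolding matrix_vector_mult_def vec_lambda_beta
     by (rule sum.cong) (use 3 in auto)
    then show "(A *v x) $ i = (\<chi> i. A $ i $ i * x $ i) $ i" by simp
   qed
   also have "\<dots> = (\<Sum>i\<in>UNIV. (A $ i $ i * x $ i) *\<^sub>R axis i 1)"
    by (simp add: vec_eq_iff axis_def if_distrib cong: if_cong)
   also have "\<dots> = (\<Sum>j\<in>Basis. (c j * (x \<bullet> j)) *\<^sub>R j)"
    unfolding Basis_vec_eq_axis
    by (subst sum.reindex) (auto simp: inj_on_def axis_eq_axis c inner_axis)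
   finally show ?thesis .
  qed
  have T': "(*v) A = (\<lambda>x. \<Sum>j\<in>Basis. (c j * (x \<bullet> j)) *\<^sub>R j)" using T by blast
  have "c j \<noteq> 0" if "j \<in> Basis" for j using that nz' c by (auto simp: Basis_vec_eq_axis)
  from lborel_affine_euclidean[of c 0, OF this]
  have "lborel = density (distr lborel borel ((*v) A)) (\<lambda>_. \<Prod>j\<in>Basis. \<bar>c j\<bar>)"
   by (simp add: T')
  also have "(\<Prod>j\<in>Basis. \<bar>c j\<bar>) = \<bar>det A\<bar>"
   by (simp add: prod_Basis_axis c det abs_prod)
  finally have "lborel = density (distr lborel borel ((*v) A)) (\<lambda>_. ennreal \<bar>det A\<bar>)" by simp
  from arg_cong[OF this, of "\<lambda>M. \<integral>\<^sup>+x. f x \<partial>M"]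
  show "ennreal \<bar>det A\<bar> * (\<integral>\<^sup>+x. f (A *v x) \<partial>lborel) = (\<integral>\<^sup>+x. f x \<partial>lborel)"
   by (simp add: nn_integral_density nn_integral_distr nn_integral_cmult)
 qed
next
 case (4 m n)
 let ?P = "\<chi> i j. (mat 1 :: real^'d^'d) $ i $ Transposition.transpose m n j"
 have Px: "(?P *v x) $ i = x $ Transposition.transpose m n i" for x and i :: 'd
 proof -
  have "(i = Transposition.transpose m n j) = (j = Transposition.transpose m n i)" for j
   using transpose_involutory[of m n] by auto
  then have "(?P *v x) $ i = (\<Sum>j\<in>UNIV. if j = Transposition.transpose m n i then x $ j else 0)"
   unfolding matrix_vector_mult_def mat_def vec_lambda_beta by (intro sum.cong) auto
  then show ?thesis by simp
 qed
 have "det ?P = of_int (sign (Transposition.transpose m n)) * det (mat 1 :: real^'d^'d)"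
  by (rule det_permute_columns) (simp add: permutes_swap_id)
 then have det: "\<bar>det ?P\<bar> = 1" by (simp add: sign_def)
 have bij: "bij (Transposition.transpose m n)" by simp
 have "lborel = distr lborel borel ((*v) ?P)"
 proof (rule lborel_eqI)
  fix l u :: "real^'d" assume le: "\<And>b. b \<in> Basis ==> l \<bullet> b \<le> u \<bullet> b"
  let ?s = "\<lambda>x :: real^'d. \<chi> i. x $ Transposition.transpose m n i"
  have "(\<forall>i. R (Transposition.transpose m n i) i) \<longleftrightarrow> (\<forall>i. R i (Transposition.transpose m n i))" for R
   using transpose_involutory[of m n] by metis
  from this[of "\<lambda>j i. l $ i < x $ j \<and> x $ j < u $ i" for x]
  have vim: "(*v) ?P -` box l u = box (?s l) (?s u)"
   by (simp add: set_eq_iff mem_box_cart Px)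
  have le': "?s l \<bullet> b \<le> ?s u \<bullet> b" if "b \<in> Basis" for b
   using that le[of "axis _ 1"] by (auto simp: Basis_vec_eq_axis inner_axis)
  have "emeasure (distr lborel borel ((*v) ?P)) (box l u) = emeasure lborel (box (?s l) (?s u))"
   by (simp add: emeasure_distr vim)
  also have "\<dots> = (\<Prod>b\<in>Basis. (?s u - ?s l) \<bullet> b)"
   using le' by (simp add: emeasure_lborel_box_eq)
  also have "(\<Prod>b\<in>Basis. (?s u - ?s l) \<bullet> b) = (\<Prod>i\<in>UNIV. u $ Transposition.transpose m n i - l $ Transposition.transpose m n i)"
   by (simp add: prod_Basis_axis inner_axis)
  also have "\<dots> = (\<Prod>i\<in>UNIV. u $ i - l $ i)"
   using prod.reindex_bij_betw[OF bij, of "\<lambda>i. u $ i - l $ i"] by simp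
  finally show "emeasure (distr lborel borel ((*v) ?P)) (box l u) = (\<Prod>b\<in>Basis. (u - l) \<bullet> b)"
   by (simp add: prod_Basis_axis inner_axis)
 qed simp
 note distr = this
 have "(\<integral>\<^sup>+x. f (?P *v x) \<partial>lborel) = (\<integral>\<^sup>+x. f x \<partial>lborel)"
  if [measurable]: "f \<in> borel_measurable borel" for f
  by (subst (2) distr) (simp add: nn_integral_distr)
 then show ?case by (simp add: det)
next
 case (5 m n c)
 let ?P = "(\<chi> i j. if i = m \<and> j = n then c else of_bool (i = j)) :: real^'d^'d"
 have "det ?P = det (\<chi> k. if k = m then row m (mat 1 :: real^'d^'d) + c *s row n (mat 1) else row k (mat 1))"
  using \<open>m \<noteq> n\<close> by (intro arg_cong[of _ _ det]) (auto simp: vec_eq_iff row_def mat_def)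
 also have "\<dots> = 1" using \<open>m \<noteq> n\<close> by (subst det_row_operation) auto
 finally have det: "det ?P = 1" .
 have Px: "(?P *v x) $ i = (if i = m then x $ m + c * x $ n else x $ i)" for x and i :: 'd
 proof -
  have "(?P *v x) $ i = (\<Sum>j\<in>UNIV. (if i = m \<and> j = n then c * x $ n else 0) + (if j = i then x $ i else 0))"
   unfolding matrix_vector_mult_def using \<open>m \<noteq> n\<close> by (auto intro!: sum.cong)
  also have "\<dots> = (if i = m then x $ m + c * x $ n else x $ i)"
   by (auto simp: sum.distrib)
  finally show ?thesis .
 qed
 have shear: "(\<integral>\<^sup>+x. f (?P *v x) \<partial>lborel) = (\<integral>\<^sup>+x. f x \<partial>lborel)"
  if f [measurable]: "f \<in> borel_measurable borel" for f :: "real^'d => ennreal"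
 proof -
  have split: "(\<integral>\<^sup>+x. g x \<partial>lborel) =
    (\<integral>\<^sup>+x. (\<integral>\<^sup>+t. g (\<chi> i. (x(m := t)) i) \<partial>lborel) \<partial>(\<Pi>\<^sub>M i\<in>UNIV - {m}. lborel))"
   if [measurable]: "g \<in> borel_measurable borel" for g :: "real^'d => ennreal"
  proof -
   have "(\<integral>\<^sup>+x. g x \<partial>lborel) = (\<integral>\<^sup>+x. g (\<chi> i. x i) \<partial>(\<Pi>\<^sub>M i\<in>insert m (UNIV - {m}). lborel))"
    by (subst lborel_vec) (simp add: nn_integral_distr insert_UNIV)
   also have "\<dots> = (\<integral>\<^sup>+x. (\<integral>\<^sup>+t. g (\<chi> i. (x(m := t)) i) \<partial>lborel) \<partial>(\<Pi>\<^sub>M i\<in>UNIV - {m}. lborel))"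
    by (subst lborel_product.product_nn_integral_insert) (simp_all add: insert_UNIV)
   finally show ?thesis .
  qed
  have eq: "?P *v (\<chi> i. (x(m := t)) i) = (\<chi> i. (x(m := c * x n + t)) i)" for x t
   using \<open>m \<noteq> n\<close> by (simp add: vec_eq_iff Px)
  have meas [measurable]: "(\<lambda>t. f (\<chi> i. (x(m := t)) i)) \<in> borel_measurable borel" for x
  proof -
   have "(\<lambda>t. (x(m := t)) i) \<in> borel_measurable borel" for i
    by (cases "i = m") auto
   then show ?thesis by measurable
  qed
  have "(\<integral>\<^sup>+t. f (\<chi> i. (x(m := c * x n + t)) i) \<partial>lborel) = (\<integral>\<^sup>+t. f (\<chi> i. (x(m := t)) i) \<partial>lborel)" for x
   using nn_integral_real_affine[OF meas[of x], of 1 "c * x n"] by simp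
  then show ?thesis
   unfolding split[OF f] by (subst split) (simp_all only: eq, measurable)
 qed
 show ?case by (simp add: det shear)
qed

section \<open>Smooth test functions\<close>

text \<open>The functions \<open>p(1/t) e\<^sup>-\<^sup>1\<^sup>/\<^sup>t\<close>, flat at the origin. Their derivatives have the same form with another polynomial.\<close>

definition flat_exp :: "real poly => real => real" where
 "flat_exp p t = (if 0 < t then poly p (1 / t) * exp (- (1 / t)) else 0)"

lemma power_poly_div_exp_tendsto_0: "((\<lambda>y::real. y ^ k * poly p y / exp y) \<longlongrightarrow> 0) at_top"
proof (induction p arbitrary: k)
 case (pCons a p)
 have "((\<lambda>y::real. a * (y ^ k / exp y) + y ^ Suc k * poly p y / exp y) \<longlongrightarrow> a * 0 + 0) at_top"
  by (intro tendsto_intros tendsto_power_div_exp_0 pCons.IH)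
 then show ?case by (simp add: algebra_simps add_divide_distrib)
qed simp

lemma flat_exp_deriv: "(flat_exp p has_real_derivative flat_exp ([:0, 0, 1:] * (p - pderiv p)) t) (at t)"
proof -
 consider "0 < t" | "t < 0" | "t = 0" by linarith
 then show ?thesis
 proof cases
  case 1
  have "((\<lambda>t. poly p (1 / t) * exp (- (1 / t))) has_real_derivative
    flat_exp ([:0, 0, 1:] * (p - pderiv p)) t) (at t)"
   using 1 by (auto intro!: derivative_eq_intros simp: flat_exp_def field_simps power2_eq_square)
  then show ?thesis
   by (rule has_field_derivative_transform_within_open[where S="{0<..}"]) (use 1 in \<open>auto simp: flat_exp_def\<close>)
 next
  case 2
  have "((\<lambda>t. 0) has_real_derivative flat_exp ([:0, 0, 1:] * (p - pderiv p)) t) (at t)"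
   using 2 by (simp add: flat_exp_def)
  then show ?thesis
   by (rule has_field_derivative_transform_within_open[where S="{..<0}"]) (use 2 in \<open>auto simp: flat_exp_def\<close>)
 next
  case 3
  have "((\<lambda>h. flat_exp p h / h) \<longlongrightarrow> 0) (at_right 0)"
  proof (rule Lim_transform_eventually)
   show "((\<lambda>h::real. inverse h ^ 1 * poly p (inverse h) / exp (inverse h)) \<longlongrightarrow> 0) (at_right 0)"
    by (rule filterlim_compose[OF power_poly_div_exp_tendsto_0 filterlim_inverse_at_top_right])
   show "eventually (\<lambda>h. inverse h ^ 1 * poly p (inverse h) / exp (inverse h) = flat_exp p h / h) (at_right 0)"
    using eventually_at_right_less[of "0::real"]
    by eventually_elim (simp add: flat_exp_def exp_minus field_simps)
  qed
  moreover have "((\<lambda>h. flat_exp p h / h) \<longlongrightarrow> 0) (at_left 0)"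
   by (rule Lim_transform_eventually[OF tendsto_const])
    (auto simp: flat_exp_def eventually_at_filter)
  ultimately have "((\<lambda>h. flat_exp p h / h) \<longlongrightarrow> 0) (at 0)"
   by (rule filterlim_split_at[rotated])
  then show ?thesis
   using 3 by (simp add: DERIV_def flat_exp_def)
 qed
qed

text \<open>An algebra of smooth functions on the line that is closed under differentiation and contains
 bump functions.\<close>

inductive_set smooth1 :: "(real => real) set" where
 base: "(\<lambda>t. flat_exp p (a * t + b)) \<in> smooth1"
| const: "(\<lambda>t. c) \<in> smooth1"
| add: "u \<in> smooth1 ==> v \<in> smooth1 ==> (\<lambda>t. u t + v t) \<in> smooth1"
| mult: "u \<in> smooth1 ==> v \<in> smooth1 ==> (\<lambda>t. u t * v t) \<in> smooth1"

lemma smooth1_derivE: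
 assumes "u \<in> smooth1"
 obtains u' where "u' \<in> smooth1" "\<And>t. (u has_real_derivative u' t) (at t)"
proof -
 from assms have "\<exists>u'\<in>smooth1. \<forall>t. (u has_real_derivative u' t) (at t)"
 proof induction
  case (base p a b)
  have "((\<lambda>t. flat_exp p (a * t + b)) has_real_derivative
    a * flat_exp ([:0, 0, 1:] * (p - pderiv p)) (a * t + b)) (at t)" for t
   by (rule DERIV_cong[OF DERIV_chain2[OF flat_exp_deriv]]) (auto intro!: derivative_eq_intros)
  then show ?case by (intro bexI[of _ "\<lambda>t. a * flat_exp _ (a * t + b)"] smooth1.intros) blast
 next
  case (const c)
  then show ?case by (intro bexI[of _ "\<lambda>t. 0"] smooth1.intros) auto
 next
  case (add u v)
  then obtain u' v' where "u' \<in> smooth1" "v' \<in> smooth1"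
   "\<And>t. (u has_real_derivative u' t) (at t)" "\<And>t. (v has_real_derivative v' t) (at t)" by blast
  then show ?case
   by (intro bexI[of _ "\<lambda>t. u' t + v' t"] smooth1.intros) (auto intro!: derivative_eq_intros)
 next
  case (mult u v)
  then obtain u' v' where "u' \<in> smooth1" "v' \<in> smooth1"
   "\<And>t. (u has_real_derivative u' t) (at t)" "\<And>t. (v has_real_derivative v' t) (at t)" by blast
  with mult.hyps show ?case
   by (intro bexI[of _ "\<lambda>t. u' t * v t + u t * v' t"] smooth1.intros)
    (auto intro!: derivative_eq_intros)
 qed
 then obtain u' where "u' \<in> smooth1" "\<forall>t. (u has_real_derivative u' t) (at t)" by blast
 then show thesis by (intro that[of u']) auto
qed

lemma smooth1_deriv:
 assumes "u \<in> smooth1"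
 shows "deriv u \<in> smooth1" "(u has_real_derivative deriv u t) (at t)"
proof -
 obtain u' where u': "u' \<in> smooth1" "\<And>t. (u has_real_derivative u' t) (at t)"
  using smooth1_derivE[OF assms] by metis
 then have "deriv u = u'" by (intro ext DERIV_imp_deriv)
 with u' show "deriv u \<in> smooth1" "(u has_real_derivative deriv u t) (at t)" by auto
qed

lemma smooth1_deriv_funpow: "u \<in> smooth1 ==> (deriv ^^ n) u \<in> smooth1"
 by (induction n) (auto intro: smooth1_deriv)

lemma smooth1_continuous: "u \<in> smooth1 ==> continuous_on S u"
 by (meson DERIV_continuous_on has_field_derivative_at_within smooth1_deriv(2))

definition tensor :: "('d::finite => real => real) => real^'d => complex" where
 "tensor u x = (\<Prod>i\<in>UNIV. complex_of_real (u i (x $ i)))"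

text \<open>Tensor products of one-dimensional test functions suffice everywhere: their iterated partial
 derivatives act on separate factors, so they commute for trivial reasons.\<close>

definition box_test :: "real^'d => real^'d => ('d => real => real) set" where
 "box_test a b = {u. \<forall>i. u i \<in> smooth1 \<and> (\<forall>t. t \<notin> {a $ i..b $ i} \<longrightarrow> u i t = 0)}"

lemma box_testD:
 assumes "u \<in> box_test a b"
 shows "u i \<in> smooth1" "t \<notin> {a $ i..b $ i} ==> u i t = 0"
 using assms by (auto simp: box_test_def)

lemma deriv_eq_0_outside:
 assumes "u \<in> smooth1" "\<And>t. t \<notin> {a..b} ==> u t = 0" "t \<notin> {a..b}"
 shows "deriv u t = 0"
proof -
 have "((\<lambda>_. 0) has_real_derivative deriv u t) (at t)"
  by (rule has_field_derivative_transform_within_open[OF smooth1_deriv(2)[OF assms(1)], where S="- {a..b}"])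
   (use assms in \<open>auto simp: open_Compl\<close>)
 then show ?thesis using DERIV_const DERIV_unique by blast
qed

lemma box_test_deriv:
 assumes "u \<in> box_test a b" shows "u(i := deriv (u i)) \<in> box_test a b"
 using assms by (auto simp: box_test_def smooth1_deriv intro!: deriv_eq_0_outside[of "u i" "a $ i" "b $ i"])

lemma tensor_has_derivative:
 assumes "\<And>i. u i \<in> smooth1"
 shows "(tensor u has_derivative (\<lambda>y. \<Sum>i\<in>UNIV. complex_of_real (y $ i) * tensor (u(i := deriv (u i))) x)) (at x)"
proof -
 have "((\<lambda>x. complex_of_real (u i (x $ i))) has_derivative
   (\<lambda>y. complex_of_real (deriv (u i) (x $ i) * y $ i))) (at x)" for i
 proof -
  have "(u i has_derivative (\<lambda>h. deriv (u i) (x $ i) * h)) (at (x $ i))"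
   using smooth1_deriv(2)[OF assms] by (simp add: has_field_derivative_def)
  moreover have "((\<lambda>x. x $ i) has_derivative (\<lambda>y. y $ i)) (at x)"
   by (intro bounded_linear_imp_has_derivative bounded_linear_vec_nth)
  ultimately have "((\<lambda>x. u i (x $ i)) has_derivative (\<lambda>y. deriv (u i) (x $ i) * y $ i)) (at x)"
   by (rule has_derivative_compose[rotated])
  then show ?thesis by (rule has_derivative_of_real)
 qed
 then have prod: "((\<lambda>x. \<Prod>i\<in>UNIV. complex_of_real (u i (x $ i))) has_derivative
   (\<lambda>y. \<Sum>i\<in>UNIV. complex_of_real (deriv (u i) (x $ i) * y $ i) *
    (\<Prod>j\<in>UNIV - {i}. complex_of_real (u j (x $ j))))) (at x)"
  by (intro has_derivative_prod)
 have eq: "complex_of_real (deriv (u i) (x $ i) * y $ i) * (\<Prod>j\<in>UNIV - {i}. complex_of_real (u j (x $ j)))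
   = complex_of_real (y $ i) * tensor (u(i := deriv (u i))) x" for i y
 proof -
  have "tensor (u(i := deriv (u i))) x =
    complex_of_real (deriv (u i) (x $ i)) * (\<Prod>j\<in>UNIV - {i}. complex_of_real (u j (x $ j)))"
   unfolding tensor_def by (subst prod.remove[of _ i]) (auto intro!: prod.cong)
  then show ?thesis by (simp add: mult_ac)
 qed
 have tu: "tensor u = (\<lambda>x. \<Prod>i\<in>UNIV. complex_of_real (u i (x $ i)))"
  by (simp add: tensor_def fun_eq_iff)
 from prod[unfolded eq] show ?thesis by (subst tu)
qed

lemma tensor_line_derivative:
 assumes "\<And>i. u i \<in> smooth1"
 shows "((\<lambda>\<tau>. tensor u (x + \<tau> *\<^sub>R y)) has_vector_derivative
  (\<Sum>i\<in>UNIV. complex_of_real (y $ i) * tensor (u(i := deriv (u i))) (x + \<tau> *\<^sub>R y))) (at \<tau>)"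
proof -
 have "((\<lambda>\<tau>. x + \<tau> *\<^sub>R y) has_derivative (\<lambda>h. h *\<^sub>R y)) (at \<tau>)"
  by (auto intro!: derivative_eq_intros)
 from has_derivative_compose[OF this tensor_has_derivative[of u, OF assms]]
 show ?thesis
  by (simp add: has_vector_derivative_def scaleR_sum_right scaleR_conv_of_real[where 'a=complex] sum_distrib_left mult.assoc)
qed

lemma partial_tensor:
 assumes "\<And>i. u i \<in> smooth1"
 shows "partial i (tensor u) = tensor (u(i := deriv (u i)))"
proof
 fix x
 have "(\<Sum>j\<in>UNIV. complex_of_real (axis i 1 $ j) * tensor (u(j := deriv (u j))) x) = tensor (u(i := deriv (u i))) x"
  by (subst sum.remove[of _ i]) (auto simp: axis_def intro!: sum.neutral)
 with tensor_line_derivative[of u x "axis i 1" 0, OF assms]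
 show "partial i (tensor u) x = tensor (u(i := deriv (u i))) x"
  unfolding partial_def by (intro vector_derivative_at) simp
qed

lemma partial_funpow_tensor:
 assumes "\<And>i. u i \<in> smooth1"
 shows "(partial i ^^ n) (tensor u) = tensor (u(i := (deriv ^^ n) (u i)))"
proof (induction n)
 case (Suc n)
 have "(partial i ^^ Suc n) (tensor u) = partial i (tensor (u(i := (deriv ^^ n) (u i))))"
  by (simp only: funpow.simps o_apply Suc)
 also have "\<dots> = tensor (u(i := (deriv ^^ Suc n) (u i)))"
  using assms by (subst partial_tensor) (auto simp: smooth1_deriv_funpow)
 finally show ?case .
qed simp

lemma coord_list: "distinct (coord_list :: 'd::finite list)" "set (coord_list :: 'd list) = UNIV"
proof -
 have "\<exists>xs :: 'd list. distinct xs \<and> set xs = UNIV"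
  using finite_distinct_list[of "UNIV :: 'd set"] by auto
 from someI_ex[OF this] show "distinct (coord_list :: 'd list)" "set (coord_list :: 'd list) = UNIV"
  by (auto simp: coord_list_def)
qed

lemma mi_deriv_tensor:
 assumes u: "\<And>i. u i \<in> smooth1"
 shows "mi_deriv \<alpha> (tensor u) = tensor (\<lambda>i. (deriv ^^ \<alpha> i) (u i))"
proof -
 have "foldr (\<lambda>i. (partial i) ^^ (\<alpha> i)) xs (tensor u)
   = tensor (\<lambda>i. if i \<in> set xs then (deriv ^^ \<alpha> i) (u i) else u i)" if "distinct xs" for xs
  using that
 proof (induction xs)
  case (Cons i xs)
  then have "foldr (\<lambda>i. (partial i) ^^ (\<alpha> i)) (i # xs) (tensor u)
   = ((partial i) ^^ (\<alpha> i)) (tensor (\<lambda>j. if j \<in> set xs then (deriv ^^ \<alpha> j) (u j) else u j))"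
   by simp
  also have "\<dots> = tensor (\<lambda>j. if j \<in> set (i # xs) then (deriv ^^ \<alpha> j) (u j) else u j)"
   using Cons.prems u
   by (subst partial_funpow_tensor) (auto simp: smooth1_deriv_funpow intro!: arg_cong[of _ _ tensor])
  finally show ?case .
 qed simp
 from this[OF coord_list(1)] show ?thesis
  by (simp add: mi_deriv_def coord_list(2))
qed

lemma tensor_continuous:
 assumes "\<And>i. u i \<in> smooth1" shows "continuous_on S (tensor u)"
proof -
 have "continuous_on S (\<lambda>x. u i (x $ i))" for i
  by (rule continuous_on_compose2[of UNIV]) (auto intro!: smooth1_continuous assms continuous_intros)
 then show ?thesis unfolding tensor_def by (intro continuous_intros)
qed

lemma Ck_tensor:
 assumes "\<And>i. u i \<in> smooth1" shows "Ck k (tensor u)"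
 using assms
proof (induction k arbitrary: u)
 case (Suc k)
 have "tensor u differentiable_on UNIV"
  using tensor_has_derivative[of u, OF Suc.prems] by (meson differentiableI differentiable_at_imp_differentiable_on)
 moreover have "Ck k (partial i (tensor u))" for i
  unfolding partial_tensor[OF Suc.prems] using Suc.prems by (intro Suc.IH) (auto simp: smooth1_deriv)
 ultimately show ?case by simp
qed (simp add: tensor_continuous)

lemma tensor_eq_0_outside:
 assumes "u \<in> box_test a b" "x \<notin> cbox a b" shows "tensor u x = 0"
 using assms by (auto simp: mem_box_cart tensor_def box_test_def not_le)

lemma test_function_tensor:
 assumes "u \<in> box_test a b" shows "test_function (tensor u)"
proof -
 have "closure {x. tensor u x \<noteq> 0} \<subseteq> cbox a b"
  by (rule closure_minimal) (use tensor_eq_0_outside[OF assms] in auto)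
 then have "compact (closure {x. tensor u x \<noteq> 0})"
  by (metis closed_closure compact_Int_closed compact_cbox inf.absorb2)
 with assms show ?thesis by (auto simp: test_function_def intro: Ck_tensor box_testD)
qed

definition bump :: "real => real => real => real => real" where
 "bump c a b t = flat_exp 1 (c * t + (- c * a)) * flat_exp 1 ((- c) * t + c * b)"

lemma bump_smooth1: "bump c a b \<in> smooth1"
 unfolding bump_def[abs_def] by (intro smooth1.intros)

lemma flat_exp_1_bounds: "0 \<le> flat_exp 1 t" "flat_exp 1 t \<le> 1" "0 < t ==> 0 < flat_exp 1 t"
 by (auto simp: flat_exp_def)

lemma bump_bounds: "0 \<le> bump c a b t" "bump c a b t \<le> 1"
 by (auto simp: bump_def flat_exp_1_bounds intro!: mult_le_one)

lemma bump_eq_0: "0 < c ==> t \<notin> {a<..<b} ==> bump c a b t = 0"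
proof -
 assume c: "0 < c" and "t \<notin> {a<..<b}"
 then consider "t \<le> a" | "b \<le> t" by fastforce
 then show "bump c a b t = 0"
 proof cases
  case 1
  then have "c * t \<le> c * a" using c by simp
  then show ?thesis by (simp add: bump_def flat_exp_def)
 next
  case 2
  then have "c * b \<le> c * t" using c by simp
  then show ?thesis by (simp add: bump_def flat_exp_def)
 qed
qed

lemma bump_tendsto: "(\<lambda>n. bump (real (Suc n)) a b t) \<longlonglongrightarrow> indicator {a<..<b} t"
proof (cases "t \<in> {a<..<b}")
 case True
 have *: "(\<lambda>n. flat_exp 1 (real (Suc n) * s)) \<longlonglongrightarrow> 1" if "0 < s" for s
 proof -
  have "(\<lambda>n. exp (- (1 / real (Suc n) * (1 / s)))) \<longlonglongrightarrow> exp (- (0 * (1 / s)))"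
   by (intro tendsto_intros lim_1_over_n[THEN LIMSEQ_Suc])
  then show ?thesis using that by (simp add: flat_exp_def)
 qed
 have "(\<lambda>n. flat_exp 1 (real (Suc n) * (t - a)) * flat_exp 1 (real (Suc n) * (b - t))) \<longlonglongrightarrow> 1 * 1"
  using True by (intro tendsto_mult *) auto
 then show ?thesis using True by (simp add: bump_def algebra_simps)
next
 case False
 then show ?thesis by (subst bump_eq_0) auto
qed

lemma bump_box_test: "0 < c ==> (\<lambda>i. bump c (a $ i) (b $ i)) \<in> box_test a b"
 by (auto simp: box_test_def bump_smooth1 intro!: bump_eq_0)

lemma borel_measurable_tensor:
 "(\<And>i. u i \<in> smooth1) ==> tensor u \<in> borel_measurable borel"
 by (intro borel_measurable_continuous_onI tensor_continuous)

lemma tensor_bounded: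
 assumes u: "u \<in> box_test a b"
 obtains B where "0 \<le> B" "\<And>x. norm (tensor u x) \<le> B * indicator (cbox a b) x"
proof -
 have "compact (tensor u ` cbox a b)"
  using box_testD(1)[OF u] by (intro compact_continuous_image tensor_continuous) auto
 then obtain B where B: "\<And>x. x \<in> cbox a b ==> norm (tensor u x) \<le> B"
  by (meson compact_imp_bounded bounded_iff image_eqI)
 have "norm (tensor u x) \<le> max B 0 * indicator (cbox a b) x" for x
  using B[of x] tensor_eq_0_outside[OF u, of x] by (auto simp: indicator_def)
 then show thesis by (intro that[of "max B 0"]) auto
qed

lemma AE_eq_0_if_box_integrals_0:
 fixes v :: "real^'d => complex"
 assumes v: "integrable lborel v"
  and box: "\<And>a b. (\<integral>x. indicator (box a b) x *\<^sub>R v x \<partial>lborel) = 0"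
 shows "AE x in lborel. v x = 0"
proof -
 have [measurable]: "v \<in> borel_measurable borel" using v by simp
 have int: "integrable lborel (\<lambda>x. indicator A x *\<^sub>R v x)" if "A \<in> sets borel" for A
  using v that by (intro integrable_mult_indicator) auto
 let ?E = "range (\<lambda>(a, b). box a b :: (real^'d) set)"
 have UN: "(\<integral>x. v x \<partial>lborel) = 0"
 proof -
  have "(\<lambda>n. \<integral>x. indicator (box (\<chi> i. - real n) (\<chi> i. real n)) x *\<^sub>R v x \<partial>lborel) \<longlonglongrightarrow> (\<integral>x. v x \<partial>lborel)"
  proof (rule integral_dominated_convergence[where w="\<lambda>x. norm (v x)"])
   show "AE x in lborel. (\<lambda>n. indicator (box (\<chi> i. - real n) (\<chi> i. real n)) x *\<^sub>R v x) \<longlonglongrightarrow> v x"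
   proof (rule AE_I2, rule tendsto_eventually)
    fix x :: "real^'d"
    obtain n0 where n0: "norm x < real n0" using reals_Archimedean2 by blast
    have "x \<in> box (\<chi> i. - real n) (\<chi> i. real n)" if "n0 \<le> n" for n
    proof -
     have "\<bar>x $ i\<bar> < real n" for i
      using component_le_norm_cart[of x i] n0 that by linarith
     then have "- real n < x $ i \<and> x $ i < real n" for i
      by (smt (verit))
     then show ?thesis by (simp add: mem_box_cart)
    qed
    then show "\<forall>\<^sub>F n in sequentially. indicator (box (\<chi> i. - real n) (\<chi> i. real n)) x *\<^sub>R v x = v x"
     by (auto simp: eventually_sequentially intro!: exI[of _ n0])
   qed
  qed (use v in \<open>auto simp: indicator_def\<close>)
  then show ?thesis unfolding box by (simp add: LIMSEQ_const_iff)
 qed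
 have "(\<integral>x. indicator A x *\<^sub>R v x \<partial>lborel) = 0" if "A \<in> sets borel" for A
 proof -
  have "Int_stable ?E" by (auto simp: Int_stable_def box_Int_box)
  moreover have "?E \<subseteq> Pow UNIV" by simp
  moreover have "A \<in> sigma_sets UNIV ?E" using that by (simp add: borel_eq_box)
  ultimately show ?thesis
  proof (induction rule: sigma_sets_induct_disjoint)
   case (basic A) then show ?case using box by auto
  next
   case (compl A)
   then have "A \<in> sets borel" by (simp add: borel_eq_box)
   have "(\<integral>x. indicator (UNIV - A) x *\<^sub>R v x \<partial>lborel) = (\<integral>x. v x - indicator A x *\<^sub>R v x \<partial>lborel)"
    by (intro Bochner_Integration.integral_cong) (auto simp: indicator_def)
   also have "\<dots> = 0" using compl UN v int[OF \<open>A \<in> sets borel\<close>] by simp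
   finally show ?case .
  next
   case (union A)
   then have A: "A i \<in> sets borel" for i by (auto simp: borel_eq_box)
   have "set_integrable lborel (\<Union>i. A i) v"
    using v A by (auto simp: set_integrable_def intro!: integrable_mult_indicator)
   from lebesgue_integral_countable_add[OF _ _ this] A union
   show ?case by (auto simp: set_lebesgue_integral_def disjoint_family_on_def)
  qed simp
 qed
 then show ?thesis
  using sigma_finite_measure.density_zero[OF sigma_finite_lborel v] by (simp add: set_lebesgue_integral_def)
qed

text \<open>The fundamental lemma of the calculus of variations: bumps converge boundedly to indicators of
 boxes, and boxes determine an integrable function.\<close>

lemma AE_eq_0_if_orthogonal_to_tensors:
 fixes w :: "real^'d => complex"
 assumes V: "open V" and w [measurable]: "w \<in> borel_measurable borel"
  and int: "\<And>a b. cbox a b \<subseteq> V ==> integrable lborel (\<lambda>x. indicator (cbox a b) x *\<^sub>R w x)"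
  and orth: "\<And>a b u. cbox a b \<subseteq> V ==> u \<in> box_test a b ==> (\<integral>x. w x * tensor u x \<partial>lborel) = 0"
 shows "AE x in lborel. x \<in> V \<longrightarrow> w x = 0"
proof -
 have box: "AE x in lborel. indicator (box a b) x *\<^sub>R w x = 0" if ab: "cbox a b \<subseteq> V" for a b
 proof (rule AE_eq_0_if_box_integrals_0)
  have "integrable lborel (\<lambda>x. indicator (box a b) x *\<^sub>R (indicator (cbox a b) x *\<^sub>R w x))"
   by (intro integrable_mult_indicator int ab) auto
  also have "(\<lambda>x. indicator (box a b) x *\<^sub>R (indicator (cbox a b) x *\<^sub>R w x)) = (\<lambda>x. indicator (box a b) x *\<^sub>R w x)"
   using box_subset_cbox[of a b] by (auto simp: fun_eq_iff indicator_def)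
  finally show "integrable lborel (\<lambda>x. indicator (box a b) x *\<^sub>R w x)" .
  fix c d :: "real^'d"
  obtain c' d' where cd: "box c d \<inter> box a b = box c' d'" "cbox c' d' \<subseteq> cbox a b"
  proof
   show "box c d \<inter> box a b = box (\<chi> i. max (c $ i) (a $ i)) (\<chi> i. min (d $ i) (b $ i))"
    by (auto simp: mem_box_cart)
   show "cbox (\<chi> i. max (c $ i) (a $ i)) (\<chi> i. min (d $ i) (b $ i)) \<subseteq> cbox a b"
    by (auto simp: mem_box_cart)
  qed
  have "(\<lambda>n. \<integral>x. w x * tensor (\<lambda>i. bump (real (Suc n)) (c' $ i) (d' $ i)) x \<partial>lborel) \<longlonglongrightarrow>
    (\<integral>x. indicator (box c d) x *\<^sub>R indicator (box a b) x *\<^sub>R w x \<partial>lborel)"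
  proof (rule integral_dominated_convergence[where w="\<lambda>x. norm (indicator (cbox a b) x *\<^sub>R w x)"])
   show "AE x in lborel. (\<lambda>n. w x * tensor (\<lambda>i. bump (real (Suc n)) (c' $ i) (d' $ i)) x)
     \<longlonglongrightarrow> indicator (box c d) x *\<^sub>R indicator (box a b) x *\<^sub>R w x"
   proof (rule AE_I2)
    fix x
    have "(\<lambda>n. w x * tensor (\<lambda>i. bump (real (Suc n)) (c' $ i) (d' $ i)) x)
     \<longlonglongrightarrow> w x * (\<Prod>i\<in>UNIV. complex_of_real (indicator {c' $ i<..<d' $ i} (x $ i)))"
     unfolding tensor_def by (intro tendsto_intros bump_tendsto)
    also have "(\<Prod>i\<in>UNIV. complex_of_real (indicator {c' $ i<..<d' $ i} (x $ i))) = indicator (box c' d') x"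
     by (auto simp: indicator_def mem_box_cart)
    also have "w x * indicator (box c' d') x = indicator (box c d) x *\<^sub>R indicator (box a b) x *\<^sub>R w x"
     by (simp add: cd(1)[symmetric] indicator_inter_arith indicator_def)
    finally show "(\<lambda>n. w x * tensor (\<lambda>i. bump (real (Suc n)) (c' $ i) (d' $ i)) x)
     \<longlonglongrightarrow> indicator (box c d) x *\<^sub>R indicator (box a b) x *\<^sub>R w x" .
   qed
   show "AE x in lborel. norm (w x * tensor (\<lambda>i. bump (real (Suc n)) (c' $ i) (d' $ i)) x)
     \<le> norm (indicator (cbox a b) x *\<^sub>R w x)" for n
   proof (rule AE_I2)
    fix x
    show "norm (w x * tensor (\<lambda>i. bump (real (Suc n)) (c' $ i) (d' $ i)) x) \<le> norm (indicator (cbox a b) x *\<^sub>R w x)"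
    proof (cases "x \<in> cbox a b")
     case True
     have "norm (tensor (\<lambda>i. bump (real (Suc n)) (c' $ i) (d' $ i)) x) \<le> 1"
      unfolding tensor_def prod_norm[symmetric]
      by (rule prod_le_1) (use bump_bounds in auto)
     then show ?thesis using True by (simp add: norm_mult mult_left_le)
    next
     case False
     then have "x \<notin> cbox c' d'" using cd by blast
     then show ?thesis
      using tensor_eq_0_outside[OF bump_box_test[of "real (Suc n)"], of x c' d'] False by (simp del: of_nat_Suc)
    qed
   qed
  next
   show "integrable lborel (\<lambda>x. norm (indicator (cbox a b) x *\<^sub>R w x))"
    using int[OF ab] by (rule integrable_norm)
  qed (auto intro!: borel_measurable_times borel_measurable_tensor bump_smooth1)
  moreover have "(\<integral>x. w x * tensor (\<lambda>i. bump (real (Suc n)) (c' $ i) (d' $ i)) x \<partial>lborel) = 0" for n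
   using cd ab by (intro orth[of c' d'] bump_box_test) auto
  ultimately show "(\<integral>x. indicator (box c d) x *\<^sub>R indicator (box a b) x *\<^sub>R w x \<partial>lborel) = 0"
   by (simp add: LIMSEQ_const_iff)
 qed
 obtain \<D> where \<D>: "countable \<D>" "\<And>X. X \<in> \<D> ==> X \<subseteq> V" "\<And>X. X \<in> \<D> ==> \<exists>a b. X = cbox a b" "\<Union>\<D> = V"
  using open_countable_Union_open_cbox[OF V] by (metis (no_types, lifting) subsetD Pow_iff)
 have "AE x in lborel. x \<in> X \<longrightarrow> w x = 0" if "X \<in> \<D>" for X
 proof -
  have "\<exists>a b. X = cbox a b" using \<D>(3) that by blast
  then obtain a b where X: "X = cbox a b" by blast
  have "emeasure lborel (cbox a b - box a b) = 0"
   by (subst emeasure_Diff) (auto simp: emeasure_lborel_cbox_eq emeasure_lborel_box_eq box_subset_cbox)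
  then have "AE x in lborel. x \<notin> cbox a b - box a b"
   by (intro AE_not_in) auto
  moreover have "AE x in lborel. indicator (box a b) x *\<^sub>R w x = 0"
   using box \<D>(2)[OF that] X by blast
  ultimately show ?thesis
   by eventually_elim (auto simp: X indicator_def split: if_splits)
 qed
 then have "AE x in lborel. \<forall>X\<in>\<D>. x \<in> X \<longrightarrow> w x = 0"
  by (subst AE_ball_countable) (use \<D>(1) in auto)
 then show ?thesis by eventually_elim (use \<D>(4) in auto)
qed

section \<open>The Fourier transform of integrable functions\<close>

lemma fourier_cis: "fourier f \<xi> = (\<integral>x. f x * cis (- (2 * pi * (x \<bullet> \<xi>))) \<partial>lborel)"
 by (simp add: fourier_def cis_conv_exp algebra_simps)

lemma borel_measurable_cis [measurable (raw)]:
 assumes "f \<in> borel_measurable M" shows "(\<lambda>x. cis (f x)) \<in> borel_measurable M"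
 using assms by (rule borel_measurable_continuous_on[rotated]) (simp add: cis_conv_exp[abs_def] continuous_intros)

lemma borel_measurable_cnj [measurable (raw)]:
 assumes "f \<in> borel_measurable M" shows "(\<lambda>x. cnj (f x)) \<in> borel_measurable M"
 using assms by (rule borel_measurable_continuous_on[rotated]) (intro continuous_intros)

lemma continuous_on_cis' [continuous_intros]:
 "continuous_on S f ==> continuous_on S (\<lambda>x. cis (f x))"
 unfolding cis_conv_exp by (intro continuous_intros)

lemma integrable_mult_cis:
 fixes f :: "'a => complex"
 assumes "integrable M f" "g \<in> borel_measurable M"
 shows "integrable M (\<lambda>x. f x * cis (g x))"
 by (rule Bochner_Integration.integrable_bound[OF assms(1)]) (use assms in \<open>auto simp: norm_mult\<close>)

lemma norm_fourier_le:
 assumes "integrable lborel f" shows "norm (fourier f \<xi>) \<le> (\<integral>x. norm (f x) \<partial>lborel)"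
 unfolding fourier_cis
 by (rule order_trans[OF integral_norm_bound]) (simp add: norm_mult)

lemma continuous_on_fourier:
 assumes f: "integrable lborel f" shows "continuous_on S (fourier f)"
 unfolding continuous_on_sequentially comp_def
proof (intro allI ballI impI, elim conjE)
 fix u :: "nat => real^'a" and a
 assume u: "u \<longlonglongrightarrow> a"
 show "(\<lambda>n. fourier f (u n)) \<longlonglongrightarrow> fourier f a"
  unfolding fourier_cis
 proof (rule integral_dominated_convergence[where w="\<lambda>x. norm (f x)"])
  show "AE x in lborel. (\<lambda>n. f x * cis (- (2 * pi * (x \<bullet> u n)))) \<longlonglongrightarrow> f x * cis (- (2 * pi * (x \<bullet> a)))"
   using u unfolding cis_conv_exp by (intro AE_I2 tendsto_intros)
 qed (use f in \<open>auto simp: norm_mult\<close>)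
qed

lemma borel_measurable_fourier [measurable]:
 "integrable lborel f ==> fourier f \<in> borel_measurable borel"
 by (intro borel_measurable_continuous_onI continuous_on_fourier)

lemma fourier_diff:
 assumes "integrable lborel f" "integrable lborel g"
 shows "fourier (\<lambda>x. f x - g x) \<xi> = fourier f \<xi> - fourier g \<xi>"
 unfolding fourier_cis using assms
 by (simp add: left_diff_distrib integrable_mult_cis)

lemma integrable_pair_mult:
 fixes f :: "'a => complex" and g :: "'b => complex"
 assumes M: "sigma_finite_measure M" and N: "sigma_finite_measure N"
  and f: "integrable M f" and g: "integrable N g"
  and h [measurable]: "h \<in> borel_measurable (M \<Otimes>\<^sub>M N)" and le: "\<And>z. norm (h z) \<le> 1"
 shows "integrable (M \<Otimes>\<^sub>M N) (\<lambda>z. f (fst z) * g (snd z) * h z)"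
proof -
 interpret M: sigma_finite_measure M by fact
 interpret N: sigma_finite_measure N by fact
 interpret P: pair_sigma_finite M N ..
 note f[measurable] g[measurable]
 have "integrable (M \<Otimes>\<^sub>M N) (\<lambda>z. f (fst z) * g (snd z))"
  by (rule P.Fubini_integrable) (use f g in \<open>auto simp: norm_mult\<close>)
 then show ?thesis
  by (rule Bochner_Integration.integrable_bound)
   (auto simp: norm_mult intro!: AE_I2 mult_left_le le)
qed

lemma fourier_multiplication:
 fixes f g :: "real^'d => complex"
 assumes f: "integrable lborel f" and g: "integrable lborel g"
 shows "(\<integral>\<xi>. fourier f \<xi> * g \<xi> \<partial>lborel) = (\<integral>x. f x * fourier g x \<partial>lborel)"
proof -
 have "integrable (lborel \<Otimes>\<^sub>M lborel) (\<lambda>z. f (fst z) * g (snd z) * cis (- (2 * pi * (fst z \<bullet> snd z))))"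
  by (rule integrable_pair_mult[OF _ _ f g]) (auto intro: sigma_finite_lborel)
 then have "(\<integral>\<xi>. (\<integral>x. f x * g \<xi> * cis (- (2 * pi * (x \<bullet> \<xi>))) \<partial>lborel) \<partial>lborel)
   = (\<integral>x. (\<integral>\<xi>. f x * g \<xi> * cis (- (2 * pi * (x \<bullet> \<xi>))) \<partial>lborel) \<partial>lborel)"
  by (intro lborel_pair.Fubini_integral) (simp add: split_beta')
 moreover have "(\<integral>x. f x * g \<xi> * cis (- (2 * pi * (x \<bullet> \<xi>))) \<partial>lborel) = fourier f \<xi> * g \<xi>" for \<xi>
  unfolding fourier_cis by (subst integral_mult_left_zero[symmetric]) (simp add: mult_ac)
 moreover have "(\<integral>\<xi>. f x * g \<xi> * cis (- (2 * pi * (x \<bullet> \<xi>))) \<partial>lborel) = f x * fourier g x" for x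
  unfolding fourier_cis by (subst integral_mult_right_zero[symmetric]) (simp add: mult_ac inner_commute)
 ultimately show ?thesis by simp
qed

definition gauss :: "real => real^'d => real" where
 "gauss \<delta> x = exp (- pi * \<delta>\<^sup>2 * (norm x)\<^sup>2)"

definition gauss_kernel :: "real => real^'d => real" where
 "gauss_kernel \<delta> x = gauss (1 / \<delta>) x / \<delta> ^ CARD('d)"

lemma gauss_bounds: "0 < gauss \<delta> x" "gauss \<delta> x \<le> 1"
 by (auto simp: gauss_def)

lemma gauss_kernel_nonneg: "0 < \<delta> ==> 0 \<le> gauss_kernel \<delta> x"
 by (auto simp: gauss_kernel_def gauss_bounds less_imp_le)

lemma gauss_measurable [measurable]: "gauss \<delta> \<in> borel_measurable borel" "gauss_kernel \<delta> \<in> borel_measurable borel"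
 by (auto simp: gauss_def[abs_def] gauss_kernel_def[abs_def])

lemma gauss_prod: "gauss \<delta> x = (\<Prod>i\<in>UNIV. exp (- pi * \<delta>\<^sup>2 * (x $ i)\<^sup>2))"
proof -
 have "- pi * \<delta>\<^sup>2 * (norm x)\<^sup>2 = (\<Sum>i\<in>UNIV. - pi * \<delta>\<^sup>2 * (x $ i)\<^sup>2)"
  by (simp add: norm_vec_def L2_set_def sum_nonneg sum_distrib_left sum_negf)
 then show ?thesis by (simp only: gauss_def exp_sum[OF finite])
qed

lemma gauss_1d:
 assumes d: "0 < \<delta>"
 shows "integrable lborel (\<lambda>t. complex_of_real (exp (- pi * \<delta>\<^sup>2 * t\<^sup>2)) * cis (- (2 * pi * (t * s))))"
  and "(\<integral>t. complex_of_real (exp (- pi * \<delta>\<^sup>2 * t\<^sup>2)) * cis (- (2 * pi * (t * s))) \<partial>lborel)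
   = complex_of_real (exp (- pi * (1 / \<delta>)\<^sup>2 * s\<^sup>2) / \<delta>)"
proof -
 define c where "c = sqrt (2 * pi) * \<delta>"
 have c: "0 < c" using d by (simp add: c_def)
 have c2: "c\<^sup>2 = 2 * pi * \<delta>\<^sup>2" by (simp add: c_def power_mult_distrib)
 define F where "F x = complex_of_real (std_normal_density x) * cis (- (2 * pi * s / c) * x)" for x
 have int: "integrable lborel F"
  unfolding F_def
  by (intro integrable_mult_cis integrable_of_real) (auto simp: integrable_normal_density)
 have "char std_normal_distribution (- (2 * pi * s / c)) = (\<integral>x. F x \<partial>lborel)"
  unfolding char_def F_def
  by (subst integral_density) (auto simp: scaleR_conv_of_real cis_conv_exp mult_ac)
 then have val: "(\<integral>x. F x \<partial>lborel) = complex_of_real (exp (- (2 * pi * s / c)\<^sup>2 / 2))"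
  by (simp add: char_std_normal_distribution)
 have Fc: "F (0 + c * t) = complex_of_real (1 / sqrt (2 * pi)) *
   (complex_of_real (exp (- pi * \<delta>\<^sup>2 * t\<^sup>2)) * cis (- (2 * pi * (t * s))))" for t
 proof -
  have "(c * t)\<^sup>2 / 2 = pi * \<delta>\<^sup>2 * t\<^sup>2" by (simp add: power_mult_distrib c2)
  moreover have "- (2 * pi * s / c) * (c * t) = - (2 * pi * (t * s))" using c by simp
  ultimately show ?thesis by (simp add: F_def std_normal_density_def)
 qed
 have "integrable lborel (\<lambda>t. F (0 + c * t))"
  using int c by (intro lborel_integrable_real_affine) auto
 then have "integrable lborel (\<lambda>t. complex_of_real (sqrt (2 * pi)) * F (0 + c * t))"
  by (rule integrable_mult_right)
 moreover have "complex_of_real (sqrt (2 * pi)) * F (0 + c * t)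
   = complex_of_real (exp (- pi * \<delta>\<^sup>2 * t\<^sup>2)) * cis (- (2 * pi * (t * s)))" for t
  unfolding Fc mult.assoc[symmetric] of_real_mult[symmetric] by simp
 ultimately show "integrable lborel (\<lambda>t. complex_of_real (exp (- pi * \<delta>\<^sup>2 * t\<^sup>2)) * cis (- (2 * pi * (t * s))))"
  by simp
 have "complex_of_real (exp (- (2 * pi * s / c)\<^sup>2 / 2)) = c *\<^sub>R (\<integral>t. F (0 + c * t) \<partial>lborel)"
  using c unfolding val[symmetric] by (subst lborel_integral_real_affine[where c=c and t=0]) auto
 also have "\<dots> = complex_of_real (c / sqrt (2 * pi)) *
   (\<integral>t. complex_of_real (exp (- pi * \<delta>\<^sup>2 * t\<^sup>2)) * cis (- (2 * pi * (t * s))) \<partial>lborel)"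
  unfolding Fc by (subst integral_mult_right_zero) (simp add: scaleR_conv_of_real)
 also have "c / sqrt (2 * pi) = \<delta>" by (simp add: c_def)
 also have "- (2 * pi * s / c)\<^sup>2 / 2 = - pi * (1 / \<delta>)\<^sup>2 * s\<^sup>2"
 proof -
  have "(2 * pi * s / c)\<^sup>2 = (2 * pi)\<^sup>2 * s\<^sup>2 / (2 * pi * \<delta>\<^sup>2)"
   by (simp only: power_divide power_mult_distrib c2)
  also have "\<dots> = 2 * (pi * (1 / \<delta>)\<^sup>2 * s\<^sup>2)"
   using d by (simp add: power2_eq_square field_simps)
  finally show ?thesis by simp
 qed
 finally show "(\<integral>t. complex_of_real (exp (- pi * \<delta>\<^sup>2 * t\<^sup>2)) * cis (- (2 * pi * (t * s))) \<partial>lborel)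
   = complex_of_real (exp (- pi * (1 / \<delta>)\<^sup>2 * s\<^sup>2) / \<delta>)"
  using d by (simp add: field_simps)
qed

lemma cis_sum: "cis (\<Sum>i\<in>I. f i) = (\<Prod>i\<in>I. cis (f i))" if "finite I"
 using that by (induction I rule: finite_induct) (auto simp: cis_mult[symmetric])

lemma fourier_gauss_aux:
 fixes \<xi> :: "real^'d"
 assumes d: "0 < \<delta>"
 shows "integrable lborel (\<lambda>x. complex_of_real (gauss \<delta> x) * cis (- (2 * pi * (x \<bullet> \<xi>))))"
  and "(\<integral>x. complex_of_real (gauss \<delta> x) * cis (- (2 * pi * (x \<bullet> \<xi>))) \<partial>lborel) = complex_of_real (gauss_kernel \<delta> \<xi>)"
proof -
 have eq: "complex_of_real (gauss \<delta> x) * cis (- (2 * pi * (x \<bullet> \<xi>))) =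
   (\<Prod>i\<in>UNIV. complex_of_real (exp (- pi * \<delta>\<^sup>2 * (x $ i)\<^sup>2)) * cis (- (2 * pi * (x $ i * \<xi> $ i))))" for x
  by (simp add: gauss_prod inner_vec_def prod.distrib sum_distrib_left sum_negf[symmetric] cis_sum)
 show "integrable lborel (\<lambda>x. complex_of_real (gauss \<delta> x) * cis (- (2 * pi * (x \<bullet> \<xi>))))"
  unfolding eq by (intro integral_prod_vec(1) gauss_1d(1) d)
 have "(\<integral>x. complex_of_real (gauss \<delta> x) * cis (- (2 * pi * (x \<bullet> \<xi>))) \<partial>lborel)
   = (\<Prod>i\<in>UNIV. complex_of_real (exp (- pi * (1 / \<delta>)\<^sup>2 * (\<xi> $ i)\<^sup>2) / \<delta>))"
  unfolding eq integral_prod_vec(2)[OF gauss_1d(1)[OF d]] gauss_1d(2)[OF d] ..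
 also have "\<dots> = complex_of_real (gauss_kernel \<delta> \<xi>)"
  by (simp add: gauss_kernel_def gauss_prod prod_dividef)
 finally show "(\<integral>x. complex_of_real (gauss \<delta> x) * cis (- (2 * pi * (x \<bullet> \<xi>))) \<partial>lborel) = complex_of_real (gauss_kernel \<delta> \<xi>)" .
qed

lemma integrable_gauss:
 assumes "0 < \<delta>"
 shows "integrable lborel (gauss \<delta> :: real^'d => real)" "integrable lborel (gauss_kernel \<delta> :: real^'d => real)"
proof -
 have *: "integrable lborel (gauss \<delta> :: real^'d => real)" if "0 < \<delta>" for \<delta>
  using integrable_Re[OF fourier_gauss_aux(1)[OF that, of "0 :: real^'d"]] by simp
 show "integrable lborel (gauss \<delta> :: real^'d => real)" using * assms by simp
 show "integrable lborel (gauss_kernel \<delta> :: real^'d => real)"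
  unfolding gauss_kernel_def[abs_def] using *[of "1 / \<delta>"] assms by (intro integrable_divide_zero) auto
qed

lemma integral_gauss_kernel:
 assumes "0 < \<delta>" shows "(\<integral>x. gauss_kernel \<delta> x \<partial>(lborel :: (real^'d) measure)) = 1"
proof -
 have "complex_of_real (\<integral>x. gauss (1 / \<delta>) x \<partial>(lborel :: (real^'d) measure)) = complex_of_real (gauss_kernel (1 / \<delta>) (0 :: real^'d))"
  using fourier_gauss_aux(2)[of "1 / \<delta>" "0 :: real^'d"] assms by (simp del: of_real_eq_iff)
 then have "(\<integral>x. gauss (1 / \<delta>) x \<partial>(lborel :: (real^'d) measure)) = \<delta> ^ CARD('d)"
  using assms by (simp add: gauss_kernel_def gauss_def power_one_over flip: of_real_power)
 then show ?thesis
  using assms unfolding gauss_kernel_def[abs_def] by simp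
qed

lemma integral_translation:
 fixes f :: "real^'d => 'b::{banach, second_countable_topology}"
 shows "(\<integral>x. f (a + x) \<partial>lborel) = (\<integral>x. f x \<partial>lborel)"
  and "integrable lborel (\<lambda>x. f (a + x)) \<longleftrightarrow> integrable lborel f"
proof -
 have *: "distr lborel lborel (\<lambda>x. a + x) = (lborel :: (real^'d) measure)"
  using lborel_translation[of a] by (simp cong: distr_cong)
 have i: "integrable lborel (\<lambda>x. f (b + x))" if "integrable lborel f" for b and f :: "real^'d => 'b"
 proof -
  have [measurable]: "f \<in> borel_measurable borel" using that by simp
  show ?thesis
   using that integrable_distr_eq[of "\<lambda>x. b + x" lborel borel f] lborel_translation[of b] by simp
 qed
 show iff: "integrable lborel (\<lambda>x. f (a + x)) \<longleftrightarrow> integrable lborel f"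
  using i[of f a] i[of "\<lambda>x. f (a + x)" "- a"] by (auto simp: add.assoc)
 show "(\<integral>x. f (a + x) \<partial>lborel) = (\<integral>x. f x \<partial>lborel)"
 proof (cases "integrable lborel f")
  case True
  then have [measurable]: "f \<in> borel_measurable borel" by simp
  show ?thesis
   by (subst (2) lborel_translation[of a, symmetric]) (simp add: integral_distr)
 next
  case False
  then show ?thesis using iff by (simp add: not_integrable_integral_eq)
 qed
qed

lemma integral_scaling:
 fixes f :: "real^'d => complex"
 assumes [measurable]: "f \<in> borel_measurable borel" and c: "0 < c"
 shows "(\<integral>x. f x \<partial>lborel) = of_real (c ^ CARD('d)) * (\<integral>x. f (c *\<^sub>R x) \<partial>lborel)"
proof -
 have "(lborel :: (real^'d) measure) = density (distr lborel borel (\<lambda>x. c *\<^sub>R x)) (\<lambda>_. ennreal (c ^ CARD('d)))"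
  using lborel_affine[of c "0 :: real^'d"] c by simp
 then have "(\<integral>x. f x \<partial>lborel) = (\<integral>x. f x \<partial>density (distr lborel borel (\<lambda>x :: real^'d. c *\<^sub>R x)) (\<lambda>_. ennreal (c ^ CARD('d))))"
  by simp
 also have "\<dots> = of_real (c ^ CARD('d)) * (\<integral>x. f (c *\<^sub>R x) \<partial>lborel)"
  using c by (subst integral_density) (auto simp: integral_distr scaleR_conv_of_real)
 finally show ?thesis .
qed

definition gauss_mollify :: "real => (real^'d => complex) => real^'d => complex" where
 "gauss_mollify \<delta> g x = (\<integral>u. g u * complex_of_real (gauss_kernel \<delta> (u - x)) \<partial>lborel)"

lemma gauss_kernel_minus [simp]: "gauss_kernel \<delta> (- x) = gauss_kernel \<delta> x"
 by (simp add: gauss_kernel_def gauss_def)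

lemma gauss_mollify_scaled:
 fixes g :: "real^'d => complex"
 assumes [measurable]: "g \<in> borel_measurable borel" and d: "0 < \<delta>"
 shows "gauss_mollify \<delta> g x = (\<integral>v. g (x + \<delta> *\<^sub>R v) * complex_of_real (gauss_kernel 1 v) \<partial>lborel)"
proof -
 have "gauss_mollify \<delta> g x = (\<integral>u. g (x + u) * complex_of_real (gauss_kernel \<delta> u) \<partial>lborel)"
  unfolding gauss_mollify_def by (subst integral_translation(1)[of _ x, symmetric]) simp
 also have "\<dots> = of_real (\<delta> ^ CARD('d)) * (\<integral>v. g (x + \<delta> *\<^sub>R v) * complex_of_real (gauss_kernel \<delta> (\<delta> *\<^sub>R v)) \<partial>lborel)"
  by (rule integral_scaling) (use d in auto)
 also have "\<dots> = (\<integral>v. g (x + \<delta> *\<^sub>R v) * complex_of_real (gauss_kernel 1 v) \<partial>lborel)"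
  using d by (subst integral_mult_right_zero[symmetric])
   (simp add: gauss_kernel_def gauss_def power_mult_distrib power_divide field_simps)
 finally show ?thesis .
qed

lemma gauss_mollify_bounded:
 fixes g :: "real^'d => complex"
 assumes [measurable]: "g \<in> borel_measurable borel" and B: "\<And>x. norm (g x) \<le> B" and d: "0 < \<delta>"
 shows "norm (gauss_mollify \<delta> g x) \<le> B"
proof -
 have "norm (gauss_mollify \<delta> g x) \<le> (\<integral>v. norm (g (x + \<delta> *\<^sub>R v) * complex_of_real (gauss_kernel 1 v)) \<partial>lborel)"
  unfolding gauss_mollify_scaled[OF assms(1) d] by (rule integral_norm_bound)
 also have "\<dots> \<le> (\<integral>v. B * gauss_kernel 1 v \<partial>(lborel :: (real^'d) measure))"
 proof (rule integral_mono')
  show "integrable lborel (\<lambda>v :: real^'d. B * gauss_kernel 1 v)"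
   by (intro integrable_mult_right integrable_gauss) auto
 qed (use B gauss_kernel_nonneg[of 1, where 'a='d] order_trans[OF norm_ge_zero B] in
   \<open>auto simp: norm_mult abs_of_nonneg intro!: mult_right_mono\<close>)
 also have "\<dots> = B" by (simp add: integral_gauss_kernel)
 finally show ?thesis .
qed

lemma gauss_mollify_tendsto:
 fixes g :: "real^'d => complex"
 assumes g: "continuous_on UNIV g" and B: "\<And>x. norm (g x) \<le> B"
 shows "(\<lambda>n. gauss_mollify (1 / real (Suc n)) g x) \<longlonglongrightarrow> g x"
proof -
 have [measurable]: "g \<in> borel_measurable borel" using g by (rule borel_measurable_continuous_onI)
 have "(\<lambda>n. \<integral>v. g (x + (1 / real (Suc n)) *\<^sub>R v) * complex_of_real (gauss_kernel 1 v) \<partial>lborel) \<longlonglongrightarrow>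
   (\<integral>v. g x * complex_of_real (gauss_kernel 1 (v :: real^'d)) \<partial>lborel)"
 proof (rule integral_dominated_convergence[where w="\<lambda>v :: real^'d. B * gauss_kernel 1 v"])
  show "integrable lborel (\<lambda>v :: real^'d. B * gauss_kernel 1 v)"
   by (intro integrable_mult_right integrable_gauss) auto
  show "AE v in lborel. (\<lambda>n. g (x + (1 / real (Suc n)) *\<^sub>R v) * complex_of_real (gauss_kernel 1 v))
    \<longlonglongrightarrow> g x * complex_of_real (gauss_kernel 1 v)"
  proof (rule AE_I2)
   fix v :: "real^'d"
   have "(\<lambda>n. x + (1 / real (Suc n)) *\<^sub>R v) \<longlonglongrightarrow> x + 0 *\<^sub>R v"
    by (intro tendsto_intros lim_1_over_n[THEN LIMSEQ_Suc])
   then have "(\<lambda>n. g (x + (1 / real (Suc n)) *\<^sub>R v)) \<longlonglongrightarrow> g x"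
    using continuous_on_tendsto_compose[OF g, of _ x] by simp
   then show "(\<lambda>n. g (x + (1 / real (Suc n)) *\<^sub>R v) * complex_of_real (gauss_kernel 1 v))
    \<longlonglongrightarrow> g x * complex_of_real (gauss_kernel 1 v)"
    by (intro tendsto_intros)
  qed
 qed (use B gauss_kernel_nonneg[of 1, where 'a='d] order_trans[OF norm_ge_zero B] in
   \<open>auto simp: norm_mult abs_of_nonneg intro!: mult_right_mono\<close>)
 also have "(\<integral>v. g x * complex_of_real (gauss_kernel 1 (v :: real^'d)) \<partial>lborel) = g x"
  by (simp add: integral_gauss_kernel)
 finally show ?thesis by (subst gauss_mollify_scaled) auto
qed

lemma gauss_modulated:
 fixes y :: "real^'d"
 assumes "0 < \<delta>"
 shows "integrable lborel (\<lambda>\<xi>. complex_of_real (gauss \<delta> \<xi>) * cis (2 * pi * (y \<bullet> \<xi>)))"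
  and "fourier (\<lambda>\<xi>. complex_of_real (gauss \<delta> \<xi>) * cis (2 * pi * (y \<bullet> \<xi>))) x = complex_of_real (gauss_kernel \<delta> (x - y))"
proof -
 show "integrable lborel (\<lambda>\<xi>. complex_of_real (gauss \<delta> \<xi>) * cis (2 * pi * (y \<bullet> \<xi>)))"
  by (intro integrable_mult_cis integrable_of_real integrable_gauss assms) auto
 have "fourier (\<lambda>\<xi>. complex_of_real (gauss \<delta> \<xi>) * cis (2 * pi * (y \<bullet> \<xi>))) x
   = (\<integral>\<xi>. complex_of_real (gauss \<delta> \<xi>) * cis (- (2 * pi * (\<xi> \<bullet> (x - y)))) \<partial>lborel)"
  unfolding fourier_cis
  by (intro Bochner_Integration.integral_cong)
   (auto simp: mult.assoc cis_mult inner_diff_right inner_commute algebra_simps)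
 then show "fourier (\<lambda>\<xi>. complex_of_real (gauss \<delta> \<xi>) * cis (2 * pi * (y \<bullet> \<xi>))) x = complex_of_real (gauss_kernel \<delta> (x - y))"
  by (simp add: fourier_gauss_aux(2)[OF assms])
qed

text \<open>Damping the inversion integral by a Gaussian amounts to mollifying the function.\<close>

lemma fourier_gauss_inversion:
 fixes f :: "real^'d => complex"
 assumes f: "integrable lborel f" and d: "0 < \<delta>"
 shows "(\<integral>\<xi>. fourier f \<xi> * complex_of_real (gauss \<delta> \<xi>) * cis (2 * pi * (y \<bullet> \<xi>)) \<partial>lborel) = gauss_mollify \<delta> f y"
 using fourier_multiplication[OF f gauss_modulated(1)[OF d, of y]]
 unfolding gauss_modulated(2)[OF d] gauss_mollify_def by (simp add: mult.assoc)

lemma gauss_tendsto_1: "(\<lambda>n. gauss (1 / real (Suc n)) x) \<longlonglongrightarrow> 1"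
proof -
 have "(\<lambda>n. exp (- pi * (1 / real (Suc n))\<^sup>2 * (norm x)\<^sup>2)) \<longlonglongrightarrow> exp (- pi * 0\<^sup>2 * (norm x)\<^sup>2)"
  by (intro tendsto_intros lim_1_over_n[THEN LIMSEQ_Suc])
 then show ?thesis by (simp add: gauss_def)
qed

lemma fourier_pairing_gauss:
 fixes f g :: "real^'d => complex"
 assumes f: "integrable lborel f" and g: "integrable lborel g" and d: "0 < \<delta>"
 shows "(\<integral>\<xi>. fourier f \<xi> * cnj (fourier g \<xi>) * complex_of_real (gauss \<delta> \<xi>) \<partial>lborel)
  = (\<integral>x. f x * cnj (gauss_mollify \<delta> g x) \<partial>lborel)"
proof -
 define k where "k \<xi> = cnj (fourier g \<xi>) * complex_of_real (gauss \<delta> \<xi>)" for \<xi>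
 have [measurable]: "k \<in> borel_measurable borel"
  unfolding k_def by (intro borel_measurable_times borel_measurable_cnj borel_measurable_fourier g) measurable
 have k: "integrable lborel k"
 proof (rule Bochner_Integration.integrable_bound)
  show "integrable lborel (\<lambda>\<xi>. (\<integral>x. norm (g x) \<partial>lborel) * gauss \<delta> \<xi> :: real)"
   by (intro integrable_mult_right integrable_gauss d)
  show "AE \<xi> in lborel. norm (k \<xi>) \<le> norm ((\<integral>x. norm (g x) \<partial>lborel) * gauss \<delta> \<xi>)"
  proof (rule AE_I2)
   fix \<xi> :: "real^'d"
   have "norm (k \<xi>) = norm (fourier g \<xi>) * gauss \<delta> \<xi>"
    by (simp add: k_def norm_mult gauss_bounds less_imp_le)
   also have "\<dots> \<le> (\<integral>x. norm (g x) \<partial>lborel) * gauss \<delta> \<xi>"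
    by (intro mult_right_mono norm_fourier_le g less_imp_le gauss_bounds)
   finally show "norm (k \<xi>) \<le> norm ((\<integral>x. norm (g x) \<partial>lborel) * gauss \<delta> \<xi>)" by simp
  qed
 qed simp
 have "fourier k x = cnj (gauss_mollify \<delta> g x)" for x
 proof -
  have "fourier k x = (\<integral>\<xi>. cnj (fourier g \<xi> * complex_of_real (gauss \<delta> \<xi>) * cis (2 * pi * (x \<bullet> \<xi>))) \<partial>lborel)"
   unfolding fourier_cis k_def by (simp add: cis_cnj inner_commute)
  also have "\<dots> = cnj (\<integral>\<xi>. fourier g \<xi> * complex_of_real (gauss \<delta> \<xi>) * cis (2 * pi * (x \<bullet> \<xi>)) \<partial>lborel)"
   by (rule Bochner_Integration.integral_cnj)
  also have "\<dots> = cnj (gauss_mollify \<delta> g x)"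
   by (simp only: fourier_gauss_inversion[OF g d])
  finally show ?thesis .
 qed
 then show ?thesis
  using fourier_multiplication[OF f k] by (simp add: k_def mult.assoc)
qed

lemma fourier_pairing_gauss_tendsto:
 fixes f g :: "real^'d => complex"
 assumes f: "integrable lborel f" and g: "integrable lborel g"
  and cont: "continuous_on UNIV g" and B: "\<And>x. norm (g x) \<le> B"
 shows "(\<lambda>n. \<integral>\<xi>. fourier f \<xi> * cnj (fourier g \<xi>) * complex_of_real (gauss (1 / real (Suc n)) \<xi>) \<partial>lborel)
  \<longlonglongrightarrow> (\<integral>x. f x * cnj (g x) \<partial>lborel)"
proof -
 have [measurable]: "g \<in> borel_measurable borel" using g by simp
 have [measurable]: "f \<in> borel_measurable borel" using f by simp
 have [measurable]: "gauss_mollify \<delta> g \<in> borel_measurable borel" for \<delta>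
  unfolding gauss_mollify_def[abs_def] by measurable
 have "(\<lambda>n. \<integral>x. f x * cnj (gauss_mollify (1 / real (Suc n)) g x) \<partial>lborel) \<longlonglongrightarrow> (\<integral>x. f x * cnj (g x) \<partial>lborel)"
 proof (rule integral_dominated_convergence[where w="\<lambda>x. norm (f x) * B"])
  show "AE x in lborel. (\<lambda>n. f x * cnj (gauss_mollify (1 / real (Suc n)) g x)) \<longlonglongrightarrow> f x * cnj (g x)"
   by (intro AE_I2 tendsto_intros gauss_mollify_tendsto[OF cont B])
  show "AE x in lborel. norm (f x * cnj (gauss_mollify (1 / real (Suc n)) g x)) \<le> norm (f x) * B" for n
   unfolding norm_mult complex_mod_cnj
   by (intro AE_I2 mult_left_mono gauss_mollify_bounded B) auto
 qed (use f in auto)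
 then show ?thesis by (subst fourier_pairing_gauss[OF f g]) auto
qed

section \<open>The Fourier transform on square-integrable functions\<close>

lemma distr_lborel_linear:
 fixes A :: "real^'d^'d"
 assumes A: "det A \<noteq> 0"
 shows "distr lborel borel ((*v) A) = density lborel (\<lambda>_. ennreal (1 / \<bar>det A\<bar>))"
proof (rule measure_eqI)
 fix X assume "X \<in> sets (distr lborel borel ((*v) A))"
 then have X [measurable]: "X \<in> sets borel" by simp
 have *: "ennreal \<bar>det A\<bar> * (\<integral>\<^sup>+x. indicator X (A *v x) \<partial>lborel) = (\<integral>\<^sup>+x. indicator X x \<partial>lborel)"
  using nn_integral_linear_image[of A] A by (auto dest!: bspec[of _ _ "indicator X"])
 have "emeasure (distr lborel borel ((*v) A)) X = (\<integral>\<^sup>+x. indicator X x \<partial>distr lborel borel ((*v) A))"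
  by (simp del: nn_integral_indicator add: nn_integral_indicator[symmetric])
 also have "\<dots> = ennreal (1 / \<bar>det A\<bar>) * (ennreal \<bar>det A\<bar> * (\<integral>\<^sup>+x. indicator X (A *v x) \<partial>lborel))"
  using A by (subst nn_integral_distr) (auto simp flip: mult.assoc ennreal_mult)
 also have "\<dots> = emeasure (density lborel (\<lambda>_. ennreal (1 / \<bar>det A\<bar>))) X"
  unfolding * by (simp add: emeasure_density nn_integral_cmult)
 finally show "emeasure (distr lborel borel ((*v) A)) X = emeasure (density lborel (\<lambda>_. ennreal (1 / \<bar>det A\<bar>))) X" .
qed simp

lemma nn_integral_linear:
 fixes A :: "real^'d^'d"
 assumes A: "det A \<noteq> 0" and [measurable]: "f \<in> borel_measurable borel"
 shows "(\<integral>\<^sup>+x. f (A *v x) \<partial>lborel) = ennreal (1 / \<bar>det A\<bar>) * (\<integral>\<^sup>+x. f x \<partial>lborel)"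
proof -
 have "(\<integral>\<^sup>+x. f (A *v x) \<partial>lborel) = (\<integral>\<^sup>+x. f x \<partial>distr lborel borel ((*v) A))"
  by (simp add: nn_integral_distr)
 also have "\<dots> = ennreal (1 / \<bar>det A\<bar>) * (\<integral>\<^sup>+x. f x \<partial>lborel)"
  unfolding distr_lborel_linear[OF A] by (simp add: nn_integral_density nn_integral_cmult)
 finally show ?thesis .
qed

lemma integral_linear:
 fixes A :: "real^'d^'d" and f :: "real^'d => complex"
 assumes A: "det A \<noteq> 0" and [measurable]: "f \<in> borel_measurable borel"
 shows "(\<integral>x. f (A *v x) \<partial>lborel) = complex_of_real (1 / \<bar>det A\<bar>) * (\<integral>x. f x \<partial>lborel)"
  and "integrable lborel (\<lambda>x. f (A *v x)) \<longleftrightarrow> integrable lborel f"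
proof -
 have "(\<integral>x. f (A *v x) \<partial>lborel) = (\<integral>x. f x \<partial>distr lborel borel ((*v) A))"
  by (simp add: integral_distr)
 then show "(\<integral>x. f (A *v x) \<partial>lborel) = complex_of_real (1 / \<bar>det A\<bar>) * (\<integral>x. f x \<partial>lborel)"
  unfolding distr_lborel_linear[OF A] by (simp add: integral_density scaleR_conv_of_real)
 have "integrable lborel (\<lambda>x. f (A *v x)) \<longleftrightarrow> integrable (distr lborel borel ((*v) A)) f"
  by (simp add: integrable_distr_eq)
 also have "\<dots> \<longleftrightarrow> integrable lborel f"
 proof -
  have "integrable (distr lborel borel ((*v) A)) f \<longleftrightarrow> integrable lborel (\<lambda>x. (1 / \<bar>det A\<bar>) *\<^sub>R f x)"
   unfolding distr_lborel_linear[OF A] by (subst integrable_density) auto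
  moreover have "integrable lborel f" if "integrable lborel (\<lambda>x. (1 / \<bar>det A\<bar>) *\<^sub>R f x)"
   using integrable_scaleR_right[of "\<bar>det A\<bar>", OF that] A by simp
  ultimately show ?thesis by blast
 qed
 finally show "integrable lborel (\<lambda>x. f (A *v x)) \<longleftrightarrow> integrable lborel f" .
qed

definition sqint :: "(real^'d => complex) => bool" where
 "sqint f \<longleftrightarrow> f \<in> borel_measurable borel \<and> integrable lborel (\<lambda>x. (norm (f x))\<^sup>2)"

definition l2norm :: "(real^'d => complex) => real" where
 "l2norm f = sqrt (\<integral>x. (norm (f x))\<^sup>2 \<partial>lborel)"

lemma l2norm_nonneg [simp]: "0 \<le> l2norm f"
 by (simp add: l2norm_def integral_nonneg_AE)

lemma l2norm_power2: "(l2norm f)\<^sup>2 = (\<integral>x. (norm (f x))\<^sup>2 \<partial>lborel)"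
 by (simp add: l2norm_def integral_nonneg_AE)

lemma sqint_measurable [measurable_dest]: "sqint f ==> f \<in> borel_measurable borel"
 by (simp add: sqint_def)

lemma epow_norm_2: "epow (ennreal (norm z)) 2 = ennreal ((norm z)\<^sup>2)"
 by (simp add: epow_ennreal powr_numeral)

lemma lp_norm_2: "lp_norm M 2 f = epow (\<integral>\<^sup>+x. epow (f x) 2 \<partial>M) (1 / 2)"
 using lp_norm_ennreal[of 2 M f] by simp

lemma sqint_iff: "sqint f \<longleftrightarrow> f \<in> borel_measurable borel \<and> lp_norm lborel 2 (\<lambda>x. ennreal (norm (f x))) < \<infinity>"
 by (auto simp: sqint_def lp_norm_2 epow_norm_2 epow_less_top integrable_iff_bounded)

lemma Lp_2_iff: "f \<in> Lp lborel 2 \<longleftrightarrow> sqint f"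
 by (auto simp: Lp_def sqint_iff)

lemma lp_norm_sqint: "sqint f ==> lp_norm lborel 2 (\<lambda>x. ennreal (norm (f x))) = ennreal (l2norm f)"
 unfolding lp_norm_2 epow_norm_2
 by (subst nn_integral_eq_integral)
  (auto simp: sqint_def l2norm_def epow_ennreal integral_nonneg_AE powr_half_sqrt)

lemma sqint_bound:
 assumes "sqint f" "g \<in> borel_measurable borel" "AE x in lborel. norm (g x) \<le> norm (f x)"
 shows "sqint g" "l2norm g \<le> l2norm f"
proof -
 show g: "sqint g"
  unfolding sqint_def using assms
  by (auto intro!: Bochner_Integration.integrable_bound[of lborel "\<lambda>x. (norm (f x))\<^sup>2"] power_mono
    simp: sqint_def elim!: eventually_mono)
 show "l2norm g \<le> l2norm f"
  unfolding l2norm_def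
  by (intro real_sqrt_le_mono integral_mono_AE)
   (use assms g in \<open>auto simp: sqint_def power_mono elim!: eventually_mono\<close>)
qed

lemma sqint_product:
 assumes f: "sqint f" and g: "sqint g"
 shows "integrable lborel (\<lambda>x. norm (f x) * norm (g x))" "integrable lborel (\<lambda>x. f x * cnj (g x))"
  "integrable lborel (\<lambda>x. f x * g x)"
proof -
 note [measurable] = sqint_measurable[OF f] sqint_measurable[OF g]
 have int: "integrable lborel (\<lambda>x. (norm (f x))\<^sup>2 + (norm (g x))\<^sup>2)"
  using f g by (auto simp: sqint_def)
 have "norm (f x) * norm (g x) \<le> (norm (f x))\<^sup>2 + (norm (g x))\<^sup>2" for x
  using sum_squares_bound[of "norm (f x)" "norm (g x)"] mult_nonneg_nonneg[OF norm_ge_zero norm_ge_zero, of "f x" "g x"]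
  by linarith
 then have le: "norm (f x) * norm (g x) \<le> norm ((norm (f x))\<^sup>2 + (norm (g x))\<^sup>2)" for x
  by (metis abs_ge_self order_trans real_norm_def)
 show "integrable lborel (\<lambda>x. norm (f x) * norm (g x))" "integrable lborel (\<lambda>x. f x * cnj (g x))"
  "integrable lborel (\<lambda>x. f x * g x)"
  by (rule Bochner_Integration.integrable_bound[OF int]; use le in \<open>auto simp: norm_mult\<close>)+
qed

lemma Cauchy_Schwarz_integral:
 assumes f: "sqint f" and g: "sqint g"
 shows "(\<integral>x. norm (f x) * norm (g x) \<partial>lborel) \<le> l2norm f * l2norm g"
proof (rule field_le_epsilon)
 fix e :: real assume e: "0 < e"
 let ?A = "l2norm f" and ?B = "l2norm g"
 define \<eta> where "\<eta> = e / (?A + ?B + 1)"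
 have \<eta>: "0 < \<eta>" using e by (simp add: \<eta>_def add_nonneg_pos)
 define s where "s = (?B + \<eta>) / (?A + \<eta>)"
 have nz: "?A + \<eta> \<noteq> 0" "?B + \<eta> \<noteq> 0"
  using \<eta> l2norm_nonneg[of f] l2norm_nonneg[of g] by linarith+
 have s: "0 < s" using \<eta> by (simp add: s_def add_nonneg_pos)
 have pt: "norm (f x) * norm (g x) \<le> s / 2 * (norm (f x))\<^sup>2 + 1 / (2 * s) * (norm (g x))\<^sup>2" for x
 proof -
  have "0 \<le> (sqrt s * norm (f x) - norm (g x) / sqrt s)\<^sup>2" by simp
  also have "\<dots> = s * (norm (f x))\<^sup>2 + (norm (g x))\<^sup>2 / s - 2 * (norm (f x) * norm (g x))"
   using s by (simp add: power2_diff power_mult_distrib power_divide)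
  finally show ?thesis by (simp add: field_simps)
 qed
 have "(\<integral>x. norm (f x) * norm (g x) \<partial>lborel)
   \<le> (\<integral>x. s / 2 * (norm (f x))\<^sup>2 + 1 / (2 * s) * (norm (g x))\<^sup>2 \<partial>lborel)"
  using f g by (intro integral_mono sqint_product pt) (auto simp: sqint_def)
 also have "\<dots> = s / 2 * ?A\<^sup>2 + 1 / (2 * s) * ?B\<^sup>2"
  using f g by (simp add: sqint_def l2norm_power2)
 also have "\<dots> \<le> (?A * (?B + \<eta>) + ?B * (?A + \<eta>)) / 2"
 proof -
  have "?A\<^sup>2 \<le> ?A * (?A + \<eta>)" "?B\<^sup>2 \<le> ?B * (?B + \<eta>)"
   using \<eta> by (auto simp: power2_eq_square intro!: mult_left_mono)
  then have "s * ?A\<^sup>2 \<le> s * (?A * (?A + \<eta>))" "?B\<^sup>2 / s \<le> ?B * (?B + \<eta>) / s"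
   using s by (auto intro: divide_right_mono)
  moreover have "s * (?A * (?A + \<eta>)) = ?A * (?B + \<eta>)" "?B * (?B + \<eta>) / s = ?B * (?A + \<eta>)"
   using nz by (simp_all add: s_def)
  ultimately show ?thesis by (simp add: field_simps)
 qed
 also have "\<dots> = ?A * ?B + \<eta> * (?A + ?B) / 2" by (simp add: field_simps)
 also have "\<dots> \<le> ?A * ?B + e"
 proof -
  have "\<eta> * (?A + ?B) \<le> \<eta> * (?A + ?B + 1)" using \<eta> by simp
  also have "\<dots> = e"
   using l2norm_nonneg[of f] l2norm_nonneg[of g] by (simp add: \<eta>_def add_nonneg_eq_0_iff)
  finally show ?thesis using e by simp
 qed
 finally show "(\<integral>x. norm (f x) * norm (g x) \<partial>lborel) \<le> ?A * ?B + e" .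
qed

lemma norm_inner_le:
 assumes f: "sqint f" and g: "sqint g"
 shows "norm (\<integral>x. f x * cnj (g x) \<partial>lborel) \<le> l2norm f * l2norm g"
 using Cauchy_Schwarz_integral[OF f g] integral_norm_bound[of lborel "\<lambda>x. f x * cnj (g x)"]
 by (simp add: norm_mult)

lemma sqint_add:
 assumes f: "sqint f" and g: "sqint g"
 shows "sqint (\<lambda>x. f x + g x)" "l2norm (\<lambda>x. f x + g x) \<le> l2norm f + l2norm g"
proof -
 note [measurable] = sqint_measurable[OF f] sqint_measurable[OF g]
 have int: "integrable lborel (\<lambda>x. (norm (f x))\<^sup>2 + (norm (g x))\<^sup>2 + 2 * (norm (f x) * norm (g x)))"
  using f g sqint_product[OF f g] by (auto simp: sqint_def)
 have le: "(norm (f x + g x))\<^sup>2 \<le> (norm (f x))\<^sup>2 + (norm (g x))\<^sup>2 + 2 * (norm (f x) * norm (g x))" for x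
  using power_mono[OF norm_triangle_ineq[of "f x" "g x"] norm_ge_zero, of 2] by (simp add: power2_sum)
 show *: "sqint (\<lambda>x. f x + g x)"
  unfolding sqint_def
  by (auto intro!: Bochner_Integration.integrable_bound[OF int] order_trans[OF le] abs_ge_self)
 have "(l2norm (\<lambda>x. f x + g x))\<^sup>2 \<le> (\<integral>x. (norm (f x))\<^sup>2 + (norm (g x))\<^sup>2 + 2 * (norm (f x) * norm (g x)) \<partial>lborel)"
  unfolding l2norm_power2 using * by (intro integral_mono int le) (auto simp: sqint_def)
 also have "\<dots> = (l2norm f)\<^sup>2 + (l2norm g)\<^sup>2 + 2 * (\<integral>x. norm (f x) * norm (g x) \<partial>lborel)"
  using f g sqint_product[OF f g] by (simp add: sqint_def l2norm_power2)
 also have "\<dots> \<le> (l2norm f + l2norm g)\<^sup>2"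
  using Cauchy_Schwarz_integral[OF f g] by (simp add: power2_sum)
 finally show "l2norm (\<lambda>x. f x + g x) \<le> l2norm f + l2norm g"
  by (rule power2_le_imp_le) simp
qed

lemma sqint_cmult:
 assumes f: "sqint f"
 shows "sqint (\<lambda>x. c * f x)" "l2norm (\<lambda>x. c * f x) = norm c * l2norm f"
 using f by (auto simp: sqint_def l2norm_def norm_mult power_mult_distrib real_sqrt_mult)

lemma sqint_diff:
 assumes f: "sqint f" and g: "sqint g"
 shows "sqint (\<lambda>x. f x - g x)" "l2norm (\<lambda>x. f x - g x) \<le> l2norm f + l2norm g"
 using sqint_add[OF f sqint_cmult(1)[OF g, of "-1"]] sqint_cmult(2)[OF g, of "-1"] by simp_all

lemma l2norm_minus_commute: "l2norm (\<lambda>x. f x - g x) = l2norm (\<lambda>x. g x - f x)"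
 by (simp add: l2norm_def norm_minus_commute)

lemma l2norm_triangle:
 assumes "sqint f" "sqint g" "sqint h"
 shows "l2norm (\<lambda>x. f x - h x) \<le> l2norm (\<lambda>x. f x - g x) + l2norm (\<lambda>x. g x - h x)"
 using sqint_add(2)[OF sqint_diff(1)[OF assms(1,2)] sqint_diff(1)[OF assms(2,3)]] by simp

lemma inner_tendsto:
 assumes f: "\<And>n. sqint (f n)" "sqint F" "(\<lambda>n. l2norm (\<lambda>x. f n x - F x)) \<longlonglongrightarrow> 0"
  and g: "\<And>n. sqint (g n)" "sqint G" "(\<lambda>n. l2norm (\<lambda>x. g n x - G x)) \<longlonglongrightarrow> 0"
 shows "(\<lambda>n. \<integral>x. f n x * cnj (g n x) \<partial>lborel) \<longlonglongrightarrow> (\<integral>x. F x * cnj (G x) \<partial>lborel)"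
proof (rule LIM_zero_cancel, rule Lim_null_comparison)
 let ?a = "\<lambda>n. l2norm (\<lambda>x. f n x - F x)" and ?b = "\<lambda>n. l2norm (\<lambda>x. g n x - G x)"
 have le: "norm ((\<integral>x. f n x * cnj (g n x) \<partial>lborel) - (\<integral>x. F x * cnj (G x) \<partial>lborel))
   \<le> ?a n * (l2norm G + ?b n) + l2norm F * ?b n" for n
 proof -
  have "(\<integral>x. f n x * cnj (g n x) \<partial>lborel) - (\<integral>x. F x * cnj (G x) \<partial>lborel)
   = (\<integral>x. f n x * cnj (g n x) - F x * cnj (G x) \<partial>lborel)"
   using f g by (simp add: sqint_product)
  also have "\<dots> = (\<integral>x. (f n x - F x) * cnj (g n x) + F x * cnj (g n x - G x) \<partial>lborel)"
   by (simp add: algebra_simps)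
  also have "\<dots> = (\<integral>x. (f n x - F x) * cnj (g n x) \<partial>lborel) + (\<integral>x. F x * cnj (g n x - G x) \<partial>lborel)"
   using f g by (intro Bochner_Integration.integral_add sqint_product sqint_diff) auto
  finally have "norm ((\<integral>x. f n x * cnj (g n x) \<partial>lborel) - (\<integral>x. F x * cnj (G x) \<partial>lborel))
   \<le> norm (\<integral>x. (f n x - F x) * cnj (g n x) \<partial>lborel) + norm (\<integral>x. F x * cnj (g n x - G x) \<partial>lborel)"
   by (simp add: norm_triangle_ineq)
  also have "\<dots> \<le> ?a n * l2norm (g n) + l2norm F * ?b n"
   using f g by (intro add_mono norm_inner_le sqint_diff) auto
  also have "l2norm (g n) \<le> l2norm G + ?b n"
   using sqint_add(2)[OF g(2) sqint_diff(1)[OF g(1)[of n] g(2)]] by simp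
  finally show ?thesis by (simp add: mult_left_mono)
 qed
 then show "\<forall>\<^sub>F n in sequentially. norm ((\<integral>x. f n x * cnj (g n x) \<partial>lborel) - (\<integral>x. F x * cnj (G x) \<partial>lborel))
   \<le> ?a n * (l2norm G + ?b n) + l2norm F * ?b n" by simp
 have "(\<lambda>n. ?a n * (l2norm G + ?b n) + l2norm F * ?b n) \<longlonglongrightarrow> 0 * (l2norm G + 0) + l2norm F * 0"
  by (intro tendsto_intros f g)
 then show "(\<lambda>n. ?a n * (l2norm G + ?b n) + l2norm F * ?b n) \<longlonglongrightarrow> 0" by simp
qed

text \<open>Completeness: by Minkowski's inequality the series of increments converges absolutely almost
 everywhere, and its tails are small in norm.\<close>

lemma Riesz_Fischer:
 fixes f :: "nat => real^'d => complex"
 assumes f: "\<And>n. sqint (f n)" and le: "\<And>n. l2norm (\<lambda>x. f (Suc n) x - f n x) \<le> (1 / 2) ^ n"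
 obtains F where "sqint F" "(\<lambda>n. l2norm (\<lambda>x. f n x - F x)) \<longlonglongrightarrow> 0"
proof -
 note [measurable] = sqint_measurable[OF f]
 define D where "D k x = norm (f (Suc k) x - f k x)" for k x
 have [measurable]: "D k \<in> borel_measurable borel" for k unfolding D_def by measurable
 have tail: "lp_norm lborel 2 (\<lambda>x. \<Sum>k. ennreal (D (k + n) x)) \<le> ennreal (2 * (1 / 2) ^ n)" for n
 proof -
  have "lp_norm lborel 2 (\<lambda>x. \<integral>\<^sup>+k. ennreal (D (k + n) x) \<partial>count_space UNIV)
    \<le> (\<integral>\<^sup>+k. ennreal ((1 / 2) ^ (k + n)) \<partial>count_space UNIV)"
  proof (rule Minkowski_nn_integral)
   show "(\<lambda>(x, k). ennreal (D (k + n) x)) \<in> borel_measurable (lborel \<Otimes>\<^sub>M count_space UNIV)"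
    unfolding split_beta'
    by (rule measurable_compose_countable[where f="\<lambda>k z. ennreal (D (k + n) (fst z))" and g=snd]) measurable
   show "lp_norm lborel 2 (\<lambda>x. ennreal (D (k + n) x)) \<le> ennreal ((1 / 2) ^ (k + n))" for k
    unfolding D_def by (subst lp_norm_sqint) (auto intro!: sqint_diff f ennreal_leI le)
  qed (auto intro: sigma_finite_lborel sigma_finite_measure_count_space)
  also have "\<dots> = (\<Sum>k. ennreal ((1 / 2) ^ (k + n)))"
   by (rule nn_integral_count_space_nat)
  also have "\<dots> = ennreal (2 * (1 / 2) ^ n)"
  proof (rule suminf_ennreal_eq)
   have "(\<lambda>k. (1 / 2) ^ k * (1 / 2) ^ n :: real) sums (1 / (1 - 1 / 2) * (1 / 2) ^ n)"
    by (intro sums_mult2 geometric_sums) simp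
   then show "(\<lambda>k. (1 / 2) ^ (k + n) :: real) sums (2 * (1 / 2) ^ n)" by (simp add: power_add)
  qed simp
  finally show ?thesis by (simp add: nn_integral_count_space_nat)
 qed
 have "AE x in lborel. (\<Sum>k. ennreal (D k x)) \<noteq> \<infinity>"
 proof -
  have "(\<integral>\<^sup>+x. epow (\<Sum>k. ennreal (D k x)) 2 \<partial>lborel) < \<infinity>"
   using order.strict_trans1[OF tail[of 0], of \<infinity>] by (simp add: lp_norm_2 epow_less_top)
  then have "AE x in lborel. epow (\<Sum>k. ennreal (D k x)) 2 \<noteq> \<infinity>"
   by (intro nn_integral_noteq_infinite) auto
  then show ?thesis by eventually_elim auto
 qed
 define F where "F x = lim (\<lambda>n. f n x)" for x
 have [measurable]: "F \<in> borel_measurable borel" unfolding F_def by measurable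
 have near: "AE x in lborel. \<forall>n. ennreal (norm (f n x - F x)) \<le> (\<Sum>k. ennreal (D (k + n) x))"
  using \<open>AE x in lborel. (\<Sum>k. ennreal (D k x)) \<noteq> \<infinity>\<close>
 proof eventually_elim
  case (elim x)
  have sD: "summable (\<lambda>k. D k x)"
   using elim by (intro summable_suminf_not_top) (auto simp: D_def)
  then have "summable (\<lambda>k. f (Suc k) x - f k x)"
   unfolding D_def by (rule summable_norm_cancel)
  then have "(\<lambda>n. \<Sum>k<n. f (Suc k) x - f k x) \<longlonglongrightarrow> (\<Sum>k. f (Suc k) x - f k x)"
   by (rule summable_LIMSEQ)
  then have "(\<lambda>n. f n x - f 0 x) \<longlonglongrightarrow> (\<Sum>k. f (Suc k) x - f k x)"
   by (simp only: sum_lessThan_telescope[of "\<lambda>k. f k x"])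
  from tendsto_add[OF tendsto_const[of "f 0 x"] this] have "convergent (\<lambda>n. f n x)" by (auto simp: convergent_def)
  then have lim: "(\<lambda>n. f n x) \<longlonglongrightarrow> F x" unfolding F_def by (simp add: convergent_LIMSEQ_iff)
  show ?case
  proof
   fix n
   have sDn: "summable (\<lambda>k. D (k + n) x)" using sD by (rule summable_ignore_initial_segment)
   have "norm (f n x - f (m + n) x) \<le> (\<Sum>k. D (k + n) x)" for m
   proof -
    have "f (m + n) x - f n x = (\<Sum>k<m. f (Suc (k + n)) x - f (k + n) x)"
     using sum_lessThan_telescope[of "\<lambda>k. f (k + n) x" m] by simp
    then have "norm (f (m + n) x - f n x) \<le> (\<Sum>k<m. D (k + n) x)"
     by (simp add: D_def norm_sum)
    also have "\<dots> \<le> (\<Sum>k. D (k + n) x)"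
     by (rule sum_le_suminf[OF sDn]) (auto simp: D_def)
    finally show ?thesis by (simp add: norm_minus_commute)
   qed
   moreover have "(\<lambda>m. norm (f n x - f (m + n) x)) \<longlonglongrightarrow> norm (f n x - F x)"
    by (intro tendsto_intros LIMSEQ_ignore_initial_segment lim)
   ultimately have "norm (f n x - F x) \<le> (\<Sum>k. D (k + n) x)"
    by (intro LIMSEQ_le_const2) auto
   then show "ennreal (norm (f n x - F x)) \<le> (\<Sum>k. ennreal (D (k + n) x))"
    using sDn by (subst suminf_ennreal2) (auto simp: D_def intro: ennreal_leI)
  qed
 qed
 have bound: "lp_norm lborel 2 (\<lambda>x. ennreal (norm (f n x - F x))) \<le> ennreal (2 * (1 / 2) ^ n)" for n
 proof -
  have "lp_norm lborel 2 (\<lambda>x. ennreal (norm (f n x - F x))) \<le> lp_norm lborel 2 (\<lambda>x. \<Sum>k. ennreal (D (k + n) x))"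
   using near by (intro lp_norm_mono_AE) (auto elim: eventually_mono)
  with tail[of n] show ?thesis by (rule order_trans[rotated])
 qed
 then have sq: "sqint (\<lambda>x. f n x - F x)" for n
  unfolding sqint_iff using le_less_trans[OF bound ennreal_less_top] by auto
 have F: "sqint F" using sqint_diff(1)[OF f[of 0] sq[of 0]] by simp
 have "l2norm (\<lambda>x. f n x - F x) \<le> 2 * (1 / 2) ^ n" for n
  using bound[of n] unfolding lp_norm_sqint[OF sq] by simp
 note le2 = this
 have "(\<lambda>n. 2 * (1 / 2) ^ n :: real) \<longlonglongrightarrow> 2 * 0"
  by (intro tendsto_intros LIMSEQ_power_zero) simp
 then have "(\<lambda>n. 2 * (1 / 2) ^ n :: real) \<longlonglongrightarrow> 0" by simp
 then have "(\<lambda>n. l2norm (\<lambda>x. f n x - F x)) \<longlonglongrightarrow> 0"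
  by (rule Lim_null_comparison[rotated]) (use le2 in auto)
 with F show thesis by (rule that)
qed

definition Cc :: "(real^'d => complex) => bool" where
 "Cc g \<longleftrightarrow> continuous_on UNIV g \<and> (\<exists>R. \<forall>x. R < norm x \<longrightarrow> g x = 0)"

lemma integrable_indicator_cball:
 "integrable lborel (\<lambda>x. c * indicator (cball 0 R) x :: real)" for R :: real
 using emeasure_bounded_finite[OF bounded_cball, of 0 R]
 by (intro integrable_mult_right integrable_real_indicator) auto

lemma Cc_imp:
 assumes "Cc g"
 shows "continuous_on S g" "g \<in> borel_measurable borel" "\<exists>B. \<forall>x. norm (g x) \<le> B"
  "integrable lborel g" "sqint g"
proof -
 obtain R where cont: "continuous_on UNIV g" and R: "\<And>x. R < norm x ==> g x = 0"
  using assms by (auto simp: Cc_def)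
 show "continuous_on S g" using cont continuous_on_subset by blast
 show meas [measurable]: "g \<in> borel_measurable borel" using cont by (rule borel_measurable_continuous_onI)
 have "compact (g ` cball 0 R)"
  using cont by (intro compact_continuous_image continuous_on_subset[OF cont]) auto
 then obtain B where B: "\<And>x. x \<in> cball 0 R ==> norm (g x) \<le> B"
  by (meson bounded_iff compact_imp_bounded image_eqI)
 have le: "norm (g x) \<le> max B 0 * indicator (cball 0 R) x" for x
  using B[of x] R[of x] by (cases "x \<in> cball 0 R") auto
 have "max B 0 * indicator (cball 0 R) x \<le> max B 0" for x :: "real^'a"
  by (auto simp: indicator_def)
 with le show "\<exists>B. \<forall>x. norm (g x) \<le> B" by (meson order_trans)
 show "integrable lborel g"
  by (rule Bochner_Integration.integrable_bound[OF integrable_indicator_cball[of "max B 0" R]])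
   (use le in \<open>auto simp: intro: order_trans[OF _ abs_ge_self]\<close>)
 have "(norm (g x))\<^sup>2 \<le> (max B 0)\<^sup>2 * indicator (cball 0 R) x" for x
  using power_mono[OF le[of x] norm_ge_zero, of 2] by (auto simp: power_mult_distrib indicator_def split: if_splits)
 then have "integrable lborel (\<lambda>x. (norm (g x))\<^sup>2)"
  by (intro Bochner_Integration.integrable_bound[OF integrable_indicator_cball[of "(max B 0)\<^sup>2" R]]) auto
 then show "sqint g" by (simp add: sqint_def)
qed

lemma Cc_diff: "Cc f ==> Cc g ==> Cc (\<lambda>x. f x - g x)"
proof -
 assume f: "Cc f" and g: "Cc g"
 then obtain R S where "\<And>x. R < norm x ==> f x = 0" "\<And>x. S < norm x ==> g x = 0" by (auto simp: Cc_def)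
 then have "\<forall>x. max R S < norm x \<longrightarrow> f x - g x = 0" by auto
 with f g show ?thesis
  unfolding Cc_def by (intro conjI continuous_intros exI[of _ "max R S"]) auto
qed

text \<open>A bounded function with bounded support is an almost everywhere limit of continuous functions,
 which may be clamped and cut off.\<close>

lemma bounded_approx_Cc:
 fixes f :: "real^'d => complex" and N :: real
 assumes [measurable]: "f \<in> borel_measurable borel" and N: "0 < N"
  and le: "\<And>x. norm (f x) \<le> N" and supp: "\<And>x. N < norm x ==> f x = 0"
 obtains g where "\<And>n. Cc (g n)" "\<And>n x. norm (g n x) \<le> N" "\<And>n x. N + 1 < norm x ==> g n x = 0"
  "AE x in lborel. (\<lambda>n. g n x) \<longlonglongrightarrow> f x"
proof -
 have "f measurable_on UNIV"
  by (subst measurable_on_iff_borel_measurable) (auto simp: lebesgue_on_UNIV_eq intro!: measurable_completion)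
 then obtain Z G where Z: "negligible Z" and G: "\<And>n. continuous_on UNIV (G n)"
  and lim: "\<And>x. x \<notin> Z ==> (\<lambda>n. G n x) \<longlonglongrightarrow> f x"
  by (auto simp: measurable_on_def)
 define cl where "cl z = z * complex_of_real (N / max N (norm z))" for z
 define cut where "cut x = max 0 (min 1 (N + 1 - norm x))" for x :: "real^'d"
 define g where "g n x = complex_of_real (cut x) * cl (G n x)" for n x
 have cl_cont: "continuous_on UNIV cl"
  unfolding cl_def using N by (intro continuous_intros) auto
 have cl_le: "norm (cl z) \<le> N" for z
  using N by (auto simp: cl_def norm_mult norm_divide max_def field_simps)
 have cut01: "0 \<le> cut x" "cut x \<le> 1" for x by (auto simp: cut_def)
 have supp': "g n x = 0" if "N + 1 < norm x" for n x
  using that by (simp add: g_def cut_def)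
 show thesis
 proof
  have "continuous_on UNIV (g n)" for n
   unfolding g_def cut_def
   by (intro continuous_intros continuous_on_compose2[OF cl_cont G]) auto
  with supp' show "Cc (g n)" for n by (auto simp: Cc_def)
  show "norm (g n x) \<le> N" for n x
   using mult_mono[OF cut01(2)[of x] cl_le[of "G n x"]] N by (simp add: g_def norm_mult cut01)
  show "g n x = 0" if "N + 1 < norm x" for n x using that by (rule supp')
  have "AE x in lebesgue. x \<notin> Z"
   using Z by (intro AE_not_in) (simp add: negligible_iff_null_sets)
  then have "AE x in lborel. x \<notin> Z"
   by (simp add: AE_completion_iff)
  then show "AE x in lborel. (\<lambda>n. g n x) \<longlonglongrightarrow> f x"
  proof eventually_elim
   case (elim x)
   have "isCont cl (f x)" using cl_cont by (simp add: continuous_on_eq_continuous_at)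
   then have "(\<lambda>n. g n x) \<longlonglongrightarrow> complex_of_real (cut x) * cl (f x)"
    unfolding g_def by (intro tendsto_intros isCont_tendsto_compose[OF _ lim[OF elim]])
   also have "complex_of_real (cut x) * cl (f x) = f x"
   proof (cases "N < norm x")
    case False
    then show ?thesis using le[of x] N by (simp add: cut_def cl_def max_absorb1)
   qed (simp add: supp cl_def)
   finally show ?case .
  qed
 qed
qed

lemma truncation_tendsto:
 fixes f :: "real^'d => complex"
 assumes "sqint f"
 shows "(\<lambda>n. l2norm (\<lambda>x. (if norm (f x) \<le> real n \<and> norm x \<le> real n then f x else 0) - f x)) \<longlonglongrightarrow> 0"
proof -
 note [measurable] = sqint_measurable[OF assms]
 have "(\<lambda>n. \<integral>x. (norm ((if norm (f x) \<le> real n \<and> norm x \<le> real n then f x else 0) - f x))\<^sup>2 \<partial>lborel) \<longlonglongrightarrow> (\<integral>x. 0 \<partial>(lborel :: (real^'d) measure))"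
 proof (rule integral_dominated_convergence[where w="\<lambda>x. (norm (f x))\<^sup>2"])
  show "AE x in lborel. (\<lambda>n. (norm ((if norm (f x) \<le> real n \<and> norm x \<le> real n then f x else 0) - f x))\<^sup>2) \<longlonglongrightarrow> 0"
  proof (rule AE_I2, rule tendsto_eventually)
   fix x
   obtain n0 where "max (norm (f x)) (norm x) \<le> real n0" using real_arch_simple by blast
   then show "\<forall>\<^sub>F n in sequentially. (norm ((if norm (f x) \<le> real n \<and> norm x \<le> real n then f x else 0) - f x))\<^sup>2 = 0"
    unfolding eventually_sequentially by (intro exI[of _ n0]) auto
  qed
 qed (use assms in \<open>auto simp: sqint_def\<close>)
 then show ?thesis
  unfolding l2norm_def using tendsto_real_sqrt by fastforce
qed

lemma sqint_truncation:
 assumes "sqint f"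
 shows "sqint (\<lambda>x. if norm (f x) \<le> N \<and> norm x \<le> N then f x else 0)"
 using sqint_measurable[OF assms] by (intro sqint_bound(1)[OF assms]) auto

lemma l2norm_tendsto_dominated:
 fixes f :: "real^'d => complex"
 assumes [measurable]: "\<And>n. g n \<in> borel_measurable borel" "f \<in> borel_measurable borel"
  and lim: "AE x in lborel. (\<lambda>n. g n x) \<longlonglongrightarrow> f x"
  and le: "\<And>n x. norm (g n x - f x) \<le> c * indicator (cball 0 R) x"
 shows "(\<lambda>n. l2norm (\<lambda>x. g n x - f x)) \<longlonglongrightarrow> 0"
proof -
 have "(\<lambda>n. \<integral>x. (norm (g n x - f x))\<^sup>2 \<partial>lborel) \<longlonglongrightarrow> (\<integral>x. 0 \<partial>(lborel :: (real^'d) measure))"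
 proof (rule integral_dominated_convergence[where w="\<lambda>x. c\<^sup>2 * indicator (cball 0 R) x"])
  show "AE x in lborel. (\<lambda>n. (norm (g n x - f x))\<^sup>2) \<longlonglongrightarrow> 0"
   using lim
  proof eventually_elim
   case (elim x)
   have "(\<lambda>n. (norm (g n x - f x))\<^sup>2) \<longlonglongrightarrow> (norm (f x - f x))\<^sup>2" by (intro tendsto_intros elim)
   then show ?case by simp
  qed
  show "AE x in lborel. norm ((norm (g n x - f x))\<^sup>2) \<le> c\<^sup>2 * indicator (cball 0 R) x" for n
  proof (rule AE_I2)
   fix x
   show "norm ((norm (g n x - f x))\<^sup>2) \<le> c\<^sup>2 * indicator (cball 0 R) x"
    using power_mono[OF le[of n x] norm_ge_zero, of 2] by (auto simp: power_mult_distrib indicator_def split: if_splits)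
  qed
  show "integrable lborel (\<lambda>x :: real^'d. c\<^sup>2 * indicator (cball 0 R) x)"
   by (rule integrable_indicator_cball)
 qed auto
 then show ?thesis
  unfolding l2norm_def using tendsto_real_sqrt by fastforce
qed

lemma Cc_dense:
 fixes f :: "real^'d => complex"
 assumes f: "sqint f" and e: "0 < e"
 obtains g where "Cc g" "l2norm (\<lambda>x. g x - f x) < e"
proof -
 define tr where "tr n = (\<lambda>x. if norm (f x) \<le> real n \<and> norm x \<le> real n then f x else 0)" for n
 note [measurable] = sqint_measurable[OF f]
 have "\<forall>\<^sub>F n in sequentially. l2norm (\<lambda>x. tr n x - f x) < e / 2"
  using truncation_tendsto[OF f] e unfolding tr_def by (intro order_tendstoD(2)) auto
 then obtain n where n: "0 < n" "l2norm (\<lambda>x. tr n x - f x) < e / 2"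
  by (auto simp: eventually_sequentially) (metis le_Suc_eq less_Suc_eq_0_disj linorder_not_le zero_less_Suc)
 have [measurable]: "tr n \<in> borel_measurable borel" unfolding tr_def by measurable
 have tr: "sqint (tr n)" unfolding tr_def by (rule sqint_truncation[OF f])
 obtain g where g: "\<And>k. Cc (g k)" "\<And>k x. norm (g k x) \<le> real n" "\<And>k x. real n + 1 < norm x ==> g k x = 0"
  "AE x in lborel. (\<lambda>k. g k x) \<longlonglongrightarrow> tr n x"
  by (rule bounded_approx_Cc[of "tr n" "real n"]) (use n in \<open>auto simp: tr_def\<close>)
 have "(\<lambda>k. l2norm (\<lambda>x. g k x - tr n x)) \<longlonglongrightarrow> 0"
 proof (rule l2norm_tendsto_dominated)
  show "norm (g k x - tr n x) \<le> (2 * real n) * indicator (cball 0 (real n + 1)) x" for k x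
   using norm_triangle_ineq4[of "g k x" "tr n x"] g(2)[of k x] g(3)[of x k]
   by (auto simp: tr_def indicator_def split: if_splits)
 qed (use g Cc_imp(2)[OF g(1)] in auto)
 then have "\<forall>\<^sub>F k in sequentially. l2norm (\<lambda>x. g k x - tr n x) < e / 2"
  using e by (intro order_tendstoD(2)) auto
 then obtain k where k: "l2norm (\<lambda>x. g k x - tr n x) < e / 2"
  by (auto simp: eventually_sequentially)
 have "l2norm (\<lambda>x. g k x - f x) < e"
  using l2norm_triangle[OF Cc_imp(5)[OF g(1)[of k]] tr f] k n by linarith
 with g(1) show thesis by (rule that)
qed

lemma Parseval_Cc:
 fixes g :: "real^'d => complex"
 assumes g: "Cc g"
 shows "sqint (fourier g)" "l2norm (fourier g) = l2norm g"
proof -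
 note [measurable] = Cc_imp(2)[OF g] borel_measurable_fourier[OF Cc_imp(4)[OF g]]
 obtain B where B: "\<And>x. norm (g x) \<le> B" using Cc_imp(3)[OF g] by blast
 have eq: "fourier g \<xi> * cnj (fourier g \<xi>) * complex_of_real r = complex_of_real ((norm (fourier g \<xi>))\<^sup>2 * r)" for \<xi> r
  by (simp only: of_real_mult complex_norm_square)
 have eq': "(\<integral>x. g x * cnj (g x) \<partial>lborel) = complex_of_real ((l2norm g)\<^sup>2)"
  unfolding l2norm_power2 integral_complex_of_real[symmetric] by (simp only: complex_norm_square)
 have "(\<lambda>n. complex_of_real (\<integral>\<xi>. (norm (fourier g \<xi>))\<^sup>2 * gauss (1 / real (Suc n)) \<xi> \<partial>lborel))
   \<longlonglongrightarrow> complex_of_real ((l2norm g)\<^sup>2)"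
  using fourier_pairing_gauss_tendsto[OF Cc_imp(4)[OF g] Cc_imp(4)[OF g] Cc_imp(1)[OF g] B]
  unfolding eq eq' by (simp del: of_real_mult of_real_power)
 then have lim: "(\<lambda>n. \<integral>\<xi>. (norm (fourier g \<xi>))\<^sup>2 * gauss (1 / real (Suc n)) \<xi> \<partial>lborel) \<longlonglongrightarrow> (l2norm g)\<^sup>2"
  by (simp only: tendsto_of_real_iff)
 let ?I = "\<integral>x. norm (g x) \<partial>lborel"
 have int: "integrable lborel (\<lambda>\<xi>. (norm (fourier g \<xi>))\<^sup>2 * gauss (1 / real (Suc n)) \<xi>)" for n
 proof (rule Bochner_Integration.integrable_bound)
  show "integrable lborel (\<lambda>\<xi>. ?I\<^sup>2 * gauss (1 / real (Suc n)) \<xi> :: real)"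
   by (intro integrable_mult_right integrable_gauss) auto
  show "AE \<xi> in lborel. norm ((norm (fourier g \<xi>))\<^sup>2 * gauss (1 / real (Suc n)) \<xi>) \<le> norm (?I\<^sup>2 * gauss (1 / real (Suc n)) \<xi>)"
   using norm_fourier_le[OF Cc_imp(4)[OF g]]
   by (auto simp: abs_mult gauss_bounds less_imp_le intro!: mult_right_mono power_mono)
 qed simp
 have mono: "gauss (1 / real (Suc n)) \<xi> \<le> gauss (1 / real (Suc m)) \<xi>" if "n \<le> m" for n m and \<xi> :: "real^'d"
 proof -
  have "(1 / real (Suc m))\<^sup>2 \<le> (1 / real (Suc n))\<^sup>2"
   using that by (intro power_mono) (auto simp: frac_le)
  then show ?thesis by (simp add: gauss_def mult_left_mono mult_right_mono)
 qed
 have "integrable lborel (\<lambda>\<xi>. (norm (fourier g \<xi>))\<^sup>2)" (is ?int)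
  and "(\<integral>\<xi>. (norm (fourier g \<xi>))\<^sup>2 \<partial>lborel) = (l2norm g)\<^sup>2" (is ?val)
 proof -
  have mon: "AE \<xi> in lborel. mono (\<lambda>n. (norm (fourier g \<xi>))\<^sup>2 * gauss (1 / real (Suc n)) \<xi>)"
   by (intro AE_I2 monoI mult_left_mono mono) auto
  have "(\<lambda>n. (norm (fourier g \<xi>))\<^sup>2 * gauss (1 / real (Suc n)) \<xi>) \<longlonglongrightarrow> (norm (fourier g \<xi>))\<^sup>2 * 1" for \<xi>
   by (intro tendsto_intros gauss_tendsto_1)
  then have lim': "AE \<xi> in lborel. (\<lambda>n. (norm (fourier g \<xi>))\<^sup>2 * gauss (1 / real (Suc n)) \<xi>) \<longlonglongrightarrow> (norm (fourier g \<xi>))\<^sup>2"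
   by simp
  show ?int by (rule integrable_monotone_convergence[OF int mon lim' lim]) measurable
  show ?val by (rule integral_monotone_convergence[OF int mon lim' lim]) measurable
 qed
 then show "sqint (fourier g)" "l2norm (fourier g) = l2norm g"
  by (auto simp: sqint_def l2norm_def)
qed

text \<open>A relation, since a limit in mean determines the transform of a square-integrable function only up to null sets.\<close>

definition has_L2_fourier :: "(real^'d => complex) => (real^'d => complex) => bool" where
 "has_L2_fourier g G \<longleftrightarrow> sqint g \<and> sqint G \<and>
  (\<exists>s. (\<forall>n. Cc (s n)) \<and> (\<lambda>n. l2norm (\<lambda>x. s n x - g x)) \<longlonglongrightarrow> 0 \<and>
   (\<lambda>n. l2norm (\<lambda>x. fourier (s n) x - G x)) \<longlonglongrightarrow> 0)"

lemma L2_fourier_exists: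
 fixes g :: "real^'d => complex"
 assumes g: "sqint g"
 obtains G where "has_L2_fourier g G"
proof -
 have "\<exists>s. Cc s \<and> l2norm (\<lambda>x. s x - g x) < (1 / 2) ^ Suc n" for n
  using Cc_dense[OF g, of "(1 / 2) ^ Suc n"] by (metis zero_less_divide_1_iff zero_less_numeral zero_less_power)
 then obtain s where s: "\<And>n. Cc (s n)" "\<And>n. l2norm (\<lambda>x. s n x - g x) < (1 / 2) ^ Suc n"
  by metis
 have near: "l2norm (\<lambda>x. fourier (s (Suc n)) x - fourier (s n) x) \<le> (1 / 2) ^ n" for n
 proof -
  have "(\<lambda>x. fourier (s (Suc n)) x - fourier (s n) x) = fourier (\<lambda>x. s (Suc n) x - s n x)"
   using s by (simp add: fourier_diff Cc_imp(4) fun_eq_iff)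
  then have "l2norm (\<lambda>x. fourier (s (Suc n)) x - fourier (s n) x) = l2norm (\<lambda>x. s (Suc n) x - s n x)"
   by (simp add: Parseval_Cc Cc_diff s)
  also have "\<dots> \<le> l2norm (\<lambda>x. s (Suc n) x - g x) + l2norm (\<lambda>x. g x - s n x)"
   by (intro l2norm_triangle g Cc_imp(5) s)
  also have "\<dots> \<le> (1 / 2) ^ Suc (Suc n) + (1 / 2) ^ Suc n"
   using s(2)[of n] s(2)[of "Suc n"] by (simp only: l2norm_minus_commute[of g])
  also have "\<dots> \<le> (1 / 2) ^ n" by simp
  finally show ?thesis .
 qed
 obtain G where G: "sqint G" "(\<lambda>n. l2norm (\<lambda>x. fourier (s n) x - G x)) \<longlonglongrightarrow> 0"
  using Riesz_Fischer[of "\<lambda>n. fourier (s n)", OF Parseval_Cc(1)[OF s(1)] near] by blast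
 have "(\<lambda>n. (1 / 2) ^ Suc n :: real) \<longlonglongrightarrow> 0"
  by (intro LIMSEQ_Suc LIMSEQ_power_zero) simp
 then have "(\<lambda>n. l2norm (\<lambda>x. s n x - g x)) \<longlonglongrightarrow> 0"
  by (rule Lim_null_comparison[rotated]) (use less_imp_le[OF s(2)] in auto)
 with g G s(1) show thesis by (intro that[of G]) (auto simp: has_L2_fourier_def)
qed

text \<open>Pairing an integrable function with a continuous one; the transform \<open>g\<close> only has to make the
 product of transforms integrable.\<close>

lemma Parseval_L1_continuous:
 fixes f g :: "real^'d => complex"
 assumes f: "integrable lborel f" and g: "integrable lborel g"
  and cont: "continuous_on UNIV g" and B: "\<And>x. norm (g x) \<le> B"
  and int: "integrable lborel (\<lambda>\<xi>. fourier f \<xi> * cnj (fourier g \<xi>))"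
 shows "(\<integral>\<xi>. fourier f \<xi> * cnj (fourier g \<xi>) \<partial>lborel) = (\<integral>x. f x * cnj (g x) \<partial>lborel)"
proof (rule LIMSEQ_unique)
 note [measurable] = borel_measurable_fourier[OF f] borel_measurable_fourier[OF g]
 show "(\<lambda>n. \<integral>\<xi>. fourier f \<xi> * cnj (fourier g \<xi>) * complex_of_real (gauss (1 / real (Suc n)) \<xi>) \<partial>lborel)
  \<longlonglongrightarrow> (\<integral>x. f x * cnj (g x) \<partial>lborel)"
  by (rule fourier_pairing_gauss_tendsto[OF f g cont B])
 show "(\<lambda>n. \<integral>\<xi>. fourier f \<xi> * cnj (fourier g \<xi>) * complex_of_real (gauss (1 / real (Suc n)) \<xi>) \<partial>lborel)
  \<longlonglongrightarrow> (\<integral>\<xi>. fourier f \<xi> * cnj (fourier g \<xi>) \<partial>lborel)"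
 proof (rule integral_dominated_convergence[where w="\<lambda>\<xi>. norm (fourier f \<xi> * cnj (fourier g \<xi>))"])
  show "AE \<xi> in lborel. (\<lambda>n. fourier f \<xi> * cnj (fourier g \<xi>) * complex_of_real (gauss (1 / real (Suc n)) \<xi>))
    \<longlonglongrightarrow> fourier f \<xi> * cnj (fourier g \<xi>)"
  proof (rule AE_I2)
   fix \<xi>
   have "(\<lambda>n. fourier f \<xi> * cnj (fourier g \<xi>) * complex_of_real (gauss (1 / real (Suc n)) \<xi>))
    \<longlonglongrightarrow> fourier f \<xi> * cnj (fourier g \<xi>) * complex_of_real 1"
    by (intro tendsto_intros gauss_tendsto_1)
   then show "(\<lambda>n. fourier f \<xi> * cnj (fourier g \<xi>) * complex_of_real (gauss (1 / real (Suc n)) \<xi>))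
    \<longlonglongrightarrow> fourier f \<xi> * cnj (fourier g \<xi>)" by simp
  qed
  show "AE \<xi> in lborel. norm (fourier f \<xi> * cnj (fourier g \<xi>) * complex_of_real (gauss (1 / real (Suc n)) \<xi>))
    \<le> norm (fourier f \<xi> * cnj (fourier g \<xi>))" for n
   by (intro AE_I2) (auto simp: norm_mult gauss_bounds less_imp_le intro!: mult_left_le)
 qed (use int in auto)
qed

lemma Parseval_L2:
 assumes g: "has_L2_fourier g G" and k: "has_L2_fourier k K"
 shows "(\<integral>x. g x * cnj (k x) \<partial>lborel) = (\<integral>\<xi>. G \<xi> * cnj (K \<xi>) \<partial>lborel)"
proof -
 obtain s where s: "\<And>n. Cc (s n)" "(\<lambda>n. l2norm (\<lambda>x. s n x - g x)) \<longlonglongrightarrow> 0"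
   "(\<lambda>n. l2norm (\<lambda>x. fourier (s n) x - G x)) \<longlonglongrightarrow> 0"
  using g unfolding has_L2_fourier_def by blast
 obtain t where t: "\<And>n. Cc (t n)" "(\<lambda>n. l2norm (\<lambda>x. t n x - k x)) \<longlonglongrightarrow> 0"
   "(\<lambda>n. l2norm (\<lambda>x. fourier (t n) x - K x)) \<longlonglongrightarrow> 0"
  using k unfolding has_L2_fourier_def by blast
 have sq: "sqint g" "sqint G" "sqint k" "sqint K" using g k by (auto simp: has_L2_fourier_def)
 have eq: "(\<integral>x. s n x * cnj (t n x) \<partial>lborel) = (\<integral>\<xi>. fourier (s n) \<xi> * cnj (fourier (t n) \<xi>) \<partial>lborel)" for n
 proof -
  obtain B where "\<And>x. norm (t n x) \<le> B" using Cc_imp(3)[OF t(1)] by blast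
  then show ?thesis
   by (intro Parseval_L1_continuous[symmetric] Cc_imp s t sqint_product Parseval_Cc)
 qed
 have "(\<lambda>n. \<integral>x. s n x * cnj (t n x) \<partial>lborel) \<longlonglongrightarrow> (\<integral>x. g x * cnj (k x) \<partial>lborel)"
  by (intro inner_tendsto Cc_imp s t sq)
 moreover have "(\<lambda>n. \<integral>x. s n x * cnj (t n x) \<partial>lborel) \<longlonglongrightarrow> (\<integral>\<xi>. G \<xi> * cnj (K \<xi>) \<partial>lborel)"
  unfolding eq by (intro inner_tendsto Parseval_Cc s t sq)
 ultimately show ?thesis by (rule LIMSEQ_unique)
qed

text \<open>An integrable function with square-integrable transform is square-integrable: test it against
 truncations of itself.\<close>

lemma sqint_if_fourier_sqint:
 fixes f :: "real^'d => complex"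
 assumes f: "integrable lborel f" and F: "sqint (fourier f)"
 shows "sqint f" and "has_L2_fourier g G ==> (\<integral>x. f x * cnj (g x) \<partial>lborel) = (\<integral>\<xi>. fourier f \<xi> * cnj (G \<xi>) \<partial>lborel)"
proof -
 have [measurable]: "f \<in> borel_measurable borel" using f by simp
 have pair: "(\<integral>x. f x * cnj (g x) \<partial>lborel) = (\<integral>\<xi>. fourier f \<xi> * cnj (fourier g \<xi>) \<partial>lborel)" if g: "Cc g" for g
 proof -
  obtain B where "\<And>x. norm (g x) \<le> B" using Cc_imp(3)[OF g] by blast
  then show ?thesis
   by (intro Parseval_L1_continuous[symmetric] Cc_imp g f sqint_product F Parseval_Cc)
 qed
 let ?tr' = "\<lambda>n x. if norm (f x) \<le> real n \<and> norm x \<le> real n then f x else 0"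
 have tr_props: "(\<integral>x. (norm (?tr' n x))\<^sup>2 \<partial>lborel) \<le> (l2norm (fourier f))\<^sup>2 \<and> sqint (?tr' n)" if n: "0 < n" for n
 proof -
  let ?tr = "?tr' n"
  have [measurable]: "?tr \<in> borel_measurable borel" by measurable
  obtain g where g: "\<And>k. Cc (g k)" "\<And>k x. norm (g k x) \<le> real n" "\<And>k x. real n + 1 < norm x ==> g k x = 0"
   "AE x in lborel. (\<lambda>k. g k x) \<longlonglongrightarrow> ?tr x"
   by (rule bounded_approx_Cc[of ?tr "real n"]) (use n in auto)
  have "norm (?tr x) \<le> norm (real n * indicator (cball 0 (real n)) x)" for x
   by (auto simp: indicator_def)
  from power_mono[OF this norm_ge_zero, of 2] have tr: "sqint ?tr"
   unfolding sqint_def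
   by (intro conjI Bochner_Integration.integrable_bound[OF integrable_indicator_cball[of "(real n)\<^sup>2" "real n"]])
    (auto simp: power_mult_distrib indicator_def)
  have norms: "(\<lambda>k. l2norm (g k)) \<longlonglongrightarrow> l2norm ?tr"
  proof (rule LIM_zero_cancel, rule Lim_null_comparison)
   show "(\<lambda>k. l2norm (\<lambda>x. g k x - ?tr x)) \<longlonglongrightarrow> 0"
   proof (rule l2norm_tendsto_dominated)
    show "norm (g k x - ?tr x) \<le> (2 * real n) * indicator (cball 0 (real n + 1)) x" for k x
     using norm_triangle_ineq4[of "g k x" "?tr x"] g(2)[of k x] g(3)[of x k]
     by (auto simp: indicator_def split: if_splits)
   qed (use g Cc_imp(2)[OF g(1)] in auto)
   have "\<bar>l2norm (g k) - l2norm ?tr\<bar> \<le> l2norm (\<lambda>x. g k x - ?tr x)" for k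
   proof -
    have k: "sqint (g k)" by (intro Cc_imp g)
    have "l2norm (g k) \<le> l2norm (\<lambda>x. g k x - ?tr x) + l2norm ?tr"
     using sqint_add(2)[OF sqint_diff(1)[OF k tr] tr] by simp
    moreover have "l2norm ?tr \<le> l2norm (\<lambda>x. ?tr x - g k x) + l2norm (g k)"
     using sqint_add(2)[OF sqint_diff(1)[OF tr k] k] by simp
    ultimately show ?thesis by (simp only: l2norm_minus_commute[of ?tr])
   qed
   then show "\<forall>\<^sub>F k in sequentially. norm (l2norm (g k) - l2norm ?tr) \<le> l2norm (\<lambda>x. g k x - ?tr x)" by simp
  qed
  have "(\<lambda>k. \<integral>x. f x * cnj (g k x) \<partial>lborel) \<longlonglongrightarrow> (\<integral>x. f x * cnj (?tr x) \<partial>lborel)"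
  proof (rule integral_dominated_convergence[where w="\<lambda>x. norm (f x) * real n"])
   show "AE x in lborel. (\<lambda>k. f x * cnj (g k x)) \<longlonglongrightarrow> f x * cnj (?tr x)"
    using g(4) by eventually_elim (intro tendsto_intros)
   show "AE x in lborel. norm (f x * cnj (g k x)) \<le> norm (f x) * real n" for k
    using g(2) by (auto simp: norm_mult intro!: mult_left_mono)
  qed (use f Cc_imp(2)[OF g(1)] in auto)
  moreover have "norm (\<integral>x. f x * cnj (g k x) \<partial>lborel) \<le> l2norm (fourier f) * l2norm (g k)" for k
   unfolding pair[OF g(1)] using norm_inner_le[OF F Parseval_Cc(1)[OF g(1)[of k]]] by (simp add: Parseval_Cc g)
  ultimately have "norm (\<integral>x. f x * cnj (?tr x) \<partial>lborel) \<le> l2norm (fourier f) * l2norm ?tr"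
   by (intro LIMSEQ_le[OF tendsto_norm tendsto_mult_left[OF norms]]) auto
  moreover have "(\<integral>x. f x * cnj (?tr x) \<partial>lborel) = complex_of_real ((l2norm ?tr)\<^sup>2)"
   unfolding l2norm_power2 integral_complex_of_real[symmetric]
   by (intro Bochner_Integration.integral_cong) (auto simp: complex_norm_square simp del: of_real_power)
  ultimately have "l2norm ?tr * l2norm ?tr \<le> l2norm (fourier f) * l2norm ?tr"
   by (simp add: power2_eq_square norm_mult)
  then have "l2norm ?tr \<le> l2norm (fourier f)"
   using l2norm_nonneg[of ?tr] by (cases "l2norm ?tr = 0") (auto simp: mult_le_cancel_right)
  then show ?thesis
   using tr unfolding l2norm_power2[symmetric] by (auto intro: power_mono)
 qed
 have "(\<integral>\<^sup>+x. ennreal ((norm (f x))\<^sup>2) \<partial>lborel) \<le> ennreal ((l2norm (fourier f))\<^sup>2)"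
 proof -
  let ?t = "\<lambda>n x. if norm (f x) \<le> real n \<and> norm x \<le> real n then f x else 0"
  have "(\<integral>\<^sup>+x. ennreal ((norm (f x))\<^sup>2) \<partial>lborel) = (\<integral>\<^sup>+x. liminf (\<lambda>n. ennreal ((norm (?t (Suc n) x))\<^sup>2)) \<partial>lborel)"
  proof (rule nn_integral_cong)
   fix x
   obtain n0 where "max (norm (f x)) (norm x) \<le> real n0" using real_arch_simple by blast
   then have "(\<lambda>n. ennreal ((norm (?t (Suc n) x))\<^sup>2)) \<longlonglongrightarrow> ennreal ((norm (f x))\<^sup>2)"
    by (intro tendsto_eventually) (auto simp: eventually_sequentially intro!: exI[of _ n0])
   then show "ennreal ((norm (f x))\<^sup>2) = liminf (\<lambda>n. ennreal ((norm (?t (Suc n) x))\<^sup>2))"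
    by (intro lim_imp_Liminf[symmetric]) auto
  qed
  also have "\<dots> \<le> liminf (\<lambda>n. \<integral>\<^sup>+x. ennreal ((norm (?t (Suc n) x))\<^sup>2) \<partial>lborel)"
   by (rule nn_integral_liminf) measurable
  also have "\<dots> \<le> ennreal ((l2norm (fourier f))\<^sup>2)"
  proof (rule Liminf_le)
   have "(\<integral>\<^sup>+x. ennreal ((norm (?t (Suc n) x))\<^sup>2) \<partial>lborel) \<le> ennreal ((l2norm (fourier f))\<^sup>2)" for n
    using tr_props[of "Suc n"]
    by (subst nn_integral_eq_integral) (auto simp: sqint_def intro: ennreal_leI)
   then show "\<forall>\<^sub>F n in sequentially. (\<integral>\<^sup>+x. ennreal ((norm (?t (Suc n) x))\<^sup>2) \<partial>lborel) \<le> ennreal ((l2norm (fourier f))\<^sup>2)"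
    by simp
  qed simp
  finally show ?thesis .
 qed
 then show sq: "sqint f"
  by (auto simp: sqint_def integrable_iff_bounded intro: le_less_trans)
 assume g: "has_L2_fourier g G"
 then obtain s where s: "\<And>n. Cc (s n)" "(\<lambda>n. l2norm (\<lambda>x. s n x - g x)) \<longlonglongrightarrow> 0"
   "(\<lambda>n. l2norm (\<lambda>x. fourier (s n) x - G x)) \<longlonglongrightarrow> 0"
  unfolding has_L2_fourier_def by blast
 have sqg: "sqint g" "sqint G" using g by (auto simp: has_L2_fourier_def)
 have "(\<lambda>n. \<integral>x. f x * cnj (s n x) \<partial>lborel) \<longlonglongrightarrow> (\<integral>x. f x * cnj (g x) \<partial>lborel)"
  by (rule inner_tendsto[of "\<lambda>_. f"]) (auto simp: l2norm_def intro: sq sqg s Cc_imp s(2)[unfolded l2norm_def])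
 moreover have "(\<lambda>n. \<integral>x. f x * cnj (s n x) \<partial>lborel) \<longlonglongrightarrow> (\<integral>\<xi>. fourier f \<xi> * cnj (G \<xi>) \<partial>lborel)"
  unfolding pair[OF s(1)]
  by (rule inner_tendsto[of "\<lambda>_. fourier f"]) (auto simp: l2norm_def intro: F sqg Parseval_Cc s(1) s(3)[unfolded l2norm_def])
 ultimately show "(\<integral>x. f x * cnj (g x) \<partial>lborel) = (\<integral>\<xi>. fourier f \<xi> * cnj (G \<xi>) \<partial>lborel)"
  by (rule LIMSEQ_unique)
qed

section \<open>Vanishing moments and decay of the Fourier transform\<close>

lemma smooth1_shift: "u \<in> smooth1 ==> (\<lambda>t. u (t - c)) \<in> smooth1"
proof (induction rule: smooth1.induct)
 case (base p a b)
 have "(\<lambda>t. flat_exp p (a * (t - c) + b)) = (\<lambda>t. flat_exp p (a * t + (b - a * c)))"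
  by (simp add: algebra_simps)
 then show ?case by (simp only: smooth1.base)
qed (auto intro: smooth1.intros)

lemma deriv_shift: "u \<in> smooth1 ==> deriv (\<lambda>t. u (t - c)) = (\<lambda>t. deriv u (t - c))"
proof
 fix t assume "u \<in> smooth1"
 from smooth1_deriv(2)[OF this, of "t - c"]
 have "((\<lambda>t. u (t + - c)) has_real_derivative deriv u (t + - c)) (at t)"
  using DERIV_shift[of u "deriv u (t - c)" t "- c"] by simp
 then show "deriv (\<lambda>t. u (t - c)) t = deriv u (t - c)" by (intro DERIV_imp_deriv) simp
qed

lemma tensor_shift: "tensor (u(i := \<lambda>t. u i (t - c))) x = tensor u (x - c *\<^sub>R axis i 1)"
 unfolding tensor_def by (intro prod.cong) (auto simp: axis_def)

lemma continuous_eq_0_if_AE: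
 fixes w :: "real^'d => complex"
 assumes "continuous_on UNIV w" "AE x in lborel. w x = 0"
 shows "w x = 0"
proof (rule ccontr)
 assume "w x \<noteq> 0"
 have "open (w -` (- {0}))"
  using assms(1) by (intro open_vimage) auto
 moreover have "negligible (w -` (- {0}))"
 proof -
  have "w -` (- {0}) \<in> null_sets lborel"
   using assms(2) \<open>open (w -` (- {0}))\<close> by (simp add: AE_iff_null_sets vimage_def)

  then show ?thesis by (simp add: negligible_iff_null_sets null_sets_completionI)
 qed
 ultimately show False using open_not_negligible \<open>w x \<noteq> 0\<close> by blast
qed

lemma integrable_continuous_compact_support:
 fixes c :: "real^'d => complex"
 assumes c: "continuous_on UNIV c" and R: "\<And>x. x \<notin> cbox a b ==> c x = 0"
 shows "integrable lborel c"
proof -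
 have "integrable lborel (\<lambda>x. indicator (cbox a b) x *\<^sub>R c x)"
  using borel_integrable_compact[OF compact_cbox continuous_on_subset[OF c]] by blast
 also have "(\<lambda>x. indicator (cbox a b) x *\<^sub>R c x) = c"
  using R by (auto simp: indicator_def fun_eq_iff)
 finally show ?thesis .
qed

lemma Fubini_compact_support:
 fixes c :: "real => real^'d => complex"
 assumes c: "continuous_on UNIV (\<lambda>z. c (fst z) (snd z))"
  and R: "\<And>\<tau> x. \<tau> \<in> {0..s} ==> x \<notin> cbox a b ==> c \<tau> x = 0"
 shows "(\<integral>x. integral {0..s} (\<lambda>\<tau>. c \<tau> x) \<partial>lborel) = integral {0..s} (\<lambda>\<tau>. \<integral>x. c \<tau> x \<partial>lborel)"
proof -
 define C where "C z = indicator ({0..s} \<times> cbox a b) z *\<^sub>R c (fst z) (snd z)" for z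
 have "compact ({0..s} \<times> cbox a b)" by (intro compact_Times) auto
 then have "integrable lborel C"
  using borel_integrable_compact[OF _ continuous_on_subset[OF c]] unfolding C_def by blast
 then have int: "integrable (lborel \<Otimes>\<^sub>M lborel) C" by (simp add: lborel_prod)
 have C: "C (\<tau>, x) = indicator {0..s} \<tau> *\<^sub>R c \<tau> x" for \<tau> x
  using R[of \<tau> x] by (auto simp: C_def indicator_def)
 have cont_\<tau>: "continuous_on S (\<lambda>\<tau>. c \<tau> x)" for x S
  by (rule continuous_on_compose2[OF c, of S "\<lambda>\<tau>. (\<tau>, x)", simplified]) (intro continuous_intros)
 have 1: "(\<integral>\<tau>. C (\<tau>, x) \<partial>lborel) = integral {0..s} (\<lambda>\<tau>. c \<tau> x)" for x
  using set_borel_integral_eq_integral(2)[OF borel_integrable_atLeastAtMost'[OF cont_\<tau>]]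
  unfolding C set_lebesgue_integral_def .
 have 2: "(\<integral>x. C (\<tau>, x) \<partial>lborel) = indicator {0..s} \<tau> *\<^sub>R (\<integral>x. c \<tau> x \<partial>lborel)" for \<tau>
  unfolding C by simp
 have "integrable lborel (\<lambda>\<tau>. \<integral>x. C (\<tau>, x) \<partial>lborel)"
  using lborel_pair.integrable_fst[of "\<lambda>\<tau> x. C (\<tau>, x)"] int by simp
 then have si: "set_integrable lborel {0..s} (\<lambda>\<tau>. \<integral>x. c \<tau> x \<partial>lborel)"
  unfolding 2 set_integrable_def .
 have "(\<integral>x. (\<integral>\<tau>. C (\<tau>, x) \<partial>lborel) \<partial>lborel) = (\<integral>\<tau>. (\<integral>x. C (\<tau>, x) \<partial>lborel) \<partial>lborel)"
  using lborel_pair.Fubini_integral[of "\<lambda>\<tau> x. C (\<tau>, x)"] int by simp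
 then show ?thesis
  unfolding 1 2 using set_borel_integral_eq_integral(2)[OF si] by (simp add: set_lebesgue_integral_def)
qed

lemma integral_shift_axis:
 fixes f :: "real^'d => complex"
 shows "(\<integral>x. f (x + a) \<partial>lborel) = (\<integral>x. f x \<partial>lborel)"
  "integrable lborel (\<lambda>x. f (x + a)) \<longleftrightarrow> integrable lborel f"
 using integral_translation[of f a] by (simp_all add: add.commute)

text \<open>A continuous function with continuous distributional derivative \<open>k'\<close> in direction \<open>i\<close> is the integral
 of \<open>k'\<close> along every line in that direction: the difference is continuous and orthogonal to all test functions.\<close>

lemma distr_deriv_integral:
 fixes k k' :: "real^'d => complex"
 assumes k: "continuous_on UNIV k" and k': "continuous_on UNIV k'"
  and distr: "\<And>a b u. u \<in> box_test a b ==>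
   (\<integral>x. k x * tensor (u(i := deriv (u i))) x \<partial>lborel) = - (\<integral>x. k' x * tensor u x \<partial>lborel)"
  and s: "0 \<le> s"
 shows "k (x + s *\<^sub>R axis i 1) - k x = integral {0..s} (\<lambda>\<tau>. k' (x + \<tau> *\<^sub>R axis i 1))"
proof -
 let ?e = "axis i 1 :: real^'d"
 define w where "w x = k (x + s *\<^sub>R ?e) - k x - integral {0..s} (\<lambda>\<tau>. k' (x + \<tau> *\<^sub>R ?e))" for x
 have kc: "continuous_on S (\<lambda>x. k (g x))" if "continuous_on S g" for S and g :: "'x::topological_space => real^'d"
  using continuous_on_compose2[OF k that] by simp
 have kc': "continuous_on S (\<lambda>x. k' (g x))" if "continuous_on S g" for S and g :: "'x::topological_space => real^'d"
  using continuous_on_compose2[OF k' that] by simp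
 have intc: "continuous_on UNIV (\<lambda>x. integral (cbox 0 s) (\<lambda>\<tau>. k' (x + \<tau> *\<^sub>R ?e)))"
  by (rule integral_continuous_on_param) (auto simp: split_beta' intro!: kc' continuous_intros)
 have w: "continuous_on UNIV w"
  unfolding w_def using intc by (intro continuous_intros kc) auto
 have "(\<integral>x. w x * tensor u x \<partial>lborel) = 0" if u: "u \<in> box_test a b" for a b u
 proof -
  let ?\<phi> = "tensor u" and ?\<phi>' = "tensor (u(i := deriv (u i)))"
  have sm: "\<And>j. u j \<in> smooth1" using u by (rule box_testD)
  have sm': "\<And>j. (u(i := deriv (u i))) j \<in> smooth1" using box_test_deriv[OF u, of i] by (rule box_testD)
  have tc: "continuous_on S (\<lambda>x. ?\<phi> (g x))" if "continuous_on S g" for S and g :: "'x::topological_space => real^'d"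
   using continuous_on_compose2[OF tensor_continuous[of u UNIV, OF sm] that] by simp
  have tc': "continuous_on S (\<lambda>x. ?\<phi>' (g x))" if "continuous_on S g" for S and g :: "'x::topological_space => real^'d"
   using continuous_on_compose2[OF tensor_continuous[of "u(i := deriv (u i))" UNIV, OF sm'] that] by simp
  have zero: "?\<phi> x = 0" "?\<phi>' x = 0" if "x \<notin> cbox a b" for x
   using tensor_eq_0_outside[OF u that] tensor_eq_0_outside[OF box_test_deriv[OF u] that] by auto
  define b' where "b' = b + s *\<^sub>R ?e"
  have zero': "?\<phi> (x - \<tau> *\<^sub>R ?e) = 0" "?\<phi>' (x - \<tau> *\<^sub>R ?e) = 0"
   if "0 \<le> \<tau>" "\<tau> \<le> s" "x \<notin> cbox a b'" for \<tau> x
  proof -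
   have "x - \<tau> *\<^sub>R ?e \<notin> cbox a b"
   proof
    assume h: "x - \<tau> *\<^sub>R ?e \<in> cbox a b"
    have "a $ j \<le> x $ j \<and> x $ j \<le> b' $ j" for j
     using h that(1,2) by (auto simp: mem_box_cart b'_def axis_def dest!: spec[of _ j] split: if_splits)
    with that(3) show False by (simp add: mem_box_cart)
   qed
   then show "?\<phi> (x - \<tau> *\<^sub>R ?e) = 0" "?\<phi>' (x - \<tau> *\<^sub>R ?e) = 0" by (auto intro: zero)
  qed
  have int1: "integrable lborel (\<lambda>x. k x * ?\<phi> (x - \<tau> *\<^sub>R ?e))" if "\<tau> \<in> {0..s}" for \<tau>
   by (rule integrable_continuous_compact_support[of _ a b']) (use that in \<open>auto intro!: continuous_intros k tc simp: zero'\<close>)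
  have intk: "integrable lborel (\<lambda>x. k (x + s *\<^sub>R ?e) * ?\<phi> x)"
   by (rule integrable_continuous_compact_support[of _ a b]) (auto intro!: continuous_intros kc tc simp: zero)
  have intk0: "integrable lborel (\<lambda>x. k x * ?\<phi> x)"
   by (rule integrable_continuous_compact_support[of _ a b]) (auto intro!: continuous_intros kc tc simp: zero)
  have intI: "integrable lborel (\<lambda>x. integral {0..s} (\<lambda>\<tau>. k' (x + \<tau> *\<^sub>R ?e)) * ?\<phi> x)"
   by (rule integrable_continuous_compact_support[of _ a b])
    (use intc in \<open>auto intro!: continuous_intros tc simp: zero\<close>)
  have ftc: "?\<phi> (x - s *\<^sub>R ?e) - ?\<phi> x = integral {0..s} (\<lambda>\<tau>. - ?\<phi>' (x - \<tau> *\<^sub>R ?e))" for x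
  proof -
   have "((\<lambda>\<tau>. ?\<phi> (x + \<tau> *\<^sub>R (- ?e))) has_vector_derivative - ?\<phi>' (x - \<tau> *\<^sub>R ?e)) (at \<tau> within {0..s})" for \<tau>
   proof -
    have "(\<Sum>j\<in>UNIV. complex_of_real ((- ?e) $ j) * tensor (u(j := deriv (u j))) y) = - ?\<phi>' y" for y
     by (subst sum.remove[of _ i]) (auto simp: axis_def intro!: sum.neutral)
    then show ?thesis
     using tensor_line_derivative[of u x "- ?e" \<tau>, OF sm] by (auto intro: has_vector_derivative_at_within)
   qed
   then have "((\<lambda>\<tau>. - ?\<phi>' (x - \<tau> *\<^sub>R ?e)) has_integral ?\<phi> (x + s *\<^sub>R (- ?e)) - ?\<phi> (x + 0 *\<^sub>R (- ?e))) {0..s}"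
    by (intro fundamental_theorem_of_calculus[OF s, where f="\<lambda>\<tau>. ?\<phi> (x + \<tau> *\<^sub>R (- ?e))"])
   then have "integral {0..s} (\<lambda>\<tau>. - ?\<phi>' (x - \<tau> *\<^sub>R ?e)) = ?\<phi> (x + s *\<^sub>R (- ?e)) - ?\<phi> (x + 0 *\<^sub>R (- ?e))"
    by (rule integral_unique)
   then show ?thesis by simp
  qed
  have "(\<integral>x. (k (x + s *\<^sub>R ?e) - k x) * ?\<phi> x \<partial>lborel)
    = (\<integral>x. k (x + s *\<^sub>R ?e) * ?\<phi> x \<partial>lborel) - (\<integral>x. k x * ?\<phi> x \<partial>lborel)"
   using intk intk0 by (simp add: left_diff_distrib)
  also have "(\<integral>x. k (x + s *\<^sub>R ?e) * ?\<phi> x \<partial>lborel) = (\<integral>x. k x * ?\<phi> (x - s *\<^sub>R ?e) \<partial>lborel)"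
   using integral_shift_axis(1)[of "\<lambda>x. k x * ?\<phi> (x - s *\<^sub>R ?e)" "s *\<^sub>R ?e"] by simp
  also have "\<dots> - (\<integral>x. k x * ?\<phi> x \<partial>lborel) = (\<integral>x. k x * (?\<phi> (x - s *\<^sub>R ?e) - ?\<phi> x) \<partial>lborel)"
   using int1[of s] intk0 s by (simp add: right_diff_distrib)
  also have "\<dots> = (\<integral>x. integral {0..s} (\<lambda>\<tau>. k x * (- ?\<phi>' (x - \<tau> *\<^sub>R ?e))) \<partial>lborel)"
   unfolding ftc by simp
  also have "\<dots> = integral {0..s} (\<lambda>\<tau>. \<integral>x. k x * (- ?\<phi>' (x - \<tau> *\<^sub>R ?e)) \<partial>lborel)"
   by (rule Fubini_compact_support[of _ _ a b']) (auto intro!: continuous_intros kc tc' simp: zero')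
  also have "\<dots> = integral {0..s} (\<lambda>\<tau>. \<integral>x. k' (x + \<tau> *\<^sub>R ?e) * ?\<phi> x \<partial>lborel)"
  proof (rule integral_cong)
   fix \<tau> assume \<tau>: "\<tau> \<in> {0..s}"
   define u' where "u' = u(i := \<lambda>t. u i (t - \<tau>))"
   have u': "u' \<in> box_test a b'"
    unfolding box_test_def
   proof (intro CollectI allI conjI impI)
    fix j t
    show "u' j \<in> smooth1" using sm by (auto simp: u'_def smooth1_shift)
    assume t: "t \<notin> {a $ j..b' $ j}"
    show "u' j t = 0"
    proof (cases "j = i")
     case True
     then show ?thesis using t \<tau> box_testD(2)[OF u, of "t - \<tau>" i] by (auto simp: u'_def b'_def axis_def)
    next
     case False
     then show ?thesis using t box_testD(2)[OF u, of t j] by (auto simp: u'_def b'_def axis_def)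
    qed
   qed
   have 1: "tensor u' x = ?\<phi> (x - \<tau> *\<^sub>R ?e)" for x
    unfolding u'_def by (rule tensor_shift)
   have "u'(i := deriv (u' i)) = (u(i := deriv (u i)))(i := \<lambda>t. (u(i := deriv (u i))) i (t - \<tau>))"
    by (simp add: u'_def deriv_shift[OF sm])
   then have 2: "tensor (u'(i := deriv (u' i))) x = ?\<phi>' (x - \<tau> *\<^sub>R ?e)" for x
    by (simp only: tensor_shift)
   have "(\<integral>x. k x * (- ?\<phi>' (x - \<tau> *\<^sub>R ?e)) \<partial>lborel) = (\<integral>x. k' x * ?\<phi> (x - \<tau> *\<^sub>R ?e) \<partial>lborel)"
    using distr[OF u'] unfolding 1 2 by simp
   also have "\<dots> = (\<integral>x. k' (x + \<tau> *\<^sub>R ?e) * ?\<phi> x \<partial>lborel)"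
    using integral_shift_axis(1)[of "\<lambda>x. k' x * ?\<phi> (x - \<tau> *\<^sub>R ?e)" "\<tau> *\<^sub>R ?e"] by simp
   finally show "(\<integral>x. k x * (- ?\<phi>' (x - \<tau> *\<^sub>R ?e)) \<partial>lborel) = (\<integral>x. k' (x + \<tau> *\<^sub>R ?e) * ?\<phi> x \<partial>lborel)" .
  qed
  also have "\<dots> = (\<integral>x. integral {0..s} (\<lambda>\<tau>. k' (x + \<tau> *\<^sub>R ?e) * ?\<phi> x) \<partial>lborel)"
   by (rule Fubini_compact_support[symmetric, of _ _ a b]) (auto intro!: continuous_intros kc' tc simp: zero)
  also have "\<dots> = (\<integral>x. integral {0..s} (\<lambda>\<tau>. k' (x + \<tau> *\<^sub>R ?e)) * ?\<phi> x \<partial>lborel)"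
   by simp
  finally have "(\<integral>x. (k (x + s *\<^sub>R ?e) - k x) * ?\<phi> x \<partial>lborel)
   = (\<integral>x. integral {0..s} (\<lambda>\<tau>. k' (x + \<tau> *\<^sub>R ?e)) * ?\<phi> x \<partial>lborel)" .
  moreover have "integrable lborel (\<lambda>x. (k (x + s *\<^sub>R ?e) - k x) * ?\<phi> x)"
   using intk intk0 by (simp add: left_diff_distrib)
  ultimately show ?thesis
   using intI unfolding w_def left_diff_distrib[of "_ - _"] by simp
 qed
 then have "AE x in lborel. x \<in> UNIV \<longrightarrow> w x = 0"
  using w by (intro AE_eq_0_if_orthogonal_to_tensors borel_measurable_continuous_onI)
   (auto intro!: borel_integrable_compact continuous_on_subset[OF w])
 then have "w x = 0" by (intro continuous_eq_0_if_AE w) simp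
 then show ?thesis by (simp add: w_def)
qed

lemma distr_deriv_classical:
 fixes k k' :: "real^'d => complex"
 assumes k: "continuous_on UNIV k" and k': "continuous_on UNIV k'"
  and distr: "\<And>a b u. u \<in> box_test a b ==>
   (\<integral>x. k x * tensor (u(i := deriv (u i))) x \<partial>lborel) = - (\<integral>x. k' x * tensor u x \<partial>lborel)"
 shows "((\<lambda>t. k (x + t *\<^sub>R axis i 1)) has_vector_derivative k' (x + t *\<^sub>R axis i 1)) (at t)"
proof -
 let ?e = "axis i 1 :: real^'d"
 define y where "y = x + (t - 1) *\<^sub>R ?e"
 have "continuous_on {0..2} (\<lambda>\<tau>. k' (y + \<tau> *\<^sub>R ?e))"
  by (rule continuous_on_compose2[OF k']) (auto intro!: continuous_intros)
 then have "((\<lambda>r. integral {0..r} (\<lambda>\<tau>. k' (y + \<tau> *\<^sub>R ?e))) has_vector_derivative k' (y + 1 *\<^sub>R ?e)) (at 1 within {0..2})"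
  by (rule integral_has_vector_derivative) simp
 then have "((\<lambda>r. k y + integral {0..r} (\<lambda>\<tau>. k' (y + \<tau> *\<^sub>R ?e))) has_vector_derivative k' (y + 1 *\<^sub>R ?e)) (at 1)"
  by (subst (asm) at_within_interior) (auto intro!: derivative_eq_intros)
 then have "((\<lambda>r. k (y + r *\<^sub>R ?e)) has_vector_derivative k' (y + 1 *\<^sub>R ?e)) (at 1)"
 proof (rule has_vector_derivative_transform_within_open[where S="{0<..}"])
  fix r :: real assume "r \<in> {0<..}"
  then show "k y + integral {0..r} (\<lambda>\<tau>. k' (y + \<tau> *\<^sub>R ?e)) = k (y + r *\<^sub>R ?e)"
   using distr_deriv_integral[OF k k' distr, where s=r and x=y] by (simp add: algebra_simps)
 qed auto
 then have "((\<lambda>r. k (y + r *\<^sub>R ?e)) has_vector_derivative k' (y + 1 *\<^sub>R ?e)) (at ((\<lambda>r. r + (1 - t)) t))"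
  by simp
 moreover have "((\<lambda>r. r + (1 - t)) has_vector_derivative 1) (at t)"
  by (auto intro!: derivative_eq_intros)
 ultimately have "((\<lambda>r. k (y + r *\<^sub>R ?e)) \<circ> (\<lambda>r. r + (1 - t)) has_vector_derivative 1 *\<^sub>R k' (y + 1 *\<^sub>R ?e)) (at t)"
  by (intro vector_diff_chain_at)
 moreover have "y + (r + (1 - t)) *\<^sub>R ?e = x + r *\<^sub>R ?e" for r
  by (simp add: y_def scaleR_add_left[symmetric] add.assoc)
 moreover from this[of t] have "y + 1 *\<^sub>R ?e = x + t *\<^sub>R ?e" by simp
 ultimately show ?thesis by (simp only: o_def scaleR_one)
qed

lemma mi_order_Suc: "mi_order (\<alpha>(i := Suc (\<alpha> i))) = Suc (mi_order \<alpha>)"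
proof -
 have "(\<Sum>j\<in>UNIV. (\<alpha>(i := Suc (\<alpha> i))) j) = Suc (\<alpha> i) + (\<Sum>j\<in>UNIV - {i}. \<alpha> j)"
  by (subst sum.remove[of _ i]) (auto intro!: sum.cong)
 moreover have "(\<Sum>j\<in>UNIV. \<alpha> j) = \<alpha> i + (\<Sum>j\<in>UNIV - {i}. \<alpha> j)"
  by (subst sum.remove[of _ i]) auto
 ultimately show ?thesis by (simp add: mi_order_def)
qed

lemma has_cont_distr_deriv_continuous: "has_cont_distr_deriv \<alpha> F k ==> continuous_on UNIV k"
 by (simp add: has_cont_distr_deriv_def)

lemma distr_deriv_step:
 assumes k: "has_cont_distr_deriv \<alpha> F k" and k': "has_cont_distr_deriv (\<alpha>(i := Suc (\<alpha> i))) F k'"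
  and u: "u \<in> box_test a b"
 shows "(\<integral>x. k x * tensor (u(i := deriv (u i))) x \<partial>lborel) = - (\<integral>x. k' x * tensor u x \<partial>lborel)"
proof -
 let ?u = "u(i := deriv (u i))"
 have u': "?u \<in> box_test a b" using u by (rule box_test_deriv)
 have "(\<lambda>j. (deriv ^^ \<alpha> j) (?u j)) = (\<lambda>j. (deriv ^^ (\<alpha>(i := Suc (\<alpha> i))) j) (u j))"
  by (auto simp: fun_eq_iff funpow_swap1)
 then have eq: "mi_deriv \<alpha> (tensor ?u) = mi_deriv (\<alpha>(i := Suc (\<alpha> i))) (tensor u)"
  using box_testD(1)[OF u] box_testD(1)[OF u'] by (simp only: mi_deriv_tensor)
 have "(\<integral>x. F x * mi_deriv \<alpha> (tensor ?u) x \<partial>lborel) = (-1) ^ mi_order \<alpha> * (\<integral>x. k x * tensor ?u x \<partial>lborel)"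
  using k test_function_tensor[OF u'] unfolding has_cont_distr_deriv_def by blast
 moreover have "(\<integral>x. F x * mi_deriv (\<alpha>(i := Suc (\<alpha> i))) (tensor u) x \<partial>lborel)
   = (-1) ^ Suc (mi_order \<alpha>) * (\<integral>x. k' x * tensor u x \<partial>lborel)"
  using k' test_function_tensor[OF u] unfolding has_cont_distr_deriv_def mi_order_Suc by blast
 ultimately have "(-1) ^ mi_order \<alpha> * (\<integral>x. k x * tensor ?u x \<partial>lborel)
   = (-1) ^ mi_order \<alpha> * (- (\<integral>x. k' x * tensor u x \<partial>lborel))"
  unfolding eq by simp
 then show ?thesis by (subst (asm) mult_left_cancel) auto
qed

lemma cont_distr_deriv_0:
 assumes "has_cont_distr_deriv (\<lambda>_. 0) F k" "continuous_on UNIV F"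
 shows "k = F"
proof
 fix x
 have k: "continuous_on UNIV k" using assms(1) by (simp add: has_cont_distr_deriv_def)
 have w: "continuous_on UNIV (\<lambda>x. F x - k x)" using assms(2) k by (intro continuous_intros)
 have "(\<integral>x. (F x - k x) * tensor u x \<partial>lborel) = 0" if u: "u \<in> box_test a b" for a b u
 proof -
  have int: "integrable lborel (\<lambda>x. g x * tensor u x)" if "continuous_on UNIV g" for g
   using that tensor_eq_0_outside[OF u] box_testD(1)[OF u]
   by (intro integrable_continuous_compact_support[of _ a b]) (auto intro!: continuous_intros tensor_continuous)
  have "mi_deriv (\<lambda>_. 0) (tensor u) = tensor u"
   using box_testD(1)[OF u] by (simp add: mi_deriv_tensor)
  with assms(1) test_function_tensor[OF u]
  have "(\<integral>x. F x * tensor u x \<partial>lborel) = (\<integral>x. k x * tensor u x \<partial>lborel)"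
   unfolding has_cont_distr_deriv_def by (force simp: mi_order_def)
  then show ?thesis using int[OF assms(2)] int[OF k] by (simp add: left_diff_distrib)
 qed
 then have "AE x in lborel. x \<in> UNIV \<longrightarrow> F x - k x = 0"
  using w by (intro AE_eq_0_if_orthogonal_to_tensors borel_measurable_continuous_onI)
   (auto intro!: borel_integrable_compact continuous_on_subset[OF w])
 then have "F x - k x = 0" by (intro continuous_eq_0_if_AE[OF w]) simp
 then show "k x = F x" by simp
qed

lemma mi_deriv_eq_distr_deriv:
 fixes F :: "real^'d => complex"
 assumes F: "continuous_on UNIV F"
  and k: "\<And>\<alpha>. mi_order \<alpha> \<le> r ==> has_cont_distr_deriv \<alpha> F (k \<alpha>)"
  and \<alpha>: "mi_order \<alpha> \<le> r"
 shows "mi_deriv \<alpha> F = k \<alpha>"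
proof -
 have k0: "k (\<lambda>_. 0) = F"
  using k[of "\<lambda>_. 0"] F by (intro cont_distr_deriv_0) (auto simp: mi_order_def)
 have part: "partial i (k \<beta>) = k (\<beta>(i := Suc (\<beta> i)))" if "Suc (mi_order \<beta>) \<le> r" for \<beta> i
 proof
  fix x
  have b: "has_cont_distr_deriv \<beta> F (k \<beta>)" "has_cont_distr_deriv (\<beta>(i := Suc (\<beta> i))) F (k (\<beta>(i := Suc (\<beta> i))))"
   using that by (auto intro!: k simp: mi_order_Suc)
  have "((\<lambda>t. k \<beta> (x + t *\<^sub>R axis i 1)) has_vector_derivative k (\<beta>(i := Suc (\<beta> i))) (x + 0 *\<^sub>R axis i 1)) (at 0)"
   by (rule distr_deriv_classical[OF b[THEN has_cont_distr_deriv_continuous] distr_deriv_step[OF b]])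
  then show "partial i (k \<beta>) x = k (\<beta>(i := Suc (\<beta> i))) x"
   unfolding partial_def by (intro vector_derivative_at) simp
 qed
 have pow: "(partial i ^^ n) (k \<beta>) = k (\<beta>(i := \<beta> i + n))" if "mi_order \<beta> + n \<le> r" for \<beta> i n
  using that
 proof (induction n)
  case (Suc n)
  have ord: "mi_order (\<beta>(i := \<beta> i + n)) = mi_order \<beta> + n"
   unfolding mi_order_def by (subst (1 2) sum.remove[of _ i]) (auto intro!: sum.cong)
  have "(partial i ^^ Suc n) (k \<beta>) = partial i (k (\<beta>(i := \<beta> i + n)))"
   using Suc by (simp only: funpow.simps o_apply)
  also have "\<dots> = k (\<beta>(i := \<beta> i + Suc n))"
   using Suc.prems by (subst part) (auto simp: ord)
  finally show ?case .
 qed simp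
 have "foldr (\<lambda>i. (partial i) ^^ (\<alpha> i)) xs F = k (\<lambda>i. if i \<in> set xs then \<alpha> i else 0)" if "distinct xs" for xs
  using that
 proof (induction xs)
  case Nil then show ?case by (simp add: k0)
 next
  case (Cons i xs)
  let ?\<beta> = "\<lambda>j. if j \<in> set xs then \<alpha> j else 0"
  have "mi_order ?\<beta> + \<alpha> i \<le> r"
  proof -
   have "mi_order ?\<beta> + \<alpha> i = (\<Sum>j\<in>set xs. \<alpha> j) + \<alpha> i"
    unfolding mi_order_def by (simp add: sum.If_cases)
   also have "\<dots> = (\<Sum>j\<in>set (i # xs). \<alpha> j)" using Cons.prems by simp
   also have "\<dots> \<le> mi_order \<alpha>" unfolding mi_order_def by (rule sum_mono2) auto
   finally show ?thesis using \<alpha> by simp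
  qed
  from pow[OF this, of i] Cons
  have "foldr (\<lambda>i. (partial i) ^^ (\<alpha> i)) (i # xs) F = k (?\<beta>(i := ?\<beta> i + \<alpha> i))" by simp
  also have "?\<beta>(i := ?\<beta> i + \<alpha> i) = (\<lambda>j. if j \<in> set (i # xs) then \<alpha> j else 0)"
   using Cons.prems by (auto simp: fun_eq_iff)
  finally show ?case .
 qed
 from this[OF coord_list(1)] show ?thesis by (simp add: mi_deriv_def coord_list(2))
qed

text \<open>A minorant of the auxiliary function of the temperate embedding. As a product of a truncated distance and a
 decay factor it behaves well under linear maps.\<close>

definition orbit_weight :: "(real^'d) set => real^'d => real" where
 "orbit_weight Oc \<xi> = min 1 (infdist \<xi> Oc) / (1 + norm \<xi>)"

lemma orbit_weight_bounds: "0 \<le> orbit_weight Oc \<xi>" "orbit_weight Oc \<xi> \<le> 1"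
 by (auto simp: orbit_weight_def infdist_nonneg divide_le_eq add_pos_nonneg intro!: min.coboundedI1)

text \<open>Zeros of all derivatives of order below \<open>m\<close> on a closed set force the size \<open>\<delta>\<^sup>m\<close> at distance \<open>\<delta>\<close>.
 Moving from the nearest point one coordinate at a time stays within distance \<open>\<delta>\<close>
 of both end points, so only partial derivatives enter.\<close>

lemma vanishing_decay_step:
 fixes k :: "real^'d => complex" and k' :: "'d => real^'d => complex"
 assumes der: "\<And>i x t. ((\<lambda>t. k (x + t *\<^sub>R axis i 1)) has_vector_derivative k' i (x + t *\<^sub>R axis i 1)) (at t)"
  and k0: "k \<eta> = 0" and B: "0 \<le> B"
  and le: "\<And>i z. norm (z - \<eta>) \<le> norm (\<xi> - \<eta>) ==> norm (z - \<xi>) \<le> norm (\<xi> - \<eta>) ==> norm (k' i z) \<le> B"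
 shows "norm (k \<xi>) \<le> real CARD('d) * (B * norm (\<xi> - \<eta>))"
proof -
 define z where "z S = (\<chi> i. if i \<in> S then \<xi> $ i else \<eta> $ i)" for S
 have "norm (k (z S)) \<le> real (card S) * (B * norm (\<xi> - \<eta>))" if "finite S" for S
  using that
 proof (induction S rule: finite_induct)
  case empty
  have "z {} = \<eta>" by (simp add: z_def vec_eq_iff)
  then show ?case by (simp add: k0)
 next
  case (insert i S)
  let ?c = "\<xi> $ i - \<eta> $ i"
  define g where "g t = k (z S + t *\<^sub>R axis i 1)" for t
  have g1: "g ?c = k (z (insert i S))"
   using insert.hyps unfolding g_def by (intro arg_cong[of _ _ k]) (auto simp: z_def vec_eq_iff axis_def)
  have g0: "g 0 = k (z S)" by (simp add: g_def)
  have "norm (g ?c - g 0) \<le> B * norm (?c - 0)"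
  proof (rule differentiable_bound[where S="closed_segment 0 ?c" and f'="\<lambda>t h. h *\<^sub>R k' i (z S + t *\<^sub>R axis i 1)"])
   fix t assume t: "t \<in> closed_segment 0 ?c"
   show "(g has_derivative (\<lambda>h. h *\<^sub>R k' i (z S + t *\<^sub>R axis i 1))) (at t within closed_segment 0 ?c)"
    using has_vector_derivative_at_within[OF der, of "z S" i t] unfolding g_def has_vector_derivative_def .
   let ?z = "z S + t *\<^sub>R axis i 1"
   have tt: "\<bar>t\<bar> \<le> \<bar>?c\<bar>" "\<bar>t - ?c\<bar> \<le> \<bar>?c\<bar>"
    using t by (auto simp: closed_segment_eq_real_ivl split: if_splits)
   have "norm (?z - \<eta>) \<le> norm (\<xi> - \<eta>)"
    using tt insert.hyps by (intro norm_le_componentwise_cart) (auto simp: z_def axis_def)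
   moreover have "norm (?z - \<xi>) \<le> norm (\<xi> - \<eta>)"
    using tt insert.hyps
    by (intro norm_le_componentwise_cart) (auto simp: z_def axis_def abs_minus_commute algebra_simps)
   ultimately have "norm (k' i ?z) \<le> B" by (rule le)
   then show "onorm (\<lambda>h. h *\<^sub>R k' i ?z) \<le> B"
    using B by (intro onorm_bound) (auto simp: mult.commute[of B] intro: mult_left_mono)
  qed auto
  moreover have "norm (?c - 0) \<le> norm (\<xi> - \<eta>)"
   using component_le_norm_cart[of "\<xi> - \<eta>" i] by simp
  then have "B * norm (?c - 0) \<le> B * norm (\<xi> - \<eta>)" using B by (intro mult_left_mono) auto
  ultimately have "norm (g ?c) \<le> norm (g 0) + B * norm (\<xi> - \<eta>)"
   using norm_triangle_ineq2[of "g ?c" "g 0"] by linarith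
  also have "\<dots> \<le> real (card S) * (B * norm (\<xi> - \<eta>)) + B * norm (\<xi> - \<eta>)"
   using insert.IH by (simp add: g0)
  finally show ?case using insert.hyps by (simp add: g1 algebra_simps)
 qed
 from this[of UNIV] show ?thesis by (simp add: z_def)
qed

text \<open>Near \<open>Oc\<close> the vanishing moments give powers of the distance, away from it the decay \<open>(1 + \<bar>\<xi>\<bar>)\<^sup>-\<^sup>r\<close>
 suffices; powers of \<open>orbit_weight\<close> dominate both.\<close>

lemma fourier_moment_decay:
 fixes f :: "real^'d => complex"
 assumes f: "integrable lborel f" and mom: "vanishing_moments Oc r f" and Oc: "closed Oc" "Oc \<noteq> {}"
  and decay: "schwartz_norm (real r) (real r) (fourier f) < \<infinity>"
 obtains k C where "0 \<le> C" "k (\<lambda>_. 0) = fourier f"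
  and "\<And>\<alpha>. mi_order \<alpha> \<le> r ==> continuous_on UNIV (k \<alpha>)"
  and "\<And>\<alpha> i x t. mi_order \<alpha> < r ==> ((\<lambda>t. k \<alpha> (x + t *\<^sub>R axis i 1)) has_vector_derivative
   k (\<alpha>(i := Suc (\<alpha> i))) (x + t *\<^sub>R axis i 1)) (at t)"
  and "\<And>\<alpha> \<xi>. mi_order \<alpha> \<le> r ==> norm (k \<alpha> \<xi>) \<le> C / (1 + norm \<xi>) ^ r"
  and "\<And>\<alpha> m \<xi>. mi_order \<alpha> + m \<le> r ==> norm (k \<alpha> \<xi>) \<le> C * orbit_weight Oc \<xi> ^ m"
proof -
 let ?F = "fourier f"
 have "\<exists>k. mi_order \<alpha> \<le> r \<longrightarrow> has_cont_distr_deriv \<alpha> ?F k \<and> (mi_order \<alpha> < r \<longrightarrow> (\<forall>\<xi>\<in>Oc. k \<xi> = 0))" for \<alpha>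
  using mom unfolding vanishing_moments_def by blast
 then obtain k where k: "\<And>\<alpha>. mi_order \<alpha> \<le> r ==> has_cont_distr_deriv \<alpha> ?F (k \<alpha>)"
  and van: "\<And>\<alpha> \<xi>. mi_order \<alpha> < r ==> \<xi> \<in> Oc ==> k \<alpha> \<xi> = 0" by (metis less_imp_le)
 have F: "continuous_on UNIV ?F" using f by (rule continuous_on_fourier)
 have k0: "k (\<lambda>_. 0) = ?F"
  using k[of "\<lambda>_. 0"] F by (intro cont_distr_deriv_0) (auto simp: mi_order_def)
 have cont: "continuous_on UNIV (k \<alpha>)" if "mi_order \<alpha> \<le> r" for \<alpha>
  using k[OF that] by (simp add: has_cont_distr_deriv_def)
 have der: "((\<lambda>t. k \<alpha> (x + t *\<^sub>R axis i 1)) has_vector_derivative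
   k (\<alpha>(i := Suc (\<alpha> i))) (x + t *\<^sub>R axis i 1)) (at t)" if "mi_order \<alpha> < r" for \<alpha> i x t
 proof -
  have b: "has_cont_distr_deriv \<alpha> ?F (k \<alpha>)" "has_cont_distr_deriv (\<alpha>(i := Suc (\<alpha> i))) ?F (k (\<alpha>(i := Suc (\<alpha> i))))"
   using that by (auto intro!: k simp: mi_order_Suc)
  show ?thesis
   by (rule distr_deriv_classical[OF b[THEN has_cont_distr_deriv_continuous] distr_deriv_step[OF b]])
 qed
 obtain S where S: "schwartz_norm (real r) (real r) ?F = ennreal S" "0 \<le> S"
  using decay by (cases "schwartz_norm (real r) (real r) ?F") auto
 have bound: "norm (k \<alpha> \<xi>) \<le> S / (1 + norm \<xi>) ^ r" if "mi_order \<alpha> \<le> r" for \<alpha> \<xi>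
 proof -
  have "ennreal ((1 + norm \<xi>) powr real r * norm (mi_deriv \<alpha> ?F \<xi>)) \<le> ennreal S"
   unfolding S(1)[symmetric] schwartz_norm_def
   using that by (intro SUP_upper2[of \<alpha>] SUP_upper2[of \<xi>]) auto
  then have "(1 + norm \<xi>) ^ r * norm (k \<alpha> \<xi>) \<le> S"
   using S(2) mi_deriv_eq_distr_deriv[OF F k that] by (simp add: powr_realpow add_pos_nonneg)
  then show ?thesis by (simp add: field_simps add_pos_nonneg)
 qed
 define K where "K = real CARD('d) * 2 ^ r"
 have K1: "1 \<le> K"
 proof -
  have "1 * 1 \<le> real CARD('d) * 2 ^ r" by (intro mult_mono) (auto simp: Suc_le_eq)
  then show ?thesis by (simp add: K_def)
 qed
 have near: "norm (k \<alpha> \<xi>) \<le> S * K ^ m * infdist \<xi> Oc ^ m / (1 + norm \<xi>) ^ r"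
  if "mi_order \<alpha> + m \<le> r" "infdist \<xi> Oc \<le> 1" for \<alpha> m \<xi>
  using that
 proof (induction m arbitrary: \<alpha> \<xi>)
  case 0
  then show ?case using bound[of \<alpha> \<xi>] by simp
 next
  case (Suc m)
  obtain \<eta> where \<eta>: "\<eta> \<in> Oc" "infdist \<xi> Oc = norm (\<xi> - \<eta>)"
   using infdist_attains_inf[OF Oc, of \<xi>] by (auto simp: dist_norm)
  let ?d = "norm (\<xi> - \<eta>)"
  define B where "B = S * K ^ m * ?d ^ m * 2 ^ r / (1 + norm \<xi>) ^ r"
  have B: "0 \<le> B" using S K1 by (simp add: B_def)
  have "norm (k (\<alpha>(i := Suc (\<alpha> i))) z) \<le> B" if z: "norm (z - \<eta>) \<le> ?d" "norm (z - \<xi>) \<le> ?d" for i z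
  proof -
   have iz: "infdist z Oc \<le> ?d" using infdist_le2[OF \<eta>(1), of z ?d] z by (simp add: dist_norm)
   have "norm (k (\<alpha>(i := Suc (\<alpha> i))) z) \<le> S * K ^ m * infdist z Oc ^ m / (1 + norm z) ^ r"
   proof (rule Suc.IH)
    show "mi_order (\<alpha>(i := Suc (\<alpha> i))) + m \<le> r" using Suc.prems(1) by (simp only: mi_order_Suc)
    show "infdist z Oc \<le> 1" using iz Suc.prems(2) \<eta>(2) by simp
   qed
   also have "\<dots> \<le> S * K ^ m * ?d ^ m / ((1 + norm \<xi>) / 2) ^ r"
   proof (intro frac_le mult_left_mono power_mono iz)
    have "norm \<xi> \<le> norm z + 1"
     using norm_triangle_ineq2[of \<xi> z] z(2) Suc.prems(2) \<eta>(2) by (simp add: norm_minus_commute)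
    then show "(1 + norm \<xi>) / 2 \<le> 1 + norm z" using norm_ge_zero[of z] by (simp; linarith)
   qed (use S K1 in \<open>auto simp: infdist_nonneg add_pos_nonneg intro!: zero_less_power\<close>)
   also have "\<dots> = B" by (simp add: B_def power_divide)
   finally show ?thesis .
  qed
  note le = this
  have "norm (k \<alpha> \<xi>) \<le> real CARD('d) * (B * ?d)"
  proof (rule vanishing_decay_step[where k'="\<lambda>i. k (\<alpha>(i := Suc (\<alpha> i)))" and \<eta>=\<eta>])
   show "k \<alpha> \<eta> = 0" using Suc.prems \<eta>(1) by (intro van) auto
   show "((\<lambda>t. k \<alpha> (x + t *\<^sub>R axis i 1)) has_vector_derivative k (\<alpha>(i := Suc (\<alpha> i))) (x + t *\<^sub>R axis i 1)) (at t)"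
    for i x t using Suc.prems(1) by (intro der) simp
  qed (fact B, fact le)
  also have "\<dots> = S * K ^ Suc m * infdist \<xi> Oc ^ Suc m / (1 + norm \<xi>) ^ r"
   by (simp add: B_def K_def \<eta>(2))
  finally show ?case .
 qed
 define C where "C = S * K ^ r"
 have SC: "S * K ^ m \<le> C" if "m \<le> r" for m
  unfolding C_def using S K1 that by (intro mult_left_mono power_increasing) auto
 have C0: "S \<le> C" using SC[of 0] by simp
 have far: "norm (k \<alpha> \<xi>) \<le> C * orbit_weight Oc \<xi> ^ m" if m: "mi_order \<alpha> + m \<le> r" for \<alpha> m \<xi>
 proof -
  have pw: "1 / (1 + norm \<xi>) ^ r \<le> 1 / (1 + norm \<xi>) ^ m"
   using m by (intro divide_left_mono power_increasing) (auto simp: add_pos_nonneg)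
  show ?thesis
  proof (cases "infdist \<xi> Oc \<le> 1")
   case True
   have "norm (k \<alpha> \<xi>) \<le> S * K ^ m * infdist \<xi> Oc ^ m * (1 / (1 + norm \<xi>) ^ r)"
    using near[OF m True] by simp
   also have "\<dots> \<le> C * infdist \<xi> Oc ^ m * (1 / (1 + norm \<xi>) ^ m)"
    using m S K1 C0 by (intro mult_mono pw SC) (auto simp: infdist_nonneg)
   finally show ?thesis using True by (simp add: orbit_weight_def power_divide)
  next
   case False
   have "norm (k \<alpha> \<xi>) \<le> S * (1 / (1 + norm \<xi>) ^ r)"
    using bound[of \<alpha> \<xi>] m by simp
   also have "\<dots> \<le> C * (1 / (1 + norm \<xi>) ^ m)"
    using S C0 by (intro mult_mono pw) auto
   finally show ?thesis using False by (simp add: orbit_weight_def power_divide)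
  qed
 qed
 have bound': "norm (k \<alpha> \<xi>) \<le> C / (1 + norm \<xi>) ^ r" if "mi_order \<alpha> \<le> r" for \<alpha> \<xi>
  using bound[OF that, of \<xi>] divide_right_mono[OF C0, of "(1 + norm \<xi>) ^ r"] by simp
 show thesis
  by (rule that[of C k]) (use S C0 k0 cont der bound' far in auto)
qed

section \<open>The dilation group and its open dual orbit\<close>

abbreviation dual_act :: "real^'d^'d => real^'d => real^'d" where
 "dual_act h \<xi> \<equiv> transpose h *v \<xi>"

declare transpose_matrix_vector [simp del]

lemma dual_act_mult: "dual_act (g ** h) \<xi> = dual_act h (dual_act g \<xi>)"
 by (simp add: matrix_transpose_mul matrix_vector_mul_assoc)

lemma dual_act_1 [simp]: "dual_act (mat 1) \<xi> = \<xi>"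
 by (simp add: transpose_mat)

lemma continuous_on_matrix_mult' [continuous_intros]:
 fixes f :: "'a::topological_space => real^'d^'e" and g :: "'a => real^'k^'d"
 shows "continuous_on S f ==> continuous_on S g ==> continuous_on S (\<lambda>x. f x ** g x)"
 unfolding matrix_matrix_mult_def by (intro continuous_intros)

lemma continuous_on_matrix_vector_mult' [continuous_intros]:
 fixes f :: "'a::topological_space => real^'d^'e" and g :: "'a => real^'d"
 shows "continuous_on S f ==> continuous_on S g ==> continuous_on S (\<lambda>x. f x *v g x)"
 unfolding matrix_vector_mult_def by (intro continuous_intros)

lemma continuous_on_transpose' [continuous_intros]:
 fixes f :: "'a::topological_space => real^'d^'e"
 shows "continuous_on S f ==> continuous_on S (\<lambda>x. transpose (f x))"
 unfolding transpose_def by (intro continuous_intros)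

locale dual_orbit =
 fixes H :: "(real^'d^'d) set" and \<mu> :: "(real^'d^'d) measure" and Orb :: "(real^'d) set"
 assumes grp: "closed_GL_subgroup H" and haar: "left_haar_measure H \<mu>" and orbit: "open_dual_orbit H Orb"
begin

lemma one_H: "mat 1 \<in> H" and mult_H: "g \<in> H ==> h \<in> H ==> g ** h \<in> H"
 and inv_H: "h \<in> H ==> matrix_inv h \<in> H" and invertible_H: "h \<in> H ==> invertible h"
 using grp closedin_subset[of "top_of_set {h :: real^'d^'d. invertible h}" H] by (auto simp: closed_GL_subgroup_def)

lemma det_H: "h \<in> H ==> det h \<noteq> 0"
 using invertible_H by (simp add: invertible_det_nz)

lemma inv_mult: "h \<in> H ==> matrix_inv h ** h = mat 1" "h \<in> H ==> h ** matrix_inv h = mat 1"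
 using matrix_inv invertible_H by auto

lemma inv_inv: "h \<in> H ==> matrix_inv (matrix_inv h) = h"
 by (intro matrix_inv_unique' inv_mult)

lemma inv_mult_distrib: "g \<in> H ==> h \<in> H ==> matrix_inv (g ** h) = matrix_inv h ** matrix_inv g"
proof (rule matrix_inv_unique')
 assume "g \<in> H" "h \<in> H"
 have "g ** h ** (matrix_inv h ** matrix_inv g) = g ** (h ** matrix_inv h) ** matrix_inv g"
  by (simp add: matrix_mul_assoc)
 then show "g ** h ** (matrix_inv h ** matrix_inv g) = mat 1"
  using \<open>g \<in> H\<close> \<open>h \<in> H\<close> by (simp add: inv_mult)
qed

lemma det_inv: "h \<in> H ==> det (matrix_inv h) = 1 / det h"
 using det_mul[of h "matrix_inv h"] det_H[of h] by (simp add: inv_mult field_simps)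

lemma inv_cancel: "g \<in> H ==> matrix_inv g ** (g ** h) = h" "g \<in> H ==> g ** (matrix_inv g ** h) = h"
 "g \<in> H ==> h ** g ** matrix_inv g = h" "g \<in> H ==> h ** matrix_inv g ** g = h"
 by (simp_all add: matrix_mul_assoc inv_mult) (simp_all add: inv_mult flip: matrix_mul_assoc)

lemma dual_act_inv: "h \<in> H ==> dual_act (matrix_inv h) (dual_act h \<xi>) = \<xi>"
 "h \<in> H ==> dual_act h (dual_act (matrix_inv h) \<xi>) = \<xi>"
 by (simp_all add: inv_mult flip: dual_act_mult)

lemma open_Orb: "open Orb" and null_compl_Orb: "- Orb \<in> null_sets lborel"
 and compact_stabilizer: "\<xi> \<in> Orb ==> compact {h \<in> H. dual_act h \<xi> = \<xi>}"
 using orbit by (auto simp: open_dual_orbit_def)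

lemma Orb_transitive:
 assumes "\<xi> \<in> Orb" "\<eta> \<in> Orb"
 obtains h where "h \<in> H" "dual_act h \<xi> = \<eta>"
proof -
 obtain \<xi>0 where "Orb = {dual_act h \<xi>0 |h. h \<in> H}" using orbit by (auto simp: open_dual_orbit_def)
 then obtain g h where "g \<in> H" "\<xi> = dual_act g \<xi>0" "h \<in> H" "\<eta> = dual_act h \<xi>0" using assms by auto
 then show thesis
  by (intro that[of "matrix_inv g ** h"]) (auto simp: mult_H inv_H dual_act_mult dual_act_inv)
qed

lemma act_Orb: "h \<in> H ==> dual_act h \<xi> \<in> Orb \<longleftrightarrow> \<xi> \<in> Orb"
proof -
 have *: "dual_act h \<xi> \<in> Orb" if "h \<in> H" "\<xi> \<in> Orb" for h \<xi>
 proof -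
  obtain \<xi>0 where O: "Orb = {dual_act h \<xi>0 |h. h \<in> H}" using orbit by (auto simp: open_dual_orbit_def)
  then have "\<exists>g. g \<in> H \<and> \<xi> = dual_act g \<xi>0" using that by auto
  then obtain g where "g \<in> H" "\<xi> = dual_act g \<xi>0" by blast
  then show ?thesis using O that mult_H[of g h] by (auto simp flip: dual_act_mult)
 qed
 assume "h \<in> H"
 then show "dual_act h \<xi> \<in> Orb \<longleftrightarrow> \<xi> \<in> Orb"
  using *[of h \<xi>] *[of "matrix_inv h" "dual_act h \<xi>"] by (auto simp: inv_H dual_act_inv)
qed

lemma Orb_nonempty: "Orb \<noteq> {}"
 using orbit one_H by (auto simp: open_dual_orbit_def)

lemma zero_not_in_Orb: "0 \<notin> Orb"
proof
 assume "0 \<in> Orb"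
 then have "Orb = {0}" using Orb_transitive[of 0] by (metis matrix_vector_mult_0_right singletonI subset_singleton_iff subsetI empty_iff)
 with open_Orb show False by (simp add: not_open_singleton)
qed

lemma compl_Orb: "closed (- Orb)" "- Orb \<noteq> {}"
 using open_Orb zero_not_in_Orb by auto

lemma AE_Orb: "AE \<xi> in lborel. \<xi> \<in> Orb"
 using null_compl_Orb by (rule AE_I'[where N="- Orb"]) auto

text \<open>Compact sets, closed under inversion, that exhaust \<open>H\<close>.\<close>

definition HB :: "real => (real^'d^'d) set" where
 "HB R = {h \<in> H. norm h \<le> R \<and> norm (matrix_inv h) \<le> R}"

lemma HB_subset: "HB R \<subseteq> H" by (auto simp: HB_def)

lemma compact_HB: "compact (HB R)"
proof -
 obtain T where T: "closed T" "H = {h. invertible h} \<inter> T"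
  using grp by (auto simp: closed_GL_subgroup_def closedin_closed)
 have TH: "h \<in> H \<longleftrightarrow> invertible h \<and> h \<in> T" for h using T(2) by blast
 let ?P = "{z :: (real^'d^'d) \<times> (real^'d^'d). fst z ** snd z = mat 1 \<and> norm (fst z) \<le> R \<and> norm (snd z) \<le> R}"
 have "closed ?P"
  by (intro closed_Collect_conj closed_Collect_eq closed_Collect_le continuous_intros)
 moreover have "?P \<subseteq> cball 0 R \<times> cball 0 R" by auto
 then have "bounded ?P" by (rule bounded_subset[rotated]) (intro bounded_Times bounded_cball)
 ultimately have "compact ?P" by (simp add: compact_eq_bounded_closed)
 then have "compact (fst ` ?P)" by (intro compact_continuous_image continuous_intros)
 then have "compact (T \<inter> fst ` ?P)" using T(1) by (intro closed_Int_compact)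
 moreover have "HB R = T \<inter> fst ` ?P"
 proof (intro set_eqI iffI)
  fix h assume "h \<in> HB R"
  then have "h \<in> T" "(h, matrix_inv h) \<in> ?P" using TH by (auto simp: HB_def inv_mult)
  then show "h \<in> T \<inter> fst ` ?P" by (intro IntI image_eqI[of h fst "(h, matrix_inv h)"]) auto
 next
  fix h assume "h \<in> T \<inter> fst ` ?P"
  then obtain g where g: "h \<in> T" "h ** g = mat 1" "norm h \<le> R" "norm g \<le> R" by auto
  then have "matrix_inv h = g" "invertible h" by (auto intro: matrix_inv_unique' simp: invertible_right_inverse)
  then show "h \<in> HB R" using g TH by (auto simp: HB_def)
 qed
 ultimately show ?thesis by simp
qed

lemma ex_HB: "h \<in> H ==> \<exists>n. h \<in> HB (real n)"
 using real_arch_simple[of "max (norm h) (norm (matrix_inv h))"] by (auto simp: HB_def)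

lemma UN_HB: "(\<Union>n. HB (real n)) = H"
 using ex_HB HB_subset by blast

lemma HB_mult: "g \<in> HB R ==> h \<in> HB S ==> g ** h \<in> HB (R * S)"
proof -
 assume g: "g \<in> HB R" and h: "h \<in> HB S"
 then have R: "0 \<le> R" and S: "0 \<le> S" by (auto simp: HB_def intro: order_trans[OF norm_ge_zero])
 have "norm (g ** h) \<le> R * S"
  using g h R by (intro order_trans[OF norm_matrix_mult_le] mult_mono) (auto simp: HB_def)
 moreover have "norm (matrix_inv h ** matrix_inv g) \<le> S * R"
  using g h S by (intro order_trans[OF norm_matrix_mult_le] mult_mono) (auto simp: HB_def)
 ultimately show ?thesis using g h by (auto simp: HB_def mult_H inv_mult_distrib mult.commute)
qed

lemma HB_inv: "h \<in> HB R ==> matrix_inv h \<in> HB R"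
 by (auto simp: HB_def inv_H inv_inv)

lemma in_HB: "h \<in> H ==> h \<in> HB (max (norm h) (norm (matrix_inv h)))"
 by (auto simp: HB_def)

lemma sets_HB: "HB R \<in> sets borel"
 by (simp add: compact_HB compact_imp_closed)

lemma sets_H: "H \<in> sets borel"
proof -
 have "(\<Union>n. HB (real n)) \<in> sets borel" by (intro sets.countable_UN) (auto simp: sets_HB)
 then show ?thesis by (simp only: UN_HB)
qed

lemma sets_mu: "sets \<mu> = sets (restrict_space borel H)"
 using haar by (simp add: left_haar_measure_def)

lemma space_mu: "space \<mu> = H"
 using sets_eq_imp_space_eq[OF sets_mu] by (simp add: space_restrict_space)

lemma in_sets_mu: "A \<in> sets borel ==> A \<subseteq> H ==> A \<in> sets \<mu>"
 unfolding sets_mu using sets_H by (subst sets_restrict_space_iff) auto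

lemma measurable_mu_borel: "(\<lambda>h. h) \<in> \<mu> \<rightarrow>\<^sub>M borel"
 by (subst measurable_cong_sets[OF sets_mu refl]) (rule measurable_restrict_space1, simp)

lemma measurable_mu: "f \<in> borel \<rightarrow>\<^sub>M N ==> f \<in> \<mu> \<rightarrow>\<^sub>M N"
 by (rule measurable_compose[OF measurable_mu_borel])

lemma measurable_into_mu:
 assumes "f \<in> M \<rightarrow>\<^sub>M borel" "\<And>x. x \<in> space M ==> f x \<in> H"
 shows "f \<in> M \<rightarrow>\<^sub>M \<mu>"
 using assms by (subst measurable_cong_sets[OF refl sets_mu]) (auto intro!: measurable_restrict_space2)

lemma measurable_lborel_mu: "f \<in> borel \<Otimes>\<^sub>M borel \<rightarrow>\<^sub>M N ==> f \<in> lborel \<Otimes>\<^sub>M \<mu> \<rightarrow>\<^sub>M N"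
 and measurable_mu_lborel: "f' \<in> borel \<Otimes>\<^sub>M borel \<rightarrow>\<^sub>M N ==> f' \<in> \<mu> \<Otimes>\<^sub>M lborel \<rightarrow>\<^sub>M N"
 and measurable_mu_mu: "f'' \<in> borel \<Otimes>\<^sub>M borel \<rightarrow>\<^sub>M N ==> f'' \<in> \<mu> \<Otimes>\<^sub>M \<mu> \<rightarrow>\<^sub>M N"
proof -
 have id: "(\<lambda>z. (fst z, snd z)) \<in> M \<Otimes>\<^sub>M M' \<rightarrow>\<^sub>M borel \<Otimes>\<^sub>M borel"
  if "(\<lambda>x. x) \<in> M \<rightarrow>\<^sub>M borel" "(\<lambda>x. x) \<in> M' \<rightarrow>\<^sub>M borel"
  for M :: "'z::topological_space measure" and M' :: "'y::topological_space measure"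
  using measurable_compose[OF measurable_fst that(1)] measurable_compose[OF measurable_snd that(2)]
  by (intro measurable_Pair) auto
 have l: "(\<lambda>x. x) \<in> lborel \<rightarrow>\<^sub>M borel" by simp
 show "f \<in> borel \<Otimes>\<^sub>M borel \<rightarrow>\<^sub>M N ==> f \<in> lborel \<Otimes>\<^sub>M \<mu> \<rightarrow>\<^sub>M N"
  using measurable_compose[OF id[OF l measurable_mu_borel], of f N] unfolding prod.collapse .
 show "f' \<in> borel \<Otimes>\<^sub>M borel \<rightarrow>\<^sub>M N ==> f' \<in> \<mu> \<Otimes>\<^sub>M lborel \<rightarrow>\<^sub>M N"
  using measurable_compose[OF id[OF measurable_mu_borel l], of f' N] unfolding prod.collapse .
 show "f'' \<in> borel \<Otimes>\<^sub>M borel \<rightarrow>\<^sub>M N ==> f'' \<in> \<mu> \<Otimes>\<^sub>M \<mu> \<rightarrow>\<^sub>M N"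
  using measurable_compose[OF id[OF measurable_mu_borel measurable_mu_borel], of f'' N] unfolding prod.collapse .
qed

lemma HB_finite: "emeasure \<mu> (HB R) < \<infinity>"
 using haar compact_HB HB_subset by (auto simp: left_haar_measure_def)

sublocale mu: sigma_finite_measure \<mu>
proof
 show "\<exists>A. countable A \<and> A \<subseteq> sets \<mu> \<and> \<Union> A = space \<mu> \<and> (\<forall>a\<in>A. emeasure \<mu> a \<noteq> \<infinity>)"
  using HB_finite by (intro exI[of _ "range (\<lambda>n. HB (real n))"])
   (auto simp: space_mu UN_HB intro!: in_sets_mu sets_HB HB_subset[THEN subsetD] simp: less_top)
qed

sublocale P: pair_sigma_finite lborel \<mu> ..

abbreviation leb_mu :: "((real^'d) \<times> (real^'d^'d)) measure" where "leb_mu \<equiv> lborel \<Otimes>\<^sub>M \<mu>"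
sublocale PP: pair_sigma_finite \<mu> \<mu> ..

lemma mu_H_pos: "emeasure \<mu> H \<noteq> 0"
 using haar by (simp add: left_haar_measure_def)

lemma HB_pos: "\<exists>n. emeasure \<mu> (HB (real n)) \<noteq> 0"
proof (rule ccontr)
 assume "\<not> ?thesis"
 then have "emeasure \<mu> (\<Union>n. HB (real n)) = 0"
  by (intro emeasure_UN_eq_0) (auto intro!: in_sets_mu sets_HB HB_subset)
 then show False using mu_H_pos by (simp add: UN_HB)
qed

lemma left_mult_measurable: "g \<in> H ==> (\<lambda>h. g ** h) \<in> \<mu> \<rightarrow>\<^sub>M \<mu>"
 by (intro measurable_into_mu) (auto simp: space_mu mult_H intro!: measurable_mu)

lemma nn_integral_left:
 assumes g: "g \<in> H" and f: "f \<in> borel_measurable \<mu>"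
 shows "(\<integral>\<^sup>+h. f (g ** h) \<partial>\<mu>) = (\<integral>\<^sup>+h. f h \<partial>\<mu>)"
proof -
 have "distr \<mu> \<mu> (\<lambda>h. g ** h) = \<mu>" using haar g by (simp add: left_haar_measure_def)
 then have "(\<integral>\<^sup>+h. f h \<partial>\<mu>) = (\<integral>\<^sup>+h. f h \<partial>distr \<mu> \<mu> (\<lambda>h. g ** h))" by simp
 also have "\<dots> = (\<integral>\<^sup>+h. f (g ** h) \<partial>\<mu>)"
  using f left_mult_measurable[OF g] by (simp add: nn_integral_distr)
 finally show ?thesis ..
qed

lemma integral_left:
 fixes f :: "_ => complex"
 assumes g: "g \<in> H" and f: "f \<in> borel_measurable \<mu>"
 shows "(\<integral>h. f (g ** h) \<partial>\<mu>) = (\<integral>h. f h \<partial>\<mu>)"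
proof -
 have "distr \<mu> \<mu> (\<lambda>h. g ** h) = \<mu>" using haar g by (simp add: left_haar_measure_def)
 then have "(\<integral>h. f h \<partial>\<mu>) = (\<integral>h. f h \<partial>distr \<mu> \<mu> (\<lambda>h. g ** h))" by simp
 also have "\<dots> = (\<integral>h. f (g ** h) \<partial>\<mu>)"
  using f left_mult_measurable[OF g] by (simp add: integral_distr)
 finally show ?thesis ..
qed

lemma orbit_integral_const:
 assumes [measurable]: "\<phi> \<in> borel_measurable borel" and "\<xi> \<in> Orb" "\<eta> \<in> Orb"
 shows "(\<integral>\<^sup>+h. \<phi> (dual_act h \<xi>) \<partial>\<mu>) = (\<integral>\<^sup>+h. \<phi> (dual_act h \<eta>) \<partial>\<mu>)"
proof -
 obtain g where g: "g \<in> H" "dual_act g \<eta> = \<xi>" using Orb_transitive assms by blast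
 have "(\<integral>\<^sup>+h. \<phi> (dual_act (g ** h) \<eta>) \<partial>\<mu>) = (\<integral>\<^sup>+h. \<phi> (dual_act h \<eta>) \<partial>\<mu>)"
  by (rule nn_integral_left[OF g(1)]) (rule measurable_mu, measurable)
 then show ?thesis using g by (simp add: dual_act_mult)
qed

text \<open>Integrate the orbit integral of the indicator over all base points and exchange the integrals.\<close>

lemma orbit_null:
 assumes E [measurable]: "E \<in> sets borel" and \<xi>: "\<xi> \<in> Orb" and 0: "(\<integral>\<^sup>+h. indicator E (dual_act h \<xi>) \<partial>\<mu>) = 0"
 shows "AE \<eta> in lborel. \<eta> \<notin> E"
proof -
 have m: "(\<lambda>z. indicator E (dual_act (snd z) (fst z)) :: ennreal) \<in> borel_measurable (leb_mu)"
  by (rule measurable_lborel_mu) measurable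
 have "(\<integral>\<^sup>+h. (\<integral>\<^sup>+\<eta>. indicator E (dual_act h \<eta>) \<partial>lborel) \<partial>\<mu>)
   = (\<integral>\<^sup>+\<eta>. (\<integral>\<^sup>+h. indicator E (dual_act h \<eta>) \<partial>\<mu>) \<partial>lborel)"
  using P.Fubini'[of "\<lambda>\<eta> h. indicator E (dual_act h \<eta>)"] m by (simp add: split_beta')
 also have "\<dots> = 0"
 proof (rule nn_integral_zero')
  show "AE \<eta> in lborel. (\<integral>\<^sup>+h. indicator E (dual_act h \<eta>) \<partial>\<mu>) = 0"
   using AE_Orb by eventually_elim (use orbit_integral_const[of "indicator E" _ \<xi>] \<xi> 0 in auto)
 qed
 finally have "(\<integral>\<^sup>+h. ennreal (1 / \<bar>det h\<bar>) * emeasure lborel E \<partial>\<mu>) = 0"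
 proof -
  assume "(\<integral>\<^sup>+h. (\<integral>\<^sup>+\<eta>. indicator E (dual_act h \<eta>) \<partial>lborel) \<partial>\<mu>) = 0"
  moreover have "(\<integral>\<^sup>+\<eta>. indicator E (dual_act h \<eta>) \<partial>lborel) = ennreal (1 / \<bar>det h\<bar>) * emeasure lborel E"
   if "h \<in> space \<mu>" for h
   using nn_integral_linear[of "transpose h" "indicator E"] that det_H by (simp add: space_mu)
  ultimately show ?thesis by (simp cong: nn_integral_cong)
 qed
 then have "AE h in \<mu>. ennreal (1 / \<bar>det h\<bar>) * emeasure lborel E = 0"
  by (subst (asm) nn_integral_0_iff_AE) (auto intro!: measurable_mu)
 moreover have "\<not> (AE h in \<mu>. False)"
  using mu_H_pos by (simp add: AE_iff_measurable[OF _ refl] space_mu[symmetric] del: space_mu)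
 ultimately have "emeasure lborel E = 0"
 proof (rule_tac ccontr)
  assume nz: "emeasure lborel E \<noteq> 0" and ae: "AE h in \<mu>. ennreal (1 / \<bar>det h\<bar>) * emeasure lborel E = 0" and "\<not> (AE h in \<mu>. False)"
  from ae AE_space have "AE h in \<mu>. False"
   by eventually_elim (use nz det_H in \<open>auto simp: space_mu\<close>)
  then show False using \<open>\<not> (AE h in \<mu>. False)\<close> by blast
 qed
 then show ?thesis by (intro AE_not_in) (auto simp: null_sets_def)
qed

text \<open>The substitution \<open>(x, y) \<mapsto> (yx, x\<^sup>-\<^sup>1)\<close> preserves the product of the left
 Haar measure with itself; it does the work of the modular function.\<close>

lemma haar_swap:
 assumes \<phi> [measurable]: "\<phi> \<in> borel_measurable \<mu>" and \<theta> [measurable]: "\<theta> \<in> borel_measurable \<mu>"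
 shows "(\<integral>\<^sup>+x. (\<integral>\<^sup>+y. \<phi> (y ** x) \<partial>\<mu>) * \<theta> (matrix_inv x) \<partial>\<mu>) = (\<integral>\<^sup>+x. \<phi> x \<partial>\<mu>) * (\<integral>\<^sup>+y. \<theta> y \<partial>\<mu>)"
proof -
 have mult: "(\<lambda>z. snd z ** fst z) \<in> \<mu> \<Otimes>\<^sub>M \<mu> \<rightarrow>\<^sub>M \<mu>"
  by (rule measurable_into_mu, rule measurable_mu_mu) (auto simp: space_pair_measure space_mu mult_H)
 have inv1: "(\<lambda>z. matrix_inv (fst z)) \<in> \<mu> \<Otimes>\<^sub>M \<mu> \<rightarrow>\<^sub>M \<mu>"
  by (rule measurable_into_mu, rule measurable_mu_mu) (auto simp: space_pair_measure space_mu inv_H)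
 have inv2: "(\<lambda>z. matrix_inv (fst z) ** snd z) \<in> \<mu> \<Otimes>\<^sub>M \<mu> \<rightarrow>\<^sub>M \<mu>"
  by (rule measurable_into_mu, rule measurable_mu_mu) (auto simp: space_pair_measure space_mu inv_H mult_H)
 have m1: "(\<lambda>z. \<phi> (snd z ** fst z) * \<theta> (matrix_inv (fst z))) \<in> borel_measurable (\<mu> \<Otimes>\<^sub>M \<mu>)"
  using measurable_compose[OF mult \<phi>] measurable_compose[OF inv1 \<theta>] by (rule borel_measurable_times_ennreal)
 have m2: "(\<lambda>z. \<phi> (fst z) * \<theta> (matrix_inv (fst z) ** snd z)) \<in> borel_measurable (\<mu> \<Otimes>\<^sub>M \<mu>)"
  using measurable_compose[OF measurable_fst \<phi>] measurable_compose[OF inv2 \<theta>] by (rule borel_measurable_times_ennreal)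
 have sec: "(\<lambda>y. \<phi> (y ** x)) \<in> borel_measurable \<mu>" if "x \<in> H" for x
  by (rule measurable_compose[OF _ \<phi>], rule measurable_into_mu) (auto simp: space_mu mult_H that intro!: measurable_mu)
 have "(\<integral>\<^sup>+x. (\<integral>\<^sup>+y. \<phi> (y ** x) \<partial>\<mu>) * \<theta> (matrix_inv x) \<partial>\<mu>)
   = (\<integral>\<^sup>+x. (\<integral>\<^sup>+y. \<phi> (y ** x) * \<theta> (matrix_inv x) \<partial>\<mu>) \<partial>\<mu>)"
  by (intro nn_integral_cong) (simp add: nn_integral_multc sec space_mu)
 also have "\<dots> = (\<integral>\<^sup>+y. (\<integral>\<^sup>+x. \<phi> (y ** x) * \<theta> (matrix_inv x) \<partial>\<mu>) \<partial>\<mu>)"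
  using PP.Fubini'[of "\<lambda>x y. \<phi> (y ** x) * \<theta> (matrix_inv x)"] m1 by (simp add: split_beta')
 also have "\<dots> = (\<integral>\<^sup>+y. (\<integral>\<^sup>+x. \<phi> x * \<theta> (matrix_inv x ** y) \<partial>\<mu>) \<partial>\<mu>)"
 proof (rule nn_integral_cong)
  fix y assume "y \<in> space \<mu>"
  then have y: "y \<in> H" by (simp add: space_mu)
  have "(\<lambda>x. matrix_inv x ** y) \<in> \<mu> \<rightarrow>\<^sub>M \<mu>"
   by (rule measurable_into_mu) (auto simp: space_mu mult_H inv_H y intro!: measurable_mu)
  then have "(\<integral>\<^sup>+x. \<phi> (y ** x) * \<theta> (matrix_inv (y ** x) ** y) \<partial>\<mu>) = (\<integral>\<^sup>+x. \<phi> x * \<theta> (matrix_inv x ** y) \<partial>\<mu>)"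
   by (intro nn_integral_left[OF y] borel_measurable_times_ennreal \<phi> measurable_compose[OF _ \<theta>])
  moreover have "matrix_inv (y ** x) ** y = matrix_inv x" if "x \<in> H" for x
   using that y by (simp add: inv_mult_distrib inv_cancel)
  ultimately show "(\<integral>\<^sup>+x. \<phi> (y ** x) * \<theta> (matrix_inv x) \<partial>\<mu>) = (\<integral>\<^sup>+x. \<phi> x * \<theta> (matrix_inv x ** y) \<partial>\<mu>)"
   by (simp add: space_mu cong: nn_integral_cong_simp)
 qed
 also have "\<dots> = (\<integral>\<^sup>+x. (\<integral>\<^sup>+y. \<phi> x * \<theta> (matrix_inv x ** y) \<partial>\<mu>) \<partial>\<mu>)"
  using PP.Fubini'[of "\<lambda>x y. \<phi> x * \<theta> (matrix_inv x ** y)"] m2 by (simp add: split_beta')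
 also have "\<dots> = (\<integral>\<^sup>+x. \<phi> x * (\<integral>\<^sup>+y. \<theta> y \<partial>\<mu>) \<partial>\<mu>)"
 proof (rule nn_integral_cong)
  fix x assume "x \<in> space \<mu>"
  then have x: "matrix_inv x \<in> H" by (simp add: space_mu inv_H)
  show "(\<integral>\<^sup>+y. \<phi> x * \<theta> (matrix_inv x ** y) \<partial>\<mu>) = \<phi> x * (\<integral>\<^sup>+y. \<theta> y \<partial>\<mu>)"
   using nn_integral_left[OF x \<theta>] measurable_compose[OF left_mult_measurable[OF x] \<theta>]
   by (simp add: nn_integral_cmult)
 qed
 also have "\<dots> = (\<integral>\<^sup>+x. \<phi> x \<partial>\<mu>) * (\<integral>\<^sup>+y. \<theta> y \<partial>\<mu>)" by (simp add: nn_integral_multc)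
 finally show ?thesis .
qed

text \<open>Right translates of an integrable function are integrable for almost every translation
 \<open>x\<^sup>-\<^sup>1\<close>: first almost every \<open>x\<close>, and null sets are invariant under inversion.\<close>

lemma AE_right_translate_finite:
 assumes \<phi>: "\<phi> \<in> borel_measurable \<mu>" and fin: "(\<integral>\<^sup>+x. \<phi> x \<partial>\<mu>) < \<infinity>"
 shows "AE g in \<mu>. (\<integral>\<^sup>+y. \<phi> (y ** matrix_inv g) \<partial>\<mu>) < \<infinity>"
proof -
 define \<rho> where "\<rho> x = (\<integral>\<^sup>+y. \<phi> (y ** x) \<partial>\<mu>)" for x
 have mult: "(\<lambda>z. snd z ** fst z) \<in> \<mu> \<Otimes>\<^sub>M \<mu> \<rightarrow>\<^sub>M \<mu>"
  by (rule measurable_into_mu, rule measurable_mu_mu) (auto simp: space_pair_measure space_mu mult_H)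
 have \<rho> [measurable]: "\<rho> \<in> borel_measurable \<mu>"
  unfolding \<rho>_def
  by (rule mu.borel_measurable_nn_integral) (use measurable_compose[OF mult \<phi>] in \<open>simp add: split_beta'\<close>)
 have inv_m: "matrix_inv \<in> \<mu> \<rightarrow>\<^sub>M \<mu>"
  by (rule measurable_into_mu) (auto simp: space_mu inv_H intro!: measurable_mu)
 have "AE x in \<mu>. \<rho> x < \<infinity>"
 proof -
  have "AE x in \<mu>. x \<in> HB (real n) \<longrightarrow> \<rho> x < \<infinity>" for n
  proof -
   have [measurable]: "HB (real n) \<in> sets \<mu>" by (intro in_sets_mu sets_HB HB_subset)
   have "(\<integral>\<^sup>+x. \<rho> x * indicator (HB (real n)) (matrix_inv x) \<partial>\<mu>) = (\<integral>\<^sup>+x. \<phi> x \<partial>\<mu>) * emeasure \<mu> (HB (real n))"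
    unfolding \<rho>_def by (subst haar_swap[OF \<phi>]) auto
   also have "\<dots> \<noteq> \<infinity>" using fin HB_finite[of "real n"] by (simp add: ennreal_mult_eq_top_iff less_top)
   finally have "AE x in \<mu>. \<rho> x * indicator (HB (real n)) (matrix_inv x) \<noteq> \<infinity>"
    by (rule nn_integral_noteq_infinite[rotated])
     (intro borel_measurable_times_ennreal \<rho> measurable_compose[OF inv_m] borel_measurable_indicator \<open>HB (real n) \<in> sets \<mu>\<close>)
   then show ?thesis by eventually_elim (auto simp: less_top HB_inv indicator_def split: if_splits)
  qed
  then have "AE x in \<mu>. \<forall>n. x \<in> HB (real n) \<longrightarrow> \<rho> x < \<infinity>"
   unfolding AE_all_countable by blast
  then show ?thesis using AE_space
   by eventually_elim (use ex_HB in \<open>auto simp: space_mu\<close>)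
 qed
 define Z where "Z = {x \<in> space \<mu>. \<rho> x = \<infinity>}"
 have Z [measurable]: "Z \<in> sets \<mu>" unfolding Z_def by measurable
 have Z0: "AE x in \<mu>. x \<notin> Z" using \<open>AE x in \<mu>. \<rho> x < \<infinity>\<close> by eventually_elim (auto simp: Z_def)
 define \<theta> :: "_ => ennreal" where "\<theta> g = indicator Z (matrix_inv g)" for g
 have \<theta> [measurable]: "\<theta> \<in> borel_measurable \<mu>"
  unfolding \<theta>_def by (rule measurable_compose[OF inv_m]) measurable
 have "emeasure \<mu> H * (\<integral>\<^sup>+g. \<theta> g \<partial>\<mu>) = (\<integral>\<^sup>+x. (\<integral>\<^sup>+y. 1 \<partial>\<mu>) * \<theta> (matrix_inv x) \<partial>\<mu>)"
  using haar_swap[of "\<lambda>_. 1" \<theta>] by (simp add: space_mu)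
 also have "\<dots> = 0"
  by (rule nn_integral_zero') (use Z0 AE_space in \<open>eventually_elim, auto simp: \<theta>_def space_mu inv_inv\<close>)
 finally have "(\<integral>\<^sup>+g. \<theta> g \<partial>\<mu>) = 0" using mu_H_pos by simp
 then have "AE g in \<mu>. \<theta> g = 0" by (simp add: nn_integral_0_iff_AE)
 then have "AE g in \<mu>. \<rho> (matrix_inv g) < \<infinity>"
  using AE_space by eventually_elim (auto simp: \<theta>_def Z_def space_mu inv_H less_top indicator_def split: if_splits)
 then show ?thesis by (simp add: \<rho>_def)
qed

text \<open>The orbit map is locally proper. By Baire's theorem the image of some bounded part of \<open>H\<close> has
 interior, and the compactness of stabilizers bounds all group elements mapping into that interior.\<close>

lemma locally_proper:
 assumes \<xi>: "\<xi> \<in> Orb" and \<eta>: "\<eta> \<in> Orb"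
 obtains V R where "open V" "\<eta> \<in> V" "V \<subseteq> Orb" "\<And>h. h \<in> H ==> dual_act h \<xi> \<in> V ==> h \<in> HB R"
proof -
 define K where "K n = (\<lambda>h. dual_act h \<xi>) ` HB (real n)" for n
 have K: "closed (K n)" for n
  unfolding K_def by (intro compact_imp_closed compact_continuous_image compact_HB continuous_intros)
 have "Orb \<subseteq> (\<Union>n. K n)"
 proof
  fix \<zeta> assume "\<zeta> \<in> Orb"
  then obtain h where "h \<in> H" "dual_act h \<xi> = \<zeta>" using Orb_transitive[OF \<xi>] by blast
  then show "\<zeta> \<in> (\<Union>n. K n)" using ex_HB[of h] by (force simp: K_def)
 qed
 have "\<exists>n. interior (K n) \<noteq> {}"
 proof (rule ccontr)
  assume "\<not> ?thesis"
  then have int: "interior (K n) = {}" for n by blast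
  have "UNIV \<subseteq> closure (\<Inter>(range (\<lambda>n. - K n)))"
  proof (rule Baire)
   fix T assume "T \<in> range (\<lambda>n. - K n)"
   then obtain n where "T = - K n" by auto
   then show "openin (top_of_set UNIV) T \<and> UNIV \<subseteq> closure T"
    using K int[of n] by (auto simp: closure_complement)
  qed auto
  then have "closure (- (\<Union>n. K n)) = UNIV" by auto
  then have "interior (\<Union>n. K n) = {}" unfolding closure_complement by blast
  then have "Orb = {}" using \<open>Orb \<subseteq> (\<Union>n. K n)\<close> open_Orb by (metis interior_maximal subset_empty)
  then show False using Orb_nonempty by simp
 qed
 then obtain n \<zeta> where \<zeta>: "\<zeta> \<in> interior (K n)" by blast
 have KO: "K n \<subseteq> Orb" using \<xi> HB_subset act_Orb by (auto simp: K_def)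
 have "bounded {h \<in> H. dual_act h \<xi> = \<xi>}" using compact_stabilizer[OF \<xi>] by (rule compact_imp_bounded)
 then obtain B where B: "\<And>h. h \<in> H ==> dual_act h \<xi> = \<xi> ==> norm h \<le> B" by (auto simp: bounded_iff)
 have stab: "h \<in> HB B" if "h \<in> H" "dual_act h \<xi> = \<xi>" for h
  using that B[of h] B[of "matrix_inv h"] dual_act_inv(1)[of h \<xi>] by (auto simp: HB_def inv_H)
 have proper: "h \<in> HB (B * real n)" if h: "h \<in> H" "dual_act h \<xi> \<in> interior (K n)" for h
 proof -
  obtain k where k: "k \<in> HB (real n)" "dual_act h \<xi> = dual_act k \<xi>"
   using h interior_subset by (force simp: K_def)
  have kH: "k \<in> H" using k HB_subset by blast
  have "h ** matrix_inv k \<in> HB B"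
   using h k kH by (intro stab) (auto simp: mult_H inv_H dual_act_mult dual_act_inv)
  from HB_mult[OF this k(1)] show ?thesis using kH by (simp add: inv_cancel)
 qed
 have "\<zeta> \<in> Orb" using \<zeta> KO interior_subset by blast
 then obtain g where g: "g \<in> H" "dual_act g \<zeta> = \<eta>" using Orb_transitive[OF _ \<eta>] by blast
 let ?V = "(\<lambda>x. dual_act (matrix_inv g) x) -` interior (K n)"
 show thesis
 proof
  show "open ?V" by (intro open_vimage continuous_intros) auto
  show "\<eta> \<in> ?V" using g \<zeta> dual_act_inv(1)[of g \<zeta>] by simp
  show "?V \<subseteq> Orb" using KO interior_subset[of "K n"] act_Orb[OF inv_H[OF g(1)]] by auto
  fix h assume h: "h \<in> H" "dual_act h \<xi> \<in> ?V"
  then have "h ** matrix_inv g \<in> HB (B * real n)"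
   using g by (intro proper) (auto simp: mult_H inv_H dual_act_mult)
  from HB_mult[OF this in_HB[OF g(1)]] show "h \<in> HB (B * real n * max (norm g) (norm (matrix_inv g)))"
   using g by (simp add: inv_cancel)
 qed
qed

end

section \<open>Temperate embedding\<close>

lemma orbit_weight_borel [measurable]: "orbit_weight Oc \<in> borel_measurable borel"
 unfolding orbit_weight_def[abs_def]
 by (intro borel_measurable_continuous_onI continuous_intros) (auto simp: add_nonneg_eq_0_iff)

locale temperate_orbit = dual_orbit H \<mu> Orb
 for H :: "(real^'d^'d) set" and \<mu> :: "(real^'d^'d) measure" and Orb :: "(real^'d) set" +
 fixes s q :: real and w :: "real^'d^'d => real" and l :: nat
 assumes s: "0 \<le> s" and q: "1 \<le> q" and w: "weight_on H (**) w"
  and temperate: "temperately_embedded H \<mu> Orb s q w l"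
begin

abbreviation ow :: "real^'d => real" where "ow \<equiv> orbit_weight (- Orb)"

text \<open>The factor that the two functions of the temperate embedding share once \<open>\<bar>det h\<bar>\<^sup>-\<^sup>1\<close> is split off from the second.
 It is submultiplicative.\<close>

definition W :: "real^'d^'d => real" where
 "W h = \<bar>det h\<bar> powr (1 / 2 - 1 / q) * (1 + norm h) powr (s + real CARD('d) + 1) * w h"

lemma w_pos: "h \<in> H ==> 0 < w h" and w_mult: "g \<in> H ==> h \<in> H ==> w (g ** h) \<le> w g * w h"
 using w by (auto simp: weight_on_def)

lemma w_measurable: "w \<in> borel_measurable \<mu>"
 using w borel_measurable_continuous_on_restrict[of H w]
 by (subst measurable_cong_sets[OF sets_mu refl]) (auto simp: weight_on_def)

lemma W_pos: "h \<in> H ==> 0 < W h"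
 using w_pos[of h] det_H[of h] add_pos_nonneg[OF zero_less_one norm_ge_zero[of h]]
 by (simp add: W_def)

lemma W_measurable: "W \<in> borel_measurable \<mu>"
 unfolding W_def[abs_def]
 by (intro borel_measurable_times w_measurable measurable_mu) measurable

lemma one_plus_norm_mult: "1 + norm (g ** h) \<le> (1 + norm g) * (1 + norm h)" for g h :: "real^'d^'d"
proof -
 have "norm (g ** h) \<le> norm g * norm h" by (rule norm_matrix_mult_le)
 then show ?thesis by (simp add: algebra_simps add_increasing)
qed

lemma W_mult: "g \<in> H ==> h \<in> H ==> W (g ** h) \<le> W g * W h"
proof -
 assume g: "g \<in> H" and h: "h \<in> H"
 have "(1 + norm (g ** h)) powr (s + real CARD('d) + 1) \<le> ((1 + norm g) * (1 + norm h)) powr (s + real CARD('d) + 1)"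
  using s by (intro powr_mono2 one_plus_norm_mult) auto
 also have "\<dots> = (1 + norm g) powr (s + real CARD('d) + 1) * (1 + norm h) powr (s + real CARD('d) + 1)"
  by (rule powr_mult)
 finally have "(1 + norm (g ** h)) powr (s + real CARD('d) + 1) * w (g ** h)
   \<le> ((1 + norm g) powr (s + real CARD('d) + 1) * (1 + norm h) powr (s + real CARD('d) + 1)) * (w g * w h)"
  using g h w_pos by (intro mult_mono w_mult) (auto simp: less_imp_le mult_H)
 then have "\<bar>det (g ** h)\<bar> powr (1 / 2 - 1 / q) * ((1 + norm (g ** h)) powr (s + real CARD('d) + 1) * w (g ** h))
  \<le> \<bar>det (g ** h)\<bar> powr (1 / 2 - 1 / q) * (((1 + norm g) powr (s + real CARD('d) + 1) * (1 + norm h) powr (s + real CARD('d) + 1)) * (w g * w h))"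
  by (intro mult_left_mono) auto
 moreover have "\<bar>det (g ** h)\<bar> powr (1 / 2 - 1 / q) = \<bar>det g\<bar> powr (1 / 2 - 1 / q) * \<bar>det h\<bar> powr (1 / 2 - 1 / q)"
  by (simp add: det_mul abs_mult powr_mult)
 ultimately show ?thesis by (simp add: W_def mult_ac)
qed

lemma infdist_le_norm: "infdist \<xi> (- Orb) \<le> norm \<xi>"
 using infdist_le[of 0 "- Orb" \<xi>] zero_not_in_Orb by simp

lemma ow_le_aux_A: "ow \<xi> \<le> aux_A Orb \<xi>"
proof -
 let ?\<delta> = "infdist \<xi> (- Orb)"
 have d: "0 \<le> ?\<delta>" by (rule infdist_nonneg)
 have le: "?\<delta>\<^sup>2 \<le> (norm \<xi>)\<^sup>2" using infdist_le_norm d by (intro power_mono)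
 have sq: "0 \<le> sqrt ((norm \<xi>)\<^sup>2 - ?\<delta>\<^sup>2)" using le by simp
 have "sqrt ((norm \<xi>)\<^sup>2 - ?\<delta>\<^sup>2) \<le> sqrt ((norm \<xi>)\<^sup>2)" by (intro real_sqrt_le_mono) simp
 then have "min 1 ?\<delta> / (1 + norm \<xi>) \<le> ?\<delta> / (1 + sqrt ((norm \<xi>)\<^sup>2 - ?\<delta>\<^sup>2))"
  using d add_pos_nonneg[OF zero_less_one sq] by (intro frac_le) auto
 moreover have "min 1 ?\<delta> / (1 + norm \<xi>) \<le> 1 / (1 + norm \<xi>)"
  by (intro divide_right_mono) auto
 ultimately show ?thesis by (simp add: aux_A_def orbit_weight_def)
qed

lemma ow_nonneg [simp]: "0 \<le> ow \<xi>" and ow_le_1: "ow \<xi> \<le> 1"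
 by (rule orbit_weight_bounds)+

lemma ow_pos: "\<xi> \<in> Orb ==> 0 < ow \<xi>"
 using infdist_pos_not_in_closed[OF compl_Orb, of \<xi>]
 by (auto simp: orbit_weight_def intro!: divide_pos_pos add_pos_nonneg)

text \<open>The two functions of the temperate embedding, with the base point as a further argument and with the
 smaller weight \<open>ow\<close> in place of \<open>aux_A\<close>.\<close>

definition Qfun :: "real^'d => real^'d^'d => real" where
 "Qfun \<eta> h = W h * ow (dual_act h \<eta>) ^ l"

definition Pfun :: "real^'d => real^'d^'d => real" where
 "Pfun \<eta> h = W h / \<bar>det h\<bar> * ow (dual_act (matrix_inv h) \<eta>) ^ l"

lemma Qfun_nonneg: "h \<in> H ==> 0 \<le> Qfun \<eta> h" and Pfun_nonneg: "h \<in> H ==> 0 \<le> Pfun \<eta> h"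
 by (auto simp: Qfun_def Pfun_def less_imp_le W_pos)

lemma dual_act_measurable: "(\<lambda>h. dual_act h \<eta>) \<in> \<mu> \<rightarrow>\<^sub>M borel" "(\<lambda>h. dual_act (matrix_inv h) \<eta>) \<in> \<mu> \<rightarrow>\<^sub>M borel"
 by (rule measurable_mu, measurable)+

lemma Qfun_measurable: "Qfun \<eta> \<in> borel_measurable \<mu>"
 unfolding Qfun_def[abs_def]
 by (intro borel_measurable_times W_measurable borel_measurable_power measurable_compose[OF dual_act_measurable(1)]) measurable

lemma Pfun_measurable: "Pfun \<eta> \<in> borel_measurable \<mu>"
 unfolding Pfun_def[abs_def]
 by (intro borel_measurable_times borel_measurable_divide W_measurable borel_measurable_power
   measurable_compose[OF dual_act_measurable(2)] measurable_mu) measurable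

lemma base_point:
 obtains \<xi>0 where "\<xi>0 \<in> Orb" "lp_norm \<mu> (ennreal q) (\<lambda>h. ennreal (Qfun \<xi>0 h)) < \<infinity>"
  "(\<integral>\<^sup>+h. ennreal (Pfun \<xi>0 h) \<partial>\<mu>) < \<infinity>"
proof -
 obtain \<xi>0 where \<xi>0: "\<xi>0 \<in> Orb"
  and Q: "(\<lambda>h. W h * aux_A Orb (dual_act h \<xi>0) ^ l) \<in> Lp \<mu> (ennreal q)"
  and P: "(\<lambda>h. \<bar>det h\<bar> powr (- 1 / 2 - 1 / q) * (1 + norm h) powr (s + real CARD('d) + 1) * w h *
      aux_A Orb (dual_act (matrix_inv h) \<xi>0) ^ l) \<in> Lp \<mu> 1"
  using temperate unfolding temperately_embedded_def W_def by blast
 show thesis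
 proof
  show "\<xi>0 \<in> Orb" by fact
  have "lp_norm \<mu> (ennreal q) (\<lambda>h. ennreal (Qfun \<xi>0 h))
    \<le> lp_norm \<mu> (ennreal q) (\<lambda>h. ennreal (norm (W h * aux_A Orb (dual_act h \<xi>0) ^ l)))"
  proof (rule lp_norm_mono)
   fix h assume "h \<in> space \<mu>"
   then have h: "h \<in> H" by (simp add: space_mu)
   have "Qfun \<xi>0 h \<le> W h * aux_A Orb (dual_act h \<xi>0) ^ l"
    unfolding Qfun_def using W_pos[OF h] by (intro mult_left_mono power_mono ow_le_aux_A) auto
   then show "ennreal (Qfun \<xi>0 h) \<le> ennreal (norm (W h * aux_A Orb (dual_act h \<xi>0) ^ l))"
    by (intro ennreal_leI) auto
  qed (use Qfun_measurable in measurable)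
  also have "\<dots> < \<infinity>" using Q by (simp add: Lp_def)
  finally show "lp_norm \<mu> (ennreal q) (\<lambda>h. ennreal (Qfun \<xi>0 h)) < \<infinity>" .
  have "(\<integral>\<^sup>+h. ennreal (Pfun \<xi>0 h) \<partial>\<mu>) \<le> (\<integral>\<^sup>+h. ennreal (norm (\<bar>det h\<bar> powr (- 1 / 2 - 1 / q) *
    (1 + norm h) powr (s + real CARD('d) + 1) * w h * aux_A Orb (dual_act (matrix_inv h) \<xi>0) ^ l)) \<partial>\<mu>)"
  proof (rule nn_integral_mono)
   fix h assume "h \<in> space \<mu>"
   then have h: "h \<in> H" by (simp add: space_mu)
   have "- 1 / 2 - 1 / q = (1 / 2 - 1 / q) - 1" by simp
   then have "\<bar>det h\<bar> powr (- 1 / 2 - 1 / q) = \<bar>det h\<bar> powr (1 / 2 - 1 / q) / \<bar>det h\<bar>"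
    using det_H[OF h] by (simp only: powr_diff) simp
   then have eq: "\<bar>det h\<bar> powr (- 1 / 2 - 1 / q) * (1 + norm h) powr (s + real CARD('d) + 1) * w h = W h / \<bar>det h\<bar>"
    by (simp only: W_def) (simp add: algebra_simps)
   have "Pfun \<xi>0 h \<le> W h / \<bar>det h\<bar> * aux_A Orb (dual_act (matrix_inv h) \<xi>0) ^ l"
    unfolding Pfun_def using W_pos[OF h] by (intro mult_left_mono power_mono ow_le_aux_A) auto
   then show "ennreal (Pfun \<xi>0 h) \<le> ennreal (norm (\<bar>det h\<bar> powr (- 1 / 2 - 1 / q) *
    (1 + norm h) powr (s + real CARD('d) + 1) * w h * aux_A Orb (dual_act (matrix_inv h) \<xi>0) ^ l))"
    unfolding eq real_norm_def by (intro ennreal_leI order_trans[OF _ abs_ge_self])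
  qed
  also have "\<dots> < \<infinity>" using P by (simp add: Lp_def lp_norm_1)
  finally show "(\<integral>\<^sup>+h. ennreal (Pfun \<xi>0 h) \<partial>\<mu>) < \<infinity>" .
 qed
qed

lemma lp_norm_left:
 assumes g: "g \<in> H" and f: "f \<in> borel_measurable \<mu>"
 shows "lp_norm \<mu> (ennreal q) (\<lambda>h. f (g ** h)) = lp_norm \<mu> (ennreal q) f"
proof -
 have "(\<integral>\<^sup>+h. epow (f (g ** h)) q \<partial>\<mu>) = (\<integral>\<^sup>+h. epow (f h) q \<partial>\<mu>)"
  using f by (intro nn_integral_left[OF g, of "\<lambda>h. epow (f h) q"]) measurable
 then show ?thesis using q by (simp add: lp_norm_ennreal)
qed

lemma q_ge_1: "1 \<le> ennreal q"
 using q by (simp add: ennreal_ge_1)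

text \<open>Another base point amounts to a left translation, under which \<open>W\<close> changes by a bounded factor.\<close>

lemma Qfun_finite:
 assumes \<eta>: "\<eta> \<in> Orb" shows "lp_norm \<mu> (ennreal q) (\<lambda>h. ennreal (Qfun \<eta> h)) < \<infinity>"
proof -
 obtain \<xi>0 where \<xi>0: "\<xi>0 \<in> Orb" "lp_norm \<mu> (ennreal q) (\<lambda>h. ennreal (Qfun \<xi>0 h)) < \<infinity>"
  by (rule base_point)
 obtain g where g: "g \<in> H" "dual_act g \<xi>0 = \<eta>" using Orb_transitive[OF \<xi>0(1) \<eta>] by blast
 let ?c = "W (matrix_inv g)"
 have m [measurable]: "(\<lambda>h. ennreal (Qfun \<zeta> h)) \<in> borel_measurable \<mu>" for \<zeta>
  using Qfun_measurable[of \<zeta>] by measurable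
 have m': "(\<lambda>h. ennreal (Qfun \<xi>0 (g ** h))) \<in> borel_measurable \<mu>"
  using measurable_compose[OF left_mult_measurable[OF g(1)] m] by simp
 have "lp_norm \<mu> (ennreal q) (\<lambda>h. ennreal (Qfun \<eta> h))
   \<le> lp_norm \<mu> (ennreal q) (\<lambda>h. ennreal ?c * ennreal (Qfun \<xi>0 (g ** h)))"
 proof (rule lp_norm_mono[OF m])
  fix h assume "h \<in> space \<mu>"
  then have h: "h \<in> H" by (simp add: space_mu)
  have "W h \<le> ?c * W (g ** h)"
   using W_mult[OF inv_H[OF g(1)] mult_H[OF g(1) h]] g by (simp add: inv_cancel)
  then have "W h * ow (dual_act (g ** h) \<xi>0) ^ l \<le> ?c * W (g ** h) * ow (dual_act (g ** h) \<xi>0) ^ l"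
   by (intro mult_right_mono) auto
  then have "Qfun \<eta> h \<le> ?c * Qfun \<xi>0 (g ** h)"
   using g(2) by (simp add: Qfun_def dual_act_mult mult.assoc)
  then show "ennreal (Qfun \<eta> h) \<le> ennreal ?c * ennreal (Qfun \<xi>0 (g ** h))"
   using W_pos[OF inv_H[OF g(1)]] Qfun_nonneg[OF mult_H[OF g(1) h]] by (simp flip: ennreal_mult)
 qed
 also have "\<dots> \<le> ennreal ?c * lp_norm \<mu> (ennreal q) (\<lambda>h. ennreal (Qfun \<xi>0 (g ** h)))"
  using W_pos[OF inv_H[OF g(1)]] by (intro lp_norm_cmult q_ge_1 m') auto
 also have "\<dots> = ennreal ?c * lp_norm \<mu> (ennreal q) (\<lambda>h. ennreal (Qfun \<xi>0 h))"
  using lp_norm_left[OF g(1) m[of \<xi>0]] by simp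
 also have "\<dots> < \<infinity>" using \<xi>0(2) by (simp add: ennreal_mult_less_top)
 finally show ?thesis .
qed

lemma measurable_triple:
 assumes "f \<in> borel \<Otimes>\<^sub>M borel \<Otimes>\<^sub>M borel \<rightarrow>\<^sub>M N"
 shows "f \<in> \<mu> \<Otimes>\<^sub>M \<mu> \<Otimes>\<^sub>M lborel \<rightarrow>\<^sub>M N"
proof -
 have "(\<lambda>z. (fst z, fst (snd z), snd (snd z))) \<in> \<mu> \<Otimes>\<^sub>M \<mu> \<Otimes>\<^sub>M lborel \<rightarrow>\<^sub>M borel \<Otimes>\<^sub>M borel \<Otimes>\<^sub>M borel"
  using measurable_compose[OF measurable_fst measurable_mu_borel]
   measurable_compose[OF measurable_compose[OF measurable_snd measurable_fst] measurable_mu_borel]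
  by (intro measurable_Pair) auto
 from measurable_compose[OF this assms] show ?thesis by simp
qed

lemma Pfun_pair_measurable: "(\<lambda>z. ennreal (Pfun (snd z) (fst z))) \<in> borel_measurable (\<mu> \<Otimes>\<^sub>M lborel)"
proof -
 have "(\<lambda>z. ow (dual_act (matrix_inv (fst z)) (snd z)) ^ l / \<bar>det (fst z)\<bar>) \<in> borel_measurable (\<mu> \<Otimes>\<^sub>M lborel)"
  by (rule measurable_mu_lborel) measurable
 moreover have "(\<lambda>z. W (fst z)) \<in> borel_measurable (\<mu> \<Otimes>\<^sub>M lborel)"
  by (rule measurable_compose[OF measurable_fst W_measurable])
 ultimately have "(\<lambda>z. W (fst z) * (ow (dual_act (matrix_inv (fst z)) (snd z)) ^ l / \<bar>det (fst z)\<bar>)) \<in> borel_measurable (\<mu> \<Otimes>\<^sub>M lborel)"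
  by (rule borel_measurable_times[rotated])
 then show ?thesis unfolding Pfun_def by (simp add: mult.commute)
qed

lemma Qfun_pair_measurable: "(\<lambda>z. ennreal (Qfun (snd z) (fst z))) \<in> borel_measurable (\<mu> \<Otimes>\<^sub>M lborel)"
proof -
 have "(\<lambda>z. ow (dual_act (fst z) (snd z)) ^ l) \<in> borel_measurable (\<mu> \<Otimes>\<^sub>M lborel)"
  by (rule measurable_mu_lborel) measurable
 moreover have "(\<lambda>z. W (fst z)) \<in> borel_measurable (\<mu> \<Otimes>\<^sub>M lborel)"
  by (rule measurable_compose[OF measurable_fst W_measurable])
 ultimately have "(\<lambda>z. W (fst z) * ow (dual_act (fst z) (snd z)) ^ l) \<in> borel_measurable (\<mu> \<Otimes>\<^sub>M lborel)"
  by (rule borel_measurable_times[rotated])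
 then show ?thesis unfolding Qfun_def by simp
qed

lemma measurable_swap_mu_lborel:
 "(\<lambda>z. f (snd z) (fst z)) \<in> borel_measurable (\<mu> \<Otimes>\<^sub>M lborel) ==> (\<lambda>z. f (fst z) (snd z)) \<in> borel_measurable (leb_mu)"
 using measurable_compose[OF measurable_pair_swap'[of lborel \<mu>], of "\<lambda>z. f (snd z) (fst z)"] by (simp add: split_beta')

text \<open>Here another base point amounts to a right translation; integrability survives it for almost every group element.\<close>

lemma Pfun_finite_AE: "AE \<eta> in lborel. (\<integral>\<^sup>+h. ennreal (Pfun \<eta> h) \<partial>\<mu>) < \<infinity>"
proof -
 obtain \<xi>0 where \<xi>0: "\<xi>0 \<in> Orb" "(\<integral>\<^sup>+h. ennreal (Pfun \<xi>0 h) \<partial>\<mu>) < \<infinity>"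
  by (rule base_point)
 define E where "E = {\<eta>. (\<integral>\<^sup>+h. ennreal (Pfun \<eta> h) \<partial>\<mu>) = \<infinity>}"
 have "(\<lambda>\<eta>. \<integral>\<^sup>+h. ennreal (Pfun \<eta> h) \<partial>\<mu>) \<in> borel_measurable lborel"
  using measurable_swap_mu_lborel[of "\<lambda>\<eta> h. ennreal (Pfun \<eta> h)"] Pfun_pair_measurable
  by (intro mu.borel_measurable_nn_integral) (simp add: split_beta')
 then have "{\<eta> \<in> space lborel. (\<integral>\<^sup>+h. ennreal (Pfun \<eta> h) \<partial>\<mu>) = \<infinity>} \<in> sets lborel" by measurable
 then have E: "E \<in> sets borel" by (simp add: E_def)
 have P_m: "(\<lambda>h. ennreal (Pfun \<xi>0 h)) \<in> borel_measurable \<mu>"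
  using Pfun_measurable[of \<xi>0] by measurable
 have "AE g in \<mu>. dual_act g \<xi>0 \<notin> E"
  using AE_right_translate_finite[OF P_m \<xi>0(2)] AE_space
 proof eventually_elim
  case (elim g)
  then have g: "g \<in> H" by (simp add: space_mu)
  let ?c = "W g / \<bar>det g\<bar>"
  have "(\<lambda>k. k ** matrix_inv g) \<in> \<mu> \<rightarrow>\<^sub>M \<mu>"
   by (rule measurable_into_mu) (auto simp: space_mu mult_H inv_H g intro!: measurable_mu)
  then have m: "(\<lambda>k. ennreal (Pfun \<xi>0 (k ** matrix_inv g))) \<in> borel_measurable \<mu>"
   by (rule measurable_compose[OF _ P_m])
  have "(\<integral>\<^sup>+k. ennreal (Pfun (dual_act g \<xi>0) k) \<partial>\<mu>) \<le> (\<integral>\<^sup>+k. ennreal ?c * ennreal (Pfun \<xi>0 (k ** matrix_inv g)) \<partial>\<mu>)"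
  proof (rule nn_integral_mono)
   fix k assume "k \<in> space \<mu>"
   then have k: "k \<in> H" by (simp add: space_mu)
   let ?k = "k ** matrix_inv g"
   have kH: "?k \<in> H" using k g by (simp add: mult_H inv_H)
   have "W k \<le> W ?k * W g" using W_mult[OF kH g] g by (simp add: inv_cancel)
   moreover have "1 / \<bar>det k\<bar> = 1 / \<bar>det ?k\<bar> * (1 / \<bar>det g\<bar>)"
    using det_H[OF g] by (simp add: det_mul det_inv[OF g] abs_mult)
   moreover have "dual_act (matrix_inv k) (dual_act g \<xi>0) = dual_act (matrix_inv ?k) \<xi>0"
    using k g by (simp add: inv_mult_distrib inv_H inv_inv dual_act_mult)
   moreover have "0 \<le> ow z ^ l" "0 \<le> 1 / \<bar>det ?k\<bar> * (1 / \<bar>det g\<bar>)" for z by auto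
   ultimately have "W k * (1 / \<bar>det k\<bar>) * ow (dual_act (matrix_inv k) (dual_act g \<xi>0)) ^ l
     \<le> W ?k * W g * (1 / \<bar>det ?k\<bar> * (1 / \<bar>det g\<bar>)) * ow (dual_act (matrix_inv ?k) \<xi>0) ^ l"
    by (simp only:) (intro mult_right_mono)
   then have "Pfun (dual_act g \<xi>0) k \<le> ?c * Pfun \<xi>0 ?k"
    by (simp add: Pfun_def mult_ac)
   then show "ennreal (Pfun (dual_act g \<xi>0) k) \<le> ennreal ?c * ennreal (Pfun \<xi>0 ?k)"
    using W_pos[OF g] Pfun_nonneg[OF kH] by (simp flip: ennreal_mult)
  qed
  also have "\<dots> = ennreal ?c * (\<integral>\<^sup>+k. ennreal (Pfun \<xi>0 (k ** matrix_inv g)) \<partial>\<mu>)"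
   by (rule nn_integral_cmult[OF m])
  also have "\<dots> < \<infinity>" using elim by (simp add: ennreal_mult_less_top)
  finally show ?case by (simp add: E_def)
 qed
 then have "(\<integral>\<^sup>+g. indicator E (dual_act g \<xi>0) \<partial>\<mu>) = 0"
  by (intro nn_integral_zero') (auto elim: eventually_mono)
 from orbit_null[OF E \<xi>0(1) this] show ?thesis
  by eventually_elim (auto simp: E_def less_top)
qed

definition Phi :: "real^'d^'d => ennreal" where
 "Phi h = (\<integral>\<^sup>+\<xi>. ennreal (ow \<xi> ^ l * ow (dual_act h \<xi>) ^ l) \<partial>lborel)"

text \<open>Up to a constant, \<open>Phi\<close> is the convolution on \<open>H\<close> of \<open>\<bar>det k\<bar>\<^sup>-\<^sup>1 A(k\<^sup>-\<^sup>T \<eta>)\<^sup>l\<close> and \<open>A(h\<^sup>T \<eta>)\<^sup>l\<close>: insert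
 the constant function \<open>\<xi> \<mapsto> \<mu> {k. k\<^sup>T \<xi> \<in> K}\<close> and substitute \<open>\<eta> = k\<^sup>T \<xi>\<close>. As \<open>W\<close> is submultiplicative, Minkowski's
 inequality bounds its \<open>L\<^sup>q\<close> norm by the two norms of the temperate embedding. The base points range over a set \<open>K\<close> of
 positive measure on which these norms are bounded.\<close>

lemma Phi_finite: "lp_norm \<mu> (ennreal q) (\<lambda>h. ennreal (W h) * Phi h) < \<infinity>"
proof -
 define p1 where "p1 \<eta> = (\<integral>\<^sup>+h. ennreal (Pfun \<eta> h) \<partial>\<mu>)" for \<eta>
 define q1 where "q1 \<eta> = lp_norm \<mu> (ennreal q) (\<lambda>h. ennreal (Qfun \<eta> h))" for \<eta>
 have p1 [measurable]: "p1 \<in> borel_measurable borel"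
  unfolding p1_def[abs_def] measurable_lborel2[symmetric]
  using measurable_swap_mu_lborel[of "\<lambda>\<eta> h. ennreal (Pfun \<eta> h)"] Pfun_pair_measurable
  by (intro mu.borel_measurable_nn_integral) (simp add: split_beta')
 have q1 [measurable]: "q1 \<in> borel_measurable borel"
  unfolding q1_def[abs_def] measurable_lborel2[symmetric]
  using measurable_swap_mu_lborel[of "\<lambda>\<eta> h. ennreal (Qfun \<eta> h)"] Qfun_pair_measurable
  by (intro borel_measurable_lp_norm mu.sigma_finite_measure_axioms q_ge_1) (simp add: split_beta')
 define K where "K n = {\<eta> \<in> cball 0 (real n) \<inter> Orb. p1 \<eta> \<le> of_nat n \<and> q1 \<eta> \<le> of_nat n}" for n
 have K [measurable]: "K n \<in> sets borel" for n
 proof -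
  have [measurable]: "Orb \<in> sets borel" using open_Orb by simp
  have "K n = (cball 0 (real n) \<inter> Orb) \<inter> {\<eta> \<in> space borel. p1 \<eta> \<le> of_nat n \<and> q1 \<eta> \<le> of_nat n}"
   by (auto simp: K_def)
  also have "\<dots> \<in> sets borel" by measurable
  finally show ?thesis .
 qed
 have "\<exists>n. emeasure lborel (K n) \<noteq> 0"
 proof (rule ccontr)
  assume "\<not> ?thesis"
  then have "AE \<eta> in lborel. \<eta> \<notin> K n" for n by (intro AE_not_in) (auto simp: null_sets_def)
  then have "AE \<eta> in lborel. \<forall>n. \<eta> \<notin> K n" by (simp add: AE_all_countable)
  then have "AE \<eta> in (lborel :: (real^'d) measure). False"
   using AE_Orb Pfun_finite_AE
  proof eventually_elim
   case (elim \<eta>)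
   obtain n1 where n1: "p1 \<eta> \<le> of_nat n1" using ennreal_Ex_less_of_nat[of "p1 \<eta>"] elim(3) unfolding p1_def infinity_ennreal_def by (meson less_imp_le)
   obtain n2 where n2: "q1 \<eta> \<le> of_nat n2"
    using ennreal_Ex_less_of_nat[of "q1 \<eta>"] Qfun_finite[OF elim(2)] unfolding q1_def infinity_ennreal_def by (meson less_imp_le)
   obtain n3 where n3: "norm \<eta> \<le> real n3" using real_arch_simple by blast
   have "\<eta> \<in> K (max n1 (max n2 n3))"
    using n1 n2 n3 elim(2) by (auto simp: K_def intro: order_trans)
   with elim(1) show False by blast
  qed
  then show False by (simp add: AE_iff_measurable[OF _ refl])
 qed
 then obtain n where n: "emeasure lborel (K n) \<noteq> 0" by blast
 define \<kappa> where "\<kappa> \<xi> = (\<integral>\<^sup>+k. indicator (K n) (dual_act k \<xi>) \<partial>\<mu>)" for \<xi>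
 obtain \<zeta> where \<zeta>: "\<zeta> \<in> Orb" using Orb_nonempty by blast
 have \<kappa>_eq: "\<kappa> \<xi> = \<kappa> \<zeta>" if "\<xi> \<in> Orb" for \<xi>
  unfolding \<kappa>_def using that \<zeta> by (intro orbit_integral_const) measurable
 have "\<kappa> \<zeta> \<noteq> 0"
 proof
  assume "\<kappa> \<zeta> = 0"
  then have "AE \<eta> in lborel. \<eta> \<notin> K n" unfolding \<kappa>_def by (intro orbit_null[OF K \<zeta>])
  then have "emeasure lborel (K n) = 0" by (subst (asm) AE_iff_measurable[OF _ refl]) auto
  with n show False by simp
 qed
 have K_fin: "emeasure lborel (K n) < \<infinity>"
 proof -
  have "emeasure lborel (K n) \<le> emeasure lborel (cball (0 :: real^'d) (real n))"
   by (intro emeasure_mono) (auto simp: K_def)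
  also have "\<dots> < \<infinity>" using emeasure_bounded_finite[OF bounded_cball] .
  finally show ?thesis .
 qed
 define F where "F h u = indicator (K n) (snd u) * (ennreal (Pfun (snd u) (fst u)) * ennreal (Qfun (snd u) (matrix_inv (fst u) ** h)))"
  for h and u :: "(real^'d^'d) \<times> (real^'d)"
 have F_meas: "(\<lambda>z. F (fst z) (snd z)) \<in> borel_measurable (\<mu> \<Otimes>\<^sub>M \<mu> \<Otimes>\<^sub>M lborel)"
 proof -
  have 1: "(\<lambda>z. indicator (K n) (snd (snd z)) :: ennreal) \<in> borel_measurable (\<mu> \<Otimes>\<^sub>M \<mu> \<Otimes>\<^sub>M lborel)"
   by (rule measurable_triple) measurable
  have 2: "(\<lambda>z. ennreal (Pfun (snd (snd z)) (fst (snd z)))) \<in> borel_measurable (\<mu> \<Otimes>\<^sub>M \<mu> \<Otimes>\<^sub>M lborel)"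
   by (rule measurable_compose[OF measurable_snd Pfun_pair_measurable])
  have "(\<lambda>z. (matrix_inv (fst (snd z)) ** fst z, snd (snd z))) \<in> \<mu> \<Otimes>\<^sub>M \<mu> \<Otimes>\<^sub>M lborel \<rightarrow>\<^sub>M \<mu> \<Otimes>\<^sub>M lborel"
   by (intro measurable_Pair measurable_into_mu measurable_triple)
    (auto simp: space_pair_measure space_mu mult_H inv_H)
  from measurable_compose[OF this Qfun_pair_measurable]
  have 3: "(\<lambda>z. ennreal (Qfun (snd (snd z)) (matrix_inv (fst (snd z)) ** fst z))) \<in> borel_measurable (\<mu> \<Otimes>\<^sub>M \<mu> \<Otimes>\<^sub>M lborel)"
   by simp
  show ?thesis unfolding F_def by (intro borel_measurable_times_ennreal 1 2 3)
 qed
 have ml: "sigma_finite_measure (\<mu> \<Otimes>\<^sub>M (lborel :: (real^'d) measure))"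
  by (rule sigma_finite_pair_measure[OF mu.sigma_finite_measure_axioms sigma_finite_lborel])
 have pt: "min 1 (\<kappa> \<zeta>) * (ennreal (W h) * Phi h) \<le> (\<integral>\<^sup>+u. F h u \<partial>(\<mu> \<Otimes>\<^sub>M lborel))" if h: "h \<in> H" for h
 proof -
  let ?a = "\<lambda>\<xi>. ennreal (ow \<xi> ^ l * ow (dual_act h \<xi>) ^ l)"
  have a_m [measurable]: "?a \<in> borel_measurable borel" by measurable
  have "min 1 (\<kappa> \<zeta>) * Phi h \<le> \<kappa> \<zeta> * Phi h" by (intro mult_right_mono) auto
  also have "\<dots> = (\<integral>\<^sup>+\<xi>. \<kappa> \<zeta> * ?a \<xi> \<partial>lborel)"
   unfolding Phi_def by (rule nn_integral_cmult[symmetric]) simp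
  also have "\<dots> = (\<integral>\<^sup>+\<xi>. \<kappa> \<xi> * ?a \<xi> \<partial>lborel)"
   using AE_Orb by (intro nn_integral_cong_AE) (auto elim!: eventually_mono simp: \<kappa>_eq)
  also have "\<dots> = (\<integral>\<^sup>+\<xi>. (\<integral>\<^sup>+k. indicator (K n) (dual_act k \<xi>) * ?a \<xi> \<partial>\<mu>) \<partial>lborel)"
   unfolding \<kappa>_def by (intro nn_integral_cong nn_integral_multc[symmetric] measurable_mu) measurable
  also have "\<dots> = (\<integral>\<^sup>+k. (\<integral>\<^sup>+\<xi>. indicator (K n) (dual_act k \<xi>) * ?a \<xi> \<partial>lborel) \<partial>\<mu>)"
  proof (rule P.Fubini'[symmetric])
   show "(\<lambda>(\<xi>, k). indicator (K n) (dual_act k \<xi>) * ?a \<xi>) \<in> borel_measurable (leb_mu)"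
    unfolding split_beta' by (rule measurable_lborel_mu) measurable
  qed
  also have "\<dots> = (\<integral>\<^sup>+k. (\<integral>\<^sup>+\<eta>. indicator (K n) \<eta> * ((ennreal (1 / \<bar>det k\<bar>) * ennreal (ow (dual_act (matrix_inv k) \<eta>) ^ l)) *
    ennreal (ow (dual_act (matrix_inv k ** h) \<eta>) ^ l)) \<partial>lborel) \<partial>\<mu>)"
  proof (rule nn_integral_cong)
   fix k assume "k \<in> space \<mu>"
   then have k: "k \<in> H" by (simp add: space_mu)
   let ?b = "\<lambda>\<eta>. indicator (K n) \<eta> * ?a (dual_act (matrix_inv k) \<eta>)"
   have "(\<integral>\<^sup>+\<xi>. ?b (dual_act k \<xi>) \<partial>lborel) = ennreal (1 / \<bar>det (transpose k)\<bar>) * (\<integral>\<^sup>+\<eta>. ?b \<eta> \<partial>lborel)"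
    using det_H[OF k] by (intro nn_integral_linear) auto
   also have "\<dots> = (\<integral>\<^sup>+\<eta>. ennreal (1 / \<bar>det k\<bar>) * ?b \<eta> \<partial>lborel)"
    by (simp add: nn_integral_cmult)
   finally show "(\<integral>\<^sup>+\<xi>. indicator (K n) (dual_act k \<xi>) * ?a \<xi> \<partial>lborel) = (\<integral>\<^sup>+\<eta>. indicator (K n) \<eta> *
     ((ennreal (1 / \<bar>det k\<bar>) * ennreal (ow (dual_act (matrix_inv k) \<eta>) ^ l)) * ennreal (ow (dual_act (matrix_inv k ** h) \<eta>) ^ l)) \<partial>lborel)"
    using k by (simp add: dual_act_inv dual_act_mult ennreal_mult mult_ac)
  qed
  finally have "ennreal (W h) * (min 1 (\<kappa> \<zeta>) * Phi h) \<le> ennreal (W h) * \<dots>"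
   by (rule mult_left_mono) simp
  also have "\<dots> = (\<integral>\<^sup>+k. (\<integral>\<^sup>+\<eta>. ennreal (W h) * (indicator (K n) \<eta> * ((ennreal (1 / \<bar>det k\<bar>) * ennreal (ow (dual_act (matrix_inv k) \<eta>) ^ l)) *
    ennreal (ow (dual_act (matrix_inv k ** h) \<eta>) ^ l))) \<partial>lborel) \<partial>\<mu>)"
  proof -
   have "(\<lambda>z. indicator (K n) (snd z) * ((ennreal (1 / \<bar>det (fst z)\<bar>) * ennreal (ow (dual_act (matrix_inv (fst z)) (snd z)) ^ l)) *
    ennreal (ow (dual_act (matrix_inv (fst z) ** h) (snd z)) ^ l))) \<in> borel_measurable (\<mu> \<Otimes>\<^sub>M lborel)"
    by (rule measurable_mu_lborel) measurable
   then show ?thesis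
    by (subst nn_integral_cmult[symmetric])
     (auto simp: nn_integral_cmult split_beta' intro!: lborel.borel_measurable_nn_integral nn_integral_cong)
  qed
  also have "\<dots> \<le> (\<integral>\<^sup>+k. (\<integral>\<^sup>+\<eta>. F h (k, \<eta>) \<partial>lborel) \<partial>\<mu>)"
  proof (intro nn_integral_mono)
   fix k \<eta> assume "k \<in> space \<mu>"
   then have k: "k \<in> H" "matrix_inv k ** h \<in> H" using h by (auto simp: space_mu mult_H inv_H)
   have "W h \<le> W k * W (matrix_inv k ** h)" using W_mult[OF k] k(1) by (simp add: inv_cancel)
   then have "W h * (1 / \<bar>det k\<bar> * ow (dual_act (matrix_inv k) \<eta>) ^ l * ow (dual_act (matrix_inv k ** h) \<eta>) ^ l)
     \<le> (W k * W (matrix_inv k ** h)) * (1 / \<bar>det k\<bar> * ow (dual_act (matrix_inv k) \<eta>) ^ l * ow (dual_act (matrix_inv k ** h) \<eta>) ^ l)"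
    by (intro mult_right_mono) auto
   also have "\<dots> = Pfun \<eta> k * Qfun \<eta> (matrix_inv k ** h)" by (simp add: Pfun_def Qfun_def mult_ac)
   finally have "ennreal (W h) * ((ennreal (1 / \<bar>det k\<bar>) * ennreal (ow (dual_act (matrix_inv k) \<eta>) ^ l)) *
     ennreal (ow (dual_act (matrix_inv k ** h) \<eta>) ^ l))
    \<le> ennreal (Pfun \<eta> k) * ennreal (Qfun \<eta> (matrix_inv k ** h))"
    using W_pos[OF h] Pfun_nonneg[OF k(1)] Qfun_nonneg[OF k(2)] by (simp flip: ennreal_mult)
   then show "ennreal (W h) * (indicator (K n) \<eta> * ((ennreal (1 / \<bar>det k\<bar>) * ennreal (ow (dual_act (matrix_inv k) \<eta>) ^ l)) *
    ennreal (ow (dual_act (matrix_inv k ** h) \<eta>) ^ l))) \<le> F h (k, \<eta>)"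
    by (auto simp: F_def indicator_def)
  qed
  also have "\<dots> = (\<integral>\<^sup>+u. F h u \<partial>(\<mu> \<Otimes>\<^sub>M lborel))"
  proof (rule lborel.nn_integral_fst)
   show "F h \<in> borel_measurable (\<mu> \<Otimes>\<^sub>M lborel)"
    using measurable_compose[OF measurable_Pair1'[of h \<mu>] F_meas] h by (simp add: space_mu)
  qed
  finally show ?thesis by (simp add: mult_ac)
 qed
 have "lp_norm \<mu> (ennreal q) (\<lambda>h. min 1 (\<kappa> \<zeta>) * (ennreal (W h) * Phi h)) \<le> lp_norm \<mu> (ennreal q) (\<lambda>h. \<integral>\<^sup>+u. F h u \<partial>(\<mu> \<Otimes>\<^sub>M lborel))"
  unfolding lp_norm_ennreal[OF less_le_trans[OF zero_less_one q]]
  using q by (intro epow_mono nn_integral_mono pt) (auto simp: space_mu)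
 also have "\<dots> \<le> (\<integral>\<^sup>+u. indicator (K n) (snd u) * (ennreal (Pfun (snd u) (fst u)) * of_nat n) \<partial>(\<mu> \<Otimes>\<^sub>M lborel))"
 proof (rule Minkowski_nn_integral[OF mu.sigma_finite_measure_axioms ml _ _ q_ge_1])
  show "(\<lambda>(h, u). F h u) \<in> borel_measurable (\<mu> \<Otimes>\<^sub>M \<mu> \<Otimes>\<^sub>M lborel)"
   using F_meas by (simp add: split_beta')
  have "(\<lambda>u. indicator (K n) (snd u) :: ennreal) \<in> borel_measurable (\<mu> \<Otimes>\<^sub>M lborel)"
   by (rule measurable_mu_lborel) measurable
  then show "(\<lambda>u. indicator (K n) (snd u) * (ennreal (Pfun (snd u) (fst u)) * of_nat n)) \<in> borel_measurable (\<mu> \<Otimes>\<^sub>M lborel)"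
   by (intro borel_measurable_times_ennreal Pfun_pair_measurable) auto
  fix u assume "u \<in> space (\<mu> \<Otimes>\<^sub>M (lborel :: (real^'d) measure))"
  then have k: "matrix_inv (fst u) \<in> H" "fst u \<in> H" by (auto simp: space_pair_measure space_mu inv_H)
  have m: "(\<lambda>h. ennreal (Qfun (snd u) h)) \<in> borel_measurable \<mu>" using Qfun_measurable by measurable
  have m': "(\<lambda>h. ennreal (Qfun (snd u) (matrix_inv (fst u) ** h))) \<in> borel_measurable \<mu>"
   using measurable_compose[OF left_mult_measurable[OF k(1)] m] by simp
  show "lp_norm \<mu> (ennreal q) (\<lambda>h. F h u) \<le> indicator (K n) (snd u) * (ennreal (Pfun (snd u) (fst u)) * of_nat n)"
  proof (cases "snd u \<in> K n")
   case True
   have "lp_norm \<mu> (ennreal q) (\<lambda>h. F h u) = lp_norm \<mu> (ennreal q) (\<lambda>h. ennreal (Pfun (snd u) (fst u)) *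
     ennreal (Qfun (snd u) (matrix_inv (fst u) ** h)))"
    using True by (simp add: F_def)
   also have "\<dots> \<le> ennreal (Pfun (snd u) (fst u)) * lp_norm \<mu> (ennreal q) (\<lambda>h. ennreal (Qfun (snd u) (matrix_inv (fst u) ** h)))"
    by (intro lp_norm_cmult q_ge_1 m' Pfun_nonneg k)
   also have "\<dots> = ennreal (Pfun (snd u) (fst u)) * q1 (snd u)"
    unfolding q1_def using lp_norm_left[OF k(1) m] by simp
   also have "\<dots> \<le> ennreal (Pfun (snd u) (fst u)) * of_nat n"
    using True by (intro mult_left_mono) (auto simp: K_def)
   finally show ?thesis using True by simp
  next
   case False
   then show ?thesis using q by (simp add: F_def lp_norm_ennreal)
  qed
 qed
 also have "\<dots> = (\<integral>\<^sup>+\<eta>. (\<integral>\<^sup>+k. indicator (K n) \<eta> * (ennreal (Pfun \<eta> k) * of_nat n) \<partial>\<mu>) \<partial>lborel)"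
 proof -
  have "(\<lambda>u. indicator (K n) (snd u) :: ennreal) \<in> borel_measurable (\<mu> \<Otimes>\<^sub>M lborel)"
   by (rule measurable_mu_lborel) measurable
  then have m: "(\<lambda>u. indicator (K n) (snd u) * (ennreal (Pfun (snd u) (fst u)) * of_nat n)) \<in> borel_measurable (\<mu> \<Otimes>\<^sub>M lborel)"
   by (intro borel_measurable_times_ennreal Pfun_pair_measurable) auto
  interpret Q: pair_sigma_finite \<mu> "lborel :: (real^'d) measure" ..
  show ?thesis using Q.nn_integral_snd[of "\<lambda>u. indicator (K n) (snd u) * (ennreal (Pfun (snd u) (fst u)) * of_nat n)"] m
   by (simp add: split_beta')
 qed
 also have "\<dots> \<le> (\<integral>\<^sup>+\<eta>. (of_nat n * of_nat n) * indicator (K n) \<eta> \<partial>lborel)"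
 proof (rule nn_integral_mono)
  fix \<eta> :: "real^'d"
  have m: "(\<lambda>k. ennreal (Pfun \<eta> k)) \<in> borel_measurable \<mu>" using Pfun_measurable by measurable
  have "(\<integral>\<^sup>+k. indicator (K n) \<eta> * (ennreal (Pfun \<eta> k) * of_nat n) \<partial>\<mu>) = indicator (K n) \<eta> * (p1 \<eta> * of_nat n)"
   unfolding p1_def using m by (simp add: nn_integral_cmult nn_integral_multc)
  also have "\<dots> \<le> (of_nat n * of_nat n) * indicator (K n) \<eta>"
   by (cases "\<eta> \<in> K n") (auto simp: K_def intro: mult_right_mono)
  finally show "(\<integral>\<^sup>+k. indicator (K n) \<eta> * (ennreal (Pfun \<eta> k) * of_nat n) \<partial>\<mu>) \<le> (of_nat n * of_nat n) * indicator (K n) \<eta>" .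
 qed
 also have "\<dots> = (of_nat n * of_nat n) * emeasure lborel (K n)"
  by (subst nn_integral_cmult_indicator) auto
 also have "\<dots> < \<infinity>" using K_fin by (simp add: ennreal_mult_less_top of_nat_less_top)
 finally have fin: "lp_norm \<mu> (ennreal q) (\<lambda>h. min 1 (\<kappa> \<zeta>) * (ennreal (W h) * Phi h)) < \<infinity>" .
 have "min 1 (\<kappa> \<zeta>) \<noteq> \<infinity>" "min 1 (\<kappa> \<zeta>) \<noteq> 0" using \<open>\<kappa> \<zeta> \<noteq> 0\<close> by (auto simp: min_def)
 then obtain \<epsilon> where \<epsilon>: "min 1 (\<kappa> \<zeta>) = ennreal \<epsilon>" "0 < \<epsilon>"
  by (cases "min 1 (\<kappa> \<zeta>)") (auto simp: less_le)
 have Phi_m: "Phi \<in> borel_measurable \<mu>"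
  unfolding Phi_def[abs_def]
 proof (rule lborel.borel_measurable_nn_integral)
  show "(\<lambda>(h, \<xi>). ennreal (ow \<xi> ^ l * ow (dual_act h \<xi>) ^ l)) \<in> borel_measurable (\<mu> \<Otimes>\<^sub>M lborel)"
   unfolding split_beta' by (rule measurable_mu_lborel) measurable
 qed
 have WP_m: "(\<lambda>h. ennreal (W h) * Phi h) \<in> borel_measurable \<mu>"
  using W_measurable Phi_m by measurable
 have "lp_norm \<mu> (ennreal q) (\<lambda>h. ennreal (W h) * Phi h)
   = lp_norm \<mu> (ennreal q) (\<lambda>h. ennreal (1 / \<epsilon>) * (ennreal \<epsilon> * (ennreal (W h) * Phi h)))"
  using \<epsilon>(2) by (simp flip: mult.assoc ennreal_mult)
 also have "\<dots> \<le> ennreal (1 / \<epsilon>) * lp_norm \<mu> (ennreal q) (\<lambda>h. ennreal \<epsilon> * (ennreal (W h) * Phi h))"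
  using \<epsilon>(2)
  by (intro lp_norm_cmult[OF _ q_ge_1 borel_measurable_times_ennreal[OF borel_measurable_const WP_m]]) auto
 also have "\<dots> < \<infinity>" using fin by (simp add: \<epsilon>(1) ennreal_mult_less_top)
 finally show ?thesis .
qed

end

lemma nn_integral_inverse_power_real:
 assumes b: "1 < b"
 shows "(\<integral>\<^sup>+t. ennreal ((1 + \<bar>t\<bar>) powr (- b)) \<partial>(lborel :: real measure)) < \<infinity>"
proof -
 let ?f = "\<lambda>t::real. (1 + \<bar>t\<bar>) powr (- b)"
 define I where "I = (\<integral>\<^sup>+t. ennreal (?f t) * indicator {0..} t \<partial>lborel)"
 have "I = (\<integral>\<^sup>+t. ennreal ((1 + t) powr (- b)) * indicator {0..} t \<partial>lborel)"
  unfolding I_def by (intro nn_integral_cong) (auto simp: indicator_def)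
 also have "\<dots> = ennreal (0 - - (1 / (b - 1)) * (1 + 0) powr (1 - b))"
 proof (rule nn_integral_FTC_atLeast)
  show "((\<lambda>t. - (1 / (b - 1)) * (1 + t) powr (1 - b)) has_real_derivative (1 + t) powr (- b)) (at t)" if "0 \<le> t" for t
  proof -
   have "((\<lambda>t. - (1 / (b - 1)) * (1 + t) powr (1 - b)) has_real_derivative
     - (1 / (b - 1)) * ((1 - b) * (1 + t) powr (1 - b - 1))) (at t)"
    using that b by (auto intro!: derivative_eq_intros)
   moreover have "- (1 / (b - 1)) * ((1 - b) * x) = x" for x
   proof -
    have "(1 - b) * x = - ((b - 1) * x)" by (simp add: algebra_simps)
    then show ?thesis using b by simp
   qed
   ultimately show ?thesis by simp
  qed
  have "((\<lambda>t. (1 + t) powr (1 - b)) \<longlongrightarrow> 0) at_top"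
   using b by (intro tendsto_neg_powr filterlim_tendsto_add_at_top[OF tendsto_const filterlim_ident]) auto
  then have "((\<lambda>t. - (1 / (b - 1)) * (1 + t) powr (1 - b)) \<longlongrightarrow> - (1 / (b - 1)) * 0) at_top"
   by (intro tendsto_mult tendsto_const)
  then show "((\<lambda>t. - (1 / (b - 1)) * (1 + t) powr (1 - b)) \<longlongrightarrow> 0) at_top" by simp
 qed auto
 finally have I: "I < \<infinity>" by simp
 have "(\<integral>\<^sup>+t. ennreal (?f t) \<partial>lborel) \<le> (\<integral>\<^sup>+t. ennreal (?f t) * indicator {0..} t + ennreal (?f t) * indicator {0..} (- t) \<partial>lborel)"
  by (intro nn_integral_mono) (auto simp: indicator_def)
 also have "\<dots> = I + (\<integral>\<^sup>+t. ennreal (?f t) * indicator {0..} (- t) \<partial>lborel)"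
  unfolding I_def by (rule nn_integral_add) measurable
 also have "(\<integral>\<^sup>+t. ennreal (?f t) * indicator {0..} (- t) \<partial>lborel) = I"
  unfolding I_def by (subst (2) nn_integral_real_affine[of _ "-1" 0]) auto
 finally show ?thesis using I by (simp add: le_less_trans ennreal_add_less_top)
qed

lemma nn_integral_inverse_power:
 assumes a: "real CARD('d) < a"
 shows "(\<integral>\<^sup>+x. ennreal ((1 + norm x) powr (- a)) \<partial>(lborel :: (real^'d) measure)) < \<infinity>"
proof -
 let ?n = "real CARD('d)"
 have n: "0 < ?n" by simp
 have le: "(1 + norm x) powr (- a) \<le> (\<Prod>i\<in>UNIV. (1 + \<bar>x $ i\<bar>) powr (- (a / ?n)))" for x :: "real^'d"
 proof -
  have "(1 + norm x) powr (- a) = (\<Prod>i\<in>(UNIV::'d set). (1 + norm x) powr (- (a / ?n)))"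
  proof -
   have "0 < 1 + norm x" by (simp add: add_pos_nonneg)
   then show ?thesis using n by (simp add: powr_realpow[symmetric] powr_powr)
  qed
  also have "\<dots> \<le> (\<Prod>i\<in>UNIV. (1 + \<bar>x $ i\<bar>) powr (- (a / ?n)))"
   using component_le_norm_cart[of x] a n by (intro prod_mono conjI powr_mono2') auto
  finally show ?thesis .
 qed
 have "(\<integral>\<^sup>+x. ennreal ((1 + norm x) powr (- a)) \<partial>(lborel :: (real^'d) measure))
   \<le> (\<integral>\<^sup>+x. (\<Prod>i\<in>UNIV. ennreal ((1 + \<bar>x $ i\<bar>) powr (- (a / ?n)))) \<partial>(lborel :: (real^'d) measure))"
  by (intro nn_integral_mono) (auto simp: prod_ennreal intro!: ennreal_leI le)
 also have "\<dots> = (\<Prod>i\<in>(UNIV::'d set). \<integral>\<^sup>+t. ennreal ((1 + \<bar>t\<bar>) powr (- (a / ?n))) \<partial>lborel)"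
  by (rule nn_integral_prod_vec) measurable
 also have "\<dots> < \<infinity>"
  using nn_integral_inverse_power_real[of "a / ?n"] a n by (simp add: power_less_top_ennreal)
 finally show ?thesis .
qed

context temperate_orbit
begin

lemma Phi_measurable: "Phi \<in> borel_measurable \<mu>"
 unfolding Phi_def
 by (rule lborel.borel_measurable_nn_integral) (simp add: split_beta', rule measurable_mu_lborel, measurable)

lemma AE_Phi_finite: "AE h in \<mu>. Phi h < \<infinity>"
proof -
 have q0: "0 < q" using q by simp
 have WP_m: "(\<lambda>h. ennreal (W h) * Phi h) \<in> borel_measurable \<mu>" using W_measurable Phi_measurable by measurable
 have "(\<integral>\<^sup>+h. epow (ennreal (W h) * Phi h) q \<partial>\<mu>) \<noteq> \<infinity>"
  using Phi_finite q0 by (simp add: lp_norm_ennreal epow_less_top less_top)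
 then have "AE h in \<mu>. epow (ennreal (W h) * Phi h) q \<noteq> \<infinity>"
  by (intro nn_integral_noteq_infinite epow_measurable WP_m)
 then show ?thesis using AE_space
 proof eventually_elim
  case (elim h)
  then have "ennreal (W h) \<noteq> 0" using W_pos[of h] by (simp add: space_mu)
  then show ?case using elim by (cases "Phi h = \<infinity>") (auto simp: less_top)
 qed
qed

definition size :: "real^'d^'d => real" where
 "size h = (1 + norm h) * (1 + norm (matrix_inv h))"

lemma size_ge_1: "1 \<le> size h"
 using mult_mono[of 1 "1 + norm h" 1 "1 + norm (matrix_inv h)"] by (simp add: size_def)

text \<open>The action of \<open>h\<close> maps the complement of the orbit to itself, so it distorts the distance at most by the norms of \<open>h\<close> and its inverse.\<close>

lemma ow_lower_bound:
 assumes h: "h \<in> H"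
 shows "ow \<xi> / size h \<le> ow (dual_act h \<xi>)"
proof -
 let ?\<delta> = "infdist \<xi> (- Orb)" and ?\<delta>' = "infdist (dual_act h \<xi>) (- Orb)" and ?N = "norm (matrix_inv h)"
 obtain \<eta> where \<eta>: "\<eta> \<in> - Orb" "?\<delta>' = norm (dual_act h \<xi> - \<eta>)"
  using infdist_attains_inf[OF compl_Orb, of "dual_act h \<xi>"] by (auto simp: dist_norm)
 have "dual_act (matrix_inv h) \<eta> \<in> - Orb" using \<eta>(1) act_Orb[OF inv_H[OF h]] by simp
 then have "?\<delta> \<le> norm (\<xi> - dual_act (matrix_inv h) \<eta>)" by (simp add: infdist_le2 dist_norm)
 also have "\<xi> - dual_act (matrix_inv h) \<eta> = dual_act (matrix_inv h) (dual_act h \<xi> - \<eta>)"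
  by (simp add: matrix_vector_mult_diff_distrib dual_act_inv h)
 also have "norm \<dots> \<le> ?N * ?\<delta>'"
  using norm_matrix_vector_mult_le[of "transpose (matrix_inv h)"] by (simp add: \<eta>(2) norm_transpose)
 finally have "?\<delta> \<le> (1 + ?N) * ?\<delta>'" using infdist_nonneg[of "dual_act h \<xi>" "- Orb"] by (simp add: algebra_simps)
 then have "min 1 ?\<delta> \<le> (1 + ?N) * min 1 ?\<delta>'"
 proof (cases "1 \<le> ?\<delta>'")
  case True
  have "min 1 ?\<delta> \<le> 1 + ?N" by (rule min.coboundedI1) simp
  then show ?thesis using True by simp
 next
  case False
  then show ?thesis using \<open>?\<delta> \<le> (1 + ?N) * ?\<delta>'\<close> by (simp add: min.coboundedI2)
 qed
 moreover have "1 + norm (dual_act h \<xi>) \<le> (1 + norm h) * (1 + norm \<xi>)"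
  using norm_matrix_vector_mult_le[of "transpose h" \<xi>] by (simp add: norm_transpose algebra_simps add_increasing)
 ultimately have "min 1 ?\<delta> * (1 + norm (dual_act h \<xi>)) \<le> ((1 + ?N) * min 1 ?\<delta>') * ((1 + norm h) * (1 + norm \<xi>))"
  by (intro mult_mono) (auto simp: infdist_nonneg)
 then have "min 1 ?\<delta> * (1 + norm (dual_act h \<xi>)) \<le> min 1 ?\<delta>' * ((1 + norm \<xi>) * size h)"
  by (simp only: size_def mult_ac)
 moreover have "0 < (1 + norm \<xi>) * size h" "0 < 1 + norm (dual_act h \<xi>)"
  using size_ge_1[of h] by (auto simp: add_pos_nonneg intro!: mult_pos_pos)
 ultimately have "min 1 ?\<delta> / ((1 + norm \<xi>) * size h) \<le> min 1 ?\<delta>' / (1 + norm (dual_act h \<xi>))"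
  by (simp only: pos_divide_le_eq pos_le_divide_eq times_divide_eq_left)
 then show ?thesis by (simp only: orbit_weight_def divide_divide_eq_left)
qed

end

section \<open>Decay of the transform with a band-limited window\<close>

lemma integral_line_derivative_eq_0:
 fixes u u' :: "real^'d => complex"
 assumes u: "continuous_on UNIV u" and u': "continuous_on UNIV u'"
  and supp: "\<And>x. R < norm x ==> u x = 0" "\<And>x. R < norm x ==> u' x = 0"
  and der: "\<And>x \<tau>. ((\<lambda>\<tau>. u (x + \<tau> *\<^sub>R e)) has_vector_derivative u' (x + \<tau> *\<^sub>R e)) (at \<tau>)"
 shows "(\<integral>x. u' x \<partial>lborel) = 0"
proof -
 obtain b :: "real^'d" where b: "cball 0 (R + norm e) \<subseteq> cbox (- b) b"
  using bounded_subset_cbox_symmetric[OF bounded_cball] by blast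
 have far: "R < norm (x + \<tau> *\<^sub>R e)" if "\<tau> \<in> {0..1}" "x \<notin> cbox (- b) b" for x \<tau>
 proof -
  have "R + norm e < norm x" using that b by (auto simp: subset_iff not_le[symmetric])
  moreover have "norm x \<le> norm (x + \<tau> *\<^sub>R e) + norm (\<tau> *\<^sub>R e)"
   using norm_triangle_ineq4[of "x + \<tau> *\<^sub>R e" "\<tau> *\<^sub>R e"] by simp
  moreover have "norm (\<tau> *\<^sub>R e) \<le> 1 * norm e" using that by (simp only: norm_scaleR) (intro mult_right_mono; simp)
  ultimately show ?thesis by linarith
 qed
 have int: "integrable lborel u"
  using far[of 0] supp(1) by (intro integrable_continuous_compact_support[OF u, of "- b" b]) simp
 have "(\<integral>x. integral {0..1} (\<lambda>\<tau>. u' (x + \<tau> *\<^sub>R e)) \<partial>lborel) = (\<integral>x. u (x + e) - u x \<partial>lborel)"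
 proof (intro Bochner_cong refl)
  fix x
  have "((\<lambda>\<tau>. u' (x + \<tau> *\<^sub>R e)) has_integral u (x + 1 *\<^sub>R e) - u (x + 0 *\<^sub>R e)) {0..1}"
   using der by (intro fundamental_theorem_of_calculus) (auto intro: has_vector_derivative_at_within)
  then show "integral {0..1} (\<lambda>\<tau>. u' (x + \<tau> *\<^sub>R e)) = u (x + e) - u x" by (simp add: integral_unique)
 qed
 also have "\<dots> = 0" using int by (simp add: integral_shift_axis)
 also have "(\<integral>x. integral {0..1} (\<lambda>\<tau>. u' (x + \<tau> *\<^sub>R e)) \<partial>lborel) = integral {0..1} (\<lambda>\<tau>. \<integral>x. u' (x + \<tau> *\<^sub>R e) \<partial>lborel)"
 proof (rule Fubini_compact_support)
  show "continuous_on UNIV (\<lambda>z. u' (snd z + fst z *\<^sub>R e))"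
   by (rule continuous_on_compose2[OF u']) (auto intro!: continuous_intros)
  show "u' (x + \<tau> *\<^sub>R e) = 0" if "\<tau> \<in> {0..1}" "x \<notin> cbox (- b) b" for \<tau> x
   using far[OF that] supp(2) by blast
 qed
 also have "\<dots> = (\<integral>x. u' x \<partial>lborel)" by (simp add: integral_shift_axis)
 finally show ?thesis .
qed

text \<open>Integration by parts: each factor \<open>2\<pi>x\<^sub>i\<close> is absorbed by one derivative of the amplitude, which
 the product rule distributes over the two factors.\<close>

lemma oscillatory_integral_decay:
 fixes \<kappa> G :: "nat => real^'d => complex" and x :: "real^'d"
 assumes \<kappa>: "\<And>j. j \<le> m ==> continuous_on UNIV (\<kappa> j)" and G: "\<And>j. j \<le> m ==> continuous_on UNIV (G j)"
  and supp: "\<And>j \<xi>. j \<le> m ==> R < norm \<xi> ==> G j \<xi> = 0"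
  and der_\<kappa>: "\<And>j \<xi> \<tau>. j < m ==> ((\<lambda>\<tau>. \<kappa> j (\<xi> + \<tau> *\<^sub>R axis i 1)) has_vector_derivative \<kappa> (Suc j) (\<xi> + \<tau> *\<^sub>R axis i 1)) (at \<tau>)"
  and der_G: "\<And>j \<xi> \<tau>. j < m ==> ((\<lambda>\<tau>. G j (\<xi> + \<tau> *\<^sub>R axis i 1)) has_vector_derivative G (Suc j) (\<xi> + \<tau> *\<^sub>R axis i 1)) (at \<tau>)"
  and I: "\<And>a b. a + b \<le> m ==> (\<integral>\<xi>. norm (\<kappa> a \<xi> * G b \<xi>) \<partial>lborel) \<le> I"
 shows "n + a + b \<le> m ==> \<bar>2 * pi * x $ i\<bar> ^ n * norm (\<integral>\<xi>. \<kappa> a \<xi> * G b \<xi> * cis (2 * pi * (x \<bullet> \<xi>)) \<partial>lborel) \<le> 2 ^ n * I"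
proof (induction n arbitrary: a b)
 case 0
 have "norm (\<integral>\<xi>. \<kappa> a \<xi> * G b \<xi> * cis (2 * pi * (x \<bullet> \<xi>)) \<partial>lborel) \<le> (\<integral>\<xi>. norm (\<kappa> a \<xi> * G b \<xi> * cis (2 * pi * (x \<bullet> \<xi>))) \<partial>lborel)"
  by (rule integral_norm_bound)
 then show ?case using I[of a b] 0 by (simp add: norm_mult)
next
 case (Suc n)
 let ?e = "axis i 1 :: real^'d" and ?c = "\<lambda>\<xi>. cis (2 * pi * (x \<bullet> \<xi>))"
 let ?J = "\<lambda>a b. \<integral>\<xi>. \<kappa> a \<xi> * G b \<xi> * ?c \<xi> \<partial>lborel"
 have a: "a < m" "b < m" using Suc.prems by auto
 obtain B :: "real^'d" where B: "cball 0 R \<subseteq> cbox (- B) B"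
  using bounded_subset_cbox_symmetric[OF bounded_cball] by blast
 have cont: "continuous_on UNIV (\<lambda>\<xi>. \<kappa> a \<xi> * G b \<xi> * ?c \<xi>)" if "a \<le> m" "b \<le> m" for a b
  using \<kappa>[OF that(1)] G[OF that(2)] by (intro continuous_intros)
 have int: "integrable lborel (\<lambda>\<xi>. \<kappa> a \<xi> * G b \<xi> * ?c \<xi>)" if "a \<le> m" "b \<le> m" for a b
 proof (rule integrable_continuous_compact_support[OF cont[OF that], of "- B" B])
  fix \<xi> assume "\<xi> \<notin> cbox (- B) B"
  then have "R < norm \<xi>" using B by (auto simp: subset_iff not_le[symmetric])
  then show "\<kappa> a \<xi> * G b \<xi> * ?c \<xi> = 0" using supp[OF that(2)] by simp
 qed
 let ?u' = "\<lambda>\<xi>. \<kappa> (Suc a) \<xi> * G b \<xi> * ?c \<xi> + \<kappa> a \<xi> * G (Suc b) \<xi> * ?c \<xi> + \<i> * of_real (2 * pi * x $ i) * (\<kappa> a \<xi> * G b \<xi> * ?c \<xi>)"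
 have "(\<integral>\<xi>. ?u' \<xi> \<partial>lborel) = 0"
 proof (rule integral_line_derivative_eq_0)
  show "continuous_on UNIV (\<lambda>\<xi>. \<kappa> a \<xi> * G b \<xi> * ?c \<xi>)" using a by (intro cont) auto
  show "continuous_on UNIV ?u'" using a by (intro continuous_on_add cont continuous_on_mult continuous_on_const) auto
  show "\<kappa> a \<xi> * G b \<xi> * ?c \<xi> = 0" "?u' \<xi> = 0" if "R < norm \<xi>" for \<xi> using supp[OF _ that] a by auto
  fix \<xi> \<tau>
  let ?z = "\<xi> + \<tau> *\<^sub>R ?e"
  have xe: "x \<bullet> (\<xi> + \<tau> *\<^sub>R ?e) = x \<bullet> \<xi> + \<tau> * x $ i" for \<tau>
   by (simp add: inner_add_right inner_axis)
  have "((\<lambda>\<tau>. exp (\<i> * of_real (2 * pi * (x \<bullet> \<xi>)) + of_real \<tau> * (\<i> * of_real (2 * pi * x $ i)))) has_vector_derivative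
    \<i> * of_real (2 * pi * x $ i) * exp (\<i> * of_real (2 * pi * (x \<bullet> \<xi>)) + of_real \<tau> * (\<i> * of_real (2 * pi * x $ i)))) (at \<tau>)"
   by (rule has_vector_derivative_real_field) (auto intro!: derivative_eq_intros)
  then have c: "((\<lambda>\<tau>. ?c (\<xi> + \<tau> *\<^sub>R ?e)) has_vector_derivative \<i> * of_real (2 * pi * x $ i) * ?c ?z) (at \<tau>)"
   by (simp add: cis_conv_exp xe inner_axis algebra_simps)
  have "((\<lambda>\<tau>. \<kappa> a (\<xi> + \<tau> *\<^sub>R ?e) * G b (\<xi> + \<tau> *\<^sub>R ?e) * ?c (\<xi> + \<tau> *\<^sub>R ?e)) has_vector_derivative
    \<kappa> a ?z * G b ?z * (\<i> * of_real (2 * pi * x $ i) * ?c ?z) + (\<kappa> a ?z * G (Suc b) ?z + \<kappa> (Suc a) ?z * G b ?z) * ?c ?z) (at \<tau>)"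
   by (intro has_vector_derivative_mult der_\<kappa> der_G c a)
  then show "((\<lambda>\<tau>. \<kappa> a (\<xi> + \<tau> *\<^sub>R ?e) * G b (\<xi> + \<tau> *\<^sub>R ?e) * ?c (\<xi> + \<tau> *\<^sub>R ?e)) has_vector_derivative ?u' ?z) (at \<tau>)"
   by (simp add: algebra_simps)
 qed
 then have "?J (Suc a) b + ?J a (Suc b) + \<i> * of_real (2 * pi * x $ i) * ?J a b = 0"
  using a int[of "Suc a" b] int[of a "Suc b"] int[of a b] by simp
 then have "\<i> * of_real (2 * pi * x $ i) * ?J a b = - (?J (Suc a) b + ?J a (Suc b))"
  by (simp only: add_eq_0_iff)
 then have "norm (\<i> * of_real (2 * pi * x $ i) * ?J a b) = norm (?J (Suc a) b + ?J a (Suc b))"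
  by (simp only: norm_minus_cancel)
 then have "\<bar>2 * pi * x $ i\<bar> * norm (?J a b) \<le> norm (?J (Suc a) b) + norm (?J a (Suc b))"
  using norm_triangle_ineq[of "?J (Suc a) b" "?J a (Suc b)"] by (simp add: norm_mult abs_mult)
 then have "\<bar>2 * pi * x $ i\<bar> ^ n * (\<bar>2 * pi * x $ i\<bar> * norm (?J a b)) \<le> \<bar>2 * pi * x $ i\<bar> ^ n * (norm (?J (Suc a) b) + norm (?J a (Suc b)))"
  by (rule mult_left_mono) auto
 also have "\<dots> \<le> 2 ^ n * I + 2 ^ n * I"
  using Suc.IH[of "Suc a" b] Suc.IH[of a "Suc b"] Suc.prems unfolding distrib_left by (intro add_mono) auto
 finally show ?case by (simp add: mult_ac)
qed

text \<open>All derivatives along one line, up to order \<open>m\<close>, as a single family. The direction \<open>y = h\<^sup>T e\<^sub>i\<close>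
 depends on \<open>h\<close>, so the bound has to be uniform up to polynomial growth in \<open>y\<close>.\<close>

definition derivative_tower :: "nat => real => (real^'d) set => real^'d => (nat => real^'d => complex) => bool" where
 "derivative_tower m B K y g \<longleftrightarrow>
  (\<forall>j\<le>m. continuous_on UNIV (g j) \<and> (\<forall>x. norm (g j x) \<le> B * indicator K x)) \<and>
  (\<forall>j<m. \<forall>x \<tau>. ((\<lambda>\<tau>. g j (x + \<tau> *\<^sub>R y)) has_vector_derivative g (Suc j) (x + \<tau> *\<^sub>R y)) (at \<tau>))"

lemma derivative_towerD:
 assumes "derivative_tower m B K y g"
 shows "j \<le> m ==> continuous_on UNIV (g j)" "j \<le> m ==> norm (g j x) \<le> B * indicator K x"
  "j < m ==> ((\<lambda>\<tau>. g j (x + \<tau> *\<^sub>R y)) has_vector_derivative g (Suc j) (x + \<tau> *\<^sub>R y)) (at \<tau>)"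
 using assms unfolding derivative_tower_def by blast+

lemma tensor_line_derivatives:
 fixes a b :: "real^'d"
 assumes "u \<in> box_test a b"
 shows "\<exists>C\<ge>0. \<forall>y. \<exists>g. g 0 = tensor u \<and> derivative_tower m (C * (1 + norm y) ^ m) (cbox a b) y g"
 using assms
proof (induction m arbitrary: u)
 case 0
 obtain B where B: "0 \<le> B" "\<And>x. norm (tensor u x) \<le> B * indicator (cbox a b) x" using tensor_bounded[OF 0] by blast
 then have "derivative_tower 0 (B * (1 + norm y) ^ 0) (cbox a b) y (\<lambda>_. tensor u)" for y
  using tensor_continuous[of u UNIV, OF box_testD(1)[OF 0]] by (simp add: derivative_tower_def)
 with B(1) show ?case by (intro exI[of _ B] conjI allI exI[of _ "\<lambda>_. tensor u"]) simp_all
next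
 case (Suc m)
 obtain B where B: "0 \<le> B" "\<And>x. norm (tensor u x) \<le> B * indicator (cbox a b) x" using tensor_bounded[OF Suc.prems] by blast
 have sm: "\<And>i. u i \<in> smooth1" using box_testD(1)[OF Suc.prems] .
 have "\<forall>i. \<exists>C\<ge>0. \<forall>y. \<exists>g. g 0 = tensor (u(i := deriv (u i))) \<and> derivative_tower m (C * (1 + norm y) ^ m) (cbox a b) y g"
  using Suc.IH[OF box_test_deriv[OF Suc.prems]] by blast
 then obtain C where C: "\<And>i. 0 \<le> C i" "\<And>i y. \<exists>g. g 0 = tensor (u(i := deriv (u i))) \<and>
   derivative_tower m (C i * (1 + norm y) ^ m) (cbox a b) y g"
  by metis
 let ?C = "B + (\<Sum>i\<in>UNIV. C i)"
 have C0: "0 \<le> (\<Sum>i\<in>UNIV. C i)" using C(1) by (simp add: sum_nonneg)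
 have "\<exists>g. g 0 = tensor u \<and> derivative_tower (Suc m) (?C * (1 + norm y) ^ Suc m) (cbox a b) y g" for y
 proof -
  obtain g where g: "\<And>i. g i 0 = tensor (u(i := deriv (u i)))"
    "\<And>i. derivative_tower m (C i * (1 + norm y) ^ m) (cbox a b) y (g i)"
   using C(2)[of _ y] by metis
  note g0 = g(1) and gc = derivative_towerD(1)[OF g(2)] and gb = derivative_towerD(2)[OF g(2)]
   and gd = derivative_towerD(3)[OF g(2)]
  define G where "G j = (case j of 0 => tensor u | Suc j => (\<lambda>x. \<Sum>i\<in>UNIV. complex_of_real (y $ i) * g i j x))" for j
  have G: "G 0 = tensor u" "\<And>j. G (Suc j) = (\<lambda>x. \<Sum>i\<in>UNIV. complex_of_real (y $ i) * g i j x)"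
   by (auto simp: G_def)
  have cont: "continuous_on UNIV (G j)" if "j \<le> Suc m" for j
   using that tensor_continuous[of u UNIV, OF sm] gc by (cases j) (auto simp: G intro!: continuous_intros)
  have bnd: "norm (G j x) \<le> ?C * (1 + norm y) ^ Suc m * indicator (cbox a b) x" if j: "j \<le> Suc m" for j x
  proof (cases j)
   case 0
   have "1 \<le> (1 + norm y) ^ Suc m" by (rule one_le_power) simp
   then have "B * 1 \<le> ?C * (1 + norm y) ^ Suc m" using B(1) C0 by (intro mult_mono) auto
   then have "B * indicator (cbox a b) x \<le> ?C * (1 + norm y) ^ Suc m * indicator (cbox a b) x"
    by (intro mult_right_mono) auto
   with B(2)[of x] show ?thesis by (simp add: 0 G)
  next
   case (Suc k)
   have "norm (G j x) \<le> (\<Sum>i\<in>UNIV. norm (complex_of_real (y $ i) * g i k x))" by (simp add: Suc G norm_sum)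
   also have "\<dots> \<le> (\<Sum>i\<in>UNIV. (1 + norm y) * (C i * (1 + norm y) ^ m * indicator (cbox a b) x))"
   proof (intro sum_mono)
    fix i
    have "\<bar>y $ i\<bar> \<le> 1 + norm y" using component_le_norm_cart[of y i] by simp
    then show "norm (complex_of_real (y $ i) * g i k x) \<le> (1 + norm y) * (C i * (1 + norm y) ^ m * indicator (cbox a b) x)"
     using gb[of k i x] j Suc by (simp only: norm_mult norm_of_real) (intro mult_mono; simp)
   qed
   also have "\<dots> = (\<Sum>i\<in>UNIV. C i) * (1 + norm y) ^ Suc m * indicator (cbox a b) x"
    unfolding sum_distrib_right by (intro sum.cong refl) (simp add: mult_ac)
   also have "\<dots> \<le> ?C * (1 + norm y) ^ Suc m * indicator (cbox a b) x"
    using B(1) by (intro mult_right_mono) auto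
   finally show ?thesis .
  qed
  have der: "((\<lambda>\<tau>. G j (x + \<tau> *\<^sub>R y)) has_vector_derivative G (Suc j) (x + \<tau> *\<^sub>R y)) (at \<tau>)" if j: "j < Suc m" for j x \<tau>
  proof (cases j)
   case 0
   then show ?thesis using tensor_line_derivative[of u x y \<tau>, OF sm] by (simp add: G g0)
  next
   case (Suc k)
   then show ?thesis
    using j unfolding Suc G by (intro has_vector_derivative_sum has_vector_derivative_mult_right gd) auto
  qed
  have "derivative_tower (Suc m) (?C * (1 + norm y) ^ Suc m) (cbox a b) y G"
   unfolding derivative_tower_def using cont bnd der by blast
  with G(1) show ?thesis by blast
 qed
 moreover have "0 \<le> ?C" using B(1) C0 by simp
 ultimately show ?case by blast
qed

text \<open>The wavelet transform of \<open>f\<close>, in terms of the Fourier transforms \<open>F\<close> of \<open>f\<close> and \<open>\<phi>\<close> of the window.\<close>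

definition dual_wavelet :: "(real^'d => complex) => (real^'d => complex) => real^'d => real^'d^'d => complex" where
 "dual_wavelet F \<phi> x h =
  complex_of_real (sqrt \<bar>det h\<bar>) * (\<integral>\<xi>. F \<xi> * cnj (\<phi> (dual_act h \<xi>)) * cis (2 * pi * (x \<bullet> \<xi>)) \<partial>lborel)"

lemma (in dual_orbit) dual_wavelet_measurable:
 assumes [measurable]: "F \<in> borel_measurable borel" "\<phi> \<in> borel_measurable borel"
 shows "(\<lambda>z. dual_wavelet F \<phi> (fst z) (snd z)) \<in> borel_measurable (leb_mu)"
proof (rule measurable_lborel_mu)
 have "(\<lambda>z. \<integral>\<xi>. F \<xi> * cnj (\<phi> (dual_act (snd z) \<xi>)) * cis (2 * pi * (fst z \<bullet> \<xi>)) \<partial>lborel)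
   \<in> borel_measurable (borel \<Otimes>\<^sub>M (borel :: (real^'d^'d) measure))"
  by (rule lborel.borel_measurable_lebesgue_integral) measurable
 then show "(\<lambda>z. dual_wavelet F \<phi> (fst z) (snd z)) \<in> borel_measurable (borel \<Otimes>\<^sub>M borel)"
  unfolding dual_wavelet_def by measurable
qed

lemma norm_le_card_max_component:
 fixes x :: "real^'d"
 obtains i where "norm x \<le> real CARD('d) * \<bar>x $ i\<bar>"
proof -
 obtain i where i: "\<And>j. \<bar>x $ j\<bar> \<le> \<bar>x $ i\<bar>"
 proof -
  have "Max (range (\<lambda>j. \<bar>x $ j\<bar>)) \<in> range (\<lambda>j. \<bar>x $ j\<bar>)" by (intro Max_in) auto
  then obtain i where "Max (range (\<lambda>j. \<bar>x $ j\<bar>)) = \<bar>x $ i\<bar>" by (rule rangeE)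
  moreover have "\<bar>x $ j\<bar> \<le> Max (range (\<lambda>j. \<bar>x $ j\<bar>))" for j by (intro Max_ge) auto
  ultimately show thesis using that by metis
 qed
 have "norm x \<le> (\<Sum>j\<in>UNIV. \<bar>x $ j\<bar>)" by (rule norm_le_l1_cart)
 also have "\<dots> \<le> (\<Sum>j\<in>(UNIV::'d set). \<bar>x $ i\<bar>)" by (intro sum_mono i)
 finally show thesis using that by simp
qed

context temperate_orbit
begin

text \<open>Decay of the transform with a band-limited window: \<open>m\<close> integrations by parts give \<open>\<bar>x\<bar>\<^sup>-\<^sup>m\<close> at the cost of
 \<open>(1 + \<parallel>h\<parallel>)\<^sup>m\<close>, and the derivatives that are left still vanish to order \<open>l\<close> on the complement of the orbit.\<close>

lemma dual_wavelet_decay: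
 fixes f :: "real^'d => complex" and a b :: "real^'d"
 assumes f: "integrable lborel f" and mom: "vanishing_moments (- Orb) r f"
  and decay: "schwartz_norm (real r) (real r) (fourier f) < \<infinity>" and m: "m + l \<le> r"
  and u: "u \<in> box_test a b" and ab: "cbox a b \<subseteq> Orb"
 obtains C where "0 \<le> C" "\<And>x h. h \<in> H ==> Phi h < \<infinity> ==>
  ennreal ((1 + norm x) ^ m * norm (dual_wavelet (fourier f) (tensor u) x h))
   \<le> ennreal (C * sqrt \<bar>det h\<bar> * (1 + norm h) ^ m) * Phi h"
proof -
 obtain k C1 where C1: "0 \<le> C1" and k0: "k (\<lambda>_. 0) = fourier f"
  and kc: "\<And>\<alpha>. mi_order \<alpha> \<le> r ==> continuous_on UNIV (k \<alpha>)"
  and kd: "\<And>\<alpha> i x t. mi_order \<alpha> < r ==> ((\<lambda>t. k \<alpha> (x + t *\<^sub>R axis i 1)) has_vector_derivative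
    k (\<alpha>(i := Suc (\<alpha> i))) (x + t *\<^sub>R axis i 1)) (at t)"
  and kb: "\<And>\<alpha> j \<xi>. mi_order \<alpha> + j \<le> r ==> norm (k \<alpha> \<xi>) \<le> C1 * ow \<xi> ^ j"
  by (rule fourier_moment_decay[OF f mom compl_Orb decay]) blast
 obtain C2 where C2: "0 \<le> C2" and win: "\<And>y. \<exists>g. g 0 = tensor u \<and>
   derivative_tower m (C2 * (1 + norm y) ^ m) (cbox a b) y g"
  using tensor_line_derivatives[OF u, of m] by blast
 obtain C3 where C3: "0 \<le> C3" "\<And>\<zeta>. indicator (cbox a b) \<zeta> \<le> C3 * ow \<zeta> ^ l"
 proof (cases "cbox a b = {}")
  case True
  then show thesis by (intro that[of 0]) auto
 next
  case False
  have "continuous_on (cbox a b) (orbit_weight (- Orb))"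
   unfolding orbit_weight_def[abs_def] by (intro continuous_intros) (auto simp: add_nonneg_eq_0_iff)
  then obtain \<zeta>0 where z: "\<zeta>0 \<in> cbox a b" "\<And>\<zeta>. \<zeta> \<in> cbox a b ==> ow \<zeta>0 \<le> ow \<zeta>"
   using continuous_attains_inf[OF compact_cbox False] by blast
  then have "0 < ow \<zeta>0" using ab by (auto intro: ow_pos)
  then have "1 \<le> (1 / ow \<zeta>0 ^ l) * ow \<zeta> ^ l" if "\<zeta> \<in> cbox a b" for \<zeta>
   using power_mono[OF z(2)[OF that], of l] by simp
  then show thesis using \<open>0 < ow \<zeta>0\<close> by (intro that[of "1 / ow \<zeta>0 ^ l"]) (auto simp: indicator_def)
 qed
 define C where "C = 2 ^ m * (1 + real CARD('d) ^ m) * (2 ^ m * (C1 * C2 * C3))"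
 have "ennreal ((1 + norm x) ^ m * norm (dual_wavelet (fourier f) (tensor u) x h))
   \<le> ennreal (C * sqrt \<bar>det h\<bar> * (1 + norm h) ^ m) * Phi h" if h: "h \<in> H" and fin: "Phi h < \<infinity>" for x h
 proof -
  define K where "K = enn2real (Phi h)"
  have K: "Phi h = ennreal K" "0 \<le> K" using fin by (auto simp: K_def less_top)
  let ?I = "C1 * C2 * C3 * (1 + norm h) ^ m * K"
  let ?J = "\<integral>\<xi>. fourier f \<xi> * cnj (tensor u (dual_act h \<xi>)) * cis (2 * pi * (x \<bullet> \<xi>)) \<partial>lborel"
  have key: "\<bar>2 * pi * x $ i\<bar> ^ n * norm ?J \<le> 2 ^ n * ?I" if n: "n \<le> m" for i n
  proof -
   let ?y = "dual_act h (axis i 1)"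
   have y: "1 + norm ?y \<le> 1 + norm h"
    using norm_matrix_vector_mult_le[of "transpose h" "axis i 1"] by (simp add: norm_transpose norm_axis_1)
   obtain g where g0: "g 0 = tensor u" and g: "derivative_tower m (C2 * (1 + norm ?y) ^ m) (cbox a b) ?y g"
    using win[of ?y] by blast
   note gc = derivative_towerD(1)[OF g] and gb = derivative_towerD(2)[OF g] and gd = derivative_towerD(3)[OF g]
   let ?\<alpha> = "\<lambda>j. (\<lambda>_. 0)(i := j)"
   have ord: "mi_order (?\<alpha> j) = j" for j by (simp add: mi_order_def sum.delta fun_upd_def)
   define \<kappa> where "\<kappa> j = k (?\<alpha> j)" for j
   define G where "G j \<xi> = cnj (g j (dual_act h \<xi>))" for j \<xi>
   obtain R0 where R0: "\<And>\<zeta>. \<zeta> \<in> cbox a b ==> norm \<zeta> \<le> R0" using bounded_cbox[of a b] by (auto simp: bounded_iff)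
   have "\<bar>2 * pi * x $ i\<bar> ^ n * norm (\<integral>\<xi>. \<kappa> 0 \<xi> * G 0 \<xi> * cis (2 * pi * (x \<bullet> \<xi>)) \<partial>lborel) \<le> 2 ^ n * ?I"
   proof (rule oscillatory_integral_decay[where m=m and R="norm (matrix_inv h) * R0"])
    show "continuous_on UNIV (\<kappa> j)" if "j \<le> m" for j
     unfolding \<kappa>_def using m that by (intro kc) (simp add: ord)
    show Gc: "continuous_on UNIV (G j)" if "j \<le> m" for j
     unfolding G_def
     by (intro continuous_intros continuous_on_compose2[OF gc[OF that]]) auto
    show "G j \<xi> = 0" if "j \<le> m" "norm (matrix_inv h) * R0 < norm \<xi>" for j \<xi>
    proof -
     have "dual_act h \<xi> \<notin> cbox a b"
     proof
      assume "dual_act h \<xi> \<in> cbox a b"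
      then have "norm (matrix_inv h) * norm (dual_act h \<xi>) \<le> norm (matrix_inv h) * R0"
       by (intro mult_left_mono R0) auto
      moreover have "norm \<xi> \<le> norm (matrix_inv h) * norm (dual_act h \<xi>)"
       using norm_matrix_vector_mult_le[of "transpose (matrix_inv h)" "dual_act h \<xi>"] h
       by (simp add: dual_act_inv norm_transpose)
      ultimately show False using that(2) by simp
     qed
     then show ?thesis using gb[OF that(1), of "dual_act h \<xi>"] by (simp add: G_def)
    qed
    show "((\<lambda>\<tau>. \<kappa> j (\<xi> + \<tau> *\<^sub>R axis i 1)) has_vector_derivative \<kappa> (Suc j) (\<xi> + \<tau> *\<^sub>R axis i 1)) (at \<tau>)"
     if "j < m" for j \<xi> \<tau>
     using kd[of "?\<alpha> j" \<xi> i \<tau>] m that by (simp add: \<kappa>_def ord)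
    show "((\<lambda>\<tau>. G j (\<xi> + \<tau> *\<^sub>R axis i 1)) has_vector_derivative G (Suc j) (\<xi> + \<tau> *\<^sub>R axis i 1)) (at \<tau>)"
     if "j < m" for j \<xi> \<tau>
     using has_vector_derivative_cnj[OF gd[OF that, of "dual_act h \<xi>" \<tau>]]
     by (simp add: G_def matrix_vector_right_distrib matrix_vector_mult_scaleR)
    show "(\<integral>\<xi>. norm (\<kappa> c \<xi> * G e \<xi>) \<partial>lborel) \<le> ?I" if ce: "c + e \<le> m" for c e
    proof -
     have pt: "norm (\<kappa> c \<xi> * G e \<xi>) \<le> (C1 * C2 * C3 * (1 + norm h) ^ m) * (ow \<xi> ^ l * ow (dual_act h \<xi>) ^ l)" for \<xi>
     proof -
      have 1: "norm (\<kappa> c \<xi>) \<le> C1 * ow \<xi> ^ l" unfolding \<kappa>_def using ce m by (intro kb) (simp add: ord)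
      have "norm (G e \<xi>) \<le> C2 * (1 + norm ?y) ^ m * indicator (cbox a b) (dual_act h \<xi>)"
       using gb[of e "dual_act h \<xi>"] ce by (simp add: G_def)
      also have "\<dots> \<le> C2 * (1 + norm h) ^ m * (C3 * ow (dual_act h \<xi>) ^ l)"
       using C2 C3 y by (intro mult_mono power_mono) auto
      finally have 2: "norm (G e \<xi>) \<le> C2 * (1 + norm h) ^ m * (C3 * ow (dual_act h \<xi>) ^ l)" .
      have "norm (\<kappa> c \<xi>) * norm (G e \<xi>) \<le> (C1 * ow \<xi> ^ l) * (C2 * (1 + norm h) ^ m * (C3 * ow (dual_act h \<xi>) ^ l))"
       using C1 by (intro mult_mono 1 2) auto
      then show ?thesis by (simp only: norm_mult mult_ac)
     qed
     have cc: "0 \<le> C1 * C2 * C3 * (1 + norm h) ^ m" using C1 C2 C3(1) by simp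
     have "(\<integral>\<^sup>+\<xi>. ennreal (norm (\<kappa> c \<xi> * G e \<xi>)) \<partial>lborel)
       \<le> (\<integral>\<^sup>+\<xi>. ennreal (C1 * C2 * C3 * (1 + norm h) ^ m) * ennreal (ow \<xi> ^ l * ow (dual_act h \<xi>) ^ l) \<partial>lborel)"
      using cc by (intro nn_integral_mono) (simp add: pt ennreal_leI flip: ennreal_mult)
     also have "\<dots> = ennreal (C1 * C2 * C3 * (1 + norm h) ^ m) * Phi h"
      unfolding Phi_def by (rule nn_integral_cmult) measurable
     also have "\<dots> = ennreal ?I" using K cc by (simp add: ennreal_mult)
     finally have "(\<integral>\<^sup>+\<xi>. ennreal (norm (\<kappa> c \<xi> * G e \<xi>)) \<partial>lborel) \<le> ennreal ?I" .
     moreover have "0 \<le> ?I" using cc K(2) by simp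
     ultimately show ?thesis by (intro integral_real_bounded)
    qed
   qed (use n in auto)
   then show ?thesis by (simp add: \<kappa>_def G_def g0 k0 fun_upd_idem)
  qed
  obtain i where i: "norm x \<le> real CARD('d) * \<bar>x $ i\<bar>" by (rule norm_le_card_max_component)
  have I0: "0 \<le> ?I" using C1 C2 C3(1) K(2) by simp
  have n0: "norm ?J \<le> ?I" using key[of 0] by simp
  have nm: "\<bar>x $ i\<bar> ^ m * norm ?J \<le> 2 ^ m * ?I"
  proof -
   have "\<bar>x $ i\<bar> \<le> \<bar>2 * pi * x $ i\<bar>"
   proof -
    have "1 * \<bar>x $ i\<bar> \<le> (2 * pi) * \<bar>x $ i\<bar>" using pi_ge_two by (intro mult_right_mono) auto
    then show ?thesis by (simp add: abs_mult)
   qed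
   then have "\<bar>x $ i\<bar> ^ m * norm ?J \<le> \<bar>2 * pi * x $ i\<bar> ^ m * norm ?J"
    by (intro mult_right_mono power_mono) auto
   then show ?thesis using key[of m i] by simp
  qed
  have "(1 + norm x) ^ m \<le> 2 ^ m * (1 + (real CARD('d) * \<bar>x $ i\<bar>) ^ m)"
  proof (cases "norm x \<le> 1")
   case True
   then have "(1 + norm x) ^ m \<le> 2 ^ m" by (intro power_mono) auto
   then show ?thesis by (simp add: distrib_left add_increasing2)
  next
   case False
   then have "(1 + norm x) ^ m \<le> (2 * (real CARD('d) * \<bar>x $ i\<bar>)) ^ m" using i by (intro power_mono) auto
   then show ?thesis unfolding power_mult_distrib[of 2] by (simp add: distrib_left add_increasing)
  qed
  then have "(1 + norm x) ^ m * norm ?J \<le> 2 ^ m * (1 + (real CARD('d) * \<bar>x $ i\<bar>) ^ m) * norm ?J"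
   by (rule mult_right_mono) auto
  also have "\<dots> = 2 ^ m * (norm ?J + real CARD('d) ^ m * (\<bar>x $ i\<bar> ^ m * norm ?J))"
   by (simp add: power_mult_distrib algebra_simps)
  also have "\<dots> \<le> 2 ^ m * (2 ^ m * ?I + real CARD('d) ^ m * (2 ^ m * ?I))"
  proof (intro mult_left_mono add_mono nm)
   have "1 * ?I \<le> 2 ^ m * ?I" using I0 by (intro mult_right_mono) auto
   with n0 show "norm ?J \<le> 2 ^ m * ?I" by linarith
  qed auto
  also have "\<dots> = C * (1 + norm h) ^ m * K" by (simp add: C_def algebra_simps)
  finally have "sqrt \<bar>det h\<bar> * ((1 + norm x) ^ m * norm ?J) \<le> sqrt \<bar>det h\<bar> * (C * (1 + norm h) ^ m * K)"
   by (rule mult_left_mono) auto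
  then have "(1 + norm x) ^ m * norm (dual_wavelet (fourier f) (tensor u) x h) \<le> (C * sqrt \<bar>det h\<bar> * (1 + norm h) ^ m) * K"
   by (simp add: dual_wavelet_def norm_mult mult_ac)
  moreover have "0 \<le> C * sqrt \<bar>det h\<bar> * (1 + norm h) ^ m" using C1 C2 C3(1) by (simp add: C_def)
  ultimately show ?thesis using K by (simp add: ennreal_leI flip: ennreal_mult)
 qed
 moreover have "0 \<le> C" using C1 C2 C3(1) by (simp add: C_def)
 ultimately show thesis using that by blast
qed

end

lemma lp_norm_power_decay:
 assumes p: "1 \<le> p" and m: "s + enn2real (of_nat CARD('d) / p) < m"
 shows "lp_norm lborel p (\<lambda>x::real^'d. ennreal ((1 + norm x) powr (s - m))) < \<infinity>"
 using p
proof (cases rule: exponent_cases)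
 case 1
 have "(1 + norm x) powr (s - m) \<le> 1" for x :: "real^'d"
  using m powr_mono[of "s - m" 0 "1 + norm x"] by (auto simp: 1 split: if_splits)
 then have "esssup lborel (\<lambda>x::real^'d. ennreal ((1 + norm x) powr (s - m))) \<le> 1"
  by (intro esssup_I) (auto simp: ennreal_le_1)
 then show ?thesis unfolding 1 lp_norm_top by (rule order_le_less_trans) simp
next
 case (2 r)
 have "of_nat CARD('d) / p = ennreal (real CARD('d) / r)"
  using 2 by (simp add: divide_ennreal ennreal_of_nat_eq_real_of_nat)
 then have "real CARD('d) / r < m - s" using m 2 by simp
 then have "real CARD('d) < (m - s) * r" using 2 by (simp add: pos_divide_less_eq)
 from nn_integral_inverse_power[OF this] have "(\<integral>\<^sup>+x. ennreal ((1 + norm x) powr ((s - m) * r)) \<partial>(lborel :: (real^'d) measure)) < \<infinity>"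
  by (simp add: algebra_simps)
 then show ?thesis
  using 2 by (simp add: lp_norm_ennreal epow_ennreal epow_less_top powr_powr)
qed

lemma lp_norm_density_det:
 fixes \<mu> :: "(real^'d^'d) measure"
 assumes q: "1 \<le> q" and sets: "sets \<mu> = sets (restrict_space borel H)"
  and g [measurable]: "g \<in> borel_measurable \<mu>"
 shows "lp_norm (density \<mu> (\<lambda>h. ennreal (1 / \<bar>det h\<bar>))) (ennreal q) g
  = lp_norm \<mu> (ennreal q) (\<lambda>h. ennreal (\<bar>det h\<bar> powr (- 1 / q)) * g h)"
proof -
 have [measurable]: "(\<lambda>h. \<bar>det h\<bar>) \<in> borel_measurable \<mu>"
  by (subst measurable_cong_sets[OF sets refl]) (intro measurable_restrict_space1, measurable)
 have "1 / \<bar>det h\<bar> = (\<bar>det h\<bar> powr (- 1 / q)) powr q" for h :: "real^'d^'d"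
 proof (cases "det h = 0")
  case False
  have "(\<bar>det h\<bar> powr (- 1 / q)) powr q = \<bar>det h\<bar> powr (- 1)"
   unfolding powr_powr using q by simp
  then show ?thesis using False by (simp add: powr_neg_one)
 qed (use q in simp)
 then have "epow (ennreal (\<bar>det h\<bar> powr (- 1 / q)) * x) q = ennreal (1 / \<bar>det h\<bar>) * epow x q" for h :: "real^'d^'d" and x
  using q by (simp add: epow_mult epow_ennreal)
 then show ?thesis
  using q by (simp add: lp_norm_ennreal nn_integral_density)
qed

context dual_orbit
begin

lemma weight_G_measurable:
 assumes "weight_on (UNIV \<times> H) sd_mult v"
 shows "v \<in> borel_measurable (leb_mu)"
proof -
 have v: "v \<in> borel_measurable (restrict_space borel (UNIV \<times> H))"
  using assms by (intro borel_measurable_continuous_on_restrict) (simp add: weight_on_def)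
 have "(\<lambda>z. z) \<in> leb_mu \<rightarrow>\<^sub>M restrict_space borel (UNIV \<times> H)"
 proof (rule measurable_restrict_space2)
  show "(\<lambda>z. z) \<in> leb_mu \<rightarrow>\<^sub>M borel" by (rule measurable_lborel_mu) (simp add: borel_prod)
 qed (auto simp: space_pair_measure space_mu)
 from measurable_compose[OF this v] show ?thesis by simp
qed

lemma weight_G_pos: "weight_on (UNIV \<times> H) sd_mult v ==> h \<in> H ==> 0 < v (x, h)"
 by (auto simp: weight_on_def)

end

context temperate_orbit
begin

text \<open>For fixed \<open>h\<close> the weights at \<open>\<xi>\<close> and at \<open>h\<^sup>T \<xi>\<close> are comparable, so that finiteness of \<open>Phi h\<close> for a single \<open>h\<close>
 makes \<open>ow\<^sup>2\<^sup>l\<close> integrable, and this power dominates the square of the Fourier transform.\<close>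

lemma sqint_fourier:
 fixes f :: "real^'d => complex"
 assumes f: "integrable lborel f" and mom: "vanishing_moments (- Orb) r f"
  and decay: "schwartz_norm (real r) (real r) (fourier f) < \<infinity>" and r: "l \<le> r"
 shows "sqint (fourier f)"
proof -
 obtain k C where C: "0 \<le> C" and k0: "k (\<lambda>_ :: 'd. 0) = fourier f"
  and kb: "\<And>\<alpha> m \<xi>. mi_order \<alpha> + m \<le> r ==> norm (k \<alpha> \<xi>) \<le> C * ow \<xi> ^ m"
  by (rule fourier_moment_decay[OF f mom compl_Orb decay]) blast
 have "\<exists>h\<in>H. Phi h < \<infinity>"
 proof (rule ccontr)
  assume none: "\<not> ?thesis"
  have "AE h in \<mu>. False" using AE_Phi_finite AE_space by eventually_elim (use none in \<open>auto simp: space_mu\<close>)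
  then show False
   using mu_H_pos by (simp add: AE_iff_measurable[OF _ refl] space_mu[symmetric] del: space_mu)
 qed
 then obtain h where h: "h \<in> H" "Phi h < \<infinity>" by blast
 let ?c = "C\<^sup>2 * size h ^ l"
 have c0: "0 \<le> ?c" using size_ge_1[of h] by simp
 have le: "(norm (fourier f \<xi>))\<^sup>2 \<le> ?c * (ow \<xi> ^ l * ow (dual_act h \<xi>) ^ l)" for \<xi>
 proof -
  have "norm (fourier f \<xi>) \<le> C * ow \<xi> ^ l" using kb[of "\<lambda>_. 0" l \<xi>] r by (simp add: mi_order_def k0)
  then have "(norm (fourier f \<xi>))\<^sup>2 \<le> (C * ow \<xi> ^ l)\<^sup>2" by (intro power_mono) auto
  also have "\<dots> = C\<^sup>2 * ow \<xi> ^ l * ow \<xi> ^ l" by (simp add: power2_eq_square mult_ac)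
  also have "\<dots> \<le> C\<^sup>2 * ow \<xi> ^ l * (size h * ow (dual_act h \<xi>)) ^ l"
   using ow_lower_bound[OF h(1), of \<xi>] size_ge_1[of h]
   by (intro mult_left_mono power_mono) (auto simp: pos_divide_le_eq mult.commute)
  finally show ?thesis by (simp add: power_mult_distrib mult_ac)
 qed
 have "(\<integral>\<^sup>+\<xi>. ennreal ((norm (fourier f \<xi>))\<^sup>2) \<partial>lborel)
   \<le> (\<integral>\<^sup>+\<xi>. ennreal ?c * ennreal (ow \<xi> ^ l * ow (dual_act h \<xi>) ^ l) \<partial>lborel)"
  using c0 by (intro nn_integral_mono) (simp add: le ennreal_leI flip: ennreal_mult)
 also have "\<dots> = ennreal ?c * Phi h" unfolding Phi_def by (rule nn_integral_cmult) measurable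
 also have "\<dots> < \<infinity>" using h(2) by (simp add: ennreal_mult_less_top)
 finally have fin: "(\<integral>\<^sup>+\<xi>. ennreal ((norm (fourier f \<xi>))\<^sup>2) \<partial>lborel) < \<infinity>" .
 have [measurable]: "fourier f \<in> borel_measurable borel" using f by (rule borel_measurable_fourier)
 show ?thesis using fin by (simp add: sqint_def integrable_iff_bounded)
qed

text \<open>The \<open>x\<close>-integral of the decay estimate costs nothing but \<open>m > s + d/p\<close>; what remains is the weighted norm of
 \<open>Phi\<close> that temperate embeddedness controls.\<close>

lemma dual_wavelet_mixed_norm:
 fixes f :: "real^'d => complex" and a b :: "real^'d"
 assumes f: "integrable lborel f" and mom: "vanishing_moments (- Orb) r f"
  and decay: "schwartz_norm (real r) (real r) (fourier f) < \<infinity>"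
  and u: "u \<in> box_test a b" and ab: "cbox a b \<subseteq> Orb"
  and p: "1 \<le> p" and r: "real l + s + enn2real (of_nat CARD('d) / p) + 1 < real r"
  and v: "weight_on (UNIV \<times> H) sd_mult v"
  and v_le: "\<And>x h. h \<in> H ==> v (x, h) \<le> (1 + norm x) powr s * w h"
 shows "mixed_norm \<mu> p (ennreal q) v (\<lambda>z. dual_wavelet (fourier f) (tensor u) (fst z) (snd z)) < \<infinity>"
proof -
 let ?\<delta> = "enn2real (of_nat CARD('d) / p)"
 define m where "m = Suc (nat \<lfloor>s + ?\<delta>\<rfloor>)"
 have \<delta>: "0 \<le> ?\<delta>" "?\<delta> \<le> real CARD('d)"
 proof -
  show "?\<delta> \<le> real CARD('d)" using p
  proof (cases rule: exponent_cases)
   case (2 r)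
   have "of_nat CARD('d) / p = ennreal (real CARD('d) / r)"
    using 2 by (simp add: divide_ennreal ennreal_of_nat_eq_real_of_nat)
   moreover have "real CARD('d) / r \<le> real CARD('d)" using 2 by (simp add: divide_le_eq mult_le_cancel_left1)
   ultimately show ?thesis using 2 by simp
  qed simp
 qed simp
 have m1: "s + ?\<delta> < real m" "real m \<le> s + ?\<delta> + 1"
 proof -
  have "real m = 1 + real_of_int \<lfloor>s + ?\<delta>\<rfloor>" using s \<delta>(1) by (simp add: m_def)
  then show "s + ?\<delta> < real m" "real m \<le> s + ?\<delta> + 1" by linarith+
 qed
 have ml: "m + l \<le> r" using m1 r by linarith
 obtain C where C: "0 \<le> C" and dec: "\<And>x h. h \<in> H ==> Phi h < \<infinity> ==>
   ennreal ((1 + norm x) ^ m * norm (dual_wavelet (fourier f) (tensor u) x h))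
   \<le> ennreal (C * sqrt \<bar>det h\<bar> * (1 + norm h) ^ m) * Phi h"
  by (rule dual_wavelet_decay[OF f mom decay ml u ab]) blast
 let ?V = "\<lambda>x h. dual_wavelet (fourier f) (tensor u) x h"
 have V_m: "(\<lambda>z. ?V (fst z) (snd z)) \<in> borel_measurable (leb_mu)"
  by (intro dual_wavelet_measurable borel_measurable_fourier f borel_measurable_tensor box_testD(1)[OF u])
 have Vv_m: "(\<lambda>z. ennreal (norm (?V (fst z) (snd z)) * v z)) \<in> borel_measurable (leb_mu)"
  using V_m weight_G_measurable[OF v] by measurable
 define K where "K = enn2real (lp_norm lborel p (\<lambda>x::real^'d. ennreal ((1 + norm x) powr (s - real m))))"
 have K: "lp_norm lborel p (\<lambda>x::real^'d. ennreal ((1 + norm x) powr (s - real m))) = ennreal K" "0 \<le> K"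
  using lp_norm_power_decay[OF p m1(1)] by (auto simp: K_def less_top)
 define c where "c h = C * sqrt \<bar>det h\<bar> * (1 + norm h) ^ m * w h" for h
 have c0: "0 \<le> c h" if "h \<in> H" for h using C w_pos[OF that] by (simp add: c_def)
 let ?N = "\<lambda>h. lp_norm lborel p (\<lambda>x. ennreal (norm (?V x h) * v (x, h)))"
 note Phi_m = Phi_measurable
 have N_m: "?N \<in> borel_measurable \<mu>"
 proof (rule borel_measurable_lp_norm[OF lborel.sigma_finite_measure_axioms _ p])
  show "(\<lambda>(h, x). ennreal (norm (?V x h) * v (x, h))) \<in> borel_measurable (\<mu> \<Otimes>\<^sub>M lborel)"
   using measurable_compose[OF measurable_pair_swap' Vv_m] by (simp add: split_beta')
 qed
 have N: "?N h \<le> ennreal (K * c h) * Phi h" if h: "h \<in> H" and fin: "Phi h < \<infinity>" for h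
 proof -
  define P where "P = enn2real (Phi h)"
  have P: "Phi h = ennreal P" "0 \<le> P" using fin by (auto simp: P_def less_top)
  have le: "ennreal (norm (?V x h) * v (x, h)) \<le> ennreal (c h * P) * ennreal ((1 + norm x) powr (s - real m))" for x
  proof -
   let ?X = "1 + norm x" and ?c = "C * sqrt \<bar>det h\<bar> * (1 + norm h) ^ m"
   have X: "0 < ?X" by (simp add: add_pos_nonneg)
   have cc: "0 \<le> ?c" using C by simp
   have "ennreal (?X ^ m * norm (?V x h)) \<le> ennreal (?c * P)"
    using dec[OF h fin, of x] cc P by (simp only: P(1) ennreal_mult)
   then have "?X ^ m * norm (?V x h) \<le> ?c * P" using cc P(2) by (subst (asm) ennreal_le_iff) auto
   then have "norm (?V x h) \<le> ?c * P / ?X ^ m"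
    using X by (simp add: pos_le_divide_eq mult.commute)
   then have "norm (?V x h) * v (x, h) \<le> (?c * P / ?X ^ m) * (?X powr s * w h)"
    using weight_G_pos[OF v h, of x] cc P(2) X by (intro mult_mono v_le h) auto
   also have "\<dots> = (c h * P) * (?X powr s / ?X powr real m)"
    using X by (simp add: c_def powr_realpow)
   finally show ?thesis using c0[OF h] P(2) by (simp add: powr_diff ennreal_leI flip: ennreal_mult)
  qed
  have "?N h \<le> lp_norm lborel p (\<lambda>x::real^'d. ennreal (c h * P) * ennreal ((1 + norm x) powr (s - real m)))"
  proof (rule lp_norm_mono)
   show "(\<lambda>x. ennreal (norm (?V x h) * v (x, h))) \<in> borel_measurable lborel"
    using measurable_compose[OF measurable_Pair2' Vv_m, of h] h by (simp add: space_mu)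
  qed (rule le)
  also have "\<dots> \<le> ennreal (c h * P) * ennreal K"
   unfolding K(1)[symmetric] using c0[OF h] P(2) by (intro lp_norm_cmult p) auto
  also have "\<dots> = ennreal (K * c h) * Phi h"
   using K c0[OF h] P by (simp add: mult_ac flip: ennreal_mult)
  finally show ?thesis .
 qed
 have WP_m: "(\<lambda>h. ennreal (W h) * Phi h) \<in> borel_measurable \<mu>" using W_measurable Phi_m by measurable
 have "AE h in \<mu>. Phi h < \<infinity>" by (rule AE_Phi_finite)
 then have "AE h in \<mu>. ennreal (\<bar>det h\<bar> powr (- 1 / q)) * ?N h \<le> ennreal (K * C) * (ennreal (W h) * Phi h)"
  using AE_space
 proof eventually_elim
  case (elim h)
  then have h: "h \<in> H" by (simp add: space_mu)
  have "(1 + norm h) ^ m \<le> (1 + norm h) powr (s + real CARD('d) + 1)"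
  proof -
   have "(1 + norm h) ^ m = (1 + norm h) powr real m" by (simp add: powr_realpow add_pos_nonneg)
   also have "\<dots> \<le> (1 + norm h) powr (s + real CARD('d) + 1)"
    using m1(2) \<delta>(2) by (intro powr_mono) auto
   finally show ?thesis .
  qed
  moreover have "\<bar>det h\<bar> powr (- 1 / q) * sqrt \<bar>det h\<bar> = \<bar>det h\<bar> powr (1 / 2 - 1 / q)"
   by (simp add: powr_half_sqrt[symmetric] flip: powr_add)
  ultimately have "(\<bar>det h\<bar> powr (- 1 / q) * sqrt \<bar>det h\<bar>) * (1 + norm h) ^ m * w h \<le> W h"
   unfolding W_def using w_pos[OF h] by (intro mult_mono) auto
  then have "(K * C) * ((\<bar>det h\<bar> powr (- 1 / q) * sqrt \<bar>det h\<bar>) * (1 + norm h) ^ m * w h) \<le> (K * C) * W h"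
   using K(2) C by (intro mult_left_mono) auto
  then have "\<bar>det h\<bar> powr (- 1 / q) * (K * c h) \<le> (K * C) * W h" by (simp add: c_def mult_ac)
  then have "ennreal (\<bar>det h\<bar> powr (- 1 / q)) * ennreal (K * c h) \<le> ennreal (K * C) * ennreal (W h)"
   using K(2) C c0[OF h] W_pos[OF h] by (simp add: ennreal_leI flip: ennreal_mult)
  from mult_right_mono[OF this, of "Phi h"]
  have "ennreal (\<bar>det h\<bar> powr (- 1 / q)) * (ennreal (K * c h) * Phi h) \<le> ennreal (K * C) * (ennreal (W h) * Phi h)"
   by (simp add: mult_ac)
  moreover have "ennreal (\<bar>det h\<bar> powr (- 1 / q)) * ?N h \<le> ennreal (\<bar>det h\<bar> powr (- 1 / q)) * (ennreal (K * c h) * Phi h)"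
   using N[OF h] elim by (intro mult_left_mono) auto
  ultimately show ?case by (rule order_trans[rotated])
 qed
 then have "lp_norm \<mu> (ennreal q) (\<lambda>h. ennreal (\<bar>det h\<bar> powr (- 1 / q)) * ?N h)
   \<le> lp_norm \<mu> (ennreal q) (\<lambda>h. ennreal (K * C) * (ennreal (W h) * Phi h))"
 proof (rule lp_norm_mono_AE[rotated])
  have "(\<lambda>h. ennreal (\<bar>det h\<bar> powr (- 1 / q))) \<in> borel_measurable \<mu>" by (rule measurable_mu) measurable
  then show "(\<lambda>h. ennreal (\<bar>det h\<bar> powr (- 1 / q)) * ?N h) \<in> borel_measurable \<mu>"
   using N_m by (rule borel_measurable_times_ennreal)
 qed
 also have "\<dots> \<le> ennreal (K * C) * lp_norm \<mu> (ennreal q) (\<lambda>h. ennreal (W h) * Phi h)"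
  using K(2) C by (intro lp_norm_cmult q_ge_1 WP_m) auto
 also have "\<dots> < \<infinity>" using Phi_finite by (simp add: ennreal_mult_less_top)
 finally show ?thesis
  using lp_norm_density_det[OF q sets_mu N_m] by (simp add: mixed_norm_def)
qed

end

section \<open>Overlap of windows along the orbit\<close>

lemma cnj_tensor: "cnj (tensor u x) = tensor u x"
 by (simp add: tensor_def)

lemma emeasure_open_neq_0:
 fixes V :: "(real^'d) set"
 assumes "open V" "V \<noteq> {}" shows "emeasure lborel V \<noteq> 0"
proof
 assume "emeasure lborel V = 0"
 then have "negligible V" using assms(1) by (simp add: negligible_iff_null_sets null_sets_completionI null_sets_def)
 then show False using open_not_negligible assms by blast
qed

context dual_orbit
begin

definition overlap :: "(real^'d => complex) => real^'d => complex" where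
 "overlap \<Psi> \<xi> = (\<integral>h. \<Psi> (dual_act h \<xi>) \<partial>\<mu>)"

lemma overlap_const:
 assumes [measurable]: "\<Psi> \<in> borel_measurable borel" and "\<xi> \<in> Orb" "\<eta> \<in> Orb"
 shows "overlap \<Psi> \<xi> = overlap \<Psi> \<eta>"
proof -
 obtain g where g: "g \<in> H" "dual_act g \<eta> = \<xi>" using Orb_transitive assms by blast
 have "(\<integral>h. \<Psi> (dual_act (g ** h) \<eta>) \<partial>\<mu>) = (\<integral>h. \<Psi> (dual_act h \<eta>) \<partial>\<mu>)"
  by (rule integral_left[OF g(1)]) (rule measurable_mu, measurable)
 then show ?thesis using g by (simp add: dual_act_mult overlap_def)
qed

text \<open>The density with respect to Lebesgue measure of the sum of the orbit measures over all base points in \<open>V\<close>.\<close>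

definition orbit_density :: "(real^'d) set => real^'d => ennreal" where
 "orbit_density V \<eta> = (\<integral>\<^sup>+h. ennreal (1 / \<bar>det h\<bar>) * indicator V (dual_act (matrix_inv h) \<eta>) \<partial>\<mu>)"

lemma orbit_density_measurable [measurable]:
 assumes [measurable]: "V \<in> sets borel" shows "orbit_density V \<in> borel_measurable borel"
proof -
 have "(\<lambda>z. ennreal (1 / \<bar>det (snd z)\<bar>) * indicator V (dual_act (matrix_inv (snd z)) (fst z))) \<in> borel_measurable (leb_mu)"
  by (rule measurable_lborel_mu) measurable
 then have "orbit_density V \<in> borel_measurable lborel"
  unfolding orbit_density_def by (intro mu.borel_measurable_nn_integral) (simp add: split_beta')
 then show ?thesis by simp
qed

lemma nn_integral_orbit_density:
 assumes V [measurable]: "V \<in> sets borel" and \<theta> [measurable]: "\<theta> \<in> borel_measurable borel"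
 shows "(\<integral>\<^sup>+\<xi>. indicator V \<xi> * (\<integral>\<^sup>+h. \<theta> (dual_act h \<xi>) \<partial>\<mu>) \<partial>lborel) = (\<integral>\<^sup>+\<eta>. \<theta> \<eta> * orbit_density V \<eta> \<partial>lborel)"
proof -
 have m1: "(\<lambda>z. indicator V (fst z) * \<theta> (dual_act (snd z) (fst z))) \<in> borel_measurable (leb_mu)"
  by (rule measurable_lborel_mu) measurable
 have m2: "(\<lambda>z. \<theta> (fst z) * (ennreal (1 / \<bar>det (snd z)\<bar>) * indicator V (dual_act (matrix_inv (snd z)) (fst z)))) \<in> borel_measurable (leb_mu)"
  by (rule measurable_lborel_mu) measurable
 have sec: "(\<lambda>h. \<theta> (dual_act h \<xi>)) \<in> borel_measurable \<mu>"
  "(\<lambda>h. ennreal (1 / \<bar>det h\<bar>) * indicator V (dual_act (matrix_inv h) \<xi>)) \<in> borel_measurable \<mu>" for \<xi>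
  by (rule measurable_mu, measurable)+
 have "(\<integral>\<^sup>+\<xi>. indicator V \<xi> * (\<integral>\<^sup>+h. \<theta> (dual_act h \<xi>) \<partial>\<mu>) \<partial>lborel)
   = (\<integral>\<^sup>+\<xi>. (\<integral>\<^sup>+h. indicator V \<xi> * \<theta> (dual_act h \<xi>) \<partial>\<mu>) \<partial>lborel)"
  by (simp add: nn_integral_cmult sec)
 also have "\<dots> = (\<integral>\<^sup>+h. (\<integral>\<^sup>+\<xi>. indicator V \<xi> * \<theta> (dual_act h \<xi>) \<partial>lborel) \<partial>\<mu>)"
  using P.Fubini'[of "\<lambda>\<xi> h. indicator V \<xi> * \<theta> (dual_act h \<xi>)"] m1 by (simp add: split_beta')
 also have "\<dots> = (\<integral>\<^sup>+h. (\<integral>\<^sup>+\<eta>. \<theta> \<eta> * (ennreal (1 / \<bar>det h\<bar>) * indicator V (dual_act (matrix_inv h) \<eta>)) \<partial>lborel) \<partial>\<mu>)"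
 proof (rule nn_integral_cong)
  fix h assume "h \<in> space \<mu>"
  then have h: "h \<in> H" by (simp add: space_mu)
  let ?f = "\<lambda>\<eta>. indicator V (dual_act (matrix_inv h) \<eta>) * \<theta> \<eta>"
  have "(\<integral>\<^sup>+\<xi>. indicator V \<xi> * \<theta> (dual_act h \<xi>) \<partial>lborel) = (\<integral>\<^sup>+\<xi>. ?f (dual_act h \<xi>) \<partial>lborel)"
   using h by (simp add: dual_act_inv)
  also have "\<dots> = ennreal (1 / \<bar>det h\<bar>) * (\<integral>\<^sup>+\<eta>. ?f \<eta> \<partial>lborel)"
   using nn_integral_linear[of "transpose h" ?f] det_H[OF h] by simp
  also have "\<dots> = (\<integral>\<^sup>+\<eta>. ennreal (1 / \<bar>det h\<bar>) * ?f \<eta> \<partial>lborel)" by (rule nn_integral_cmult[symmetric]) measurable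
  finally show "(\<integral>\<^sup>+\<xi>. indicator V \<xi> * \<theta> (dual_act h \<xi>) \<partial>lborel)
   = (\<integral>\<^sup>+\<eta>. \<theta> \<eta> * (ennreal (1 / \<bar>det h\<bar>) * indicator V (dual_act (matrix_inv h) \<eta>)) \<partial>lborel)"
   by (simp add: mult_ac)
 qed
 also have "\<dots> = (\<integral>\<^sup>+\<eta>. (\<integral>\<^sup>+h. \<theta> \<eta> * (ennreal (1 / \<bar>det h\<bar>) * indicator V (dual_act (matrix_inv h) \<eta>)) \<partial>\<mu>) \<partial>lborel)"
  using P.Fubini'[of "\<lambda>\<eta> h. \<theta> \<eta> * (ennreal (1 / \<bar>det h\<bar>) * indicator V (dual_act (matrix_inv h) \<eta>))"] m2
  by (simp add: split_beta')
 also have "\<dots> = (\<integral>\<^sup>+\<eta>. \<theta> \<eta> * orbit_density V \<eta> \<partial>lborel)"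
  unfolding orbit_density_def by (simp add: nn_integral_cmult sec)
 finally show ?thesis .
qed

lemma integral_orbit_density:
 fixes \<theta> :: "real^'d => complex"
 assumes V [measurable]: "V \<in> sets borel" and \<theta> [measurable]: "\<theta> \<in> borel_measurable borel"
  and fin: "(\<integral>\<^sup>+\<eta>. ennreal (norm (\<theta> \<eta>)) * orbit_density V \<eta> \<partial>lborel) < \<infinity>"
 shows "(\<integral>\<xi>. indicator V \<xi> *\<^sub>R overlap \<theta> \<xi> \<partial>lborel) = (\<integral>\<eta>. \<theta> \<eta> * complex_of_real (enn2real (orbit_density V \<eta>)) \<partial>lborel)"
proof -
 let ?c = "\<lambda>h \<eta>. (1 / \<bar>det h\<bar>) * indicator V (dual_act (matrix_inv h) \<eta>) :: real"
 have m1 [measurable]: "(\<lambda>z. indicator V (fst z) *\<^sub>R \<theta> (dual_act (snd z) (fst z))) \<in> borel_measurable (leb_mu)"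
  by (rule measurable_lborel_mu) measurable
 have m2 [measurable]: "(\<lambda>z. ?c (snd z) (fst z) *\<^sub>R \<theta> (fst z)) \<in> borel_measurable (leb_mu)"
  by (rule measurable_lborel_mu) measurable
 have sec: "(\<lambda>h. ennreal (norm (\<theta> (dual_act h \<xi>)))) \<in> borel_measurable \<mu>"
  "(\<lambda>h. ennreal (1 / \<bar>det h\<bar>) * indicator V (dual_act (matrix_inv h) \<xi>)) \<in> borel_measurable \<mu>"
  "(\<lambda>h. ?c h \<xi>) \<in> borel_measurable \<mu>" for \<xi>
  by (rule measurable_mu, measurable)+
 have e: "ennreal (?c h \<eta>) = ennreal (1 / \<bar>det h\<bar>) * indicator V (dual_act (matrix_inv h) \<eta>)" for h \<eta>
  by (simp add: indicator_def)
 have i1: "integrable (leb_mu) (\<lambda>z. indicator V (fst z) *\<^sub>R \<theta> (dual_act (snd z) (fst z)))"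
 proof (rule integrableI_bounded[OF m1])
  have mm: "(\<lambda>z. ennreal (norm (indicator V (fst z) *\<^sub>R \<theta> (dual_act (snd z) (fst z))))) \<in> borel_measurable (leb_mu)"
   by measurable
  have "(\<integral>\<^sup>+z. ennreal (norm (indicator V (fst z) *\<^sub>R \<theta> (dual_act (snd z) (fst z)))) \<partial>(leb_mu))
    = (\<integral>\<^sup>+\<xi>. (\<integral>\<^sup>+h. indicator V \<xi> * ennreal (norm (\<theta> (dual_act h \<xi>))) \<partial>\<mu>) \<partial>lborel)"
   unfolding mu.nn_integral_fst[OF mm, symmetric] by (auto intro!: nn_integral_cong simp: indicator_def)
  also have "\<dots> = (\<integral>\<^sup>+\<xi>. indicator V \<xi> * (\<integral>\<^sup>+h. ennreal (norm (\<theta> (dual_act h \<xi>))) \<partial>\<mu>) \<partial>lborel)"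
   by (simp add: nn_integral_cmult sec)
  also have "\<dots> < \<infinity>" using fin nn_integral_orbit_density[of V "\<lambda>\<eta>. ennreal (norm (\<theta> \<eta>))"] by simp
  finally show "(\<integral>\<^sup>+z. ennreal (norm (indicator V (fst z) *\<^sub>R \<theta> (dual_act (snd z) (fst z)))) \<partial>(leb_mu)) < \<infinity>" .
 qed
 have i2: "integrable (leb_mu) (\<lambda>z. ?c (snd z) (fst z) *\<^sub>R \<theta> (fst z))"
 proof (rule integrableI_bounded[OF m2])
  have mm: "(\<lambda>z. ennreal (norm (?c (snd z) (fst z) *\<^sub>R \<theta> (fst z)))) \<in> borel_measurable (leb_mu)"
   by (rule measurable_compose[OF m2, of "\<lambda>x. ennreal (norm x)"]) measurable
  have "(\<integral>\<^sup>+z. ennreal (norm (?c (snd z) (fst z) *\<^sub>R \<theta> (fst z))) \<partial>(leb_mu))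
    = (\<integral>\<^sup>+\<eta>. (\<integral>\<^sup>+h. ennreal (norm (\<theta> \<eta>)) * (ennreal (1 / \<bar>det h\<bar>) * indicator V (dual_act (matrix_inv h) \<eta>)) \<partial>\<mu>) \<partial>lborel)"
   unfolding mu.nn_integral_fst[OF mm, symmetric]
   by (auto intro!: nn_integral_cong simp: indicator_def mult.commute simp flip: ennreal_mult)
  also have "\<dots> = (\<integral>\<^sup>+\<eta>. ennreal (norm (\<theta> \<eta>)) * orbit_density V \<eta> \<partial>lborel)"
   unfolding orbit_density_def by (simp add: nn_integral_cmult sec)
  also have "\<dots> < \<infinity>" by (rule fin)
  finally show "(\<integral>\<^sup>+z. ennreal (norm (?c (snd z) (fst z) *\<^sub>R \<theta> (fst z))) \<partial>(leb_mu)) < \<infinity>" .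
 qed
 have "(\<integral>\<xi>. indicator V \<xi> *\<^sub>R overlap \<theta> \<xi> \<partial>lborel) = (\<integral>\<xi>. (\<integral>h. indicator V \<xi> *\<^sub>R \<theta> (dual_act h \<xi>) \<partial>\<mu>) \<partial>lborel)"
  by (simp add: overlap_def)
 also have "\<dots> = (\<integral>h. (\<integral>\<xi>. indicator V \<xi> *\<^sub>R \<theta> (dual_act h \<xi>) \<partial>lborel) \<partial>\<mu>)"
  using P.Fubini_integral[of "\<lambda>\<xi> h. indicator V \<xi> *\<^sub>R \<theta> (dual_act h \<xi>)"] i1 by (simp add: split_beta')
 also have "\<dots> = (\<integral>h. (\<integral>\<eta>. ?c h \<eta> *\<^sub>R \<theta> \<eta> \<partial>lborel) \<partial>\<mu>)"
 proof (rule Bochner_cong[OF refl])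
  fix h assume "h \<in> space \<mu>"
  then have h: "h \<in> H" by (simp add: space_mu)
  let ?f = "\<lambda>\<eta>. indicator V (dual_act (matrix_inv h) \<eta>) *\<^sub>R \<theta> \<eta>"
  have "(\<integral>\<xi>. indicator V \<xi> *\<^sub>R \<theta> (dual_act h \<xi>) \<partial>lborel) = (\<integral>\<xi>. ?f (dual_act h \<xi>) \<partial>lborel)"
   using h by (simp add: dual_act_inv)
  also have "\<dots> = complex_of_real (1 / \<bar>det h\<bar>) * (\<integral>\<eta>. ?f \<eta> \<partial>lborel)"
   using integral_linear(1)[of "transpose h" ?f] det_H[OF h] by simp
  finally show "(\<integral>\<xi>. indicator V \<xi> *\<^sub>R \<theta> (dual_act h \<xi>) \<partial>lborel) = (\<integral>\<eta>. ?c h \<eta> *\<^sub>R \<theta> \<eta> \<partial>lborel)"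
   by (simp add: scaleR_conv_of_real mult.assoc flip: integral_mult_right_zero)
 qed
 also have "\<dots> = (\<integral>\<eta>. (\<integral>h. ?c h \<eta> *\<^sub>R \<theta> \<eta> \<partial>\<mu>) \<partial>lborel)"
  using P.Fubini_integral[of "\<lambda>\<eta> h. ?c h \<eta> *\<^sub>R \<theta> \<eta>"] i2 by (simp add: split_beta')
 also have "\<dots> = (\<integral>\<eta>. \<theta> \<eta> * complex_of_real (enn2real (orbit_density V \<eta>)) \<partial>lborel)"
 proof (rule Bochner_cong[OF refl])
  fix \<eta> :: "real^'d"
  have "(\<integral>h. ?c h \<eta> *\<^sub>R \<theta> \<eta> \<partial>\<mu>) = (\<integral>h. complex_of_real (?c h \<eta>) \<partial>\<mu>) * \<theta> \<eta>"
   by (simp only: scaleR_conv_of_real integral_mult_left_zero)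
  also have "\<dots> = complex_of_real (\<integral>h. ?c h \<eta> \<partial>\<mu>) * \<theta> \<eta>" by (simp only: integral_complex_of_real)
  also have "(\<integral>h. ?c h \<eta> \<partial>\<mu>) = enn2real (orbit_density V \<eta>)"
   unfolding orbit_density_def e[symmetric] by (rule integral_eq_nn_integral[OF sec(3)]) (auto simp: indicator_def)
  finally show "(\<integral>h. ?c h \<eta> *\<^sub>R \<theta> \<eta> \<partial>\<mu>) = \<theta> \<eta> * complex_of_real (enn2real (orbit_density V \<eta>))" by (simp add: mult.commute)
 qed
 finally show ?thesis .
qed

text \<open>If \<open>\<eta>\<close> and \<open>h\<^sup>-\<^sup>T \<eta>\<close> both lie in \<open>V\<close>, then \<open>h\<close> lies in a fixed compact part of \<open>H\<close>.\<close>

lemma orbit_density_bounded: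
 assumes \<xi>: "\<xi> \<in> Orb" and V: "V \<subseteq> Orb" and proper: "\<And>h. h \<in> H ==> dual_act h \<xi> \<in> V ==> h \<in> HB R"
 obtains B where "\<And>\<eta>. \<eta> \<in> V ==> orbit_density V \<eta> \<le> ennreal B"
proof -
 have bd: "orbit_density V \<eta> \<le> (\<integral>\<^sup>+h. ennreal \<bar>det (matrix_inv h)\<bar> * indicator (HB (R * R)) h \<partial>\<mu>)" if \<eta>: "\<eta> \<in> V" for \<eta>
  unfolding orbit_density_def
 proof (rule nn_integral_mono)
  fix h assume "h \<in> space \<mu>"
  then have h: "h \<in> H" by (simp add: space_mu)
  have "h \<in> HB (R * R)" if hV: "dual_act (matrix_inv h) \<eta> \<in> V"
  proof -
   obtain k where k: "k \<in> H" "dual_act k \<xi> = \<eta>" using Orb_transitive[OF \<xi>] \<eta> V by blast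
   have "k \<in> HB R" using proper k \<eta> by blast
   moreover have "k ** matrix_inv h \<in> HB R"
    using proper[of "k ** matrix_inv h"] k h hV by (simp add: mult_H inv_H dual_act_mult)
   ultimately have "matrix_inv (k ** matrix_inv h) ** k \<in> HB (R * R)" by (intro HB_mult HB_inv)
   moreover have "matrix_inv (k ** matrix_inv h) ** k = h"
    using k h by (simp add: inv_mult_distrib inv_H inv_inv inv_cancel)
   ultimately show ?thesis by simp
  qed
  then show "ennreal (1 / \<bar>det h\<bar>) * indicator V (dual_act (matrix_inv h) \<eta>) \<le> ennreal \<bar>det (matrix_inv h)\<bar> * indicator (HB (R * R)) h"
   using h by (auto simp: indicator_def det_inv)
 qed
 have "continuous_on (HB (R * R)) (\<lambda>h. det h)" unfolding det_def by (intro continuous_intros)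
 then have "bounded ((\<lambda>h. det h) ` HB (R * R))"
  by (intro compact_imp_bounded compact_continuous_image compact_HB)
 then obtain b where b: "\<And>h. h \<in> HB (R * R) ==> \<bar>det h\<bar> \<le> b" by (auto simp: bounded_iff)
 have HBm: "HB (R * R) \<in> sets \<mu>" by (intro in_sets_mu sets_HB HB_subset)
 have "(\<integral>\<^sup>+h. ennreal \<bar>det (matrix_inv h)\<bar> * indicator (HB (R * R)) h \<partial>\<mu>) \<le> (\<integral>\<^sup>+h. ennreal b * indicator (HB (R * R)) h \<partial>\<mu>)"
  by (intro nn_integral_mono) (auto simp: indicator_def intro!: ennreal_leI b HB_inv)
 also have "\<dots> = ennreal b * emeasure \<mu> (HB (R * R))" using HBm by (simp add: nn_integral_cmult_indicator)
 also have "\<dots> < \<infinity>" using HB_finite by (simp add: ennreal_mult_less_top)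
 finally obtain B where "(\<integral>\<^sup>+h. ennreal \<bar>det (matrix_inv h)\<bar> * indicator (HB (R * R)) h \<partial>\<mu>) = ennreal B"
  by (auto simp: less_top_ennreal)
 with bd show thesis by (intro that[of B]) simp
qed

text \<open>The set of zeros is null for the orbit measure of almost every base point in \<open>V\<close>, hence for all of them, as these measures coincide.\<close>

lemma orbit_density_pos:
 assumes V: "open V" "V \<subseteq> Orb" "\<xi> \<in> V"
 shows "AE \<eta> in lborel. orbit_density V \<eta> \<noteq> 0"
proof -
 have [measurable]: "V \<in> sets borel" using V(1) by simp
 define E where "E = {\<eta>. orbit_density V \<eta> = 0}"
 have "{\<eta> \<in> space borel. orbit_density V \<eta> = 0} \<in> sets borel" by measurable
 then have E [measurable]: "E \<in> sets borel" by (simp add: E_def)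
 have "(\<integral>\<^sup>+\<xi>. indicator V \<xi> * (\<integral>\<^sup>+h. indicator E (dual_act h \<xi>) \<partial>\<mu>) \<partial>lborel) = (\<integral>\<^sup>+\<eta>. indicator E \<eta> * orbit_density V \<eta> \<partial>lborel)"
  by (rule nn_integral_orbit_density) measurable
 also have "\<dots> = 0" by (intro nn_integral_zero') (simp add: E_def indicator_def)
 also have "(\<integral>\<^sup>+\<xi>. indicator V \<xi> * (\<integral>\<^sup>+h. indicator E (dual_act h \<xi>) \<partial>\<mu>) \<partial>lborel)
   = (\<integral>\<^sup>+\<zeta>. indicator V \<zeta> * (\<integral>\<^sup>+h. indicator E (dual_act h \<xi>) \<partial>\<mu>) \<partial>lborel)"
  using V orbit_integral_const[of "indicator E" _ \<xi>] by (intro nn_integral_cong) (auto simp: indicator_def[of V])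
 also have "\<dots> = (\<integral>\<^sup>+h. indicator E (dual_act h \<xi>) \<partial>\<mu>) * emeasure lborel V"
  by (simp add: nn_integral_multc mult.commute)
 finally have "(\<integral>\<^sup>+h. indicator E (dual_act h \<xi>) \<partial>\<mu>) = 0"
 proof -
  assume "(\<integral>\<^sup>+h. indicator E (dual_act h \<xi>) \<partial>\<mu>) * emeasure lborel V = 0"
  moreover have "emeasure lborel V \<noteq> 0"
   using emeasure_open_neq_0[OF V(1)] V(3) by blast
  ultimately show ?thesis by simp
 qed
 then have "AE \<eta> in lborel. \<eta> \<notin> E" using V by (intro orbit_null[OF E, of \<xi>]) auto
 then show ?thesis by eventually_elim (simp add: E_def)
qed

end

context dual_orbit
begin

text \<open>Some smooth window with compact support in the orbit overlaps with \<open>\<Psi>\<close>: otherwise \<open>\<Psi>\<close> times a density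
 that is positive almost everywhere would be orthogonal to all test functions near each point of the orbit.\<close>

lemma ex_overlapping_window:
 assumes \<Psi>: "sqint \<Psi>" and nz: "\<not> (AE \<xi> in lborel. \<Psi> \<xi> = 0)"
 obtains a b u \<kappa> where "cbox a b \<subseteq> Orb" "u \<in> box_test a b" "\<kappa> \<noteq> 0"
  "\<And>\<xi>. \<xi> \<in> Orb ==> overlap (\<lambda>\<xi>. \<Psi> \<xi> * cnj (tensor u \<xi>)) \<xi> = \<kappa>"
  "\<And>\<xi>. \<xi> \<in> Orb ==> (\<integral>\<^sup>+h. ennreal (norm (\<Psi> (dual_act h \<xi>) * cnj (tensor u (dual_act h \<xi>)))) \<partial>\<mu>) < \<infinity>"
proof (rule ccontr)
 note window = that
 assume none: "\<not> thesis"
 have \<Psi>_m [measurable]: "\<Psi> \<in> borel_measurable borel" using \<Psi> by (simp add: sqint_def)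
 have loc: "\<exists>V. open V \<and> \<eta>0 \<in> V \<and> (AE \<eta> in lborel. \<eta> \<in> V \<longrightarrow> \<Psi> \<eta> = 0)" if \<eta>0: "\<eta>0 \<in> Orb" for \<eta>0
 proof -
  obtain V R where V: "open V" "\<eta>0 \<in> V" "V \<subseteq> Orb" and proper: "\<And>h. h \<in> H ==> dual_act h \<eta>0 \<in> V ==> h \<in> HB R"
   by (rule locally_proper[OF \<eta>0 \<eta>0]) blast
  have Vm [measurable]: "V \<in> sets borel" using V(1) by simp
  obtain B where B: "\<And>\<eta>. \<eta> \<in> V ==> orbit_density V \<eta> \<le> ennreal B"
   using orbit_density_bounded[OF \<eta>0 V(3) proper] by metis
  define D where "D \<eta> = enn2real (orbit_density V \<eta>)" for \<eta>
  have D_m [measurable]: "D \<in> borel_measurable borel" unfolding D_def by measurable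
  have D: "0 \<le> D \<eta>" "D \<eta> \<le> max B 0" "orbit_density V \<eta> = ennreal (D \<eta>)" if "\<eta> \<in> V" for \<eta>
  proof -
   have fin: "orbit_density V \<eta> < top" using B[OF that] by (simp add: le_less_trans)
   then show "orbit_density V \<eta> = ennreal (D \<eta>)" by (simp add: D_def)
   then have "ennreal (D \<eta>) \<le> ennreal (max B 0)"
    using order_trans[OF B[OF that] ennreal_leI[of B "max B 0"]] by simp
   then show "D \<eta> \<le> max B 0" by (subst (asm) ennreal_le_iff) auto
   show "0 \<le> D \<eta>" by (simp add: D_def)
  qed
  have cut: "integrable lborel (\<lambda>x. indicator (cbox a b) x *\<^sub>R \<Psi> x)" for a b
  proof -
   have "sqint (\<lambda>x. indicator (cbox a b) x :: complex)"
   proof -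
    have "(\<lambda>x. (norm (indicator (cbox a b) x :: complex))\<^sup>2) = indicat_real (cbox a b)" by (auto simp: indicator_def)
    then show ?thesis
     using integrable_real_indicator[of "cbox a b" lborel] emeasure_bounded_finite[OF bounded_cbox, of a b]
     by (simp add: sqint_def)
   qed
   from sqint_product(3)[OF \<Psi> this] show ?thesis
    by (rule Bochner_Integration.integrable_cong[THEN iffD1, rotated 2]) (auto simp: indicator_def)
  qed
  have "AE \<eta> in lborel. \<eta> \<in> V \<longrightarrow> \<Psi> \<eta> * complex_of_real (D \<eta>) = 0"
  proof (rule AE_eq_0_if_orthogonal_to_tensors[OF V(1)])
   show "(\<lambda>\<eta>. \<Psi> \<eta> * complex_of_real (D \<eta>)) \<in> borel_measurable borel" by measurable
   show "integrable lborel (\<lambda>x. indicator (cbox a b) x *\<^sub>R (\<Psi> x * complex_of_real (D x)))" if "cbox a b \<subseteq> V" for a b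
   proof (rule Bochner_Integration.integrable_bound[where f = "\<lambda>x. complex_of_real (max B 0) * (indicator (cbox a b) x *\<^sub>R \<Psi> x)"])
    show "integrable lborel (\<lambda>x. complex_of_real (max B 0) * (indicator (cbox a b) x *\<^sub>R \<Psi> x))"
     by (rule integrable_mult_right) (simp add: cut)
    show "AE x in lborel. norm (indicator (cbox a b) x *\<^sub>R (\<Psi> x * complex_of_real (D x)))
      \<le> norm (complex_of_real (max B 0) * (indicator (cbox a b) x *\<^sub>R \<Psi> x))"
    proof (rule AE_I2)
     fix x
     show "norm (indicator (cbox a b) x *\<^sub>R (\<Psi> x * complex_of_real (D x)))
      \<le> norm (complex_of_real (max B 0) * (indicator (cbox a b) x *\<^sub>R \<Psi> x))"
     proof (cases "x \<in> cbox a b")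
      case True
      then have "x \<in> V" using that by blast
      have "norm (\<Psi> x) * D x \<le> norm (\<Psi> x) * max B 0" using D(2)[OF \<open>x \<in> V\<close>] by (intro mult_left_mono) auto
      then show ?thesis using True D(1)[OF \<open>x \<in> V\<close>] by (simp add: norm_mult mult.commute)
     qed simp
    qed
   qed measurable
   show "(\<integral>x. \<Psi> x * complex_of_real (D x) * tensor u x \<partial>lborel) = 0" if ab: "cbox a b \<subseteq> V" and u: "u \<in> box_test a b" for a b u
   proof -
    define \<theta> where "\<theta> \<xi> = \<Psi> \<xi> * cnj (tensor u \<xi>)" for \<xi>
    have [measurable]: "tensor u \<in> borel_measurable borel" by (intro borel_measurable_tensor box_testD(1)[OF u])
    have \<theta>_m [measurable]: "\<theta> \<in> borel_measurable borel" unfolding \<theta>_def by measurable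
    obtain T where T: "0 \<le> T" "\<And>x. norm (tensor u x) \<le> T * indicator (cbox a b) x" using tensor_bounded[OF u] by blast
    have \<theta>_int: "integrable lborel (\<lambda>\<eta>. norm (\<theta> \<eta>))"
    proof (rule Bochner_Integration.integrable_bound[where f = "\<lambda>x. complex_of_real T * (indicator (cbox a b) x *\<^sub>R \<Psi> x)"])
     show "integrable lborel (\<lambda>x. complex_of_real T * (indicator (cbox a b) x *\<^sub>R \<Psi> x))"
      by (rule integrable_mult_right) (simp add: cut)
     have "norm (\<Psi> x) * norm (tensor u x) \<le> norm (\<Psi> x) * (T * indicator (cbox a b) x)" for x
      using T(2) by (rule mult_left_mono) auto
     then show "AE x in lborel. norm (norm (\<theta> x)) \<le> norm (complex_of_real T * (indicator (cbox a b) x *\<^sub>R \<Psi> x))"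
      using T(1) by (intro AE_I2) (simp add: \<theta>_def norm_mult mult_ac)
    qed measurable
    have "(\<integral>\<^sup>+\<eta>. ennreal (norm (\<theta> \<eta>)) * orbit_density V \<eta> \<partial>lborel) \<le> (\<integral>\<^sup>+\<eta>. ennreal B * ennreal (norm (\<theta> \<eta>)) \<partial>lborel)"
    proof (rule nn_integral_mono)
     fix \<eta>
     show "ennreal (norm (\<theta> \<eta>)) * orbit_density V \<eta> \<le> ennreal B * ennreal (norm (\<theta> \<eta>))"
     proof (cases "\<eta> \<in> cbox a b")
      case True
      then show ?thesis using B ab by (subst (2) mult.commute) (intro mult_left_mono; auto)
     next
      case False
      then show ?thesis using tensor_eq_0_outside[OF u False] by (simp add: \<theta>_def)
     qed
    qed
    also have "\<dots> < \<infinity>" using \<theta>_int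
     by (simp add: nn_integral_cmult nn_integral_eq_integral ennreal_mult_less_top)
    finally have fin: "(\<integral>\<^sup>+\<eta>. ennreal (norm (\<theta> \<eta>)) * orbit_density V \<eta> \<partial>lborel) < \<infinity>" .
    have abs_fin: "(\<integral>\<^sup>+h. ennreal (norm (\<theta> (dual_act h \<xi>))) \<partial>\<mu>) < \<infinity>" if \<xi>: "\<xi> \<in> Orb" for \<xi>
    proof -
     have c: "(\<integral>\<^sup>+h. ennreal (norm (\<theta> (dual_act h \<zeta>))) \<partial>\<mu>) = (\<integral>\<^sup>+h. ennreal (norm (\<theta> (dual_act h \<xi>))) \<partial>\<mu>)" if "\<zeta> \<in> V" for \<zeta>
      using that V(3) \<xi> orbit_integral_const[of "\<lambda>\<eta>. ennreal (norm (\<theta> \<eta>))" \<zeta> \<xi>] by auto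
     have "(\<integral>\<^sup>+\<zeta>. (\<integral>\<^sup>+h. ennreal (norm (\<theta> (dual_act h \<xi>))) \<partial>\<mu>) * indicator V \<zeta> \<partial>lborel)
       = (\<integral>\<^sup>+\<zeta>. indicator V \<zeta> * (\<integral>\<^sup>+h. ennreal (norm (\<theta> (dual_act h \<zeta>))) \<partial>\<mu>) \<partial>lborel)"
      using c by (intro nn_integral_cong) (auto simp: indicator_def[of V])
     also have "\<dots> = (\<integral>\<^sup>+\<eta>. ennreal (norm (\<theta> \<eta>)) * orbit_density V \<eta> \<partial>lborel)"
      by (rule nn_integral_orbit_density) measurable
     also have "\<dots> < \<infinity>" by (rule fin)
     finally have "(\<integral>\<^sup>+h. ennreal (norm (\<theta> (dual_act h \<xi>))) \<partial>\<mu>) * emeasure lborel V < \<infinity>"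
      by (simp add: nn_integral_cmult_indicator)
     moreover have "emeasure lborel V \<noteq> 0" using emeasure_open_neq_0 V by blast
     ultimately show ?thesis by (auto simp: ennreal_mult_less_top)
    qed
    have "overlap \<theta> \<eta>0 = 0"
    proof (rule ccontr)
     assume "overlap \<theta> \<eta>0 \<noteq> 0"
     moreover have "overlap \<theta> \<xi> = overlap \<theta> \<eta>0" if "\<xi> \<in> Orb" for \<xi>
      using overlap_const[OF \<theta>_m that \<eta>0] .
     ultimately have thesis
      using abs_fin ab V(3) u unfolding \<theta>_def[abs_def] by (intro window[of a b u "overlap \<theta> \<eta>0"]) (auto simp: \<theta>_def[abs_def])
     with none show False by blast
    qed
    then have z: "indicator V \<xi> *\<^sub>R overlap \<theta> \<xi> = 0" for \<xi>
     using overlap_const[OF \<theta>_m, of \<xi> \<eta>0] V(3) \<eta>0 by (auto simp: indicator_def)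
    have "(\<integral>x. \<theta> x * complex_of_real (D x) \<partial>lborel) = (\<integral>\<xi>. indicator V \<xi> *\<^sub>R overlap \<theta> \<xi> \<partial>lborel)"
     unfolding D_def by (rule integral_orbit_density[OF Vm \<theta>_m fin, symmetric])
    also have "\<dots> = 0" by (simp only: z Bochner_Integration.integral_zero)
    finally show ?thesis by (simp add: \<theta>_def cnj_tensor mult_ac)
   qed
  qed
  moreover have "AE \<eta> in lborel. orbit_density V \<eta> \<noteq> 0" by (rule orbit_density_pos[OF V(1,3,2)])
  ultimately have "AE \<eta> in lborel. \<eta> \<in> V \<longrightarrow> \<Psi> \<eta> = 0"
   by eventually_elim (use D(3) in auto)
  then show ?thesis using V by blast
 qed
 define \<V> where "\<V> = {V. open V \<and> (AE \<eta> in lborel. \<eta> \<in> V \<longrightarrow> \<Psi> \<eta> = 0)}"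
 obtain \<V>' where \<V>': "\<V>' \<subseteq> \<V>" "countable \<V>'" "\<Union>\<V>' = \<Union>\<V>"
 proof -
  have "\<And>S. S \<in> \<V> ==> open S" by (simp add: \<V>_def)
  from Elementary_Topology.Lindelof[OF this] show thesis using that by blast
 qed
 have ae: "AE \<eta> in lborel. \<forall>V\<in>\<V>'. \<eta> \<in> V \<longrightarrow> \<Psi> \<eta> = 0"
  using \<V>' by (subst AE_ball_countable) (auto simp: \<V>_def)
 have cover: "Orb \<subseteq> \<Union>\<V>'" using loc unfolding \<V>'(3) by (auto simp: \<V>_def)
 have "AE \<eta> in lborel. \<Psi> \<eta> = 0" using ae AE_Orb by eventually_elim (use cover in blast)
 with nz show False by blast
qed

end

lemma l2norm_qreg:
 fixes h :: "real^'d^'d"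
 assumes h: "det h \<noteq> 0" and hi: "det (matrix_inv h) = 1 / det h" and f: "sqint f"
 shows "sqint (qreg (x, h) f)" "l2norm (qreg (x, h) f) = l2norm f"
proof -
 have [measurable]: "f \<in> borel_measurable borel" using f by (simp add: sqint_def)
 have e: "(norm (qreg (x, h) f y))\<^sup>2 = (1 / \<bar>det h\<bar>) * (norm (f (matrix_inv h *v (y - x))))\<^sup>2" for y
 proof -
  have "(\<bar>det h\<bar> powr (- 1 / 2))\<^sup>2 = 1 / \<bar>det h\<bar>"
   using h by (simp add: powr_powr powr_neg_one flip: powr_realpow[of "_ powr _" 2])
  then show ?thesis by (simp add: norm_mult power_mult_distrib)
 qed
 have m [measurable]: "qreg (x, h) f \<in> borel_measurable borel" by simp
 have "(\<integral>\<^sup>+y. ennreal ((norm (qreg (x, h) f y))\<^sup>2) \<partial>lborel) = (\<integral>\<^sup>+y. ennreal ((norm (qreg (x, h) f (x + y)))\<^sup>2) \<partial>lborel)"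
  by (rule nn_integral_translation[symmetric]) measurable
 also have "\<dots> = (\<integral>\<^sup>+y. ennreal (1 / \<bar>det h\<bar>) * ennreal ((norm (f (matrix_inv h *v y)))\<^sup>2) \<partial>lborel)"
  unfolding e add_diff_cancel_left' by (intro nn_integral_cong ennreal_mult) auto
 also have "\<dots> = ennreal (1 / \<bar>det h\<bar>) * (\<integral>\<^sup>+y. ennreal ((norm (f (matrix_inv h *v y)))\<^sup>2) \<partial>lborel)"
  by (rule nn_integral_cmult) measurable
 also have "(\<integral>\<^sup>+y. ennreal ((norm (f (matrix_inv h *v y)))\<^sup>2) \<partial>lborel) = ennreal \<bar>det h\<bar> * (\<integral>\<^sup>+y. ennreal ((norm (f y))\<^sup>2) \<partial>lborel)"
  using nn_integral_linear[of "matrix_inv h" "\<lambda>y. ennreal ((norm (f y))\<^sup>2)"] h by (simp add: hi)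
 finally have I: "(\<integral>\<^sup>+y. ennreal ((norm (qreg (x, h) f y))\<^sup>2) \<partial>lborel) = (\<integral>\<^sup>+y. ennreal ((norm (f y))\<^sup>2) \<partial>lborel)"
  using h by (simp add: mult.assoc[symmetric] ennreal_mult[symmetric] del: qreg.simps)
 show s: "sqint (qreg (x, h) f)"
  using f I m unfolding sqint_def integrable_iff_bounded by simp
 show "l2norm (qreg (x, h) f) = l2norm f"
  unfolding l2norm_def using I by (subst (1 2) integral_eq_nn_integral) auto
qed

text \<open>The quasi-regular representation on the Fourier side.\<close>

definition dual_qreg :: "real^'d => real^'d^'d => (real^'d => complex) => real^'d => complex" where
 "dual_qreg x h \<Psi> \<xi> = complex_of_real (sqrt \<bar>det h\<bar>) * cis (- (2 * pi * (x \<bullet> \<xi>))) * \<Psi> (dual_act h \<xi>)"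

lemma l2norm_dual_qreg:
 fixes h :: "real^'d^'d"
 assumes h: "det h \<noteq> 0" and f: "sqint f"
 shows "sqint (dual_qreg x h f)" "l2norm (dual_qreg x h f) = l2norm f"
proof -
 have [measurable]: "f \<in> borel_measurable borel" using f by (simp add: sqint_def)
 have e: "(norm (dual_qreg x h f y))\<^sup>2 = \<bar>det h\<bar> * (norm (f (dual_act h y)))\<^sup>2" for y
  by (simp add: dual_qreg_def norm_mult power_mult_distrib)
 have m [measurable]: "dual_qreg x h f \<in> borel_measurable borel" unfolding dual_qreg_def by measurable
 have "(\<integral>\<^sup>+y. ennreal ((norm (dual_qreg x h f y))\<^sup>2) \<partial>lborel) = ennreal \<bar>det h\<bar> * (\<integral>\<^sup>+y. ennreal ((norm (f (dual_act h y)))\<^sup>2) \<partial>lborel)"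
  by (simp add: e ennreal_mult nn_integral_cmult)
 also have "(\<integral>\<^sup>+y. ennreal ((norm (f (dual_act h y)))\<^sup>2) \<partial>lborel) = ennreal (1 / \<bar>det h\<bar>) * (\<integral>\<^sup>+y. ennreal ((norm (f y))\<^sup>2) \<partial>lborel)"
  using nn_integral_linear[of "transpose h" "\<lambda>y. ennreal ((norm (f y))\<^sup>2)"] h by simp
 finally have I: "(\<integral>\<^sup>+y. ennreal ((norm (dual_qreg x h f y))\<^sup>2) \<partial>lborel) = (\<integral>\<^sup>+y. ennreal ((norm (f y))\<^sup>2) \<partial>lborel)"
  using h by (simp add: mult.assoc[symmetric] ennreal_mult[symmetric])
 show s: "sqint (dual_qreg x h f)"
  using f I m unfolding sqint_def integrable_iff_bounded by simp
 show "l2norm (dual_qreg x h f) = l2norm f"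
  unfolding l2norm_def using I by (subst (1 2) integral_eq_nn_integral) auto
qed

lemma fourier_qreg:
 fixes h :: "real^'d^'d"
 assumes h: "det h \<noteq> 0" and hi: "h ** matrix_inv h = mat 1" "det (matrix_inv h) = 1 / det h"
  and [measurable]: "f \<in> borel_measurable borel"
 shows "fourier (qreg (x, h) f) = dual_qreg x h (fourier f)"
proof
 fix \<xi> :: "real^'d"
 have inv: "(x + y) \<bullet> \<xi> = x \<bullet> \<xi> + (matrix_inv h *v y) \<bullet> dual_act h \<xi>" for y
 proof -
  have "(matrix_inv h *v y) \<bullet> dual_act h \<xi> = (h *v (matrix_inv h *v y)) \<bullet> \<xi>"
   by (subst inner_commute) (simp add: transpose_matrix_vector dot_lmul_matrix inner_commute[of \<xi>])
  then show ?thesis using hi(1) by (simp add: matrix_vector_mul_assoc inner_add_left)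
 qed
 let ?g = "\<lambda>z. f z * cis (- (2 * pi * (z \<bullet> dual_act h \<xi>)))"
 let ?c = "complex_of_real (\<bar>det h\<bar> powr (- 1 / 2)) * cis (- (2 * pi * (x \<bullet> \<xi>)))"
 have "fourier (qreg (x, h) f) \<xi> = (\<integral>y. qreg (x, h) f (x + y) * cis (- (2 * pi * ((x + y) \<bullet> \<xi>))) \<partial>lborel)"
  unfolding fourier_cis by (rule integral_translation(1)[symmetric])
 also have "\<dots> = (\<integral>y. ?c * ?g (matrix_inv h *v y) \<partial>lborel)"
 proof (intro Bochner_cong refl)
  fix y
  have "cis (- (2 * pi * ((x + y) \<bullet> \<xi>)))
    = cis (- (2 * pi * (x \<bullet> \<xi>))) * cis (- (2 * pi * ((matrix_inv h *v y) \<bullet> dual_act h \<xi>)))"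
   unfolding inv by (simp add: cis_mult algebra_simps)
  then show "qreg (x, h) f (x + y) * cis (- (2 * pi * ((x + y) \<bullet> \<xi>))) = ?c * ?g (matrix_inv h *v y)"
   by (simp add: mult_ac)
 qed
 also have "\<dots> = ?c * (complex_of_real \<bar>det h\<bar> * fourier f (dual_act h \<xi>))"
  using integral_linear(1)[of "matrix_inv h" ?g] h by (simp add: hi fourier_cis)
 also have "\<dots> = (complex_of_real (\<bar>det h\<bar> powr (- 1 / 2) * \<bar>det h\<bar>)) * cis (- (2 * pi * (x \<bullet> \<xi>))) * fourier f (dual_act h \<xi>)"
  by (simp add: mult_ac)
 also have "\<bar>det h\<bar> powr (- 1 / 2) * \<bar>det h\<bar> = sqrt \<bar>det h\<bar>"
  using h powr_add[of "\<bar>det h\<bar>" "- 1 / 2" 1] by (simp add: powr_half_sqrt)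
 finally show "fourier (qreg (x, h) f) \<xi> = dual_qreg x h (fourier f) \<xi>" by (simp add: dual_qreg_def)
qed

lemma Cc_qreg:
 fixes h :: "real^'d^'d"
 assumes h: "h ** matrix_inv h = mat 1" and f: "Cc f"
 shows "Cc (qreg (x, h) f)"
proof -
 obtain R where R: "\<And>y. R < norm y ==> f y = 0" and c: "continuous_on UNIV f" using f by (auto simp: Cc_def)
 have "qreg (x, h) f y = 0" if y: "norm x + norm h * \<bar>R\<bar> < norm y" for y
 proof -
  have "norm (y - x) \<le> norm h * norm (matrix_inv h *v (y - x))"
   using norm_matrix_vector_mult_le[of h "matrix_inv h *v (y - x)"] h by (simp add: matrix_vector_mul_assoc)
  moreover have "norm h * \<bar>R\<bar> < norm (y - x)" using y norm_triangle_ineq2[of y x] by linarith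
  ultimately have "norm h * \<bar>R\<bar> < norm h * norm (matrix_inv h *v (y - x))" by linarith
  then have "\<bar>R\<bar> < norm (matrix_inv h *v (y - x))" by (simp add: mult_less_cancel_left)
  then show ?thesis using R by simp
 qed
 moreover have "continuous_on UNIV (qreg (x, h) f)"
  by (simp, intro continuous_intros continuous_on_compose2[OF c]) auto
 ultimately show ?thesis by (auto simp: Cc_def simp del: qreg.simps)
qed

context dual_orbit
begin

lemma has_L2_fourier_qreg:
 assumes h: "h \<in> H" and \<psi>: "has_L2_fourier \<psi> \<Psi>"
 shows "has_L2_fourier (qreg (x, h) \<psi>) (dual_qreg x h \<Psi>)"
proof -
 note d = det_H[OF h] and di = det_inv[OF h] and hi = inv_mult(2)[OF h]
 obtain t where t: "\<And>n. Cc (t n)" "(\<lambda>n. l2norm (\<lambda>x. t n x - \<psi> x)) \<longlonglongrightarrow> 0"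
  "(\<lambda>n. l2norm (\<lambda>x. fourier (t n) x - \<Psi> x)) \<longlonglongrightarrow> 0" and s: "sqint \<psi>" "sqint \<Psi>"
  using \<psi> by (auto simp: has_L2_fourier_def)
 have 1: "l2norm (\<lambda>y. qreg (x, h) (t n) y - qreg (x, h) \<psi> y) = l2norm (\<lambda>x. t n x - \<psi> x)" for n
 proof -
  have "(\<lambda>y. qreg (x, h) (t n) y - qreg (x, h) \<psi> y) = qreg (x, h) (\<lambda>x. t n x - \<psi> x)" by (simp add: fun_eq_iff algebra_simps)
  then show ?thesis using l2norm_qreg(2)[OF d di, of "\<lambda>x. t n x - \<psi> x"] sqint_diff(1)[OF Cc_imp(5)[OF t(1)] s(1)] by (simp del: qreg.simps)
 qed
 have 2: "l2norm (\<lambda>y. fourier (qreg (x, h) (t n)) y - dual_qreg x h \<Psi> y) = l2norm (\<lambda>x. fourier (t n) x - \<Psi> x)" for n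
 proof -
  have "(\<lambda>y. fourier (qreg (x, h) (t n)) y - dual_qreg x h \<Psi> y) = dual_qreg x h (\<lambda>x. fourier (t n) x - \<Psi> x)"
   using fourier_qreg[OF d hi di Cc_imp(2)[OF t(1)]] by (simp add: fun_eq_iff dual_qreg_def algebra_simps)
  then show ?thesis
   using l2norm_dual_qreg(2)[OF d, of "\<lambda>x. fourier (t n) x - \<Psi> x"] sqint_diff(1)[OF Parseval_Cc(1)[OF t(1)] s(2)] by simp
 qed
 have "Cc (qreg (x, h) (t n))" for n using Cc_qreg[OF hi t(1)] .
 then show ?thesis
  unfolding has_L2_fourier_def
  using l2norm_qreg(1)[OF d di s(1)] l2norm_dual_qreg(1)[OF d s(2)] t(2,3) 1 2
  by (intro conjI exI[of _ "\<lambda>n. qreg (x, h) (t n)"]) (simp_all del: qreg.simps)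
qed

end

section \<open>The orthogonality relation\<close>

context dual_orbit
begin

lemma sqint_dual_act:
 assumes h: "h \<in> H" and \<Psi>: "sqint \<Psi>" shows "sqint (\<lambda>\<xi>. \<Psi> (dual_act h \<xi>))"
proof -
 have "sqint (\<lambda>\<xi>. complex_of_real (1 / sqrt \<bar>det h\<bar>) * dual_qreg 0 h \<Psi> \<xi>)"
  using det_H[OF h] \<Psi> by (intro sqint_cmult l2norm_dual_qreg)
 then show ?thesis using det_H[OF h] by (simp add: dual_qreg_def)
qed

lemma Cc_times_dual_window:
 assumes h: "h \<in> H" and F: "continuous_on UNIV F" and u: "u \<in> box_test a b"
 shows "Cc (\<lambda>\<xi>. F \<xi> * tensor u (dual_act h \<xi>))"
proof -
 obtain R0 where R0: "\<And>\<zeta>. \<zeta> \<in> cbox a b ==> norm \<zeta> \<le> R0" using bounded_cbox[of a b] by (auto simp: bounded_iff)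
 have "tensor u (dual_act h \<xi>) = 0" if "norm (matrix_inv h) * R0 < norm \<xi>" for \<xi>
 proof (rule tensor_eq_0_outside[OF u], rule notI)
  assume "dual_act h \<xi> \<in> cbox a b"
  then have "norm (matrix_inv h) * norm (dual_act h \<xi>) \<le> norm (matrix_inv h) * R0"
   by (intro mult_left_mono R0) auto
  moreover have "norm \<xi> \<le> norm (matrix_inv h) * norm (dual_act h \<xi>)"
   using norm_matrix_vector_mult_le[of "transpose (matrix_inv h)" "dual_act h \<xi>"] h
   by (simp add: dual_act_inv norm_transpose)
  ultimately show False using that by simp
 qed
 moreover have "continuous_on UNIV (\<lambda>\<xi>. tensor u (dual_act h \<xi>))"
  by (rule continuous_on_compose2[OF tensor_continuous[of u UNIV, OF box_testD(1)[OF u]]]) (auto intro!: continuous_intros)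
 ultimately show ?thesis using F
  unfolding Cc_def by (intro conjI continuous_intros exI[of _ "norm (matrix_inv h) * R0"]) auto
qed

text \<open>The orthogonality relation for one fixed \<open>h\<close>: up to the factor \<open>\<bar>det h\<bar>\<^sup>1\<^sup>/\<^sup>2\<close> both transforms are Fourier
 transforms in \<open>x\<close>, so that the \<open>x\<close>-integral is an instance of Parseval's identity.\<close>

lemma slice_orthogonality:
 fixes F G \<Psi> :: "real^'d => complex"
 assumes h: "h \<in> H" and F: "continuous_on UNIV F" and u: "u \<in> box_test a b"
  and \<psi>: "has_L2_fourier \<psi> \<Psi>" and g: "has_L2_fourier g G"
  and fin: "(\<integral>\<^sup>+x. ennreal (norm (l2_inner g (qreg (x, h) \<psi>))) \<partial>lborel) < \<infinity>"
 shows "ennreal (norm (\<integral>\<xi>. F \<xi> * cnj (G \<xi>) * (\<Psi> (dual_act h \<xi>) * cnj (tensor u (dual_act h \<xi>))) \<partial>lborel))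
  \<le> ennreal (1 / \<bar>det h\<bar>) * (\<integral>\<^sup>+x. ennreal (norm (dual_wavelet F (tensor u) x h) * norm (l2_inner g (qreg (x, h) \<psi>))) \<partial>lborel)"
proof -
 have s: "sqint \<Psi>" "sqint G" using \<psi> g by (auto simp: has_L2_fourier_def)
 have [measurable]: "F \<in> borel_measurable borel" "G \<in> borel_measurable borel" "\<Psi> \<in> borel_measurable borel" "tensor u \<in> borel_measurable borel"
  using F s borel_measurable_tensor[OF box_testD(1)[OF u]] by (auto simp: sqint_def intro: borel_measurable_continuous_onI)
 let ?r = "sqrt \<bar>det h\<bar>"
 have r: "0 < ?r" using det_H[OF h] by simp
 define N where "N \<xi> = cnj (G \<xi>) * \<Psi> (dual_act h \<xi>)" for \<xi>
 define M where "M \<xi> = cnj (F \<xi>) * tensor u (dual_act h \<xi>)" for \<xi>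
 have N: "integrable lborel N"
  using sqint_product(2)[OF sqint_dual_act[OF h s(1)] s(2)] by (simp add: N_def[abs_def] mult.commute)
 have "Cc M" unfolding M_def by (rule Cc_times_dual_window[OF h _ u]) (intro continuous_intros F)
 note M = Cc_imp[OF this]
 have W: "cnj (l2_inner g (qreg (x, h) \<psi>)) = complex_of_real ?r * fourier N x" for x
 proof -
  have "l2_inner g (qreg (x, h) \<psi>) = (\<integral>\<xi>. G \<xi> * cnj (dual_qreg x h \<Psi> \<xi>) \<partial>lborel)"
   unfolding l2_inner_def by (rule Parseval_L2[OF g has_L2_fourier_qreg[OF h \<psi>]])
  then have "cnj (l2_inner g (qreg (x, h) \<psi>)) = (\<integral>\<xi>. cnj (G \<xi> * cnj (dual_qreg x h \<Psi> \<xi>)) \<partial>lborel)"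
   by (simp only: Bochner_Integration.integral_cnj)
  also have "\<dots> = (\<integral>\<xi>. complex_of_real ?r * (N \<xi> * cis (- (2 * pi * (\<xi> \<bullet> x)))) \<partial>lborel)"
   by (intro Bochner_cong refl) (simp add: dual_qreg_def N_def inner_commute mult_ac)
  finally show ?thesis by (simp add: fourier_cis)
 qed
 have V: "dual_wavelet F (tensor u) x h = complex_of_real ?r * cnj (fourier M x)" for x
 proof -
  have "cnj (fourier M x) = (\<integral>\<xi>. cnj (M \<xi> * cis (- (2 * pi * (\<xi> \<bullet> x)))) \<partial>lborel)"
   unfolding fourier_cis by (simp only: Bochner_Integration.integral_cnj)
  also have "\<dots> = (\<integral>\<xi>. F \<xi> * cnj (tensor u (dual_act h \<xi>)) * cis (2 * pi * (x \<bullet> \<xi>)) \<partial>lborel)"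
   by (intro Bochner_cong refl) (simp add: M_def inner_commute cis_cnj)
  finally show ?thesis by (simp add: dual_wavelet_def)
 qed
 have nW: "norm (l2_inner g (qreg (x, h) \<psi>)) = ?r * norm (fourier N x)" for x
  using arg_cong[OF W[of x], of norm] r by (simp add: norm_mult)
 have fN_m [measurable]: "fourier N \<in> borel_measurable borel" "fourier M \<in> borel_measurable borel"
  using N M(4) by (auto intro: borel_measurable_fourier)
 have fN: "integrable lborel (fourier N)"
 proof (rule integrableI_bounded)
  have "ennreal ?r * (\<integral>\<^sup>+x. ennreal (norm (fourier N x)) \<partial>lborel) = (\<integral>\<^sup>+x. ennreal (norm (l2_inner g (qreg (x, h) \<psi>))) \<partial>lborel)"
   using r by (simp add: nW ennreal_mult nn_integral_cmult del: qreg.simps)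
  then have "ennreal ?r * (\<integral>\<^sup>+x. ennreal (norm (fourier N x)) \<partial>lborel) < \<infinity>" by (simp only: fin)
  then show "(\<integral>\<^sup>+x. ennreal (norm (fourier N x)) \<partial>lborel) < \<infinity>" using r by (auto simp: ennreal_mult_less_top)
 qed measurable
 have prod: "integrable lborel (\<lambda>x. fourier N x * cnj (fourier M x))"
 proof (rule Bochner_Integration.integrable_bound[where f = "\<lambda>x. complex_of_real (\<integral>x. norm (M x) \<partial>lborel) * fourier N x"])
  show "integrable lborel (\<lambda>x. complex_of_real (\<integral>x. norm (M x) \<partial>lborel) * fourier N x)"
   using fN by (intro integrable_mult_right) auto
  have "norm (fourier N x) * norm (fourier M x) \<le> norm (fourier N x) * (\<integral>x. norm (M x) \<partial>lborel)" for x
   using norm_fourier_le[OF M(4), of x] by (rule mult_left_mono) auto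
  then show "AE x in lborel. norm (fourier N x * cnj (fourier M x)) \<le> norm (complex_of_real (\<integral>x. norm (M x) \<partial>lborel) * fourier N x)"
   by (intro AE_I2) (simp add: norm_mult mult.commute integral_nonneg_AE)
 qed measurable
 obtain BM where BM: "\<And>x. norm (M x) \<le> BM" using M(3) by blast
 have "(\<integral>\<xi>. F \<xi> * cnj (G \<xi>) * (\<Psi> (dual_act h \<xi>) * cnj (tensor u (dual_act h \<xi>))) \<partial>lborel) = (\<integral>\<xi>. N \<xi> * cnj (M \<xi>) \<partial>lborel)"
  by (intro Bochner_cong refl) (simp add: N_def M_def mult_ac)
 also have "\<dots> = (\<integral>x. fourier N x * cnj (fourier M x) \<partial>lborel)"
  by (rule Parseval_L1_continuous[OF N M(4) M(1) BM prod, symmetric])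
 finally have "ennreal (norm (\<integral>\<xi>. F \<xi> * cnj (G \<xi>) * (\<Psi> (dual_act h \<xi>) * cnj (tensor u (dual_act h \<xi>))) \<partial>lborel))
   \<le> (\<integral>\<^sup>+x. ennreal (norm (fourier N x * cnj (fourier M x))) \<partial>lborel)"
  using integral_norm_bound_ennreal[OF prod] by simp
 also have "\<dots> = (\<integral>\<^sup>+x. ennreal (1 / \<bar>det h\<bar>) * ennreal (norm (dual_wavelet F (tensor u) x h) * norm (l2_inner g (qreg (x, h) \<psi>))) \<partial>lborel)"
 proof (rule nn_integral_cong)
  fix x
  have "norm (dual_wavelet F (tensor u) x h) * norm (l2_inner g (qreg (x, h) \<psi>)) = \<bar>det h\<bar> * (norm (fourier N x) * norm (fourier M x))"
   using r by (simp add: V nW norm_mult del: qreg.simps)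
  then show "ennreal (norm (fourier N x * cnj (fourier M x)))
    = ennreal (1 / \<bar>det h\<bar>) * ennreal (norm (dual_wavelet F (tensor u) x h) * norm (l2_inner g (qreg (x, h) \<psi>)))"
   using det_H[OF h] by (simp add: norm_mult del: qreg.simps flip: ennreal_mult)
 qed
 also have "\<dots> = ennreal (1 / \<bar>det h\<bar>) * (\<integral>\<^sup>+x. ennreal (norm (dual_wavelet F (tensor u) x h) * norm (l2_inner g (qreg (x, h) \<psi>))) \<partial>lborel)"
  unfolding V nW norm_mult by (rule nn_integral_cmult) measurable
 finally show ?thesis .
qed

text \<open>Integrating over \<open>h\<close> and exchanging integrals brings out the overlap \<open>\<kappa>\<close>, which is constant on the orbit.
 The right-hand side may be infinite.\<close>

lemma orthogonality_bound:
 fixes F G \<Psi> :: "real^'d => complex"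
 assumes F: "continuous_on UNIV F" "sqint F" and u: "u \<in> box_test a b"
  and \<psi>: "has_L2_fourier \<psi> \<Psi>" and g: "has_L2_fourier g G"
  and \<kappa>: "\<And>\<xi>. \<xi> \<in> Orb ==> overlap (\<lambda>\<xi>. \<Psi> \<xi> * cnj (tensor u \<xi>)) \<xi> = \<kappa>"
  and \<kappa>_fin: "\<And>\<xi>. \<xi> \<in> Orb ==> (\<integral>\<^sup>+h. ennreal (norm (\<Psi> (dual_act h \<xi>) * cnj (tensor u (dual_act h \<xi>)))) \<partial>\<mu>) < \<infinity>"
  and fin: "AE h in \<mu>. (\<integral>\<^sup>+x. ennreal (norm (l2_inner g (qreg (x, h) \<psi>))) \<partial>lborel) < \<infinity>"
 shows "ennreal (norm \<kappa> * norm (\<integral>\<xi>. F \<xi> * cnj (G \<xi>) \<partial>lborel))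
  \<le> (\<integral>\<^sup>+h. ennreal (1 / \<bar>det h\<bar>) * (\<integral>\<^sup>+x. ennreal (norm (dual_wavelet F (tensor u) x h) * norm (l2_inner g (qreg (x, h) \<psi>))) \<partial>lborel) \<partial>\<mu>)"
proof -
 have s: "sqint \<Psi>" "sqint G" using \<psi> g by (auto simp: has_L2_fourier_def)
 have [measurable]: "F \<in> borel_measurable borel" "G \<in> borel_measurable borel" "\<Psi> \<in> borel_measurable borel" "tensor u \<in> borel_measurable borel"
  using F s borel_measurable_tensor[OF box_testD(1)[OF u]] by (auto simp: sqint_def intro: borel_measurable_continuous_onI)
 define \<theta> where "\<theta> \<xi> = \<Psi> \<xi> * cnj (tensor u \<xi>)" for \<xi>
 have \<theta> [measurable]: "\<theta> \<in> borel_measurable borel" unfolding \<theta>_def by measurable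
 let ?f = "\<lambda>\<xi> h. F \<xi> * cnj (G \<xi>) * \<theta> (dual_act h \<xi>)"
 have m: "(\<lambda>z. ?f (fst z) (snd z)) \<in> borel_measurable (leb_mu)"
  by (rule measurable_lborel_mu) measurable
 have sec: "(\<lambda>h. ennreal (norm (\<theta> (dual_act h \<xi>)))) \<in> borel_measurable \<mu>" for \<xi>
  by (rule measurable_mu) measurable
 obtain \<xi>0 where \<xi>0: "\<xi>0 \<in> Orb" using Orb_nonempty by blast
 define A where "A = (\<integral>\<^sup>+h. ennreal (norm (\<theta> (dual_act h \<xi>0))) \<partial>\<mu>)"
 have A: "A < \<infinity>" "\<And>\<xi>. \<xi> \<in> Orb ==> (\<integral>\<^sup>+h. ennreal (norm (\<theta> (dual_act h \<xi>))) \<partial>\<mu>) = A"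
 proof -
  show "A < \<infinity>" unfolding A_def \<theta>_def by (rule \<kappa>_fin[OF \<xi>0])
  show "(\<integral>\<^sup>+h. ennreal (norm (\<theta> (dual_act h \<xi>))) \<partial>\<mu>) = A" if "\<xi> \<in> Orb" for \<xi>
   unfolding A_def by (rule orbit_integral_const[OF _ that \<xi>0]) measurable
 qed
 have int: "integrable (leb_mu) (\<lambda>z. ?f (fst z) (snd z))"
 proof (rule integrableI_bounded[OF m])
  have mm: "(\<lambda>z. ennreal (norm (?f (fst z) (snd z)))) \<in> borel_measurable (leb_mu)"
   by (rule measurable_compose[OF m, of "\<lambda>x. ennreal (norm x)"]) measurable
  have "(\<integral>\<^sup>+z. ennreal (norm (?f (fst z) (snd z))) \<partial>(leb_mu))
    = (\<integral>\<^sup>+\<xi>. (\<integral>\<^sup>+h. ennreal (norm (F \<xi>) * norm (G \<xi>)) * ennreal (norm (\<theta> (dual_act h \<xi>))) \<partial>\<mu>) \<partial>lborel)"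
   unfolding mu.nn_integral_fst[OF mm, symmetric] by (simp add: norm_mult ennreal_mult)
  also have "\<dots> = (\<integral>\<^sup>+\<xi>. ennreal (norm (F \<xi>) * norm (G \<xi>)) * A \<partial>lborel)"
   by (rule nn_integral_cong_AE) (use AE_Orb in \<open>eventually_elim, simp add: nn_integral_cmult sec A(2)\<close>)
  also have "\<dots> < \<infinity>"
   using sqint_product(1)[OF F(2) s(2)] A(1)
   by (simp add: nn_integral_multc nn_integral_eq_integral ennreal_mult_less_top)
  finally show "(\<integral>\<^sup>+z. ennreal (norm (?f (fst z) (snd z))) \<partial>(leb_mu)) < \<infinity>" .
 qed
 then have int': "integrable (leb_mu) (\<lambda>(\<xi>, h). ?f \<xi> h)" by (simp add: split_beta')
 have "\<kappa> * (\<integral>\<xi>. F \<xi> * cnj (G \<xi>) \<partial>lborel) = (\<integral>\<xi>. F \<xi> * cnj (G \<xi>) * \<kappa> \<partial>lborel)" by (simp add: mult.commute)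
 also have "\<dots> = (\<integral>\<xi>. (\<integral>h. ?f \<xi> h \<partial>\<mu>) \<partial>lborel)"
 proof (rule Bochner_Integration.integral_cong_AE)
  show "(\<lambda>\<xi>. \<integral>h. ?f \<xi> h \<partial>\<mu>) \<in> borel_measurable lborel"
   by (rule mu.borel_measurable_lebesgue_integral) (use m in \<open>simp add: split_beta'\<close>)
  show "AE \<xi> in lborel. F \<xi> * cnj (G \<xi>) * \<kappa> = (\<integral>h. ?f \<xi> h \<partial>\<mu>)"
   using AE_Orb by eventually_elim (simp add: overlap_def \<theta>_def flip: \<kappa>)
 qed measurable
 also have "\<dots> = (\<integral>h. (\<integral>\<xi>. ?f \<xi> h \<partial>lborel) \<partial>\<mu>)" by (rule P.Fubini_integral[OF int', symmetric])
 finally have "ennreal (norm (\<kappa> * (\<integral>\<xi>. F \<xi> * cnj (G \<xi>) \<partial>lborel))) \<le> (\<integral>\<^sup>+h. ennreal (norm (\<integral>\<xi>. ?f \<xi> h \<partial>lborel)) \<partial>\<mu>)"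
  using integral_norm_bound_ennreal[OF P.integrable_snd[OF int']] by simp
 also have "\<dots> \<le> (\<integral>\<^sup>+h. ennreal (1 / \<bar>det h\<bar>) * (\<integral>\<^sup>+x. ennreal (norm (dual_wavelet F (tensor u) x h) * norm (l2_inner g (qreg (x, h) \<psi>))) \<partial>lborel) \<partial>\<mu>)"
 proof (rule nn_integral_mono_AE)
  show "AE h in \<mu>. ennreal (norm (\<integral>\<xi>. ?f \<xi> h \<partial>lborel))
    \<le> ennreal (1 / \<bar>det h\<bar>) * (\<integral>\<^sup>+x. ennreal (norm (dual_wavelet F (tensor u) x h) * norm (l2_inner g (qreg (x, h) \<psi>))) \<partial>lborel)"
   using fin AE_space
   by eventually_elim (use slice_orthogonality[OF _ F(1) u \<psi> g] in \<open>simp add: \<theta>_def space_mu del: qreg.simps\<close>)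
 qed
 finally show ?thesis by (simp add: norm_mult)
qed

end

section \<open>Mixed-norm spaces on the semidirect product\<close>

lemma epow_eq_0_iff: "0 < a ==> epow x a = 0 \<longleftrightarrow> x = 0"
 by (cases x) (auto simp: epow_ennreal)

lemma AE_eq_0_if_lp_norm_0:
 assumes p: "1 \<le> p" and f [measurable]: "f \<in> borel_measurable M" and 0: "lp_norm M p f = 0"
 shows "AE x in M. f x = 0"
 using p
proof (cases rule: exponent_cases)
 case 1
 then have "esssup M f = 0" using 0 by (simp only: lp_norm_top)
 then show ?thesis using esssup_AE[of f M] by simp
next
 case (2 r)
 then have "(\<integral>\<^sup>+x. epow (f x) r \<partial>M) = 0" using 0 by (simp add: lp_norm_ennreal epow_eq_0_iff)
 then have "AE x in M. epow (f x) r = 0" by (subst (asm) nn_integral_0_iff_AE) auto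
 then show ?thesis by eventually_elim (use 2 in \<open>simp add: epow_eq_0_iff\<close>)
qed

lemma lp_norm_indicator_finite:
 assumes p: "1 \<le> p" and A: "A \<in> sets M" "emeasure M A < \<infinity>"
 shows "lp_norm M p (indicator A) < \<infinity>"
 using p
proof (cases rule: exponent_cases)
 case 1
 have "esssup M (indicator A) \<le> (1 :: ennreal)" using A by (intro esssup_I) (auto simp: indicator_def)
 then show ?thesis unfolding 1 lp_norm_top by (rule order_le_less_trans) simp
next
 case (2 r)
 have "epow (indicator A x) r = indicator A x" for x
  using 2 epow_ennreal[of 1 r] by (simp add: indicator_def)
 then show ?thesis using 2 A by (simp add: lp_norm_ennreal epow_less_top)
qed

context dual_orbit
begin

lemma measurable_sd_mult:
 assumes f: "f \<in> N \<rightarrow>\<^sub>M leb_mu" and g: "g \<in> N \<rightarrow>\<^sub>M leb_mu"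
 shows "(\<lambda>z. sd_mult (f z) (g z)) \<in> N \<rightarrow>\<^sub>M leb_mu"
proof -
 have x: "(\<lambda>z. fst (f z)) \<in> borel_measurable N" "(\<lambda>z. fst (g z)) \<in> borel_measurable N"
  using measurable_compose[OF f measurable_fst] measurable_compose[OF g measurable_fst] by auto
 have h: "(\<lambda>z. snd (f z)) \<in> borel_measurable N" "(\<lambda>z. snd (g z)) \<in> borel_measurable N"
  using measurable_compose[OF measurable_compose[OF f measurable_snd] measurable_mu_borel]
   measurable_compose[OF measurable_compose[OF g measurable_snd] measurable_mu_borel] by auto
 have H: "snd (f z) \<in> H" "snd (g z) \<in> H" if "z \<in> space N" for z
  using measurable_space[OF f that] measurable_space[OF g that] by (auto simp: space_pair_measure space_mu)
 have "(\<lambda>z. fst (f z) + snd (f z) *v fst (g z)) \<in> N \<rightarrow>\<^sub>M lborel"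
  using x h by simp
 moreover have "(\<lambda>z. snd (f z) ** snd (g z)) \<in> N \<rightarrow>\<^sub>M \<mu>"
  by (rule measurable_into_mu) (use h H mult_H in auto)
 ultimately have "(\<lambda>z. (fst (f z) + snd (f z) *v fst (g z), snd (f z) ** snd (g z))) \<in> N \<rightarrow>\<^sub>M leb_mu"
  by (rule measurable_Pair)
 moreover have "sd_mult y z = (fst y + snd y *v fst z, snd y ** snd z)" for y z :: "(real^'d) \<times> (real^'d^'d)"
  by (cases y; cases z) simp
 ultimately show ?thesis by simp
qed

lemma qreg_mult:
 assumes "h \<in> H" "k \<in> H"
 shows "qreg (x, h) (qreg (y, k) f) = qreg (sd_mult (x, h) (y, k)) f"
proof
 fix t
 have "matrix_inv (h ** k) *v (t - (x + h *v y)) = matrix_inv k *v (matrix_inv h *v (t - x) - y)"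
 proof -
  have "matrix_inv h *v (t - (x + h *v y)) = matrix_inv h *v (t - x) - (matrix_inv h ** h) *v y"
   by (simp add: matrix_vector_mult_diff_distrib matrix_vector_right_distrib matrix_vector_mul_assoc)
  then show ?thesis using assms by (simp add: inv_mult_distrib inv_mult flip: matrix_vector_mul_assoc)
 qed
 then show "qreg (x, h) (qreg (y, k) f) t = qreg (sd_mult (x, h) (y, k)) f t"
  by (simp add: det_mul abs_mult powr_mult)
qed

lemma l2_inner_qreg:
 assumes h: "h \<in> H" and [measurable]: "f \<in> borel_measurable borel" "g \<in> borel_measurable borel"
 shows "l2_inner (qreg (x, h) f) (qreg (x, h) g) = l2_inner f g"
proof -
 let ?f = "\<lambda>y. f y * cnj (g y)"
 have d: "\<bar>det h\<bar> powr (- 1 / 2) * \<bar>det h\<bar> powr (- 1 / 2) = 1 / \<bar>det h\<bar>"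
  using det_H[OF h] by (simp add: powr_neg_one flip: powr_add)
 have "l2_inner (qreg (x, h) f) (qreg (x, h) g) = (\<integral>y. qreg (x, h) f (x + y) * cnj (qreg (x, h) g (x + y)) \<partial>lborel)"
  unfolding l2_inner_def by (rule integral_translation(1)[symmetric])
 also have "\<dots> = (\<integral>y. complex_of_real (1 / \<bar>det h\<bar>) * ?f (matrix_inv h *v y) \<partial>lborel)"
  unfolding d[symmetric] by (intro Bochner_cong refl) (simp add: mult_ac)
 also have "\<dots> = complex_of_real (1 / \<bar>det h\<bar>) * (complex_of_real \<bar>det h\<bar> * (\<integral>y. ?f y \<partial>lborel))"
  using integral_linear(1)[of "matrix_inv h" ?f] det_H[OF h] by (simp add: det_inv[OF h])
 also have "\<dots> = l2_inner f g" using det_H[OF h] by (simp add: l2_inner_def)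
 finally show ?thesis .
qed

lemma wavelet_measurable:
 assumes [measurable]: "f \<in> borel_measurable borel" "g \<in> borel_measurable borel"
 shows "(\<lambda>z. l2_inner f (qreg z g)) \<in> borel_measurable (leb_mu)"
proof (rule measurable_lborel_mu)
 have "(\<lambda>z. \<integral>y. f y * cnj (complex_of_real (\<bar>det (snd z)\<bar> powr (- 1 / 2)) * g (matrix_inv (snd z) *v (y - fst z))) \<partial>lborel)
   \<in> borel_measurable (borel \<Otimes>\<^sub>M (borel :: (real^'d^'d) measure))"
  by (rule lborel.borel_measurable_lebesgue_integral) measurable
 moreover have "l2_inner f (qreg z g) = (\<integral>y. f y * cnj (complex_of_real (\<bar>det (snd z)\<bar> powr (- 1 / 2)) * g (matrix_inv (snd z) *v (y - fst z))) \<partial>lborel)" for z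
  by (cases z) (simp add: l2_inner_def)
 ultimately show "(\<lambda>z. l2_inner f (qreg z g)) \<in> borel_measurable (borel \<Otimes>\<^sub>M borel)" by simp
qed

text \<open>Left Haar integration on the semidirect product, as an iterated integral with the outer integral over \<open>H\<close>.\<close>

definition int_G :: "((real^'d) \<times> (real^'d^'d) => ennreal) => ennreal" where
 "int_G \<Phi> = (\<integral>\<^sup>+h. ennreal (1 / \<bar>det h\<bar>) * (\<integral>\<^sup>+x. \<Phi> (x, h) \<partial>lborel) \<partial>\<mu>)"

lemma int_G_mono: "(\<And>x h. h \<in> H ==> \<Phi> (x, h) \<le> \<Phi>' (x, h)) ==> int_G \<Phi> \<le> int_G \<Phi>'"
 unfolding int_G_def by (intro nn_integral_mono mult_left_mono) (auto simp: space_mu)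

lemma int_G_left:
 assumes g: "g \<in> H" and \<Phi>: "\<Phi> \<in> borel_measurable (leb_mu)"
 shows "int_G (\<lambda>z. \<Phi> (sd_mult (a, g) z)) = int_G \<Phi>"
proof -
 define \<Theta> where "\<Theta> h = ennreal (1 / \<bar>det h\<bar>) * (\<integral>\<^sup>+x. \<Phi> (x, h) \<partial>lborel)" for h
 have "(\<lambda>h. \<integral>\<^sup>+x. \<Phi> (x, h) \<partial>lborel) \<in> borel_measurable \<mu>"
  using measurable_compose[OF measurable_pair_swap' \<Phi>]
  by (intro lborel.borel_measurable_nn_integral) (simp add: split_beta')
 moreover have "(\<lambda>h. ennreal (1 / \<bar>det h\<bar>)) \<in> borel_measurable \<mu>" by (rule measurable_mu) measurable
 ultimately have \<Theta>: "\<Theta> \<in> borel_measurable \<mu>" unfolding \<Theta>_def by (rule borel_measurable_times_ennreal[rotated])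
 have "ennreal (1 / \<bar>det h\<bar>) * (\<integral>\<^sup>+x. \<Phi> (sd_mult (a, g) (x, h)) \<partial>lborel) = \<Theta> (g ** h)" if h: "h \<in> space \<mu>" for h
 proof -
  have gh: "g ** h \<in> space \<mu>" using h g by (simp add: space_mu mult_H)
  have m [measurable]: "(\<lambda>x. \<Phi> (x, g ** h)) \<in> borel_measurable borel"
   using measurable_compose[OF measurable_Pair2'[OF gh] \<Phi>] by simp
  have "(\<integral>\<^sup>+x. \<Phi> (a + g *v x, g ** h) \<partial>lborel) = ennreal (1 / \<bar>det g\<bar>) * (\<integral>\<^sup>+x. \<Phi> (a + x, g ** h) \<partial>lborel)"
   using nn_integral_linear[of g "\<lambda>x. \<Phi> (a + x, g ** h)"] det_H[OF g] by simp
  also have "(\<integral>\<^sup>+x. \<Phi> (a + x, g ** h) \<partial>lborel) = (\<integral>\<^sup>+x. \<Phi> (x, g ** h) \<partial>lborel)"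
   by (rule nn_integral_translation[OF m])
  finally show ?thesis
   by (simp add: \<Theta>_def det_mul abs_mult ennreal_mult[symmetric] mult.assoc[symmetric] mult.commute)
 qed
 then have "int_G (\<lambda>z. \<Phi> (sd_mult (a, g) z)) = (\<integral>\<^sup>+h. \<Theta> (g ** h) \<partial>\<mu>)"
  unfolding int_G_def by (rule nn_integral_cong)
 also have "\<dots> = int_G \<Phi>" unfolding int_G_def \<Theta>_def[symmetric] by (rule nn_integral_left[OF g \<Theta>])
 finally show ?thesis .
qed

lemma int_G_pair:
 assumes \<Phi>: "\<Phi> \<in> borel_measurable (leb_mu)"
 shows "int_G \<Phi> = (\<integral>\<^sup>+z. ennreal (1 / \<bar>det (snd z)\<bar>) * \<Phi> z \<partial>(leb_mu))"
proof -
 have "(\<lambda>z. ennreal (1 / \<bar>det (snd z)\<bar>)) \<in> borel_measurable (leb_mu)" by (rule measurable_lborel_mu) measurable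
 then have m: "(\<lambda>z. ennreal (1 / \<bar>det (snd z)\<bar>) * \<Phi> z) \<in> borel_measurable (leb_mu)" using \<Phi> by (rule borel_measurable_times_ennreal)
 have sec: "(\<lambda>x. \<Phi> (x, h)) \<in> borel_measurable lborel" if "h \<in> space \<mu>" for h
  using measurable_compose[OF measurable_Pair2'[OF that] \<Phi>] by simp
 have "int_G \<Phi> = (\<integral>\<^sup>+h. (\<integral>\<^sup>+x. ennreal (1 / \<bar>det h\<bar>) * \<Phi> (x, h) \<partial>lborel) \<partial>\<mu>)"
  unfolding int_G_def by (intro nn_integral_cong nn_integral_cmult[symmetric] sec)
 also have "\<dots> = (\<integral>\<^sup>+z. ennreal (1 / \<bar>det (snd z)\<bar>) * \<Phi> z \<partial>(leb_mu))"
  using P.nn_integral_snd[OF m] by simp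
 finally show ?thesis .
qed

lemma det_inverse_measurable: "(\<lambda>h. ennreal (1 / \<bar>det h\<bar>)) \<in> borel_measurable \<mu>"
 by (rule measurable_mu) measurable

lemma mixed_norm_1_1:
 assumes v: "v \<in> borel_measurable (leb_mu)" and F: "F \<in> borel_measurable (leb_mu)"
 shows "mixed_norm \<mu> 1 1 v F = int_G (\<lambda>z. ennreal (norm (F z) * v z))"
proof -
 have "(\<lambda>z. ennreal (norm (F z) * v z)) \<in> borel_measurable (leb_mu)" using v F by measurable
 from measurable_compose[OF measurable_pair_swap' this]
 have "(\<lambda>h. \<integral>\<^sup>+x. ennreal (norm (F (x, h)) * v (x, h)) \<partial>lborel) \<in> borel_measurable \<mu>"
  by (intro lborel.borel_measurable_nn_integral) (simp add: split_beta')
 then show ?thesis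
  by (simp add: mixed_norm_def lp_norm_1 int_G_def nn_integral_density det_inverse_measurable)
qed

definition det_mu :: "(real^'d^'d) measure" where "det_mu = density \<mu> (\<lambda>h. ennreal (1 / \<bar>det h\<bar>))"

lemma sets_det_mu [measurable_cong]: "sets det_mu = sets \<mu>" and space_det_mu: "space det_mu = H"
 by (simp_all add: det_mu_def space_mu)

lemma sigma_finite_det_mu: "sigma_finite_measure det_mu"
 unfolding det_mu_def by (subst mu.sigma_finite_iff_density_finite[OF det_inverse_measurable]) simp

end

locale mixed_space_setting = dual_orbit H \<mu> Orb
 for H :: "(real^'d^'d) set" and \<mu> :: "(real^'d^'d) measure" and Orb :: "(real^'d) set" +
 fixes p :: ennreal and q :: real and v :: "(real^'d) \<times> (real^'d^'d) => real"
 assumes p: "1 \<le> p" and q1: "1 \<le> q" and v: "weight_on (UNIV \<times> H) sd_mult v"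
begin

abbreviation "Y_norm \<equiv> mixed_norm \<mu> p (ennreal q) v"

lemma q1': "1 \<le> ennreal q" using q1 by (simp add: ennreal_1[symmetric] del: ennreal_1)

lemma v_m: "v \<in> borel_measurable (leb_mu)" by (rule weight_G_measurable[OF v])

lemma slice_measurable:
 assumes F: "F \<in> borel_measurable (leb_mu)"
 shows "h \<in> H ==> (\<lambda>x. ennreal (norm (F (x, h)) * v (x, h))) \<in> borel_measurable lborel"
  "(\<lambda>h. lp_norm lborel p (\<lambda>x. ennreal (norm (F (x, h)) * v (x, h)))) \<in> borel_measurable det_mu"
proof -
 have m: "(\<lambda>z. ennreal (norm (F z) * v z)) \<in> borel_measurable (leb_mu)" using v_m F by measurable
 show "h \<in> H ==> (\<lambda>x. ennreal (norm (F (x, h)) * v (x, h))) \<in> borel_measurable lborel"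
  using measurable_compose[OF measurable_Pair2' m] by (simp add: space_mu)
 have "(\<lambda>h. lp_norm lborel p (\<lambda>x. ennreal (norm (F (x, h)) * v (x, h)))) \<in> borel_measurable \<mu>"
 proof (rule borel_measurable_lp_norm[OF lborel.sigma_finite_measure_axioms _ p])
  show "(\<lambda>(h, x). ennreal (norm (F (x, h)) * v (x, h))) \<in> borel_measurable (\<mu> \<Otimes>\<^sub>M lborel)"
   using measurable_compose[OF measurable_pair_swap' m] by (simp add: split_beta')
 qed
 then show "(\<lambda>h. lp_norm lborel p (\<lambda>x. ennreal (norm (F (x, h)) * v (x, h)))) \<in> borel_measurable det_mu"
  by (subst measurable_cong_sets[OF sets_det_mu refl])
qed

lemma Y_norm_def: "Y_norm F = lp_norm det_mu (ennreal q) (\<lambda>h. lp_norm lborel p (\<lambda>x. ennreal (norm (F (x, h)) * v (x, h))))"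
 by (simp add: mixed_norm_def det_mu_def)

lemma Y_norm_cmult:
 assumes r: "0 \<le> r" and F: "F \<in> borel_measurable (leb_mu)"
 shows "Y_norm (\<lambda>z. complex_of_real r * F z) \<le> ennreal r * Y_norm F"
proof -
 have rF: "(\<lambda>z. complex_of_real r * F z) \<in> borel_measurable (leb_mu)" using F by measurable
 have "Y_norm (\<lambda>z. complex_of_real r * F z)
   \<le> lp_norm det_mu (ennreal q) (\<lambda>h. ennreal r * lp_norm lborel p (\<lambda>x. ennreal (norm (F (x, h)) * v (x, h))))"
  unfolding Y_norm_def
 proof (rule lp_norm_mono[OF slice_measurable(2)[OF rF]])
  fix h assume "h \<in> space det_mu"
  then have h: "h \<in> H" by (simp add: space_det_mu)
  have "(\<lambda>x. ennreal (norm (complex_of_real r * F (x, h)) * v (x, h))) = (\<lambda>x. ennreal r * ennreal (norm (F (x, h)) * v (x, h)))"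
   using r by (simp add: norm_mult mult.assoc ennreal_mult')
  then show "lp_norm lborel p (\<lambda>x. ennreal (norm (complex_of_real r * F (x, h)) * v (x, h)))
    \<le> ennreal r * lp_norm lborel p (\<lambda>x. ennreal (norm (F (x, h)) * v (x, h)))"
   using lp_norm_cmult[OF r p slice_measurable(1)[OF F h]] by simp
 qed
 also have "\<dots> \<le> ennreal r * Y_norm F"
  unfolding Y_norm_def by (rule lp_norm_cmult[OF r q1' slice_measurable(2)[OF F]])
 finally show ?thesis .
qed

text \<open>The supremum in \<open>mixed_opnorm\<close> runs over the unit ball. Scaling by an upper bound \<open>c\<close> of the norm also covers functions of norm zero.\<close>

lemma opnorm_bound:
 assumes T: "\<And>F. T F = (\<lambda>z. F (\<tau> z))" and op: "mixed_opnorm \<mu> p (ennreal q) v T \<le> ennreal \<alpha>"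
  and \<tau>: "\<tau> \<in> leb_mu \<rightarrow>\<^sub>M leb_mu"
  and F: "F \<in> borel_measurable (leb_mu)" and c: "0 < c" "Y_norm F \<le> ennreal c"
 shows "Y_norm (T F) \<le> ennreal c * ennreal \<alpha>"
proof -
 define F' where "F' z = complex_of_real (1 / c) * F z" for z
 have F': "F' \<in> borel_measurable (leb_mu)" unfolding F'_def using F by measurable
 have "Y_norm F' \<le> ennreal (1 / c) * Y_norm F" unfolding F'_def using c(1) by (intro Y_norm_cmult F) auto
 also have "\<dots> \<le> ennreal (1 / c) * ennreal c" by (intro mult_left_mono c) auto
 also have "\<dots> = 1" using c(1) by (simp flip: ennreal_mult)
 finally have "Y_norm F' \<le> 1" .
 then have "Y_norm (T F') \<le> mixed_opnorm \<mu> p (ennreal q) v T"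
  unfolding mixed_opnorm_def using F' by (intro SUP_upper) (auto simp: mixed_space_def le_less_trans)
 then have 1: "Y_norm (T F') \<le> ennreal \<alpha>" using op by (rule order_trans)
 have "T F = (\<lambda>z. complex_of_real c * T F' z)" using c(1) by (simp add: T F'_def)
 then have "Y_norm (T F) \<le> ennreal c * Y_norm (T F')"
  using c(1) Y_norm_cmult[of c "T F'"] measurable_compose[OF \<tau> F'] by (simp add: T)
 also have "\<dots> \<le> ennreal c * ennreal \<alpha>" by (intro mult_left_mono 1) auto
 finally show ?thesis .
qed

text \<open>The witness is the indicator of a compact product set.\<close>

lemma ex_nontrivial:
 obtains F n where "F \<in> borel_measurable (leb_mu)" "Y_norm F = ennreal n" "0 < n"
proof -
 obtain k where k: "emeasure \<mu> (HB (real k)) \<noteq> 0" using HB_pos by blast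
 let ?B = "cball (0 :: real^'d) 1" and ?K = "HB (real k)"
 have K: "?K \<in> sets \<mu>" by (intro in_sets_mu sets_HB HB_subset)
 define F :: "(real^'d) \<times> (real^'d^'d) => complex" where "F z = indicator (?B \<times> ?K) z" for z
 have F: "F \<in> borel_measurable (leb_mu)"
  unfolding F_def using K by (intro borel_measurable_indicator) auto
 have "continuous_on (?B \<times> ?K) v"
  using v HB_subset by (auto simp: weight_on_def elim!: continuous_on_subset)
 then have "bounded (v ` (?B \<times> ?K))"
  by (intro compact_imp_bounded compact_continuous_image compact_Times compact_cball compact_HB)
 then obtain b where b: "\<And>z. z \<in> ?B \<times> ?K ==> norm (v z) \<le> b" by (metis bounded_iff imageI)
 define c where "c = max b 0"
 have c: "0 \<le> c" "\<And>x h. x \<in> ?B ==> h \<in> ?K ==> v (x, h) \<le> c" using b by (force simp: c_def)+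
 have "lp_norm lborel p (indicator ?B) < \<infinity>"
  by (intro lp_norm_indicator_finite p emeasure_bounded_finite bounded_cball) auto
 then obtain K1 where K1: "lp_norm lborel p (indicator ?B) = ennreal K1" "0 \<le> K1" by (auto simp: less_top_ennreal)
 have sl: "lp_norm lborel p (\<lambda>x. ennreal (norm (F (x, h)) * v (x, h))) \<le> ennreal (c * K1) * indicator ?K h" if h: "h \<in> H" for h
 proof -
  have "lp_norm lborel p (\<lambda>x. ennreal (norm (F (x, h)) * v (x, h))) \<le> lp_norm lborel p (\<lambda>x. ennreal (c * indicator ?K h) * indicator ?B x)"
  proof (rule lp_norm_mono[OF slice_measurable(1)[OF F h]])
   fix x :: "real^'d"
   show "ennreal (norm (F (x, h)) * v (x, h)) \<le> ennreal (c * indicator ?K h) * indicator ?B x"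
    using c by (auto simp: F_def indicator_def intro!: ennreal_leI)
  qed
  also have "\<dots> \<le> ennreal (c * indicator ?K h) * ennreal K1"
   unfolding K1(1)[symmetric] using c(1)
   by (intro lp_norm_cmult p) (auto intro!: borel_measurable_indicator borel_closed closed_cball)
  also have "\<dots> = ennreal (c * K1) * indicator ?K h"
   using c(1) K1(2) by (auto simp: indicator_def ennreal_mult)
  finally show ?thesis .
 qed
 have "Y_norm F \<le> lp_norm det_mu (ennreal q) (\<lambda>h. ennreal (c * K1) * indicator ?K h)"
  unfolding Y_norm_def by (rule lp_norm_mono[OF slice_measurable(2)[OF F]]) (simp add: sl space_det_mu)
 also have "\<dots> \<le> ennreal (c * K1) * lp_norm det_mu (ennreal q) (indicator ?K)"
  using c(1) K1(2) K by (intro lp_norm_cmult q1') (auto simp: sets_det_mu)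
 also have "\<dots> < \<infinity>"
 proof -
  have "continuous_on ?K (\<lambda>h. det h)" unfolding det_def by (intro continuous_intros)
  then have "bounded ((\<lambda>h. det h) ` ?K)" by (intro compact_imp_bounded compact_continuous_image compact_HB)
  then obtain e where e: "\<And>h. h \<in> ?K ==> \<bar>det h\<bar> \<le> e" by (auto simp: bounded_iff)
  have "emeasure det_mu ?K = (\<integral>\<^sup>+h. ennreal (1 / \<bar>det h\<bar>) * indicator ?K h \<partial>\<mu>)"
   unfolding det_mu_def using K det_inverse_measurable by (rule emeasure_density[rotated])
  also have "\<dots> \<le> (\<integral>\<^sup>+h. ennreal e * indicator ?K h \<partial>\<mu>)"
  proof (rule nn_integral_mono)
   fix h
   have "1 / \<bar>det h\<bar> \<le> e" if "h \<in> ?K"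
    using e[OF HB_inv[OF that]] det_inv[of h] that HB_subset by (auto simp: subset_iff)
   then show "ennreal (1 / \<bar>det h\<bar>) * indicator ?K h \<le> ennreal e * indicator ?K h"
    by (auto simp: indicator_def intro: ennreal_leI)
  qed
  also have "\<dots> = ennreal e * emeasure \<mu> ?K" using K by (simp add: nn_integral_cmult_indicator)
  also have "\<dots> < \<infinity>" using HB_finite by (simp add: ennreal_mult_less_top)
  finally have "lp_norm det_mu (ennreal q) (indicator ?K) < \<infinity>"
   using K by (intro lp_norm_indicator_finite q1') (auto simp: sets_det_mu)
  then show ?thesis by (simp add: ennreal_mult_less_top)
 qed
 finally have fin: "Y_norm F < \<infinity>" .
 have "Y_norm F \<noteq> 0"
 proof
  assume "Y_norm F = 0"
  then have "AE h in det_mu. lp_norm lborel p (\<lambda>x. ennreal (norm (F (x, h)) * v (x, h))) = 0"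
   unfolding Y_norm_def by (intro AE_eq_0_if_lp_norm_0[OF q1' slice_measurable(2)[OF F]])
  then have "AE h in \<mu>. 0 < ennreal (1 / \<bar>det h\<bar>) \<longrightarrow> lp_norm lborel p (\<lambda>x. ennreal (norm (F (x, h)) * v (x, h))) = 0"
   unfolding det_mu_def by (subst (asm) AE_density[OF det_inverse_measurable])
  then have "AE h in \<mu>. h \<notin> ?K" using AE_space
  proof eventually_elim
   case (elim h)
   then have h: "h \<in> H" by (simp add: space_mu)
   show ?case
   proof
    assume hK: "h \<in> ?K"
    have "AE x in lborel. ennreal (norm (F (x, h)) * v (x, h)) = 0"
     using elim det_H[OF h] by (intro AE_eq_0_if_lp_norm_0[OF p slice_measurable(1)[OF F h]]) simp
    then have "AE x in lborel. x \<notin> ?B"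
    proof eventually_elim
     case (elim x)
     then show ?case using weight_G_pos[OF v h, of x] hK by (auto simp: F_def indicator_def ennreal_eq_0_iff)
    qed
    then have "AE x in lborel. x \<notin> ball (0 :: real^'d) 1" by eventually_elim auto
    then have "emeasure lborel (ball (0 :: real^'d) 1) = 0"
     by (subst (asm) AE_iff_measurable[OF _ refl]) (auto simp: ball_def)
    then show False using emeasure_open_neq_0[of "ball (0 :: real^'d) 1"] by simp
   qed
  qed
  then have "emeasure \<mu> ?K = 0" using K sets.sets_into_space[OF K] by (subst (asm) AE_iff_measurable[OF K]) auto
  with k show False by simp
 qed
 then obtain n where "Y_norm F = ennreal n" "0 < n" using fin by (cases "Y_norm F") (auto simp: less_le)
 with F show thesis by (rule that)
qed

text \<open>Translation by \<open>z\<close> followed by translation by \<open>z\<^sup>-\<^sup>1\<close> is the identity, so that \<open>v\<^sub>0(z)\<^sup>2 \<ge> 1\<close> as soon as there is a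
 function of positive finite norm.\<close>

lemma control_weight_ge_1:
 assumes v0: "control_weight H \<mu> p (ennreal q) v v\<^sub>0" and h: "h \<in> H"
 shows "1 \<le> v\<^sub>0 (x, h)"
proof -
 let ?z = "(x, h)" and ?zi = "sd_inv (x, h)" and ?\<alpha> = "v\<^sub>0 (x, h)"
 have zi: "?zi = (- (matrix_inv h *v x), matrix_inv h)" by simp
 have zG: "?z \<in> UNIV \<times> H" using h by simp
 have \<alpha>: "0 < ?\<alpha>" using v0 h by (intro weight_G_pos) (simp add: control_weight_def)
 have op: "mixed_opnorm \<mu> p (ennreal q) v (left_trans ?z) \<le> ennreal ?\<alpha>"
  "mixed_opnorm \<mu> p (ennreal q) v (left_trans ?zi) \<le> ennreal ?\<alpha>"
  using v0 zG unfolding control_weight_def by blast+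
 have const: "(\<lambda>_. (y, k)) \<in> leb_mu \<rightarrow>\<^sub>M leb_mu" if "k \<in> H" for y :: "real^'d" and k
  using that by (intro measurable_const) (simp add: space_pair_measure space_mu)
 have m1: "(\<lambda>z'. sd_mult (sd_inv ?z) z') \<in> leb_mu \<rightarrow>\<^sub>M leb_mu"
  unfolding zi by (intro measurable_sd_mult const inv_H h measurable_ident_sets[OF refl])
 have zii: "sd_inv ?zi = ?z" using h inv_mult(2)[OF h] linear_neg[OF matrix_vector_mul_linear[of h]]
  by (simp add: inv_inv matrix_vector_mul_assoc)
 have m2: "(\<lambda>z'. sd_mult (sd_inv ?zi) z') \<in> leb_mu \<rightarrow>\<^sub>M leb_mu"
  unfolding zii by (intro measurable_sd_mult const h measurable_ident_sets[OF refl])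
 obtain F n where F: "F \<in> borel_measurable (leb_mu)" "Y_norm F = ennreal n" "0 < n" by (rule ex_nontrivial)
 have LF: "left_trans ?z F \<in> borel_measurable (leb_mu)"
  unfolding left_trans_def by (rule measurable_compose[OF m1 F(1)])
 have 1: "Y_norm (left_trans ?z F) \<le> ennreal (n * ?\<alpha>)"
  using opnorm_bound[OF _ op(1) m1 F(1) F(3)] F(2,3) \<alpha> by (simp add: left_trans_def ennreal_mult del: sd_inv.simps)
 have "Y_norm (left_trans ?zi (left_trans ?z F)) \<le> ennreal (n * ?\<alpha>) * ennreal ?\<alpha>"
  using opnorm_bound[OF _ op(2) m2 LF _ 1] F(3) \<alpha> by (simp add: left_trans_def del: sd_inv.simps)
 moreover have "left_trans ?zi (left_trans ?z F) = F"
 proof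
  fix z'
  obtain y :: "real^'d" and k :: "real^'d^'d" where "z' = (y, k)" by (cases z')
  moreover have "sd_mult ?zi (sd_mult ?z (y, k)) = (y, k)"
   using h by (simp add: inv_cancel inv_mult matrix_vector_right_distrib matrix_vector_mul_assoc)
  ultimately show "left_trans ?zi (left_trans ?z F) z' = F z'" by (simp add: left_trans_def zii del: sd_inv.simps sd_mult.simps)
 qed
 ultimately have "ennreal n \<le> ennreal (n * ?\<alpha> * ?\<alpha>)" using F \<alpha> by (simp add: ennreal_mult)
 then have "n * 1 \<le> n * (?\<alpha> * ?\<alpha>)" using F(3) \<alpha> by (subst (asm) ennreal_le_iff) (auto simp: mult.assoc)
 then have "1 \<le> ?\<alpha> * ?\<alpha>" using F(3) by (simp only: mult_le_cancel_left_pos)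
 then show ?thesis using \<alpha> mult_strict_mono[of ?\<alpha> 1 ?\<alpha> 1] by fastforce
qed

text \<open>Convolution with a function in the weighted \<open>L\<^sup>1\<close> space acts on the mixed-norm space: it is an average of right translates.\<close>

lemma right_convolution_bound:
 assumes v0: "control_weight H \<mu> p (ennreal q) v v\<^sub>0"
  and V: "V \<in> borel_measurable (leb_mu)" "Y_norm V < \<infinity>"
  and U: "U \<in> borel_measurable (leb_mu)" "int_G (\<lambda>z. ennreal (norm (U z) * v\<^sub>0 z)) < \<infinity>"
  and S: "S \<in> borel_measurable (leb_mu)"
  and le: "\<And>z. z \<in> UNIV \<times> H ==> ennreal (norm (S z)) \<le> int_G (\<lambda>u. ennreal (norm (V (sd_mult z u)) * norm (U u)))"
 shows "Y_norm S < \<infinity>"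
proof -
 have v0w: "weight_on (UNIV \<times> H) sd_mult v\<^sub>0" using v0 by (simp add: control_weight_def)
 have v0m: "v\<^sub>0 \<in> borel_measurable (leb_mu)" by (rule weight_G_measurable[OF v0w])
 obtain c where c: "0 < c" "Y_norm V \<le> ennreal c"
 proof -
  obtain r where "Y_norm V = ennreal r" "0 \<le> r" using V(2) by (auto simp: less_top_ennreal)
  then show thesis by (intro that[of "r + 1"]) (auto intro: ennreal_leI)
 qed
 let ?b = "\<lambda>u. norm (U u) / \<bar>det (snd u)\<bar>"
 let ?F = "\<lambda>x h u. ennreal (norm (complex_of_real (?b u) * V (sd_mult (x, h) u)) * v (x, h))"
 let ?g = "\<lambda>u. ennreal (?b u) * (ennreal c * ennreal (v\<^sub>0 u))"
 have det_m: "(\<lambda>u. \<bar>det (snd u)\<bar>) \<in> borel_measurable (leb_mu)" by (rule measurable_lborel_mu) measurable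
 note [measurable] = U(1) v0m det_m
 have b_m: "?b \<in> borel_measurable (leb_mu)" using U(1) det_m by measurable
 have g_m: "?g \<in> borel_measurable (leb_mu)" using b_m v0m by measurable
 let ?T = "lborel \<Otimes>\<^sub>M det_mu \<Otimes>\<^sub>M (leb_mu)"
 have p1: "(\<lambda>t. (fst t, fst (snd t))) \<in> ?T \<rightarrow>\<^sub>M leb_mu"
 proof (rule measurable_Pair)
  have "(\<lambda>t. fst (snd t)) \<in> ?T \<rightarrow>\<^sub>M det_mu" by measurable
  then show "(\<lambda>t. fst (snd t)) \<in> ?T \<rightarrow>\<^sub>M \<mu>" by (subst measurable_cong_sets[OF refl sets_det_mu[symmetric]])
 qed measurable
 have p2: "(\<lambda>t. snd (snd t)) \<in> ?T \<rightarrow>\<^sub>M leb_mu" by measurable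
 have F_m: "(\<lambda>(x, h, u). ?F x h u) \<in> borel_measurable ?T"
 proof -
  define A where "A t = V (sd_mult (fst t, fst (snd t)) (snd (snd t)))" for t :: "(real^'d) \<times> (real^'d^'d) \<times> (real^'d) \<times> (real^'d^'d)"
  define B where "B t = v (fst t, fst (snd t))" for t :: "(real^'d) \<times> (real^'d^'d) \<times> (real^'d) \<times> (real^'d^'d)"
  define C where "C t = ?b (snd (snd t))" for t :: "(real^'d) \<times> (real^'d^'d) \<times> (real^'d) \<times> (real^'d^'d)"
  have [measurable]: "A \<in> borel_measurable ?T" "B \<in> borel_measurable ?T" "C \<in> borel_measurable ?T"
   unfolding A_def B_def C_def
   by (rule measurable_compose[OF measurable_sd_mult[OF p1 p2] V(1)] measurable_compose[OF p1 v_m] measurable_compose[OF p2 b_m])+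
  have "(\<lambda>t. ennreal (norm (complex_of_real (C t) * A t) * B t)) \<in> borel_measurable ?T" by measurable
  then show ?thesis unfolding A_def B_def C_def by (simp only: split_beta')
 qed
 have slice: "lp_norm det_mu (ennreal q) (\<lambda>h. lp_norm lborel p (\<lambda>x. ?F x h u)) \<le> ?g u" if "u \<in> space (leb_mu)" for u
 proof -
  have u: "u \<in> UNIV \<times> H" using that by (simp add: space_pair_measure space_mu)
  have \<tau>: "(\<lambda>z. sd_mult z u) \<in> leb_mu \<rightarrow>\<^sub>M leb_mu"
   using that by (intro measurable_sd_mult measurable_ident_sets[OF refl] measurable_const)
  have op: "mixed_opnorm \<mu> p (ennreal q) v (right_trans u) \<le> ennreal (v\<^sub>0 u)"
   using v0 u unfolding control_weight_def by blast
  have "lp_norm det_mu (ennreal q) (\<lambda>h. lp_norm lborel p (\<lambda>x. ?F x h u)) = Y_norm (\<lambda>z. complex_of_real (?b u) * right_trans u V z)"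
   by (simp add: Y_norm_def right_trans_def)
  also have "\<dots> \<le> ennreal (?b u) * Y_norm (right_trans u V)"
   by (rule Y_norm_cmult) (use measurable_compose[OF \<tau> V(1)] in \<open>simp_all add: right_trans_def\<close>)
  also have "\<dots> \<le> ?g u"
   by (intro mult_left_mono opnorm_bound[OF _ op \<tau> V(1) c]) (auto simp: right_trans_def)
  finally show ?thesis .
 qed
 have "Y_norm S \<le> lp_norm det_mu (ennreal q) (\<lambda>h. lp_norm lborel p (\<lambda>x. \<integral>\<^sup>+u. ?F x h u \<partial>(leb_mu)))"
  unfolding Y_norm_def
 proof (rule lp_norm_mono[OF slice_measurable(2)[OF S]], rule lp_norm_mono[OF slice_measurable(1)[OF S]])
  fix h x assume "h \<in> space det_mu"
  then show h: "h \<in> H" by (simp add: space_det_mu)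
  have \<tau>: "(\<lambda>u. sd_mult (x, h) u) \<in> leb_mu \<rightarrow>\<^sub>M leb_mu"
   using h by (intro measurable_sd_mult measurable_ident_sets[OF refl] measurable_const) (simp add: space_pair_measure space_mu)
  define A where "A u = norm (V (sd_mult (x, h) u)) * norm (U u)" for u
  have A [measurable]: "A \<in> borel_measurable (leb_mu)"
   unfolding A_def
   by (intro borel_measurable_times measurable_compose[OF measurable_compose[OF \<tau> V(1)] borel_measurable_norm]
     measurable_compose[OF U(1) borel_measurable_norm])
  have det_m' [measurable]: "(\<lambda>u. 1 / \<bar>det (snd u)\<bar>) \<in> borel_measurable (leb_mu)" by (rule measurable_lborel_mu) measurable
  have v0': "0 \<le> v (x, h)" using weight_G_pos[OF v h, of x] by simp
  have "ennreal (norm (S (x, h)) * v (x, h)) \<le> int_G (\<lambda>u. ennreal (A u)) * ennreal (v (x, h))"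
   using v0' le[of "(x, h)"] h by (simp add: A_def ennreal_mult mult_right_mono del: sd_mult.simps)
  also have "\<dots> = (\<integral>\<^sup>+u. ennreal (1 / \<bar>det (snd u)\<bar>) * ennreal (A u) \<partial>(leb_mu)) * ennreal (v (x, h))"
   by (subst int_G_pair) measurable
  also have "\<dots> = (\<integral>\<^sup>+u. ennreal (1 / \<bar>det (snd u)\<bar>) * ennreal (A u) * ennreal (v (x, h)) \<partial>(leb_mu))"
   by (rule nn_integral_multc[symmetric]) measurable
  also have "\<dots> = (\<integral>\<^sup>+u. ?F x h u \<partial>(leb_mu))"
   using v0' by (intro nn_integral_cong) (simp add: A_def norm_mult norm_divide mult_ac del: sd_mult.simps flip: ennreal_mult)
  finally show "ennreal (norm (S (x, h)) * v (x, h)) \<le> (\<integral>\<^sup>+u. ?F x h u \<partial>(leb_mu))" .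
 qed
 also have "\<dots> \<le> (\<integral>\<^sup>+u. ?g u \<partial>(leb_mu))"
  by (rule Minkowski_mixed[OF lborel.sigma_finite_measure_axioms sigma_finite_det_mu P.sigma_finite_measure_axioms F_m g_m p q1' slice])
 also have "\<dots> = (\<integral>\<^sup>+u. ennreal c * (ennreal (1 / \<bar>det (snd u)\<bar>) * ennreal (norm (U u) * v\<^sub>0 u)) \<partial>(leb_mu))"
 proof (rule nn_integral_cong)
  fix u :: "(real^'d) \<times> (real^'d^'d)" assume "u \<in> space (leb_mu)"
  then have "0 \<le> v\<^sub>0 u" using weight_G_pos[OF v0w, of "snd u" "fst u"] by (auto simp: space_pair_measure space_mu)
  then show "?g u = ennreal c * (ennreal (1 / \<bar>det (snd u)\<bar>) * ennreal (norm (U u) * v\<^sub>0 u))"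
   using c(1) by (simp add: mult_ac flip: ennreal_mult)
 qed
 also have "\<dots> = ennreal c * (\<integral>\<^sup>+u. ennreal (1 / \<bar>det (snd u)\<bar>) * ennreal (norm (U u) * v\<^sub>0 u) \<partial>(leb_mu))"
  by (rule nn_integral_cmult) measurable
 also have "(\<integral>\<^sup>+u. ennreal (1 / \<bar>det (snd u)\<bar>) * ennreal (norm (U u) * v\<^sub>0 u) \<partial>(leb_mu)) = int_G (\<lambda>z. ennreal (norm (U z) * v\<^sub>0 z))"
  by (rule int_G_pair[symmetric]) measurable
 also have "ennreal c * \<dots> < \<infinity>" using U(2) by (simp add: ennreal_mult_less_top)
 finally show ?thesis .
qed

end

section \<open>Membership in the coorbit space\<close>

context dual_orbit
begin

lemma int_G_cmult:
 assumes \<Phi>: "\<Phi> \<in> borel_measurable (leb_mu)"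
 shows "int_G (\<lambda>z. c * \<Phi> z) = c * int_G \<Phi>"
proof -
 have d: "(\<lambda>z. ennreal (1 / \<bar>det (snd z)\<bar>)) \<in> borel_measurable (leb_mu)" by (rule measurable_lborel_mu) measurable
 have c: "(\<lambda>z. c * \<Phi> z) \<in> borel_measurable (leb_mu)" using \<Phi> by measurable
 show ?thesis
  unfolding int_G_pair[OF \<Phi>] int_G_pair[OF c] mult.left_commute[of _ c]
  by (rule nn_integral_cmult) (rule borel_measurable_times_ennreal[OF d \<Phi>])
qed

lemma int_G_finite_slices:
 assumes \<Phi>: "\<Phi> \<in> borel_measurable (leb_mu)" and fin: "int_G \<Phi> < \<infinity>"
 shows "AE h in \<mu>. (\<integral>\<^sup>+x. \<Phi> (x, h) \<partial>lborel) < \<infinity>"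
proof -
 have "(\<lambda>h. \<integral>\<^sup>+x. \<Phi> (x, h) \<partial>lborel) \<in> borel_measurable \<mu>"
  using measurable_compose[OF measurable_pair_swap' \<Phi>]
  by (intro lborel.borel_measurable_nn_integral) (simp add: split_beta')
 then have "AE h in \<mu>. ennreal (1 / \<bar>det h\<bar>) * (\<integral>\<^sup>+x. \<Phi> (x, h) \<partial>lborel) \<noteq> \<infinity>"
  using fin by (intro nn_integral_noteq_infinite borel_measurable_times_ennreal det_inverse_measurable) (simp_all add: int_G_def)
 then show ?thesis using AE_space
 proof eventually_elim
  case (elim h)
  then have "ennreal (1 / \<bar>det h\<bar>) \<noteq> 0" using det_H[of h] by (simp add: space_mu ennreal_eq_0_iff)
  then show ?case using elim(1) by (auto simp: less_top ennreal_mult_eq_top_iff)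
 qed
qed

lemma dual_wavelet_bounded:
 assumes h: "h \<in> H" and F: "sqint F" and \<phi>: "sqint \<phi>"
 shows "norm (dual_wavelet F \<phi> x h) \<le> l2norm F * l2norm \<phi>"
proof -
 have "dual_wavelet F \<phi> x h = (\<integral>\<xi>. complex_of_real (sqrt \<bar>det h\<bar>) * (F \<xi> * cnj (\<phi> (dual_act h \<xi>)) * cis (2 * pi * (x \<bullet> \<xi>))) \<partial>lborel)"
  by (simp add: dual_wavelet_def)
 also have "\<dots> = (\<integral>\<xi>. F \<xi> * cnj (dual_qreg x h \<phi> \<xi>) \<partial>lborel)"
  by (intro Bochner_cong refl) (simp add: dual_qreg_def cis_cnj mult_ac)
 finally show ?thesis
  using norm_inner_le[OF F l2norm_dual_qreg(1)[OF det_H[OF h] \<phi>, of x]] l2norm_dual_qreg(2)[OF det_H[OF h] \<phi>, of x] by simp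
qed

end

lemma L2_fourier_not_null:
 assumes g: "has_L2_fourier g G" and nz: "\<not> ae_zero g"
 shows "\<not> (AE \<xi> in lborel. G \<xi> = 0)"
proof
 assume "AE \<xi> in lborel. G \<xi> = 0"
 then have "(\<integral>\<xi>. G \<xi> * cnj (G \<xi>) \<partial>lborel) = 0" by (intro integral_eq_zero_AE) auto
 then have "(\<integral>x. g x * cnj (g x) \<partial>lborel) = 0" by (simp add: Parseval_L2[OF g g])
 moreover have "(\<integral>x. g x * cnj (g x) \<partial>lborel) = complex_of_real (\<integral>x. (norm (g x))\<^sup>2 \<partial>lborel)"
  by (simp only: complex_norm_square[symmetric] integral_complex_of_real)
 ultimately have "(\<integral>x. (norm (g x))\<^sup>2 \<partial>lborel) = 0" by simp
 then have "AE x in lborel. (norm (g x))\<^sup>2 = 0"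
  using g by (subst (asm) integral_nonneg_eq_0_iff_AE) (auto simp: has_L2_fourier_def sqint_def)
 with nz show False by (simp add: ae_zero_def)
qed

theorem corollary4p5:
  fixes H :: "(real^'d^'d) set" and \<mu> :: "(real^'d^'d) measure" and Orb :: "(real^'d) set"
    and v v\<^sub>0 :: "(real^'d) \<times> (real^'d^'d) \<Rightarrow> real" and w w\<^sub>0 :: "real^'d^'d \<Rightarrow> real"
    and s q :: real and p :: ennreal and l t :: nat
    and f \<psi> \<psi>\<^sub>0 :: "real^'d \<Rightarrow> complex"
  assumes dim: "CARD('d) > 1"
    and haar: "left_haar_measure H \<mu>"
    and adm: "admissible_dilation_group H \<mu>"
    and orbit: "open_dual_orbit H Orb"
    and s: "s \<ge> 0"
    and v: "weight_on (UNIV \<times> H) sd_mult v"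
    and w: "weight_on H (**) w"
    and v_le: "\<And>x h. h \<in> H \<Longrightarrow> v (x, h) \<le> (1 + norm x) powr s * w h"
    and p: "1 \<le> p" and q: "1 \<le> q"
    and v0: "control_weight H \<mu> p (ennreal q) v v\<^sub>0"
    and w0: "weight_on H (**) w\<^sub>0"
    and v0_le: "\<And>x h. h \<in> H \<Longrightarrow> v\<^sub>0 (x, h) \<le> (1 + norm x) powr s * w\<^sub>0 h"
    and psi0: "\<psi>\<^sub>0 \<in> H1 \<mu> v\<^sub>0 \<psi>\<^sub>0" "\<not> ae_zero \<psi>\<^sub>0"
    and psi: "\<psi> \<in> H1 \<mu> v\<^sub>0 \<psi>\<^sub>0" "\<not> ae_zero \<psi>"
    and temperate: "temperately_embedded H \<mu> Orb s q w l"
    and f: "integrable lborel f"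
    and moments: "vanishing_moments (- Orb) t f"
    and t: "real t > real l + s + enn2real (of_nat CARD('d) / p) + 1"
    and decay: "schwartz_norm (real t) (real t) (fourier f) < \<infinity>"
  shows "f \<in> Lp lborel 2 \<and> l2_functional f \<in> coorbit \<mu> p (ennreal q) v v\<^sub>0 \<psi>\<^sub>0 \<psi>"
proof -
 interpret temperate_orbit H \<mu> Orb s q w l
  using adm haar orbit s q w temperate by unfold_locales (auto simp: admissible_dilation_group_def)
 interpret Y: mixed_space_setting H \<mu> Orb p q v
  using p q v by unfold_locales
 have "real l \<le> real t" using t s enn2real_nonneg[of "of_nat CARD('d) / p"] by linarith
 then have F: "sqint (fourier f)" by (intro sqint_fourier[OF f moments decay]) simp
 have f2: "sqint f" by (rule sqint_if_fourier_sqint(1)[OF f F])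
 have H1_sqint: "sqint g" if "g \<in> H1 \<mu> v\<^sub>0 \<psi>\<^sub>0" for g using that by (simp add: H1_def Lp_2_iff)
 obtain \<Psi> where \<Psi>: "has_L2_fourier \<psi>\<^sub>0 \<Psi>" by (rule L2_fourier_exists[OF H1_sqint[OF psi0(1)]])
 have "sqint \<Psi>" using \<Psi> by (simp add: has_L2_fourier_def)
 then obtain a b u \<kappa> where ab: "cbox a b \<subseteq> Orb" and u: "u \<in> box_test a b" and \<kappa>0: "\<kappa> \<noteq> 0"
  and \<kappa>: "\<And>\<xi>. \<xi> \<in> Orb ==> overlap (\<lambda>\<xi>. \<Psi> \<xi> * cnj (tensor u \<xi>)) \<xi> = \<kappa>"
  and \<kappa>_fin: "\<And>\<xi>. \<xi> \<in> Orb ==> (\<integral>\<^sup>+h. ennreal (norm (\<Psi> (dual_act h \<xi>) * cnj (tensor u (dual_act h \<xi>)))) \<partial>\<mu>) < \<infinity>"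
  by (rule ex_overlapping_window[OF _ L2_fourier_not_null[OF \<Psi> psi0(2)]]) blast
 define V where "V z = dual_wavelet (fourier f) (tensor u) (fst z) (snd z)" for z :: "(real^'d) \<times> (real^'d^'d)"
 have tens: "tensor u \<in> borel_measurable borel" by (intro borel_measurable_tensor box_testD(1)[OF u])
 have V_m: "V \<in> borel_measurable (leb_mu)"
  unfolding V_def by (intro dual_wavelet_measurable borel_measurable_fourier f tens)
 have V_fin: "mixed_norm \<mu> p (ennreal q) v V < \<infinity>"
  unfolding V_def[abs_def] by (rule dual_wavelet_mixed_norm[OF f moments decay u ab p t v v_le])
 have tens2: "sqint (tensor u)"
  using Cc_imp(5)[OF Cc_times_dual_window[OF one_H continuous_on_const u, of 1]] by simp
 define BV where "BV = l2norm (fourier f) * l2norm (tensor u)"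
 have BV: "norm (V (x, h)) \<le> BV" if "h \<in> H" for x h
  using dual_wavelet_bounded[OF that F tens2] by (simp add: V_def BV_def)
 let ?W = "\<lambda>g z. l2_inner g (qreg z \<psi>\<^sub>0)"
 have \<psi>0_m: "\<psi>\<^sub>0 \<in> borel_measurable borel" using H1_sqint[OF psi0(1)] by (simp add: sqint_def)
 have W_m: "?W g \<in> borel_measurable (leb_mu)" if "sqint g" for g
  using that \<psi>0_m by (intro wavelet_measurable) (auto simp: sqint_def)
 have nW_m: "(\<lambda>z. ennreal (norm (?W g z))) \<in> borel_measurable (leb_mu)" if "sqint g" for g
  by (rule measurable_compose[OF W_m[OF that], of "\<lambda>x. ennreal (norm x)"]) measurable
 have key: "ennreal (norm \<kappa> * norm (l2_inner f g)) \<le> int_G (\<lambda>z. ennreal (norm (V z) * norm (?W g z)))"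
  if g: "sqint g" and fin: "int_G (\<lambda>z. ennreal (norm (?W g z))) < \<infinity>" for g
 proof -
  obtain G where G: "has_L2_fourier g G" by (rule L2_fourier_exists[OF g])
  have "l2_inner f g = (\<integral>\<xi>. fourier f \<xi> * cnj (G \<xi>) \<partial>lborel)"
   unfolding l2_inner_def by (rule sqint_if_fourier_sqint(2)[OF f F G])
  then show ?thesis
   using orthogonality_bound[OF continuous_on_fourier[OF f] F u \<Psi> G \<kappa> \<kappa>_fin int_G_finite_slices[OF nW_m[OF g] fin]]
   by (simp add: int_G_def V_def del: qreg.simps)
 qed
 \<comment> \<open>The functional of \<open>f\<close> is bounded because \<open>V\<close> is bounded and the control weight is at least one.\<close>
 have v0w: "weight_on (UNIV \<times> H) sd_mult v\<^sub>0" using v0 by (simp add: control_weight_def)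
 have v0_m: "v\<^sub>0 \<in> borel_measurable (leb_mu)" by (rule weight_G_measurable[OF v0w])
 have wav: "wavelet \<psi>' (l2_functional g) = (\<lambda>z. l2_inner g (qreg z \<psi>'))" for g \<psi>'
  by (simp add: wavelet_def l2_functional_def fun_eq_iff)
 have H1_norm: "H1_norm \<mu> v\<^sub>0 \<psi>\<^sub>0 g = int_G (\<lambda>z. ennreal (norm (?W g z) * v\<^sub>0 z))" if "sqint g" for g
  unfolding H1_norm_def wav by (rule mixed_norm_1_1[OF v0_m W_m[OF that]])
 have H1_fin: "int_G (\<lambda>z. ennreal (norm (?W g z) * v\<^sub>0 z)) < \<infinity>" if "g \<in> H1 \<mu> v\<^sub>0 \<psi>\<^sub>0" for g
  using that H1_norm[OF H1_sqint[OF that]] by (simp add: H1_def H1_norm_def mixed_space_def)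
 have v0_ge: "int_G (\<lambda>z. ennreal (norm (?W g z))) \<le> int_G (\<lambda>z. ennreal (norm (?W g z) * v\<^sub>0 z))" for g
 proof (rule int_G_mono)
  fix x h assume "h \<in> H"
  then show "ennreal (norm (?W g (x, h))) \<le> ennreal (norm (?W g (x, h)) * v\<^sub>0 (x, h))"
   using mult_left_mono[OF Y.control_weight_ge_1[OF v0], of h "norm (?W g (x, h))" x]
   by (intro ennreal_leI) (simp del: qreg.simps)
 qed
 have W_fin: "int_G (\<lambda>z. ennreal (norm (?W g z))) < \<infinity>" if "g \<in> H1 \<mu> v\<^sub>0 \<psi>\<^sub>0" for g
  using v0_ge H1_fin[OF that] by (rule le_less_trans)
 have nk: "0 < norm \<kappa>" using \<kappa>0 by simp
 have bounded: "ennreal (norm (l2_functional f g)) \<le> ennreal (BV / norm \<kappa>) * H1_norm \<mu> v\<^sub>0 \<psi>\<^sub>0 g" if g: "g \<in> H1 \<mu> v\<^sub>0 \<psi>\<^sub>0" for g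
 proof -
  note gs = H1_sqint[OF g]
  have BV0: "0 \<le> BV" by (simp add: BV_def)
  have "ennreal (norm \<kappa> * norm (l2_inner f g)) \<le> int_G (\<lambda>z. ennreal (norm (V z) * norm (?W g z)))"
   by (rule key[OF gs W_fin[OF g]])
  also have "\<dots> \<le> int_G (\<lambda>z. ennreal BV * ennreal (norm (?W g z)))"
   using BV BV0 by (intro int_G_mono) (simp add: ennreal_leI mult_right_mono del: qreg.simps flip: ennreal_mult)
  also have "\<dots> = ennreal BV * int_G (\<lambda>z. ennreal (norm (?W g z)))" by (rule int_G_cmult[OF nW_m[OF gs]])
  also have "\<dots> \<le> ennreal BV * H1_norm \<mu> v\<^sub>0 \<psi>\<^sub>0 g"
   unfolding H1_norm[OF gs] by (intro mult_left_mono v0_ge) auto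
  finally have "ennreal (1 / norm \<kappa>) * ennreal (norm \<kappa> * norm (l2_inner f g))
    \<le> ennreal (1 / norm \<kappa>) * (ennreal BV * H1_norm \<mu> v\<^sub>0 \<psi>\<^sub>0 g)"
   by (rule mult_left_mono) auto
  also have "ennreal (1 / norm \<kappa>) * ennreal (norm \<kappa> * norm (l2_inner f g)) = ennreal (norm (l2_functional f g))"
   using nk by (simp add: l2_functional_def flip: ennreal_mult)
  also have "ennreal (1 / norm \<kappa>) * (ennreal BV * H1_norm \<mu> v\<^sub>0 \<psi>\<^sub>0 g) = ennreal (BV / norm \<kappa>) * H1_norm \<mu> v\<^sub>0 \<psi>\<^sub>0 g"
   using nk BV0 by (simp add: mult.assoc[symmetric] flip: ennreal_mult)
  finally show ?thesis .
 qed
 have dual: "l2_functional f \<in> H1_conj_dual \<mu> v\<^sub>0 \<psi>\<^sub>0"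
 proof -
  have "l2_functional f (\<lambda>x. g x + k x) = l2_functional f g + l2_functional f k" if "g \<in> H1 \<mu> v\<^sub>0 \<psi>\<^sub>0" "k \<in> H1 \<mu> v\<^sub>0 \<psi>\<^sub>0" for g k
   using sqint_product(2)[OF f2 H1_sqint[OF that(1)]] sqint_product(2)[OF f2 H1_sqint[OF that(2)]]
   by (simp add: l2_functional_def l2_inner_def distrib_left)
  moreover have "l2_functional f (\<lambda>x. c * g x) = cnj c * l2_functional f g" for c g
   by (simp add: l2_functional_def l2_inner_def mult.left_commute[of _ "cnj c"])
  ultimately show ?thesis using bounded unfolding H1_conj_dual_def by blast
 qed
 \<comment> \<open>The same inequality for \<open>\<pi>(z) \<psi>\<close>, scaled by \<open>\<bar>\<kappa>\<bar>\<close> to keep division out of the integral.\<close>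
 have \<psi>s: "sqint \<psi>" by (rule H1_sqint[OF psi(1)])
 have \<psi>_m: "\<psi> \<in> borel_measurable borel" using \<psi>s by (simp add: sqint_def)
 let ?S = "\<lambda>z. l2_inner f (qreg z \<psi>)"
 have S_m: "?S \<in> borel_measurable (leb_mu)"
  using f2 \<psi>_m by (intro wavelet_measurable) (auto simp: sqint_def)
 define S' where "S' z = complex_of_real (norm \<kappa>) * ?S z" for z
 have S'_m: "S' \<in> borel_measurable (leb_mu)" unfolding S'_def using S_m by measurable
 have "mixed_norm \<mu> p (ennreal q) v S' < \<infinity>"
 proof (rule Y.right_convolution_bound[OF v0 V_m V_fin W_m[OF \<psi>s] H1_fin[OF psi(1)] S'_m])
  fix z :: "(real^'d) \<times> (real^'d^'d)" assume "z \<in> UNIV \<times> H"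
  then obtain x h where z: "z = (x, h)" and h: "h \<in> H" by auto
  let ?g = "qreg z \<psi>"
  have gs: "sqint ?g" unfolding z by (rule l2norm_qreg(1)[OF det_H[OF h] det_inv[OF h] \<psi>s])
  \<comment> \<open>Unitarity: the transform intertwines \<open>\<pi>(z)\<close> with left translation.\<close>
  have inv: "?W ?g (sd_mult z (y, k)) = ?W \<psi> (y, k)" if k: "k \<in> H" for y k
   unfolding z qreg_mult[OF h k, symmetric]
   by (rule l2_inner_qreg[OF h \<psi>_m]) (use \<psi>0_m in simp)
  have "int_G (\<lambda>y. ennreal (norm (?W ?g y))) = int_G (\<lambda>y. ennreal (norm (?W ?g (sd_mult z y))))"
   unfolding z by (rule int_G_left[OF h nW_m[OF gs[unfolded z]], symmetric])
  also have "\<dots> \<le> int_G (\<lambda>y. ennreal (norm (?W \<psi> y)))"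
   by (intro int_G_mono) (simp add: inv del: sd_mult.simps qreg.simps)
  also have "\<dots> < \<infinity>" by (rule W_fin[OF psi(1)])
  finally have fin: "int_G (\<lambda>y. ennreal (norm (?W ?g y))) < \<infinity>" .
  have m: "(\<lambda>y. ennreal (norm (V y) * norm (?W ?g y))) \<in> borel_measurable (leb_mu)"
   using V_m W_m[OF gs]
   by (intro measurable_compose[OF _ measurable_ennreal] borel_measurable_times
     measurable_compose[OF _ borel_measurable_norm])
  have "ennreal (norm (S' z)) = ennreal (norm \<kappa> * norm (l2_inner f ?g))" by (simp add: S'_def norm_mult)
  also have "\<dots> \<le> int_G (\<lambda>y. ennreal (norm (V y) * norm (?W ?g y)))" by (rule key[OF gs fin])
  also have "\<dots> = int_G (\<lambda>y. ennreal (norm (V (sd_mult z y)) * norm (?W ?g (sd_mult z y))))"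
   unfolding z by (rule int_G_left[OF h m[unfolded z], symmetric])
  also have "\<dots> \<le> int_G (\<lambda>y. ennreal (norm (V (sd_mult z y)) * norm (?W \<psi> y)))"
   by (intro int_G_mono) (simp add: inv del: sd_mult.simps qreg.simps)
  finally show "ennreal (norm (S' z)) \<le> int_G (\<lambda>y. ennreal (norm (V (sd_mult z y)) * norm (?W \<psi> y)))" .
 qed
 moreover have "?S = (\<lambda>z. complex_of_real (1 / norm \<kappa>) * S' z)" using nk by (simp add: S'_def fun_eq_iff)
 ultimately have "mixed_norm \<mu> p (ennreal q) v ?S < \<infinity>"
  using Y.Y_norm_cmult[OF _ S'_m, of "1 / norm \<kappa>"] nk by (simp add: le_less_trans ennreal_mult_less_top)
 then have "wavelet \<psi> (l2_functional f) \<in> mixed_space \<mu> p (ennreal q) v"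
  using S_m by (simp add: wav mixed_space_def)
 with dual f2 show ?thesis by (simp add: coorbit_def Lp_2_iff)
qed

end
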